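(* Let $0\le\alpha<\dfrac{(\log 2)^2}{2\pi}$. Then, with probability $1$, the set of local pivoting points of angle $\alpha$ on a planar Brownian path $(B_t)_{t\in[0,1]}$ is non-empty and has positive Hausdorff dimension.
   Context: For $E_1,E_2\subset\mathbb C$, $E_1.E_2=\{xy:x\in E_1,y\in E_2\}$. Let $\mathcal C_\alpha=\{e^{i\theta}:\theta\in[0,\alpha]\}$. A local pivoting point of angle $\alpha$ of the path $(B_t)_{t\in[0,1]}$ is a point $B_t$, $t\in(0,1)$, for which there exists $\varepsilon>0$ with $$(B_{(t,t+\varepsilon]}-B_t)\cap \mathcal C_\alpha.(B_{[t-\varepsilon,t)}-B_t)=\varnothing,$$ i.e. locally one half of the path can be rotated around $B_t$ by any angle in $[0,\alpha]$ without intersecting the other half. *)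

theory Defs
  imports "HOL-Probability.Probability" "HOL-Library.Set_Algebras"
begin

section \<open>Hausdorff dimension\<close>

text \<open>The cases \<open>U = {}\<close> and \<open>s = 0\<close> are split off because \<open>0 powr 0 = 0\<close>, whereas
  the zero-dimensional Hausdorff measure should be the counting measure.\<close>

definition hausdorff_gauge :: "real \<Rightarrow> 'a::metric_space set \<Rightarrow> ennreal" where
  "hausdorff_gauge s U =
    (if U = {} then 0 else if s = 0 then 1 else ennreal (diameter U powr s))"

text \<open>Boundedness is required explicitly since \<^const>\<open>diameter\<close> is real-valued and
  meaningless on unbounded sets. Finite covers are included by padding with \<open>{}\<close>.\<close>

definition hausdorff_premeasure :: "real \<Rightarrow> real \<Rightarrow> 'a::metric_space set \<Rightarrow> ennreal" where
  "hausdorff_premeasure s \<delta> A =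
    Inf {\<Sum>i. hausdorff_gauge s (U i) | U :: nat \<Rightarrow> 'a set.
           A \<subseteq> (\<Union>i. U i) \<and> (\<forall>i. bounded (U i) \<and> diameter (U i) \<le> \<delta>)}"

definition hausdorff_measure :: "real \<Rightarrow> 'a::metric_space set \<Rightarrow> ennreal" where
  "hausdorff_measure s A = (SUP \<delta>\<in>{0<..}. hausdorff_premeasure s \<delta> A)"

definition hausdorff_dim :: "'a::metric_space set \<Rightarrow> ennreal" where
  "hausdorff_dim A = Inf {ennreal s | s. 0 \<le> s \<and> hausdorff_measure s A = 0}"


section \<open>Planar Brownian motion on the time interval [0,1]\<close>

text \<open>The index set is represented by the reals, but only the values of \<open>B\<close> at times in
  \<open>{0..1}\<close> are constrained. The density below says that the real and imaginary parts of
  \<open>B t - B s\<close> are independent centred Gaussians of variance \<open>t - s\<close>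
  (\<^const>\<open>normal_density\<close> takes the standard deviation).\<close>

locale planar_brownian = prob_space M for M :: "'w measure" +
  fixes x :: complex and B :: "real \<Rightarrow> 'w \<Rightarrow> complex"
  assumes measurable_B: "t \<in> {0..1} \<Longrightarrow> random_variable borel (B t)"
    and start: "AE \<omega> in M. B 0 \<omega> = x"
    and indep_increments:
      "\<lbrakk>\<And>i. i \<le> n \<Longrightarrow> \<tau> i \<in> {0..1}; \<And>i. i < n \<Longrightarrow> \<tau> i \<le> \<tau> (Suc i)\<rbrakk>
        \<Longrightarrow> indep_vars (\<lambda>_. borel) (\<lambda>i \<omega>. B (\<tau> (Suc i)) \<omega> - B (\<tau> i) \<omega>) {..<n::nat}"
    and gaussian_increments:
      "\<lbrakk>0 \<le> s; s < t; t \<le> 1\<rbrakk>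
        \<Longrightarrow> distributed M lborel (\<lambda>\<omega>. B t \<omega> - B s \<omega>)
              (\<lambda>z. ennreal (normal_density 0 (sqrt (t - s)) (Re z) *
                            normal_density 0 (sqrt (t - s)) (Im z)))"
    and continuous_paths: "AE \<omega> in M. continuous_on {0..1} (\<lambda>t. B t \<omega>)"


section \<open>Local pivoting points\<close>

definition unit_arc :: "real \<Rightarrow> complex set" where
  "unit_arc \<alpha> = cis ` {0..\<alpha>}"

text \<open>In the following, \<open>*\<close> between sets is the elementwise product. The bounds
  \<open>0 \<le> t - \<epsilon>\<close> and \<open>t + \<epsilon> \<le> 1\<close> keep the path within its time interval; since the
  condition is inherited by smaller \<open>\<epsilon>\<close>, they are harmless.\<close>

definition local_pivoting_points :: "real \<Rightarrow> (real \<Rightarrow> complex) \<Rightarrow> complex set" where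
  "local_pivoting_points \<alpha> \<gamma> =
    {\<gamma> t | t. t \<in> {0<..<1} \<and>
       (\<exists>\<epsilon>>0. 0 \<le> t - \<epsilon> \<and> t + \<epsilon> \<le> 1 \<and>
          (\<lambda>r. \<gamma> r - \<gamma> t) ` {t<..t + \<epsilon>} \<inter>
            (unit_arc \<alpha> * ((\<lambda>r. \<gamma> r - \<gamma> t) ` {t - \<epsilon>..<t})) = {})}"

end

(* Let d = (pi - alpha / 2) / 2. Around a time t, read backwards, the path is required to stay, at
   every scale, in a spiral strip whose angle follows a zigzag function of the logarithm of the
   radius; the path after t is required to stay in the same strip turned by pi + alpha / 2. Strips of
   half-width less than d turned by angles between 0 and alpha never meet, so t is a pivoting time.
   A fixed zigzag of slope s costs more than it gains, but all zigzags with 2n steps of length l, of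
   which n go up, are allowed, with s * l = d so that two different zigzags have no common path.
   Up to subexponential factors, their number 4^n, the scale e^(4nl) of the time and the cost
   exp (-(pi / (2 a)) (1 + s^2) 2nl) of a strip of half-width a < d for either half of the path
   balance in favour of existence iff 2 pi l (1 + s^2) < a (2 ln 2 + 4 l); with s = ln 2 / (2 pi)
   this is possible for some a < d exactly if alpha < (ln 2)^2 / (2 pi).

   The cost of a strip is bounded by a positive harmonic function argument: the Dirichlet type
   functional of ln u over cross sections of the strip satisfies a linear differential inequality.
   The path is replaced by the random walk of its increments over a fine grid, whose survival in the
   strip is compared with the Green function of the strip.

   The conditions at nested scales form a tree with mean offspring at least 2; a second moment bound
   with weight (3/2)^(length of the common prefix) gives, with a probability bounded below, many words of
   bounded energy. Over disjoint time intervals these events are independent, so almost surely one of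
   them has infinitely many good levels, and compactness produces a Cantor set of pivoting points
   to which the mass distribution principle applies. *)

theory Submission
  imports Defs "HOL-Complex_Analysis.Complex_Analysis" "HOL-Real_Asymp.Real_Asymp"
begin

section \<open>Random walks with two prescribed moments\<close>

text \<open>The number 2 d is an angular gap: a past strip rotated by an angle in [0, \<alpha>]
  stays at angular distance at least pi - \<alpha> / 2 from the future strip, and the turn pi +
  \<alpha> / 2 of the latter is the one that balances the two extreme rotations. The threshold comes
  from an optimisation: with s l = d and a tending to d the stated balance reads \<alpha> < 2 s ln 2
  - 2 pi s^2, and s = ln 2 / (2 pi) maximises the right side, with value (ln 2)^2 / (2 pi).
  Disjointness matters because the probabilities of all zigzag events of one level are added up.

  The obstacle is that at a fixed mesh a path is a finite sequence of independent steps, while the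
  strip estimates concern harmonic functions. All walk estimates are therefore uniform over step
  laws, with a threshold for the step size that depends on the strip only; so the constants are
  fixed once and the same level event is used at every scale, with any sufficiently fine mesh. A
  level event ignores the increments of the cell that it selects, which leaves fresh randomness for
  the next level.\<close>

text \<open>Invariance under quarter rotations annihilates the Taylor terms of order one to three of a
  harmonic function, so all we need of a step distribution are two moments.\<close>

locale step_law = prob_space \<nu> for \<nu> :: "complex measure" +
  fixes h :: real
  assumes sets_step [measurable_cong, simp]: "sets \<nu> = sets borel"
    and rotation: "distr \<nu> borel (\<lambda>u. \<i> * u) = \<nu>"
    and h_nonneg: "0 \<le> h"
    and second_moment: "has_bochner_integral \<nu> (\<lambda>u. (cmod u)\<^sup>2) (2 * h)"
    and fourth_moment: "has_bochner_integral \<nu> (\<lambda>u. (cmod u)^4) (8 * h\<^sup>2)"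
begin

lemma space_step [simp]: "space \<nu> = UNIV"
  using sets_eq_imp_space_eq[OF sets_step] by simp

lemma measurable_step [simp]: "measurable \<nu> M = measurable borel M"
  by (rule measurable_cong_sets) auto

lemma bounded_integrable:
  fixes f :: "complex \<Rightarrow> real"
  assumes "f \<in> borel_measurable borel" "\<And>x. \<bar>f x\<bar> \<le> B"
  shows "integrable \<nu> f"
  using assms by (intro integrable_const_bound[where B = B]) auto

lemma rotated_integral:
  fixes f :: "complex \<Rightarrow> real"
  assumes [measurable]: "f \<in> borel_measurable borel"
  shows "(\<integral>u. f (\<i> * u) \<partial>\<nu>) = (\<integral>u. f u \<partial>\<nu>)"
proof -
  have "(\<integral>u. f u \<partial>\<nu>) = (\<integral>u. f u \<partial>distr \<nu> borel (\<lambda>u. \<i> * u))" by (simp add: rotation)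
  also have "\<dots> = (\<integral>u. f (\<i> * u) \<partial>\<nu>)" by (rule integral_distr) auto
  finally show ?thesis by simp
qed

text \<open>By the rotation invariance the integrals along u, i u, -u and -i u agree. So a pointwise
  bound for the mean over these four points, with a quadratic and a quartic term in |u|, integrates
  to a bound in h alone; \<open>four_point_lower\<close> and \<open>four_point_upper\<close> do this
  with the two moments.\<close>

lemma four_point_integral:
  fixes f :: "complex \<Rightarrow> real"
  assumes [measurable]: "f \<in> borel_measurable borel" and B: "\<And>x. \<bar>f x\<bar> \<le> B"
  shows "(\<integral>u. f (z + u) \<partial>\<nu>) = (\<integral>u. (f (z + u) + f (z + \<i> * u) + f (z - u) + f (z - \<i> * u)) / 4 \<partial>\<nu>)"
proof -
  have m: "(\<lambda>u. f (z + c * u)) \<in> borel_measurable borel" for c by measurable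
  have i: "integrable \<nu> (\<lambda>u. f (z + c * u))" for c by (rule bounded_integrable[OF m B])
  have r: "(\<integral>u. f (z + c * (\<i> * u)) \<partial>\<nu>) = (\<integral>u. f (z + c * u) \<partial>\<nu>)" for c
    by (rule rotated_integral[OF m])
  have "(\<integral>u. (f (z + u) + f (z + \<i> * u) + f (z - u) + f (z - \<i> * u)) / 4 \<partial>\<nu>)
     = ((\<integral>u. f (z + 1 * u) \<partial>\<nu>) + (\<integral>u. f (z + \<i> * u) \<partial>\<nu>) + (\<integral>u. f (z + (-1) * u) \<partial>\<nu>) + (\<integral>u. f (z + (-\<i>) * u) \<partial>\<nu>)) / 4"
    using i[of 1] i[of "\<i>"] i[of "-1"] i[of "-\<i>"] by simp
  also have "(\<integral>u. f (z + \<i> * u) \<partial>\<nu>) = (\<integral>u. f (z + 1 * u) \<partial>\<nu>)" using r[of 1] by simp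
  also have "(\<integral>u. f (z + (-1) * u) \<partial>\<nu>) = (\<integral>u. f (z + 1 * u) \<partial>\<nu>)" using r[of 1] r[of "\<i>"] by (simp add: mult.assoc[symmetric])
  also have "(\<integral>u. f (z + (-\<i>) * u) \<partial>\<nu>) = (\<integral>u. f (z + 1 * u) \<partial>\<nu>)" using r[of 1] r[of "\<i>"] r[of "-1"] by (simp add: mult.assoc[symmetric])
  finally show ?thesis by simp
qed

lemma four_point_lower:
  fixes f :: "complex \<Rightarrow> real"
  assumes m [measurable]: "f \<in> borel_measurable borel" and B: "\<And>x. \<bar>f x\<bar> \<le> B"
    and fp: "\<And>u. (f (z + u) + f (z + \<i> * u) + f (z - u) + f (z - \<i> * u)) / 4 \<ge> c - k * (cmod u)\<^sup>2 - C * (cmod u)^4"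
  shows "(\<integral>u. f (z + u) \<partial>\<nu>) \<ge> c - 2 * k * h - 8 * C * h\<^sup>2"
proof -
  have m': "(\<lambda>u. f (z + c * u)) \<in> borel_measurable borel" for c by measurable
  have i: "integrable \<nu> (\<lambda>u. f (z + c * u))" for c by (rule bounded_integrable[OF m' B])
  have I: "has_bochner_integral \<nu> (\<lambda>u. c - k * (cmod u)\<^sup>2 - C * (cmod u)^4) (c * 1 - k * (2 * h) - C * (8 * h\<^sup>2))"
    by (intro has_bochner_integral_diff has_bochner_integral_mult_right second_moment fourth_moment)
       (auto simp: has_bochner_integral_iff prob_space[unfolded space_step])
  have "c - 2 * k * h - 8 * C * h\<^sup>2 = (\<integral>u. c - k * (cmod u)\<^sup>2 - C * (cmod u)^4 \<partial>\<nu>)"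
    using I by (simp add: has_bochner_integral_iff)
  also have "\<dots> \<le> (\<integral>u. (f (z + u) + f (z + \<i> * u) + f (z - u) + f (z - \<i> * u)) / 4 \<partial>\<nu>)"
    using I i[of 1] i[of "\<i>"] i[of "-1"] i[of "-\<i>"] fp
    by (intro integral_mono) (auto simp: has_bochner_integral_iff)
  also have "\<dots> = (\<integral>u. f (z + u) \<partial>\<nu>)" by (rule four_point_integral[OF m B, symmetric])
  finally show ?thesis .
qed

lemma four_point_upper:
  fixes f :: "complex \<Rightarrow> real"
  assumes m [measurable]: "f \<in> borel_measurable borel" and B: "\<And>x. \<bar>f x\<bar> \<le> B"
    and fp: "\<And>u. (f (z + u) + f (z + \<i> * u) + f (z - u) + f (z - \<i> * u)) / 4 \<le> c - k * (cmod u)\<^sup>2 + C * (cmod u)^4"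
  shows "(\<integral>u. f (z + u) \<partial>\<nu>) \<le> c - 2 * k * h + 8 * C * h\<^sup>2"
proof -
  have "(\<integral>u. - f (z + u) \<partial>\<nu>) \<ge> (- c) - 2 * (- k) * h - 8 * C * h\<^sup>2"
    by (rule four_point_lower[where f = "\<lambda>z. - f z" and B = B]) (use m B fp in \<open>auto simp: field_simps\<close>)
  then show ?thesis by simp
qed

lemma tail_bound:
  assumes "\<kappa> > 0"
  shows "measure \<nu> {u. cmod u > \<kappa>} \<le> 8 * h\<^sup>2 / \<kappa>^4"
proof -
  have I: "integrable \<nu> (\<lambda>u. (cmod u)^4)" "(\<integral>u. (cmod u)^4 \<partial>\<nu>) = 8 * h\<^sup>2"
    using fourth_moment by (auto simp: has_bochner_integral_iff)
  have "measure \<nu> {u. cmod u > \<kappa>} \<le> measure \<nu> {u \<in> space \<nu>. \<kappa>^4 \<le> (cmod u)^4}"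
    using assms by (intro finite_measure_mono) (auto intro!: power_mono)
  also have "\<dots> \<le> (\<integral>u. (cmod u)^4 \<partial>\<nu>) / \<kappa>^4"
    using assms I by (intro integral_Markov_inequality_measure[where A = "space \<nu>"]) auto
  finally show ?thesis by (simp add: I)
qed

text \<open>The probability that the walk from z is in K at the times 0, ..., k - 1; the position at
  time k is free. Recursion over the first step avoids a path space here; paths enter only through
  \<open>stay_and_end\<close>, in \<open>walk_probability\<close>.\<close>

definition survival :: "complex set \<Rightarrow> nat \<Rightarrow> complex \<Rightarrow> real" where
  "survival K = rec_nat (\<lambda>z. 1) (\<lambda>_ s z. indicator K z * (\<integral>u. s (z + u) \<partial>\<nu>))"

lemma survival_0 [simp]: "survival K 0 z = 1"
  and survival_Suc: "survival K (Suc k) z = indicator K z * (\<integral>u. survival K k (z + u) \<partial>\<nu>)"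
  by (simp_all add: survival_def)

lemma measurable_shift_integral [measurable (raw)]:
  fixes f :: "complex \<Rightarrow> real"
  assumes [measurable]: "f \<in> borel_measurable borel"
  shows "(\<lambda>z. \<integral>u. f (z + u) \<partial>\<nu>) \<in> borel_measurable borel"
  by measurable

lemma integral_0_1:
  fixes f :: "complex \<Rightarrow> real"
  assumes [measurable]: "f \<in> borel_measurable borel" and "\<And>x. 0 \<le> f x" "\<And>x. f x \<le> 1"
  shows "0 \<le> (\<integral>u. f (z + u) \<partial>\<nu>)" "(\<integral>u. f (z + u) \<partial>\<nu>) \<le> 1"
proof -
  show "0 \<le> (\<integral>u. f (z + u) \<partial>\<nu>)" using assms by simp
  have m: "(\<lambda>u. f (z + u)) \<in> borel_measurable borel" by measurable
  have "(\<integral>u. f (z + u) \<partial>\<nu>) \<le> (\<integral>u. 1 \<partial>\<nu>)"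
    by (intro integral_mono bounded_integrable[OF m, of 1]) (use assms in auto)
  then show "(\<integral>u. f (z + u) \<partial>\<nu>) \<le> 1" using prob_space by simp
qed

lemma survival_props:
  assumes [measurable]: "K \<in> sets borel"
  shows "survival K k \<in> borel_measurable borel" "0 \<le> survival K k z" "survival K k z \<le> 1"
proof -
  have "survival K k \<in> borel_measurable borel \<and> (\<forall>z. 0 \<le> survival K k z \<and> survival K k z \<le> 1)"
  proof (induction k)
    case 0 then show ?case by (auto simp: survival_def)
  next
    case (Suc k)
    then have [measurable]: "survival K k \<in> borel_measurable borel" by auto
    have "(\<lambda>z. indicator K z * (\<integral>u. survival K k (z + u) \<partial>\<nu>)) \<in> borel_measurable borel" by measurable
    moreover have "survival K (Suc k) = (\<lambda>z. indicator K z * (\<integral>u. survival K k (z + u) \<partial>\<nu>))"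
      by (auto simp: survival_Suc)
    ultimately show ?case using integral_0_1[of "survival K k"] Suc
      by (auto simp: indicator_def)
  qed
  then show "survival K k \<in> borel_measurable borel" "0 \<le> survival K k z" "survival K k z \<le> 1" by auto
qed

end

section \<open>Decay of survival, and comparison of hitting probabilities with sub-mean-value
  functions\<close>

lemma cos_ge_quadratic: "cos x \<ge> 1 - x\<^sup>2 / 2" for x :: real
proof -
  have "(sin (x/2))\<^sup>2 \<le> (x/2)\<^sup>2" using abs_sin_x_le_abs_x[of "x/2"] by (simp only: abs_le_square_iff)
  moreover have "cos x = 1 - 2 * (sin (x/2))\<^sup>2" using cos_double_sin[of "x/2"] by simp
  ultimately show ?thesis by (simp add: power2_eq_square)
qed

lemma cos_le_quartic: "cos x \<le> 1 - x\<^sup>2 / 2 + x^4 / 24" for x :: real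
proof -
  obtain t where "cos x = (\<Sum>m<4. cos_coeff m * x ^ m) + (cos (t + 1/2 * real 4 * pi) / fact 4) * x ^ 4"
    using Maclaurin_cos_expansion[of x 4] by blast
  moreover have "(\<Sum>m<4. cos_coeff m * x ^ m) = 1 - x\<^sup>2 / 2"
  proof -
    have "{..<4::nat} = {0, 1, 2, 3}" by auto
    then show ?thesis by (simp add: cos_coeff_def fact_numeral)
  qed
  moreover have "cos (t + 1/2 * real 4 * pi) / fact 4 * x^4 \<le> 1 / 24 * x^4"
    by (intro mult_right_mono) (auto simp: fact_numeral)
  ultimately show ?thesis by simp
qed

context step_law
begin

text \<open>The function \<open>2 + cos (Re (z - c) / R)\<close> has values in [1, 3], and from a
  point of the disc its mean after one step is smaller by the factor 1 - h / (24 R^2), because the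
  cosine is at least 1/2 there. The summand 2 keeps it above 1 wherever an unbounded step may land,
  so the induction on k needs no control of jumps out of K.\<close>

lemma survival_bound:
  assumes K: "K \<in> sets borel" "K \<subseteq> cball c R" and R: "R > 0" and h: "h \<le> R\<^sup>2 / 4"
  shows "survival K k z \<le> 3 * (1 - h / (24 * R\<^sup>2)) ^ k"
proof -
  define g where "g = (\<lambda>z::complex. 2 + cos (Re (z - c) / R))"
  have g: "1 \<le> g z" "g z \<le> 3" "\<bar>g z\<bar> \<le> 3" for z
    using cos_ge_minus_one[of "Re (z - c) / R"] cos_le_one[of "Re (z - c) / R"] unfolding g_def by linarith+
  have gm [measurable]: "g \<in> borel_measurable borel" unfolding g_def by measurable
  define \<theta> where "\<theta> = 1 - h / (24 * R\<^sup>2)"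
  have \<theta>: "\<theta> \<ge> 0" "\<theta> \<le> 1" using h R h_nonneg by (auto simp: \<theta>_def field_simps)
  have step: "(\<integral>u. g (z + u) \<partial>\<nu>) \<le> \<theta> * g z" if z: "cmod (z - c) \<le> R" for z
  proof -
    define x where "x = Re (z - c) / R"
    have x: "\<bar>x\<bar> \<le> 1" using z abs_Re_le_cmod[of "z - c"] R by (simp add: x_def)
    have cx: "1/2 \<le> cos x" "cos x \<le> 1"
    proof -
      have "x\<^sup>2 \<le> 1" using x by (simp add: abs_square_le_1)
      then show "1/2 \<le> cos x" using cos_ge_quadratic[of x] by linarith
    qed auto
    have "(\<integral>u. g (z + u) \<partial>\<nu>) \<le> (2 + cos x) - 2 * (cos x / (4 * R\<^sup>2)) * h + 8 * (cos x / (48 * R^4)) * h\<^sup>2"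
    proof (rule four_point_upper[OF gm g(3)])
      fix u :: complex
      define a b where "a = Re u / R" and "b = Im u / R"
      have "(g (z + u) + g (z + \<i> * u) + g (z - u) + g (z - \<i> * u)) / 4 = 2 + (cos (x + a) + cos (x - b) + cos (x - a) + cos (x + b)) / 4"
      proof -
        have "Re (z + u - c) / R = x + a" "Re (z + \<i> * u - c) / R = x - b"
          "Re (z - u - c) / R = x - a" "Re (z - \<i> * u - c) / R = x + b"
          using R by (simp_all add: x_def a_def b_def field_simps)
        then show ?thesis by (simp add: g_def)
      qed
      also have "\<dots> = 2 + cos x * ((cos a + cos b) / 2)" by (simp add: cos_add cos_diff field_simps)
      also have "\<dots> \<le> 2 + cos x * (1 - (a\<^sup>2 + b\<^sup>2) / 4 + (a\<^sup>2 + b\<^sup>2)\<^sup>2 / 48)"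
      proof -
        have "(a\<^sup>2 + b\<^sup>2)\<^sup>2 = a^4 + b^4 + 2 * (a * b)\<^sup>2" by algebra
        then have "a^4 + b^4 \<le> (a\<^sup>2 + b\<^sup>2)\<^sup>2" by simp
        then have "(cos a + cos b) / 2 \<le> 1 - (a\<^sup>2 + b\<^sup>2) / 4 + (a\<^sup>2 + b\<^sup>2)\<^sup>2 / 48"
          using cos_le_quartic[of a] cos_le_quartic[of b]
          by (simp add: field_simps)
        then show ?thesis using cx by (intro add_left_mono mult_left_mono) auto
      qed
      also have "a\<^sup>2 + b\<^sup>2 = (cmod u)\<^sup>2 / R\<^sup>2" by (simp add: a_def b_def cmod_power2 power_divide add_divide_distrib)
      also have "2 + cos x * (1 - (cmod u)\<^sup>2 / R\<^sup>2 / 4 + ((cmod u)\<^sup>2 / R\<^sup>2)\<^sup>2 / 48)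
         = 2 + cos x - cos x / (4 * R\<^sup>2) * (cmod u)\<^sup>2 + cos x / (48 * R^4) * (cmod u)^4"
        by (simp add: field_simps power_divide)
      finally show "(g (z + u) + g (z + \<i> * u) + g (z - u) + g (z - \<i> * u)) / 4 \<le> \<dots>" .
    qed
    also have "\<dots> = 2 + cos x - cos x * (h / R\<^sup>2) * (1 / 2 - (h / R\<^sup>2) / 6)"
      using R by (simp add: field_simps power2_eq_square power4_eq_xxxx)
    also have "\<dots> \<le> 2 + cos x - 1/2 * (h / R\<^sup>2) * (1 / 4)"
    proof -
      define y where "y = h / R\<^sup>2"
      have y: "y \<le> 1/4" "y \<ge> 0" using h R h_nonneg by (simp_all add: y_def field_simps)
      have "1/2 * y * (1 / 4) \<le> cos x * y * (1 / 2 - y / 6)"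
        using cx y by (intro mult_mono mult_right_mono mult_nonneg_nonneg) auto
      then show ?thesis unfolding y_def by linarith
    qed
    \<comment> \<open>The loss is h / (8 R^2) and the function is at most 3: this is the origin of
      24.\<close>
    also have "\<dots> \<le> \<theta> * (2 + cos x)"
    proof -
      have "h / (24 * R\<^sup>2) * (2 + cos x) \<le> h / (24 * R\<^sup>2) * 3" using cx h_nonneg by (intro mult_left_mono) auto
      then show ?thesis by (simp add: \<theta>_def algebra_simps)
    qed
    finally show ?thesis by (simp add: g_def x_def)
  qed
  have "survival K k z \<le> \<theta> ^ k * g z"
  proof (induction k arbitrary: z)
    case 0 then show ?case using g by simp
  next
    case (Suc k)
    show ?case
    proof (cases "z \<in> K")
      case True
      have m: "(\<lambda>u. survival K k (z + u)) \<in> borel_measurable borel"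
        using survival_props(1)[OF K(1)] by measurable
      have m2: "(\<lambda>u. g (z + u)) \<in> borel_measurable borel" by measurable
      have i: "integrable \<nu> (\<lambda>u. \<theta> ^ k * g (z + u))"
        using bounded_integrable[OF m2 g(3)] by simp
      have "survival K (Suc k) z = (\<integral>u. survival K k (z + u) \<partial>\<nu>)" using True by (simp add: survival_Suc)
      also have "\<dots> \<le> (\<integral>u. \<theta> ^ k * g (z + u) \<partial>\<nu>)"
        by (intro integral_mono Suc.IH i bounded_integrable[OF m, of 1])
           (use survival_props[OF K(1)] in \<open>auto simp: abs_le_iff intro: order_trans[OF _ survival_props(2)[OF K(1)]]\<close>)
      also have "\<dots> = \<theta> ^ k * (\<integral>u. g (z + u) \<partial>\<nu>)" by simp
      also have "\<dots> \<le> \<theta> ^ k * (\<theta> * g z)" using step[of z] True K(2) \<theta> by (intro mult_left_mono) (auto simp: dist_norm norm_minus_commute)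
      finally show ?thesis by (simp add: mult_ac)
    qed (use \<theta> g[of z] in \<open>simp add: survival_Suc\<close>)
  qed
  also have "\<theta> ^ k * g z \<le> \<theta> ^ k * 3" using g \<theta> by (intro mult_left_mono) auto
  finally show ?thesis by (simp add: \<theta>_def)
qed

text \<open>The probability that the walk from z is in S at the times 0, ..., k and in T at time k.
  Unlike in \<open>survival\<close>, the last position is constrained as well.\<close>

definition stay_and_end :: "complex set \<Rightarrow> complex set \<Rightarrow> nat \<Rightarrow> complex \<Rightarrow> real" where
  "stay_and_end S T = rec_nat (indicator (S \<inter> T)) (\<lambda>_ s z. indicator S z * (\<integral>u. s (z + u) \<partial>\<nu>))"

lemma stay_and_end_0: "stay_and_end S T 0 z = indicator (S \<inter> T) z"
  and stay_and_end_Suc: "stay_and_end S T (Suc k) z = indicator S z * (\<integral>u. stay_and_end S T k (z + u) \<partial>\<nu>)"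
  by (simp_all add: stay_and_end_def)

lemma stay_and_end_props:
  assumes [measurable]: "S \<in> sets borel" "T \<in> sets borel"
  shows "stay_and_end S T k \<in> borel_measurable borel" "0 \<le> stay_and_end S T k z" "stay_and_end S T k z \<le> 1"
proof -
  have "stay_and_end S T k \<in> borel_measurable borel \<and> (\<forall>z. 0 \<le> stay_and_end S T k z \<and> stay_and_end S T k z \<le> 1)"
  proof (induction k)
    case 0 then show ?case by (auto simp: stay_and_end_def)
  next
    case (Suc k)
    then have [measurable]: "stay_and_end S T k \<in> borel_measurable borel" by auto
    have "(\<lambda>z. indicator S z * (\<integral>u. stay_and_end S T k (z + u) \<partial>\<nu>)) \<in> borel_measurable borel" by measurable
    moreover have "stay_and_end S T (Suc k) = (\<lambda>z. indicator S z * (\<integral>u. stay_and_end S T k (z + u) \<partial>\<nu>))"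
      by (auto simp: stay_and_end_Suc)
    ultimately show ?case using integral_0_1[of "stay_and_end S T k"] Suc
      by (auto simp: indicator_def)
  qed
  then show "stay_and_end S T k \<in> borel_measurable borel" "0 \<le> stay_and_end S T k z" "stay_and_end S T k z \<le> 1" by auto
qed

text \<open>Optional stopping. Along the walk stopped on leaving K, f does not decrease on average,
  up to 8 C h^2 per step. When the walk stops, f is at most F if U has been reached, 0 if K was left
  elsewhere, and at most F if the walk is still in K after j steps. So U is reached with probability
  at least (f z - 8 j C h^2 - F * survival) / F, and the time then left lies between k0 and k1,
  where c is guaranteed.\<close>

lemma hitting_lower_bound:
  fixes f :: "complex \<Rightarrow> real"
  assumes ST: "S \<in> sets borel" "T \<in> sets borel" and K: "K \<in> sets borel" "K \<subseteq> S"
    and fm [measurable]: "f \<in> borel_measurable borel" and f: "\<And>z. 0 \<le> f z" "\<And>z. f z \<le> F" and F: "F > 0"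
    and supp: "\<And>z. z \<notin> K \<union> U \<Longrightarrow> f z = 0"
    and C: "C \<ge> 0"
    and fp: "\<And>z u. z \<in> K \<Longrightarrow> (f (z + u) + f (z + \<i> * u) + f (z - u) + f (z - \<i> * u)) / 4 \<ge> f z - C * (cmod u)^4"
    and c: "c \<ge> 0" and base: "\<And>k z. k0 \<le> k \<Longrightarrow> k \<le> k1 \<Longrightarrow> z \<in> U \<Longrightarrow> stay_and_end S T k z \<ge> c"
    and k: "k0 + j \<le> k" "k \<le> k1" and z: "z \<in> K \<union> U"
  shows "stay_and_end S T k z \<ge> c / F * (f z - real j * (8 * C * h\<^sup>2) - F * survival K j z)"
  using k z
proof (induction j arbitrary: k z)
  \<comment> \<open>No time is left to reach U: \<open>survival K 0\<close> is 1 and the asserted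
    bound is not positive.\<close>
  case 0
  have "c / F * (f z - 0 - F * 1) \<le> 0" using c F f(2)[of z] by (intro mult_nonneg_nonpos) auto
  then show ?case using stay_and_end_props(2)[OF ST, of k z] by simp
next
  case (Suc j)
  note s = survival_props[OF K(1)] and v = stay_and_end_props[OF ST]
  show ?case
  proof (cases "z \<in> U")
    case True
    have "f z - real (Suc j) * (8 * C * h\<^sup>2) - F * survival K (Suc j) z \<le> F - 0 - 0"
      by (intro diff_mono f) (use C F s(2)[of "Suc j" z] in auto)
    then have "c / F * (f z - real (Suc j) * (8 * C * h\<^sup>2) - F * survival K (Suc j) z) \<le> c / F * F"
      using c F by (intro mult_left_mono) auto
    also have "\<dots> = c" using F by simp
    also have "c \<le> stay_and_end S T k z" using base[of k z] Suc.prems True by auto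
    finally show ?thesis .
  next
    case False
    then have zK: "z \<in> K" using Suc.prems by auto
    obtain k' where k': "k = Suc k'" using Suc.prems by (cases k) auto
    have fb: "\<bar>f x\<bar> \<le> F" for x using f[of x] by auto
    have sm [measurable]: "survival K j \<in> borel_measurable borel" and vm [measurable]: "stay_and_end S T k' \<in> borel_measurable borel"
      using s v by auto
    have mf: "(\<lambda>u. f (z + u)) \<in> borel_measurable borel" and ms: "(\<lambda>u. survival K j (z + u)) \<in> borel_measurable borel"
      and mv: "(\<lambda>u. stay_and_end S T k' (z + u)) \<in> borel_measurable borel" by measurable
    have i: "integrable \<nu> (\<lambda>u. f (z + u))" "integrable \<nu> (\<lambda>u. survival K j (z + u))" "integrable \<nu> (\<lambda>u. stay_and_end S T k' (z + u))"
      using bounded_integrable[OF mf fb] bounded_integrable[OF ms, of 1] bounded_integrable[OF mv, of 1] s v by auto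
    have "c / F * (f z - real (Suc j) * (8 * C * h\<^sup>2) - F * survival K (Suc j) z)
        \<le> c / F * ((\<integral>u. f (z + u) \<partial>\<nu>) - real j * (8 * C * h\<^sup>2) - F * (\<integral>u. survival K j (z + u) \<partial>\<nu>))"
    proof (intro mult_left_mono)
      have "(\<integral>u. f (z + u) \<partial>\<nu>) \<ge> f z - 2 * 0 * h - 8 * C * h\<^sup>2"
        by (rule four_point_lower[OF fm fb]) (use fp[OF zK] in auto)
      then show "f z - real (Suc j) * (8 * C * h\<^sup>2) - F * survival K (Suc j) z
        \<le> (\<integral>u. f (z + u) \<partial>\<nu>) - real j * (8 * C * h\<^sup>2) - F * (\<integral>u. survival K j (z + u) \<partial>\<nu>)"
        using zK by (simp add: survival_Suc algebra_simps)
    qed (use c F in auto)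
    also have "\<dots> = (\<integral>u. c / F * (f (z + u) - real j * (8 * C * h\<^sup>2) - F * survival K j (z + u)) \<partial>\<nu>)"
      using i prob_space[unfolded space_step] by simp
    also have "\<dots> \<le> (\<integral>u. stay_and_end S T k' (z + u) \<partial>\<nu>)"
    proof (intro integral_mono)
      fix u
      show "c / F * (f (z + u) - real j * (8 * C * h\<^sup>2) - F * survival K j (z + u)) \<le> stay_and_end S T k' (z + u)"
      \<comment> \<open>A jump out of K and U counts as a failure; f vanishes there, so the asserted
        bound is not positive.\<close>
      proof (cases "z + u \<in> K \<union> U")
        case True
        then show ?thesis using Suc.prems k' by (intro Suc.IH) auto
      next
        case False
        then have "f (z + u) = 0" by (rule supp)
        then have "c / F * (f (z + u) - real j * (8 * C * h\<^sup>2) - F * survival K j (z + u)) \<le> 0"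
        proof (intro mult_nonneg_nonpos)
          have "0 \<le> real j * (8 * C * h\<^sup>2)" "0 \<le> F * survival K j (z + u)" using F C s(2)[of j "z + u"] by auto
          then show "f (z + u) - real j * (8 * C * h\<^sup>2) - F * survival K j (z + u) \<le> 0"
            using \<open>f (z + u) = 0\<close> by linarith
        qed (use c F in auto)
        then show ?thesis using v(2)[of k' "z + u"] by linarith
      qed
    qed (use i in auto)
    also have "\<dots> = stay_and_end S T k z" using zK K(2) by (auto simp: k' stay_and_end_Suc)
    finally show ?thesis .
  qed
qed

text \<open>Here f is an approximate sub-eigenfunction supported in S and T: one step from its
  support keeps at least the factor 1 - 2 k h of its value, up to 8 C h^2. The errors merely add up,
  since the factor is at most 1.\<close>

lemma holding_lower_bound:
  fixes f :: "complex \<Rightarrow> real"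
  assumes ST: "S \<in> sets borel" "T \<in> sets borel"
    and fm [measurable]: "f \<in> borel_measurable borel" and f: "\<And>z. 0 \<le> f z" "\<And>z. f z \<le> 1"
    and supp: "\<And>z. f z > 0 \<Longrightarrow> z \<in> S \<inter> T"
    and C: "C \<ge> 0" and k: "0 \<le> k" "2 * k * h \<le> 1"
    and fp: "\<And>z u. f z > 0 \<Longrightarrow> (f (z + u) + f (z + \<i> * u) + f (z - u) + f (z - \<i> * u)) / 4 \<ge> f z - k * f z * (cmod u)\<^sup>2 - C * (cmod u)^4"
  shows "stay_and_end S T j z \<ge> (1 - 2 * k * h) ^ j * f z - real j * (8 * C * h\<^sup>2)"
proof (induction j arbitrary: z)
  case 0
  then show ?case using supp[of z] f[of z] by (cases "f z > 0") (auto simp: stay_and_end_0 indicator_def)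
next
  case (Suc j)
  note v = stay_and_end_props[OF ST]
  define e where "e = 1 - 2 * k * h"
  have e: "0 \<le> e" "e \<le> 1" using k h_nonneg by (auto simp: e_def)
  show ?case
  proof (cases "f z > 0")
    case False
    then have "f z = 0" using f[of z] by simp
    then show ?thesis using v(2)[of "Suc j" z] C h_nonneg
      by (simp add: order_trans[OF _ v(2)])
  next
    case True
    have fb: "\<bar>f x\<bar> \<le> 1" for x using f[of x] by auto
    have vm [measurable]: "stay_and_end S T j \<in> borel_measurable borel" using v by auto
    have mf: "(\<lambda>u. f (z + u)) \<in> borel_measurable borel"
      and mv: "(\<lambda>u. stay_and_end S T j (z + u)) \<in> borel_measurable borel" by measurable
    have i: "integrable \<nu> (\<lambda>u. f (z + u))" "integrable \<nu> (\<lambda>u. stay_and_end S T j (z + u))"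
      using bounded_integrable[OF mf fb] bounded_integrable[OF mv, of 1] v by auto
    have 1: "(\<integral>u. f (z + u) \<partial>\<nu>) \<ge> e * f z - 8 * C * h\<^sup>2"
    proof -
      have "(\<integral>u. f (z + u) \<partial>\<nu>) \<ge> f z - 2 * (k * f z) * h - 8 * C * h\<^sup>2"
        by (rule four_point_lower[OF fm fb fp[OF True]])
      then show ?thesis by (simp add: e_def algebra_simps)
    qed
    have "e ^ j * (8 * C * h\<^sup>2) \<le> 1 * (8 * C * h\<^sup>2)"
      using e C by (intro mult_right_mono power_le_one) auto
    then have "e ^ Suc j * f z - real (Suc j) * (8 * C * h\<^sup>2) \<le> e ^ j * (e * f z - 8 * C * h\<^sup>2) - real j * (8 * C * h\<^sup>2)"
      by (simp add: algebra_simps)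
    also have "\<dots> \<le> e ^ j * (\<integral>u. f (z + u) \<partial>\<nu>) - real j * (8 * C * h\<^sup>2)"
      using 1 e by (intro diff_right_mono mult_left_mono) auto
    also have "\<dots> = (\<integral>u. e ^ j * f (z + u) - real j * (8 * C * h\<^sup>2) \<partial>\<nu>)"
      using i prob_space[unfolded space_step] by simp
    also have "\<dots> \<le> (\<integral>u. stay_and_end S T j (z + u) \<partial>\<nu>)"
      by (intro integral_mono) (use i Suc.IH in \<open>auto simp: e_def\<close>)
    also have "\<dots> = stay_and_end S T (Suc j) z" using supp[OF True] by (auto simp: stay_and_end_Suc)
    finally show ?thesis by (simp add: e_def)
  qed
qed

end

section \<open>Positive harmonic functions on zigzag strips\<close>

text \<open>Harmonicity is expressed by a holomorphic q with du = Re (q dz); then u is the real part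
  of a primitive F of q. The map taking w to (w - u z) / (w + u z) sends the right half plane to the
  disc and F z to 0, and the Schwarz lemma bounds the derivative at the centre.\<close>

lemma positive_harmonic_gradient_bound:
  fixes u :: "complex \<Rightarrow> real"
  assumes q: "q holomorphic_on ball z r" and r: "r > 0"
    and pos: "\<And>w. w \<in> ball z r \<Longrightarrow> 0 < u w"
    and der: "\<And>w. w \<in> ball z r \<Longrightarrow> (u has_derivative (\<lambda>h. Re (q w * h))) (at w)"
  shows "cmod (q z) \<le> 2 * u z / r"
proof -
  obtain F0 where F0: "\<And>x. x \<in> ball z r \<Longrightarrow> (F0 has_field_derivative q x) (at x within ball z r)"
    using holomorphic_convex_primitive'[OF convex_ball open_ball q] by blast
  define F where "F = (\<lambda>w. F0 w + (of_real (u z) - F0 z))"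
  have F: "(F has_field_derivative q x) (at x)" if "x \<in> ball z r" for x
    unfolding F_def using F0[OF that] that
    by (auto intro!: derivative_eq_intros simp: at_within_open[OF _ open_ball])
  have "Re (F w) - u w = Re (F z) - u z" if w: "w \<in> ball z r" for w
  proof (rule has_derivative_zero_unique[of "ball z r"])
    fix x assume x: "x \<in> ball z r"
    have "((\<lambda>w. Re (F w)) has_derivative (\<lambda>h. Re (q x * h))) (at x)"
      using F[OF x] unfolding has_field_derivative_def by (auto intro!: derivative_eq_intros)
    from has_derivative_diff[OF this der[OF x]]
    show "((\<lambda>w. Re (F w) - u w) has_derivative (\<lambda>h. 0)) (at x within ball z r)"
      by (auto intro: has_derivative_at_withinI)
  qed (use w r in auto)
  then have ReF: "Re (F w) = u w" if "w \<in> ball z r" for w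
    using that by (auto simp: F_def)
  define c where "c = u z"
  have c: "c > 0" using pos r by (auto simp: c_def)
  have Fz: "F z = of_real c" by (simp add: F_def c_def)
  define h where "h = (\<lambda>\<xi>. (F (z + of_real r * \<xi>) - of_real c) / (F (z + of_real r * \<xi>) + of_real c))"
  have inb: "z + of_real r * \<xi> \<in> ball z r" if "norm \<xi> < 1" for \<xi> :: complex
    using that r by (simp add: dist_norm norm_mult)
  have nz: "F (z + of_real r * \<xi>) + of_real c \<noteq> 0" if "norm \<xi> < 1" for \<xi>
  proof
    assume "F (z + of_real r * \<xi>) + of_real c = 0"
    then have "Re (F (z + of_real r * \<xi>)) + c = 0" by (metis Re_complex_of_real plus_complex.sel(1) zero_complex.sel(1))
    then show False using ReF[OF inb[OF that]] pos[OF inb[OF that]] c by simp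
  qed
  have dF: "((\<lambda>\<xi>. F (z + of_real r * \<xi>)) has_field_derivative q (z + of_real r * \<xi>) * of_real r) (at \<xi>)"
    if "norm \<xi> < 1" for \<xi>
    by (rule DERIV_chain2[where g = "\<lambda>\<xi>. z + of_real r * \<xi>", OF F[OF inb[OF that]]]) (auto intro!: derivative_eq_intros)
  have dh: "(h has_field_derivative
      (q (z + of_real r * \<xi>) * of_real r * (F (z + of_real r * \<xi>) + of_real c) - (F (z + of_real r * \<xi>) - of_real c) * (q (z + of_real r * \<xi>) * of_real r))
        / ((F (z + of_real r * \<xi>) + of_real c) * (F (z + of_real r * \<xi>) + of_real c))) (at \<xi>)"
    if "norm \<xi> < 1" for \<xi>
    unfolding h_def
    by (rule DERIV_divide) (use that nz dF in \<open>auto intro!: derivative_eq_intros\<close>)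
  have "h holomorphic_on ball 0 1"
    unfolding holomorphic_on_open[OF open_ball] using dh by (metis mem_ball_0)
  moreover have "h 0 = 0" by (simp add: h_def Fz)
  moreover have "norm (h \<xi>) < 1" if "norm \<xi> < 1" for \<xi>
  proof -
    define w where "w = F (z + of_real r * \<xi>)"
    have w: "Re w > 0" using ReF[OF inb[OF that]] pos[OF inb[OF that]] by (simp add: w_def)
    have "(norm (w - of_real c))\<^sup>2 < (norm (w + of_real c))\<^sup>2"
      unfolding cmod_power2 using w c by (simp add: power2_eq_square algebra_simps)
    then have "norm (w - of_real c) < norm (w + of_real c)" by (rule power2_less_imp_less) simp
    then show ?thesis using nz[OF that] by (simp add: h_def w_def[symmetric] norm_divide)
  qed
  ultimately have "norm (deriv h 0) \<le> 1" by (rule Schwarz_Lemma(2)[where \<xi>=0]) auto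
  moreover have "deriv h 0 = q z * of_real r / (2 * of_real c)"
    using DERIV_imp_deriv[OF dh[of 0]] c by (simp add: Fz field_simps power2_eq_square)
  ultimately show ?thesis using r c
    by (simp add: norm_divide norm_mult c_def field_simps)
qed

text \<open>\<open>Re q / u\<close> is the x-derivative of ln u, and the weight is the square of the
  Dirichlet ground state of [-a, a]. The combination is chosen such that its derivative along a line
  is, up to a term that integrates to 0, a quadratic polynomial in the gradient of ln u which is
  bounded below.\<close>

definition strip_functional :: "(complex \<Rightarrow> complex) \<Rightarrow> (complex \<Rightarrow> real) \<Rightarrow> real \<Rightarrow> real \<Rightarrow> real \<Rightarrow> real" where
  "strip_functional q u a x y = integral {-a..a} (\<lambda>v. (cos (pi / (2*a) * v))\<^sup>2 *
      (- Re (q (Complex x (y + v))) / u (Complex x (y + v)) - pi / a * ln (u (Complex x (y + v)))))"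

text \<open>Since u is harmonic, the Laplacian of ln u is minus the square of its gradient. So
  differentiation along (1, s) under the integral, together with a v-derivative that integrates to
  0, leaves a quadratic polynomial in the gradient, and completing squares bounds it below by -p^2
  (1 + s^2) with p = pi / (2 a). Over the width 2 a this gives the rate pi^2 / (2 a) (1 +
  s^2).\<close>

lemma strip_functional_linear_piece:
  fixes u :: "complex \<Rightarrow> real"
  assumes \<Omega>: "open \<Omega>" and q: "q holomorphic_on \<Omega>"
    and pos: "\<And>w. w \<in> \<Omega> \<Longrightarrow> 0 < u w"
    and der: "\<And>w. w \<in> \<Omega> \<Longrightarrow> (u has_derivative (\<lambda>h. Re (q w * h))) (at w)"
    and a: "a > 0" and x12: "x1 \<le> x2"
    and sub: "\<And>x v. x \<in> {x1..x2} \<Longrightarrow> v \<in> {-a..a} \<Longrightarrow> Complex x (c0 + s * x + v) \<in> \<Omega>"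
  shows "strip_functional q u a x2 (c0 + s * x2) - strip_functional q u a x1 (c0 + s * x1)
           \<ge> - (pi\<^sup>2 / (2 * a)) * (1 + s\<^sup>2) * (x2 - x1)"
proof -
  define p where "p = pi / (2*a)"
  have p: "p > 0" using a by (simp add: p_def)
  define Z where "Z = (\<lambda>x v. Complex x (c0 + s * x + v))"
  define f where "f = (\<lambda>x v. (cos (p * v))\<^sup>2 * (- Re (q (Z x v)) / u (Z x v) - 2 * p * ln (u (Z x v))))"
  \<comment> \<open>The derivative of -q / u in the direction w. The quotient is only real
    differentiable; its real part is minus the x-derivative and its imaginary part the y-derivative
    of ln u.\<close>
  define rd where "rd = (\<lambda>z w. - (deriv q z * w) / of_real (u z) + q z * of_real (Re (q z * w) / (u z)\<^sup>2))"
  define w where "w = Complex 1 s"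
  define fx where "fx = (\<lambda>x v. (cos (p * v))\<^sup>2 * (Re (rd (Z x v) w) - 2 * p * (Re (q (Z x v) * w) / u (Z x v))))"
  have ZO: "Z x v \<in> \<Omega>" if "x \<in> {x1..x2}" "v \<in> {-a..a}" for x v using sub that by (auto simp: Z_def)
  have dZx: "((\<lambda>x. Z x v) has_vector_derivative w) (at x within S)" for x v S
  proof -
    have "(\<lambda>x. Z x v) = (\<lambda>x. of_real x * w + Complex 0 (c0 + v))"
      by (auto simp: Z_def w_def complex_eq_iff algebra_simps)
    then show ?thesis by (auto intro!: derivative_eq_intros)
  qed
  have dZv: "((\<lambda>v. Z x v) has_vector_derivative \<i>) (at v within S)" for x v S
  proof -
    have "(\<lambda>v. Z x v) = (\<lambda>v. of_real v * \<i> + Complex x (c0 + s * x))"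
      by (auto simp: Z_def complex_eq_iff algebra_simps)
    then show ?thesis by (auto intro!: derivative_eq_intros)
  qed
  have dq: "(q has_field_derivative deriv q z) (at z)" if "z \<in> \<Omega>" for z
    using holomorphic_derivI[OF q \<Omega> that] .
  have cu: "continuous_on \<Omega> u"
    using der by (meson continuous_at_imp_continuous_on has_derivative_continuous)
  have cq: "continuous_on \<Omega> q" using q by (rule holomorphic_on_imp_continuous_on)
  have cdq: "continuous_on \<Omega> (deriv q)" using holomorphic_deriv[OF q \<Omega>] by (rule holomorphic_on_imp_continuous_on)
  have u0: "u (Z x v) \<noteq> 0" "u (Z x v) > 0" if "x \<in> {x1..x2}" "v \<in> {-a..a}" for x v
    using pos[OF ZO[OF that]] by auto
  have dQ: "((\<lambda>t. - q (\<gamma> t) / of_real (u (\<gamma> t))) has_vector_derivative rd (\<gamma> t0) d) (at t0 within S)"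
    and dU: "((\<lambda>t. u (\<gamma> t)) has_real_derivative Re (q (\<gamma> t0) * d)) (at t0 within S)"
    if g: "(\<gamma> has_vector_derivative d) (at t0 within S)" and "\<gamma> t0 \<in> \<Omega>" for \<gamma> :: "real \<Rightarrow> complex" and d t0 S
  proof -
    have 1: "((\<lambda>t. q (\<gamma> t)) has_vector_derivative d * deriv q (\<gamma> t0)) (at t0 within S)"
      using field_vector_diff_chain_within[OF g DERIV_subset[OF dq[OF that(2)] subset_UNIV, of "\<gamma> ` S"]]
      by (auto simp: o_def)
    have "((u \<circ> \<gamma>) has_derivative ((\<lambda>h. Re (q (\<gamma> t0) * h)) \<circ> (\<lambda>h. h *\<^sub>R d))) (at t0 within S)"
      by (rule diff_chain_within[OF g[unfolded has_vector_derivative_def]])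
         (use der[OF that(2)] has_derivative_at_withinI in blast)
    then have 2: "((\<lambda>t. u (\<gamma> t)) has_real_derivative Re (q (\<gamma> t0) * d)) (at t0 within S)"
      unfolding has_field_derivative_def o_def
      by (rule has_derivative_eq_rhs) (auto simp: fun_eq_iff algebra_simps)
    then show "((\<lambda>t. u (\<gamma> t)) has_real_derivative Re (q (\<gamma> t0) * d)) (at t0 within S)" .
    have U: "u (\<gamma> t0) > 0" using pos[OF that(2)] .
    have "((\<lambda>t. inverse (u (\<gamma> t))) has_real_derivative - (Re (q (\<gamma> t0) * d) / (u (\<gamma> t0))\<^sup>2)) (at t0 within S)"
      by (rule DERIV_cong[OF DERIV_inverse'[OF 2]]) (use U in \<open>auto simp: field_simps power2_eq_square\<close>)
    then have 3: "((\<lambda>t. of_real (inverse (u (\<gamma> t))) :: complex) has_vector_derivative 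
        of_real (- (Re (q (\<gamma> t0) * d) / (u (\<gamma> t0))\<^sup>2))) (at t0 within S)"
      by (intro has_vector_derivative_of_real) (simp add: has_real_derivative_iff_has_vector_derivative)
    from has_vector_derivative_minus[OF has_vector_derivative_mult[OF 1 3]]
    show "((\<lambda>t. - q (\<gamma> t) / of_real (u (\<gamma> t))) has_vector_derivative rd (\<gamma> t0) d) (at t0 within S)"
      by (simp add: rd_def divide_inverse mult.commute add.commute)
  qed
  have dfx: "((\<lambda>x. f x v) has_real_derivative fx x v) (at x within {x1..x2})"
    if "x \<in> {x1..x2}" "v \<in> {-a..a}" for x v
  proof -
    have 1: "((\<lambda>x. Re (- q (Z x v) / of_real (u (Z x v)))) has_real_derivative Re (rd (Z x v) w)) (at x within {x1..x2})"
      using bounded_linear.has_vector_derivative[OF bounded_linear_Re, OF dQ[OF dZx ZO[OF that]]] by (simp add: has_real_derivative_iff_has_vector_derivative)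
    have 2: "((\<lambda>x. u (Z x v)) has_real_derivative Re (q (Z x v) * w)) (at x within {x1..x2})"
      using dU[OF dZx ZO[OF that]] .
    have "((\<lambda>x. (cos (p * v))\<^sup>2 * (Re (- q (Z x v) / of_real (u (Z x v))) - 2 * p * ln (u (Z x v)))) has_real_derivative fx x v) (at x within {x1..x2})"
      unfolding fx_def
      by (rule derivative_eq_intros 1 2 refl u0[OF that])+ (use u0[OF that] in \<open>auto simp: field_simps\<close>)
    then show ?thesis by (simp add: f_def)
  qed
  have contZ: "continuous_on S (\<lambda>y. Z (g y) (h y))" if "continuous_on S g" "continuous_on S h" for S :: "'z::topological_space set" and g h
    unfolding Z_def Complex_eq using that by (intro continuous_intros)
  have cont_fx: "continuous_on ({x1..x2} \<times> cbox (-a) a) (\<lambda>(x, v). fx x v)"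
    unfolding fx_def split_beta rd_def
    by (intro continuous_intros contZ continuous_on_compose2[OF cq] continuous_on_compose2[OF cdq] continuous_on_compose2[OF cu])
       (use ZO u0 in \<open>auto\<close>)
  have cont_f: "continuous_on (cbox (-a) a) (f x)" if "x \<in> {x1..x2}" for x
    unfolding f_def
    by (intro continuous_intros contZ continuous_on_compose2[OF cq] continuous_on_compose2[OF cu])
       (use ZO u0 that in \<open>auto\<close>)
  have deriv: "((\<lambda>x. integral (cbox (-a) a) (f x)) has_real_derivative integral (cbox (-a) a) (fx x)) (at x within {x1..x2})"
    if "x \<in> {x1..x2}" for x
    by (rule leibniz_rule_field_derivative[OF _ _ cont_fx that])
       (use dfx cont_f in \<open>auto intro: integrable_continuous_real simp: box_real\<close>)
  have low: "integral (cbox (-a) a) (fx x) \<ge> - (pi\<^sup>2 / (2 * a)) * (1 + s\<^sup>2)" if x: "x \<in> {x1..x2}" for x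
  proof -
    define r where "r = (\<lambda>v. - q (Z x v) / of_real (u (Z x v)))"
    define H where "H = (\<lambda>v. - Im (r v) - s * Re (r v))"
    define H' where "H' = (\<lambda>v. - Im (rd (Z x v) \<i>) - s * Re (rd (Z x v) \<i>))"
    \<comment> \<open>The v-derivative of the weight times H. The weight vanishes at both ends, as p
      a = pi / 2, so B integrates to 0; adding it supplies the second derivatives that complete the
      Laplacian of ln u.\<close>
    define B where "B = (\<lambda>v. - 2 * p * cos (p * v) * sin (p * v) * H v + (cos (p * v))\<^sup>2 * H' v)"
    have rv: "(r has_vector_derivative rd (Z x v) \<i>) (at v within S)" if "v \<in> {-a..a}" for v S
      unfolding r_def by (rule dQ[OF dZv ZO[OF x that]])
    have dH: "(H has_real_derivative H' v) (at v within S)" if "v \<in> {-a..a}" for v S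
    proof -
      have 1: "((\<lambda>v. Re (r v)) has_real_derivative Re (rd (Z x v) \<i>)) (at v within S)"
       and 2: "((\<lambda>v. Im (r v)) has_real_derivative Im (rd (Z x v) \<i>)) (at v within S)"
        using bounded_linear.has_vector_derivative[OF bounded_linear_Re, OF rv[OF that, of S]]
          bounded_linear.has_vector_derivative[OF bounded_linear_Im, OF rv[OF that, of S]]
        by (auto simp: has_real_derivative_iff_has_vector_derivative)
      show ?thesis unfolding H_def H'_def
        by (rule DERIV_cong[OF DERIV_diff[OF DERIV_minus[OF 2] DERIV_cmult[OF 1]]]) simp
    qed
    have B: "(B has_integral ((cos (p*a))\<^sup>2 * H a - (cos (p*(-a)))\<^sup>2 * H (-a))) {-a..a}"
    proof (rule fundamental_theorem_of_calculus)
      fix v assume v: "v \<in> {-a..a}"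
      show "((\<lambda>v. (cos (p * v))\<^sup>2 * H v) has_vector_derivative B v) (at v within {-a..a})"
        unfolding has_real_derivative_iff_has_vector_derivative[symmetric] B_def
        by (rule derivative_eq_intros dH[OF v] refl)+ (auto simp: algebra_simps)
    qed (use a in auto)
    have pa: "p * a = pi / 2" using a by (simp add: p_def)
    have B0: "(B has_integral 0) {-a..a}" using B by (simp add: pa)
    have pw: "fx x v + B v \<ge> - (p\<^sup>2 * (1 + s\<^sup>2))" if v: "v \<in> {-a..a}" for v
    proof -
      define k where "k = 1 + s\<^sup>2"
      have k: "k > 0" by (simp add: k_def add_pos_nonneg)
      define C S where "C = cos (p * v)" and "S = sin (p * v)"
      have CS: "C\<^sup>2 + S\<^sup>2 = 1" by (simp add: C_def S_def)
      define X Y where "X = Re (r v)" and "Y = Im (r v)"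
      define U where "U = u (Z x v)"
      have U: "U > 0" using u0[OF x v] by (simp add: U_def)
      obtain qa qb where qq: "q (Z x v) = Complex qa qb" by (cases "q (Z x v)")
      obtain da db where dd: "deriv q (Z x v) = Complex da db" by (cases "deriv q (Z x v)")
      have X: "X = - qa / U" and Y: "Y = - qb / U" by (simp_all add: X_def Y_def r_def qq U_def[symmetric])
      have id: "Re (rd (Z x v) w) + H' v = X\<^sup>2 + Y\<^sup>2"
        unfolding H'_def rd_def X Y qq dd w_def U_def[symmetric] using U
        by (simp add: field_simps power2_eq_square)
      have id2: "- (Re (q (Z x v) * w) / u (Z x v)) = X - s * Y"
        unfolding X Y qq w_def U_def[symmetric] using U by (simp add: field_simps)
      have H: "H v = - Y - s * X" by (simp add: H_def X_def Y_def)
      have tot: "fx x v + B v = C\<^sup>2 * (X\<^sup>2 + Y\<^sup>2) + 2 * p * C\<^sup>2 * (X - s * Y) - 2 * p * C * S * (- Y - s * X)"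
        unfolding fx_def B_def H id2[symmetric] C_def[symmetric] S_def[symmetric] id[symmetric]
        by (simp add: algebra_simps)
      \<comment> \<open>A sum of two squares, after multiplication by k to clear denominators. The
        terms with S come from the derivative of the weight.\<close>
      have "k * (fx x v + B v + p\<^sup>2 * k * (C\<^sup>2 + S\<^sup>2))
         = C\<^sup>2 * (X - s * Y + p * k)\<^sup>2 + (C * (- Y - s * X) - p * k * S)\<^sup>2"
        unfolding tot k_def by algebra
      also have "\<dots> \<ge> 0" by simp
      finally have "fx x v + B v + p\<^sup>2 * k * (C\<^sup>2 + S\<^sup>2) \<ge> 0" using k by (simp add: zero_le_mult_iff)
      then show ?thesis by (simp add: CS k_def)
    qed
    have "continuous_on {-a..a} (\<lambda>v. (x, v))" by (intro continuous_intros)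
    moreover have "(\<lambda>v. (x, v)) ` {-a..a} \<subseteq> {x1..x2} \<times> cbox (-a) a" using x by (auto simp: box_real)
    ultimately have "continuous_on {-a..a} (fx x)"
      using continuous_on_compose2[OF cont_fx] by fastforce
    then have "fx x integrable_on {-a..a}" by (rule integrable_continuous_real)
    then have I: "((\<lambda>v. fx x v + B v) has_integral integral {-a..a} (fx x) + 0) {-a..a}"
      by (intro has_integral_add B0) (simp add: has_integral_integral)
    have "((\<lambda>v::real. - (p\<^sup>2 * (1 + s\<^sup>2))) has_integral (a - (-a)) *\<^sub>R (- (p\<^sup>2 * (1 + s\<^sup>2)))) {-a..a}"
      using has_integral_const_real[of "- (p\<^sup>2 * (1 + s\<^sup>2))" "-a" a] a by simp
    from has_integral_le[OF this I] pw
    have "integral {-a..a} (fx x) \<ge> (a - (-a)) *\<^sub>R (- (p\<^sup>2 * (1 + s\<^sup>2)))" by simp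
    also have "(a - (-a)) *\<^sub>R (- (p\<^sup>2 * (1 + s\<^sup>2))) = - (pi\<^sup>2 / (2 * a)) * (1 + s\<^sup>2)"
      using a by (simp add: p_def field_simps power2_eq_square)
    finally show ?thesis by (simp add: box_real)
  qed
  define W where "W = (\<lambda>x. integral (cbox (-a) a) (f x) + (pi\<^sup>2 / (2 * a)) * (1 + s\<^sup>2) * x)"
  have "W x1 \<le> W x2"
  proof (rule DERIV_nonneg_imp_increasing_open[OF x12])
    fix x assume x: "x1 < x" "x < x2"
    have "(W has_real_derivative (integral (cbox (-a) a) (fx x) + (pi\<^sup>2 / (2 * a)) * (1 + s\<^sup>2))) (at x within {x1..x2})"
      unfolding W_def by (rule DERIV_cong[OF DERIV_add[OF deriv DERIV_cmult[OF DERIV_ident]]]) (use x in auto)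
    then have "(W has_real_derivative (integral (cbox (-a) a) (fx x) + (pi\<^sup>2 / (2 * a)) * (1 + s\<^sup>2))) (at x)"
      using at_within_Icc_at[OF x] by simp
    with low[of x] x show "\<exists>y. (W has_real_derivative y) (at x) \<and> 0 \<le> y" by auto
  next
    show "continuous_on {x1..x2} W" unfolding W_def
      by (rule continuous_on_add[OF DERIV_continuous_on[OF deriv]]) (use a in \<open>auto intro!: continuous_intros\<close>)
  qed
  moreover have "strip_functional q u a x (c0 + s * x) = integral (cbox (-a) a) (f x)" for x
    unfolding strip_functional_def f_def Z_def p_def box_real by (simp add: add.assoc)
  then have W: "W x = strip_functional q u a x (c0 + s * x) + (pi\<^sup>2 / (2 * a)) * (1 + s\<^sup>2) * x" for x
    unfolding W_def by (simp only:)
  ultimately show ?thesis using W[of x1] W[of x2] unfolding right_diff_distrib by linarith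
qed

text \<open>The gradient of ln u is at most 2 / r, because a ball of radius r around each point of S
  stays in the domain.\<close>

lemma log_harnack:
  fixes u :: "complex \<Rightarrow> real"
  assumes q: "q holomorphic_on \<Omega>"
    and pos: "\<And>w. w \<in> \<Omega> \<Longrightarrow> 0 < u w"
    and der: "\<And>w. w \<in> \<Omega> \<Longrightarrow> (u has_derivative (\<lambda>h. Re (q w * h))) (at w)"
    and r: "r > 0" and cov: "convex S" and sub: "\<And>z. z \<in> S \<Longrightarrow> ball z r \<subseteq> \<Omega>"
    and zw: "z \<in> S" "w \<in> S"
  shows "\<bar>ln (u z) - ln (u w)\<bar> \<le> 2 / r * cmod (z - w)"
proof -
  have "norm (ln (u z) - ln (u w)) \<le> 2 / r * norm (z - w)"
  proof (rule differentiable_bound[OF cov _ _ zw(1) zw(2)])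
    fix x assume x: "x \<in> S"
    then have xO: "x \<in> \<Omega>" using sub r by force
    have "((\<lambda>x. ln (u x)) has_derivative (\<lambda>h. Re (q x * h) * inverse (u x))) (at x)"
      by (rule has_derivative_eq_rhs[OF has_derivative_ln[OF pos[OF xO] der[OF xO]]])
         (auto simp: fun_eq_iff field_simps)
    then show "((\<lambda>x. ln (u x)) has_derivative (\<lambda>h. Re (q x * h) * inverse (u x))) (at x within S)"
      by (rule has_derivative_at_withinI)
    have "cmod (q x) \<le> 2 * u x / r"
      by (rule positive_harmonic_gradient_bound[OF holomorphic_on_subset[OF q sub[OF x]] r])
         (use sub[OF x] pos der in auto)
    then have g: "cmod (q x) * inverse (u x) \<le> 2 / r"
      using pos[OF xO] r by (simp add: field_simps)
    have "\<bar>Re (q x * h) * inverse (u x)\<bar> \<le> 2 / r * cmod h" for h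
    proof -
      have "\<bar>Re (q x * h) * inverse (u x)\<bar> \<le> cmod (q x * h) * inverse (u x)"
        unfolding abs_mult using abs_Re_le_cmod[of "q x * h"] pos[OF xO] by (simp add: mult_right_mono)
      also have "\<dots> = (cmod (q x) * inverse (u x)) * cmod h" by (simp add: norm_mult)
      also have "\<dots> \<le> 2 / r * cmod h" using g by (intro mult_right_mono) auto
      finally show ?thesis .
    qed
    then show "onorm (\<lambda>h. Re (q x * h) * inverse (u x)) \<le> 2 / r"
      by (intro onorm_le) auto
  qed
  then show ?thesis by simp
qed

text \<open>By the Harnack bounds ln u varies little on the cross section and its x-derivative is
  bounded. The weight has integral a, so the functional is -pi times ln u at the midpoint, up to the
  error; in this way u is read off from the functional at the two ends of a strip.\<close>

lemma strip_functional_approx: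
  fixes u :: "complex \<Rightarrow> real"
  assumes q: "q holomorphic_on \<Omega>"
    and pos: "\<And>w. w \<in> \<Omega> \<Longrightarrow> 0 < u w"
    and der: "\<And>w. w \<in> \<Omega> \<Longrightarrow> (u has_derivative (\<lambda>h. Re (q w * h))) (at w)"
    and r: "r > 0" and a: "a > 0" and sub: "\<And>v. v \<in> {-a..a} \<Longrightarrow> ball (Complex x (y + v)) r \<subseteq> \<Omega>"
  shows "\<bar>strip_functional q u a x y + pi * ln (u (Complex x y))\<bar> \<le> 4 * a * (1 + pi) / r"
proof -
  define p where "p = pi / (2*a)"
  have p: "p > 0" using a by (simp add: p_def)
  define Z where "Z = (\<lambda>v. Complex x (y + v))"
  have ZO: "Z v \<in> \<Omega>" if "v \<in> {-a..a}" for v using sub[OF that] r by (force simp: Z_def)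
  have contZ: "continuous_on S Z" for S unfolding Z_def Complex_eq by (intro continuous_intros)
  have cu: "continuous_on \<Omega> u"
    using der by (meson continuous_at_imp_continuous_on has_derivative_continuous)
  have cq: "continuous_on \<Omega> q" using q by (rule holomorphic_on_imp_continuous_on)
  have u0: "u (Z v) > 0" "u (Z v) \<noteq> 0" if "v \<in> {-a..a}" for v using pos[OF ZO[OF that]] by auto
  define f where "f = (\<lambda>v. (cos (p * v))\<^sup>2 * (- Re (q (Z v)) / u (Z v) - pi / a * ln (u (Z v))))"
  have cf: "continuous_on {-a..a} f"
    unfolding f_def
    by (intro continuous_intros continuous_on_compose2[OF cq contZ] continuous_on_compose2[OF cu contZ])
       (use ZO u0 in auto)
  have F: "(f has_integral strip_functional q u a x y) {-a..a}"
    using integrable_continuous_real[OF cf] unfolding strip_functional_def f_def Z_def p_def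
    by (simp add: has_integral_integral)
  have pa: "p * a = pi / 2" using a by (simp add: p_def)
  have "((\<lambda>v. (cos (p * v))\<^sup>2) has_integral (a / 2 + sin (2 * (p * a)) / (4 * p)) - (-a / 2 + sin (2 * (p * (-a))) / (4 * p))) {-a..a}"
  proof (rule fundamental_theorem_of_calculus)
    fix v assume "v \<in> {-a..a}"
    have "((\<lambda>v. v / 2 + sin (2 * (p * v)) / (4 * p)) has_real_derivative 1 / 2 + cos (2 * (p * v)) * (2 * p) / (4 * p)) (at v within {-a..a})"
      by (auto intro!: derivative_eq_intros simp: p less_imp_neq[OF p, symmetric])
    also have "1 / 2 + cos (2 * (p * v)) * (2 * p) / (4 * p) = (cos (p * v))\<^sup>2"
      using p cos_double_cos[of "p * v"] by (simp add: field_simps)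
    finally show "((\<lambda>v. v / 2 + sin (2 * (p * v)) / (4 * p)) has_vector_derivative (cos (p * v))\<^sup>2) (at v within {-a..a})"
      by (simp add: has_real_derivative_iff_has_vector_derivative)
  qed (use a in auto)
  then have C: "((\<lambda>v. (cos (p * v))\<^sup>2) has_integral a) {-a..a}"
    by (simp add: pa)
  define L where "L = ln (u (Complex x y))"
  have I: "((\<lambda>v. f v + (cos (p * v))\<^sup>2 * (pi / a * L)) has_integral (strip_functional q u a x y + a * (pi / a * L))) {-a..a}"
    by (intro has_integral_add F has_integral_mult_left C)
  have "norm (strip_functional q u a x y + a * (pi / a * L)) \<le> (2 / r + 2 * pi / r) * measure lborel (cbox (-a) a)"
  proof (rule has_integral_bound[OF _ I[folded box_real]])
    show "0 \<le> 2 / r + 2 * pi / r" using r by simp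
    fix v assume v: "v \<in> cbox (-a) a"
    then have v': "v \<in> {-a..a}" by (simp add: box_real)
    have "cmod (q (Z v)) \<le> 2 * u (Z v) / r"
      by (rule positive_harmonic_gradient_bound[OF holomorphic_on_subset[OF q] r])
         (use sub[OF v'] pos der in \<open>auto simp: Z_def\<close>)
    then have "\<bar>Re (q (Z v))\<bar> \<le> 2 * u (Z v) / r" using abs_Re_le_cmod[of "q (Z v)"] by linarith
    then have "\<bar>Re (q (Z v))\<bar> / u (Z v) \<le> (2 * u (Z v) / r) / u (Z v)"
      using u0[OF v'] by (intro divide_right_mono) auto
    then have 1: "\<bar>Re (q (Z v)) / u (Z v)\<bar> \<le> 2 / r" using u0[OF v'] by simp
    have "\<bar>ln (u (Z v)) - ln (u (Z 0))\<bar> \<le> 2 / r * cmod (Z v - Z 0)"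
    proof (rule log_harnack[OF q pos der r, where S = "Z ` {-a..a}"])
      have "Z ` {-a..a} = {z. Re z \<ge> x} \<inter> {z. Re z \<le> x} \<inter> {z. Im z \<ge> y - a} \<inter> {z. Im z \<le> y + a}"
      proof (intro equalityI subsetI)
        fix z assume "z \<in> {z. Re z \<ge> x} \<inter> {z. Re z \<le> x} \<inter> {z. Im z \<ge> y - a} \<inter> {z. Im z \<le> y + a}"
        then have "z = Z (Im z - y)" "Im z - y \<in> {-a..a}" by (auto simp: Z_def complex_eq_iff)
        then show "z \<in> Z ` {-a..a}" by (rule image_eqI)
      qed (auto simp: Z_def)
      then show "convex (Z ` {-a..a})"
        by (simp add: convex_Int convex_halfspace_Re_ge convex_halfspace_Re_le convex_halfspace_Im_ge convex_halfspace_Im_le)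
      show "\<And>z. z \<in> Z ` {-a..a} \<Longrightarrow> ball z r \<subseteq> \<Omega>" using sub unfolding Z_def by blast
    qed (use v' a in auto)
    also have "cmod (Z v - Z 0) \<le> a"
      using v' by (simp add: Z_def cmod_def abs_le_iff)
    finally have 2: "\<bar>ln (u (Z v)) - L\<bar> \<le> 2 / r * a" using r by (simp add: Z_def L_def mult_left_mono divide_right_mono)
    have "\<bar>- Re (q (Z v)) / u (Z v) - pi / a * (ln (u (Z v)) - L)\<bar> \<le> 2 / r + pi / a * (2 / r * a)"
    proof -
      have "\<bar>pi / a * (ln (u (Z v)) - L)\<bar> \<le> pi / a * (2 / r * a)"
        unfolding abs_mult using 2 a by (intro mult_mono) auto
      with 1 show ?thesis by linarith
    qed
    also have "\<dots> = 2 / r + 2 * pi / r" using a by simp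
    finally have 3: "\<bar>- Re (q (Z v)) / u (Z v) - pi / a * (ln (u (Z v)) - L)\<bar> \<le> 2 / r + 2 * pi / r" .
    have "f v + (cos (p * v))\<^sup>2 * (pi / a * L) = (cos (p * v))\<^sup>2 * (- Re (q (Z v)) / u (Z v) - pi / a * (ln (u (Z v)) - L))"
      by (simp add: f_def algebra_simps)
    then have "norm (f v + (cos (p * v))\<^sup>2 * (pi / a * L)) = (cos (p * v))\<^sup>2 * \<bar>- Re (q (Z v)) / u (Z v) - pi / a * (ln (u (Z v)) - L)\<bar>"
      by (simp only: real_norm_def abs_mult) simp
    also have "\<dots> \<le> 1 * (2 / r + 2 * pi / r)"
      using 3 by (intro mult_mono) (auto simp: abs_square_le_1)
    finally show "norm (f v + (cos (p * v))\<^sup>2 * (pi / a * L)) \<le> 2 / r + 2 * pi / r" by simp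
  qed
  also have "(2 / r + 2 * pi / r) * measure lborel (cbox (-a) a) = 4 * a * (1 + pi) / r"
    using a r by (simp add: field_simps)
  finally show ?thesis using a by (simp add: L_def)
qed

text \<open>The rate is the one of extremal length: \<open>pi / (2 * a)\<close> times the Dirichlet integral of the
  height coordinate of the strip. In particular corners of \<open>\<theta>\<close> cost nothing.\<close>

theorem positive_harmonic_growth_zigzag:
  fixes u :: "complex \<Rightarrow> real" and \<theta> :: "real \<Rightarrow> real"
  assumes \<Omega>: "open \<Omega>" and q: "q holomorphic_on \<Omega>"
    and pos: "\<And>w. w \<in> \<Omega> \<Longrightarrow> 0 < u w"
    and der: "\<And>w. w \<in> \<Omega> \<Longrightarrow> (u has_derivative (\<lambda>h. Re (q w * h))) (at w)"
    and a: "a > 0" and l: "l > 0" and r: "r > 0"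
    and lin: "\<And>j x. j < m \<Longrightarrow> x \<in> {real j * l..real (Suc j) * l} \<Longrightarrow> \<theta> x = \<theta> (real j * l) + \<sigma> j * (x - real j * l)"
    and slope: "\<And>j. j < m \<Longrightarrow> (\<sigma> j)\<^sup>2 = s\<^sup>2"
    and sub: "\<And>x v. x \<in> {0..real m * l} \<Longrightarrow> v \<in> {-a..a} \<Longrightarrow> Complex x (\<theta> x + v) \<in> \<Omega>"
    and sub0: "\<And>v. v \<in> {-a..a} \<Longrightarrow> ball (Complex 0 (\<theta> 0 + v)) r \<subseteq> \<Omega>"
    and sub1: "\<And>v. v \<in> {-a..a} \<Longrightarrow> ball (Complex (real m * l) (\<theta> (real m * l) + v)) r \<subseteq> \<Omega>"
  shows "ln (u (Complex (real m * l) (\<theta> (real m * l)))) - pi / (2 * a) * (1 + s\<^sup>2) * (real m * l) - 16 * a / r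
          \<le> ln (u (Complex 0 (\<theta> 0)))"
proof -
  define W where "W = (\<lambda>x. strip_functional q u a x (\<theta> x))"
  have "W (real k * l) - W 0 \<ge> - (pi\<^sup>2 / (2 * a)) * (1 + s\<^sup>2) * (real k * l)" if "k \<le> m" for k
    using that
  proof (induction k)
    case (Suc k)
    define c0 where "c0 = \<theta> (real k * l) - \<sigma> k * (real k * l)"
    have th: "\<theta> x = c0 + \<sigma> k * x" if "x \<in> {real k * l..real (Suc k) * l}" for x
      using lin[OF _ that] Suc.prems by (simp add: c0_def algebra_simps)
    have "strip_functional q u a (real (Suc k) * l) (c0 + \<sigma> k * (real (Suc k) * l))
        - strip_functional q u a (real k * l) (c0 + \<sigma> k * (real k * l))
           \<ge> - (pi\<^sup>2 / (2 * a)) * (1 + (\<sigma> k)\<^sup>2) * (real (Suc k) * l - real k * l)"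
    proof (rule strip_functional_linear_piece[OF \<Omega> q pos der a])
      show "real k * l \<le> real (Suc k) * l" using l by (intro mult_right_mono) auto
      fix x v assume x: "x \<in> {real k * l..real (Suc k) * l}" and v: "v \<in> {-a..a}"
      have "0 \<le> real k * l" "real (Suc k) * l \<le> real m * l" using Suc.prems l by (auto intro: mult_right_mono)
      with x have "x \<in> {0..real m * l}" by auto
      from sub[OF this v] show "Complex x (c0 + \<sigma> k * x + v) \<in> \<Omega>" by (simp add: th[OF x])
    qed auto
    then have "W (real (Suc k) * l) - W (real k * l) \<ge> - (pi\<^sup>2 / (2 * a)) * (1 + s\<^sup>2) * l"
      using th[of "real k * l"] th[of "real (Suc k) * l"] slope[of k] Suc.prems l
      by (simp add: W_def algebra_simps)
    moreover have "- (pi\<^sup>2 / (2 * a)) * (1 + s\<^sup>2) * (real (Suc k) * l)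
        = - (pi\<^sup>2 / (2 * a)) * (1 + s\<^sup>2) * (real k * l) + - (pi\<^sup>2 / (2 * a)) * (1 + s\<^sup>2) * l"
      by (simp add: distrib_left distrib_right)
    ultimately show ?case using Suc by linarith
  qed simp
  from this[of m] have 1: "W (real m * l) - W 0 \<ge> - (pi\<^sup>2 / (2 * a)) * (1 + s\<^sup>2) * (real m * l)" by simp
  define e where "e = 4 * a * (1 + pi) / r"
  define K where "K = (1 + s\<^sup>2) * (real m * l)"
  have 2: "\<bar>W 0 + pi * ln (u (Complex 0 (\<theta> 0)))\<bar> \<le> e"
    unfolding W_def e_def by (rule strip_functional_approx[OF q pos der r a sub0])
  have 3: "\<bar>W (real m * l) + pi * ln (u (Complex (real m * l) (\<theta> (real m * l))))\<bar> \<le> e"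
    unfolding W_def e_def by (rule strip_functional_approx[OF q pos der r a sub1])
  define X Y where "X = ln (u (Complex 0 (\<theta> 0)))" and "Y = ln (u (Complex (real m * l) (\<theta> (real m * l))))"
  have 4: "pi * X \<ge> pi * Y - pi\<^sup>2 / (2 * a) * K - 2 * e"
    using 1 2 3 unfolding K_def X_def Y_def by (simp add: mult.assoc)
  have 5: "2 * e \<le> pi * (16 * a / r)"
    unfolding e_def using a r pi_gt3 by (simp add: field_simps)
  have 6: "pi\<^sup>2 / (2 * a) * K = pi * (pi / (2 * a) * K)" by (simp add: power2_eq_square)
  have "pi * (Y - pi / (2 * a) * K - 16 * a / r) = pi * Y - pi * (pi / (2 * a) * K) - pi * (16 * a / r)"
    by (simp only: right_diff_distrib)
  also have "\<dots> \<le> pi * X" using 4 5 6 by linarith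
  finally have "Y - pi / (2 * a) * K - 16 * a / r \<le> X" by simp
  then show ?thesis unfolding K_def X_def Y_def by (simp add: mult.assoc)
qed

section \<open>Logarithmic potentials and Green functions of spiral strips\<close>

text \<open>If \<Phi> is a Riemann map of D with its zero at c, then -ln |\<Phi>| is the Green
  function of D with pole c. Subtracting \<epsilon> before the cut at 0 moves the support into a
  compact part of D, and the cut at F removes the pole. The zero of \<Phi> is a separate case
  because the total function \<open>ln\<close> is not infinite at 0.\<close>

definition log_potential :: "(complex \<Rightarrow> complex) \<Rightarrow> complex set \<Rightarrow> real \<Rightarrow> real \<Rightarrow> complex \<Rightarrow> real" where
  "log_potential \<Phi> D \<epsilon> F z = (if z \<in> D then if \<Phi> z = 0 then F else min F (max 0 (- ln (cmod (\<Phi> z)) - \<epsilon>)) else 0)"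

lemma log_potential_measurable:
  assumes D: "open D" and \<Phi>: "continuous_on D \<Phi>"
  shows "log_potential \<Phi> D \<epsilon> F \<in> borel_measurable borel"
proof -
  have [measurable]: "D \<in> sets borel" using D by simp
  define \<Psi> where "\<Psi> = (\<lambda>z. indicator D z *\<^sub>R \<Phi> z)"
  have [measurable]: "\<Psi> \<in> borel_measurable borel"
    unfolding \<Psi>_def by (rule borel_measurable_continuous_on_indicator) (use \<Phi> in auto)
  have "log_potential \<Phi> D \<epsilon> F = (\<lambda>z. if z \<in> D then if \<Psi> z = 0 then F else min F (max 0 (- ln (cmod (\<Psi> z)) - \<epsilon>)) else 0)"
    by (auto simp: log_potential_def \<Psi>_def fun_eq_iff)
  also have "\<dots> \<in> borel_measurable borel" by measurable
  finally show ?thesis .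
qed

lemma log_modulus_has_derivative:
  assumes D: "open D" and \<Phi>: "\<Phi> holomorphic_on D" and z: "z \<in> D" "\<Phi> z \<noteq> 0"
  shows "((\<lambda>z. - ln (cmod (\<Phi> z))) has_derivative (\<lambda>h. Re (- deriv \<Phi> z / \<Phi> z * h))) (at z)"
proof -
  have d: "(\<Phi> has_derivative (\<lambda>h. deriv \<Phi> z * h)) (at z)"
    using holomorphic_derivI[OF \<Phi> D z(1)] by (simp add: has_field_derivative_def)
  have 1: "((\<lambda>w. ln (cmod w)) has_derivative (\<lambda>h. Re (h / \<Phi> z))) (at (\<Phi> z))"
  proof -
    have "((\<lambda>w. norm w) has_derivative (\<lambda>h. inner h (\<Phi> z) / norm (\<Phi> z))) (at (\<Phi> z))"
      using has_derivative_norm[OF z(2)] by (simp add: sgn_div_norm divide_inverse mult.commute)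
    from has_derivative_ln[OF _ this] have "((\<lambda>w. ln (norm w)) has_derivative (\<lambda>h. inner h (\<Phi> z) / norm (\<Phi> z) * inverse (norm (\<Phi> z)))) (at (\<Phi> z))"
      using z by simp
    moreover have "inner h (\<Phi> z) / norm (\<Phi> z) * inverse (norm (\<Phi> z)) = Re (h / \<Phi> z)" for h
      using z(2) cmod_power2[of "\<Phi> z"] by (simp add: Re_divide inner_complex_def power2_eq_square field_simps)
    ultimately show ?thesis by (simp add: fun_eq_iff)
  qed
  have "((\<lambda>z. - ln (cmod (\<Phi> z))) has_derivative (\<lambda>h. - Re (deriv \<Phi> z * h / \<Phi> z))) (at z)"
    using has_derivative_minus[OF diff_chain_at[OF d 1]] by (simp add: o_def)
  then show ?thesis by (rule has_derivative_eq_rhs) (auto simp: fun_eq_iff)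
qed

text \<open>Summed over v, i v, -v and -i v, the Taylor polynomial of degree 3 of a holomorphic
  primitive leaves its constant term only. The remainder is controlled by the third derivative of q
  on a compact neighbourhood of K, so the constant is uniform on K.\<close>

lemma harmonic_four_point:
  fixes u :: "complex \<Rightarrow> real"
  assumes \<Omega>: "open \<Omega>" and q: "q holomorphic_on \<Omega>"
    and der: "\<And>w. w \<in> \<Omega> \<Longrightarrow> (u has_derivative (\<lambda>h. Re (q w * h))) (at w)"
    and K: "compact K" "K \<subseteq> \<Omega>"
  obtains r0 C where "r0 > 0" "C \<ge> 0"
    "\<And>z v. z \<in> K \<Longrightarrow> cmod v < r0 \<Longrightarrow> z + v \<in> \<Omega>"
    "\<And>z v. z \<in> K \<Longrightarrow> cmod v < r0 \<Longrightarrow> (u (z + v) + u (z + \<i> * v) + u (z - v) + u (z - \<i> * v)) / 4 \<ge> u z - C * (cmod v)^4"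
proof -
  obtain e where e: "e > 0" "(\<Union>x\<in>K. cball x e) \<subseteq> \<Omega>"
    using compact_subset_open_imp_cball_epsilon_subset[OF K(1) \<Omega> K(2)] by blast
  define Q where "Q = (deriv ^^ 3) q"
  have Qh: "Q holomorphic_on \<Omega>" unfolding Q_def by (rule holomorphic_higher_deriv[OF q \<Omega>])
  define K' where "K' = {x + y | x y. x \<in> K \<and> y \<in> cball 0 e}"
  have "compact K'" unfolding K'_def by (rule compact_sums[OF K(1) compact_cball])
  moreover have K'e: "cball x e \<subseteq> K'" if "x \<in> K" for x
  proof
    fix y assume "y \<in> cball x e"
    then show "y \<in> K'" unfolding K'_def using that by (intro CollectI exI[of _ x] exI[of _ "y - x"]) (auto simp: dist_norm norm_minus_commute)
  qed
  moreover have "K' \<subseteq> \<Omega>" using e(2) by (force simp: K'_def dist_norm)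
  ultimately have "bounded (Q ` K')"
    using Qh by (meson compact_imp_bounded compact_continuous_image continuous_on_subset holomorphic_on_imp_continuous_on)
  then obtain B where B: "B > 0" "\<And>w. w \<in> K' \<Longrightarrow> cmod (Q w) \<le> B" by (auto simp: bounded_pos)
  show ?thesis
  proof (rule that[of e "B / 6"])
    fix z v assume z: "z \<in> K" and v: "cmod v < e"
    have ballsub: "ball z e \<subseteq> \<Omega>" using e(2) z by force
    show "z + v \<in> \<Omega>" using ballsub v by (auto simp: dist_norm)
    have qb: "q holomorphic_on ball z e" using q ballsub holomorphic_on_subset by blast
    obtain F where F: "\<And>x. x \<in> ball z e \<Longrightarrow> (F has_field_derivative q x) (at x within ball z e)"
      using holomorphic_convex_primitive'[OF convex_ball open_ball qb] by blast
    have ReF: "Re (F w) - u w = Re (F z) - u z" if w: "w \<in> ball z e" for w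
    proof (rule has_derivative_zero_unique[of "ball z e"])
      fix x assume x: "x \<in> ball z e"
      then have "(F has_field_derivative q x) (at x)" using F by (simp add: at_within_open[OF _ open_ball])
      then have "((\<lambda>w. Re (F w)) has_derivative (\<lambda>h. Re (q x * h))) (at x)"
        unfolding has_field_derivative_def by (auto intro!: derivative_eq_intros)
      from has_derivative_diff[OF this der[OF subsetD[OF ballsub x]]]
      show "((\<lambda>w. Re (F w) - u w) has_derivative (\<lambda>h. 0)) (at x within ball z e)"
        by (auto intro: has_derivative_at_withinI)
    qed (use w e in auto)
    \<comment> \<open>The primitive followed by q and the derivatives of q: the sequence of
      successive derivatives that the Taylor formula takes.\<close>
    define f where "f = (\<lambda>i::nat. if i = 0 then F else (deriv ^^ (i - 1)) q)"
    have taylor: "cmod (F (z + w) - (\<Sum>i\<le>3. f i z * w ^ i / fact i)) \<le> B * cmod w ^ 4 / 6" if w: "cmod w < e" for w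
    proof -
      have "cmod (f 0 (z + w) - (\<Sum>i\<le>3. f i z * (z + w - z) ^ i / fact i)) \<le> B * cmod (z + w - z) ^ Suc 3 / fact 3"
      proof (rule complex_Taylor[of "ball z e"])
        fix i x assume x: "x \<in> ball z e" and i: "i \<le> (3::nat)"
        show "(f i has_field_derivative f (Suc i) x) (at x within ball z e)"
        proof (cases i)
          case 0 then show ?thesis using F[OF x] by (simp add: f_def)
        next
          case (Suc j)
          have "(deriv ^^ j) q holomorphic_on ball z e" by (rule holomorphic_higher_deriv[OF qb open_ball])
          from holomorphic_derivI[OF this open_ball x] show ?thesis
            using Suc by (auto simp: f_def intro: has_field_derivative_at_within)
        qed
      next
        fix x assume "x \<in> ball z e"
        then have "x \<in> K'" using K'e[OF z] ball_subset_cball by blast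
        then show "cmod (f (Suc 3) x) \<le> B" using B by (simp add: f_def Q_def)
      qed (use w e in \<open>auto simp: dist_norm\<close>)
      then show ?thesis by (simp add: f_def fact_numeral)
    qed
    define A where "A = (\<lambda>w. \<Sum>i\<le>3. f i z * w ^ i / fact i)"
    have A: "A v + A (\<i> * v) + A (- v) + A (- \<i> * v) = 4 * F z"
    proof -
      have "{..3::nat} = {0,1,2,3}" by auto
      then have "A w = F z + f 1 z * w + f 2 z * w^2 / 2 + f 3 z * w ^ 3 / 6" for w
        by (simp add: A_def f_def fact_numeral)
      then show ?thesis by (simp add: power2_eq_square power3_eq_cube algebra_simps)
    qed
    have R: "u (z + w) \<ge> u z - Re (F z) + Re (A w) - B / 6 * cmod v ^ 4" if "cmod w = cmod v" for w
    proof -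
      have w: "cmod w < e" using that v by simp
      have "Re (F (z + w) - A w) \<ge> - (B * cmod w ^ 4 / 6)"
        using taylor[OF w] abs_Re_le_cmod[of "F (z + w) - A w"] by (simp add: A_def)
      moreover have "u (z + w) = u z - Re (F z) + Re (F (z + w))" using ReF[of "z + w"] w by (simp add: dist_norm)
      ultimately show ?thesis using that by simp
    qed
    have "Re (A v + A (\<i> * v) + A (- v) + A (- \<i> * v)) = 4 * Re (F z)" using A by simp
    then show "(u (z + v) + u (z + \<i> * v) + u (z - v) + u (z - \<i> * v)) / 4 \<ge> u z - B / 6 * (cmod v)^4"
      using R[of v] R[of "\<i> * v"] R[of "- v"] R[of "- \<i> * v"] by (simp add: norm_mult)
  qed (use e B in auto)
qed

lemma average_mono:
  "a - e \<le> a' \<Longrightarrow> b - e \<le> b' \<Longrightarrow> c - e \<le> c' \<Longrightarrow> d - e \<le> d' \<Longrightarrow> (a + b + c + d) / 4 - e \<le> (a' + b' + c' + d') / (4::real)"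
  by (simp add: field_simps)

text \<open>Without cuts the potential is harmonic. The cut at 0 is not active on K and can only
  raise the values at neighbouring points; the cut at F would lower them, but \<open>bound\<close>
  excludes it at distance at least r / 2 from the pole.\<close>

lemma log_potential_four_point:
  assumes D: "open D" and \<Phi>: "\<Phi> holomorphic_on D" and c: "\<And>z. z \<in> D \<Longrightarrow> \<Phi> z = 0 \<Longrightarrow> z = c"
    and comp: "compact {z \<in> D. cmod (\<Phi> z) \<le> exp (- \<epsilon>)}" and r: "r > 0" and F: "F > 0"
    and bound: "\<And>z. z \<in> D \<Longrightarrow> r / 2 \<le> cmod (z - c) \<Longrightarrow> - ln (cmod (\<Phi> z)) \<le> F" and \<epsilon>: "\<epsilon> > 0"
  defines "K \<equiv> {z \<in> D. cmod (\<Phi> z) \<le> exp (- \<epsilon>)} - ball c r"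
  shows "compact K" and "\<And>z. z \<notin> K \<union> ball c r \<Longrightarrow> log_potential \<Phi> D \<epsilon> F z = 0"
    and "\<exists>C\<ge>0. \<forall>z\<in>K. \<forall>v. (log_potential \<Phi> D \<epsilon> F (z + v) + log_potential \<Phi> D \<epsilon> F (z + \<i> * v)
            + log_potential \<Phi> D \<epsilon> F (z - v) + log_potential \<Phi> D \<epsilon> F (z - \<i> * v)) / 4
          \<ge> log_potential \<Phi> D \<epsilon> F z - C * (cmod v)^4"
proof -
  let ?f = "log_potential \<Phi> D \<epsilon> F"
  show K: "compact K" unfolding K_def by (rule compact_diff[OF comp open_ball])
  show "?f z = 0" if "z \<notin> K \<union> ball c r" for z
  proof (cases "z \<in> D")
    case True
    have "z \<notin> ball c r" using that by auto
    then have "\<Phi> z \<noteq> 0" using c[OF True] r by auto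
    moreover have "cmod (\<Phi> z) > exp (- \<epsilon>)" using that True by (auto simp: K_def)
    then have "ln (exp (- \<epsilon>)) < ln (cmod (\<Phi> z))"  by (subst ln_less_cancel_iff) (auto intro: less_trans[OF exp_gt_zero])
    ultimately show ?thesis using True F by (simp add: log_potential_def)
  qed (simp add: log_potential_def)
  define \<Omega> where "\<Omega> = D - \<Phi> -` {0}"
  have \<Omega>: "open \<Omega>" unfolding \<Omega>_def using D \<Phi>
    by (metis closed_singleton continuous_open_preimage holomorphic_on_imp_continuous_on open_Compl vimage_Compl Diff_eq)
  define q where "q = (\<lambda>z. - deriv \<Phi> z / \<Phi> z)"
  have q: "q holomorphic_on \<Omega>" unfolding q_def \<Omega>_def
    by (intro holomorphic_intros holomorphic_deriv holomorphic_on_subset[OF \<Phi>] holomorphic_on_subset[OF holomorphic_deriv[OF \<Phi> D]]) auto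
  define u where "u = (\<lambda>z. - ln (cmod (\<Phi> z)))"
  have der: "(u has_derivative (\<lambda>h. Re (q w * h))) (at w)" if "w \<in> \<Omega>" for w
    unfolding u_def q_def using log_modulus_has_derivative[OF D \<Phi>] that by (auto simp: \<Omega>_def)
  have K\<Omega>: "K \<subseteq> \<Omega>" using c r by (auto simp: K_def \<Omega>_def)
  obtain r0 C where r0: "r0 > 0" and C: "C \<ge> 0" and in\<Omega>: "\<And>z v. z \<in> K \<Longrightarrow> cmod v < r0 \<Longrightarrow> z + v \<in> \<Omega>"
    and fp: "\<And>z v. z \<in> K \<Longrightarrow> cmod v < r0 \<Longrightarrow> (u (z + v) + u (z + \<i> * v) + u (z - v) + u (z - \<i> * v)) / 4 \<ge> u z - C * (cmod v)^4"
    using harmonic_four_point[OF \<Omega> q der K K\<Omega>] by blast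
  define r1 where "r1 = min r0 (r / 2)"
  have r1: "r1 > 0" using r0 r by (simp add: r1_def)
  have fK: "?f z = u z - \<epsilon>" if z: "z \<in> K" for z
  proof -
    have "\<Phi> z \<noteq> 0" "z \<in> D" using K\<Omega> z by (auto simp: \<Omega>_def)
    moreover have "ln (cmod (\<Phi> z)) \<le> ln (exp (- \<epsilon>))" using z calculation by (subst ln_le_cancel_iff) (auto simp: K_def)
    moreover have "u z \<le> F" unfolding u_def using z r by (intro bound) (auto simp: K_def dist_norm norm_minus_commute)
    ultimately show ?thesis using \<epsilon> by (simp add: log_potential_def u_def)
  qed
  have f0: "0 \<le> ?f z" "?f z \<le> F" for z using F by (auto simp: log_potential_def)
  have fbelow: "?f (z + v) \<ge> u (z + v) - \<epsilon>" if z: "z \<in> K" and v: "cmod v < r1" for z v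
  proof -
    have "z + v \<in> \<Omega>" using in\<Omega>[OF z] v by (auto simp: r1_def)
    then have "\<Phi> (z + v) \<noteq> 0" "z + v \<in> D" by (auto simp: \<Omega>_def)
    moreover have "u (z + v) \<le> F" unfolding u_def
    proof (rule bound)
      have "cmod (z - c) \<ge> r" using z by (auto simp: K_def dist_norm norm_minus_commute)
      moreover have "cmod (z - c) \<le> cmod (z + v - c) + cmod v" using norm_triangle_ineq4[of "z + v - c" v] by simp
      ultimately show "r / 2 \<le> cmod (z + v - c)" using v by (auto simp: r1_def)
    qed fact
    ultimately show ?thesis using \<epsilon> by (simp add: log_potential_def u_def)
  qed
  \<comment> \<open>For steps of length at least r1 nothing is known about the neighbours; the term
    F / r1^4 makes the asserted lower bound nonpositive.\<close>
  define C' where "C' = C + F / r1^4"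
  have "(?f (z + v) + ?f (z + \<i> * v) + ?f (z - v) + ?f (z - \<i> * v)) / 4 \<ge> ?f z - C' * (cmod v)^4" if z: "z \<in> K" for z v
  proof (cases "cmod v < r1")
    case True
    have "?f z - C * (cmod v)^4 = u z - C * (cmod v)^4 - \<epsilon>" using fK[OF z] by simp
    also have "\<dots> \<le> (u (z + v) + u (z + \<i> * v) + u (z - v) + u (z - \<i> * v)) / 4 - \<epsilon>"
      using fp[OF z, of v] True by (simp add: r1_def)
    also have "\<dots> \<le> (?f (z + v) + ?f (z + \<i> * v) + ?f (z - v) + ?f (z - \<i> * v)) / 4"
    proof -
      have "u (z + v) - \<epsilon> \<le> ?f (z + v)" "u (z + \<i> * v) - \<epsilon> \<le> ?f (z + \<i> * v)"
        "u (z - v) - \<epsilon> \<le> ?f (z - v)" "u (z - \<i> * v) - \<epsilon> \<le> ?f (z - \<i> * v)"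
        using fbelow[OF z, of v] fbelow[OF z, of "\<i> * v"] fbelow[OF z, of "- v"] fbelow[OF z, of "- \<i> * v"] True
        by (simp_all add: norm_mult)
      then show ?thesis by (rule average_mono)
    qed
    finally have "?f z - C * (cmod v)^4 \<le> (?f (z + v) + ?f (z + \<i> * v) + ?f (z - v) + ?f (z - \<i> * v)) / 4" .
    moreover have "0 \<le> F / r1^4 * (cmod v)^4" using F r1 by simp
    ultimately show ?thesis by (simp add: C'_def distrib_right)
  next
    case False
    have "r1^4 \<le> (cmod v)^4" using False r1 by (intro power_mono) auto
    then have "F \<le> F / r1^4 * (cmod v)^4" using F r1 by (simp add: field_simps)
    then have "?f z - C' * (cmod v)^4 \<le> 0" using f0(2)[of z] C by (simp add: C'_def distrib_right add_increasing)
    also have "0 \<le> (?f (z + v) + ?f (z + \<i> * v) + ?f (z - v) + ?f (z - \<i> * v)) / 4" using f0(1) by (simp add: add_nonneg_nonneg)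
    finally show ?thesis .
  qed
  moreover have "C' \<ge> 0" using C F r1 by (simp add: C'_def)
  ultimately show "\<exists>C\<ge>0. \<forall>z\<in>K. \<forall>v. (?f (z + v) + ?f (z + \<i> * v) + ?f (z - v) + ?f (z - \<i> * v)) / 4 \<ge> ?f z - C * (cmod v)^4"
    by blast
qed

section \<open>Zigzag functions, written as sums of clamped ramps\<close>

definition zigzag :: "real \<Rightarrow> real \<Rightarrow> nat \<Rightarrow> nat set \<Rightarrow> real \<Rightarrow> real" where
  "zigzag s l m A x = (\<Sum>j<m. (if j \<in> A then s else - s) * max 0 (min l (x - real j * l)))"

lemma zigzag_nonpos: "l > 0 \<Longrightarrow> x \<le> 0 \<Longrightarrow> zigzag s l m A x = 0"
proof -
  assume "l > 0" "x \<le> 0"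
  then have "x - real j * l \<le> 0" for j using mult_nonneg_nonneg[of "real j" l] by linarith
  then show ?thesis unfolding zigzag_def by (intro sum.neutral) (simp add: max.absorb1 min.coboundedI2)
qed

lemma zigzag_grid:
  assumes "l > 0" "k \<le> m"
  shows "zigzag s l m A (real k * l) = (\<Sum>j<k. if j \<in> A then s else - s) * l"
proof -
  have "zigzag s l m A (real k * l) = (\<Sum>j<m. if j < k then (if j \<in> A then s else - s) * l else 0)"
    unfolding zigzag_def
  proof (intro sum.cong refl)
    fix j
    show "(if j \<in> A then s else - s) * max 0 (min l (real k * l - real j * l)) = (if j < k then (if j \<in> A then s else - s) * l else 0)"
    proof (cases "j < k")
      case True
      then have "1 * l \<le> (real k - real j) * l" using assms(1) by (intro mult_right_mono) auto
      then show ?thesis using True assms(1) by (simp add: algebra_simps)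
    next
      case False
      then have "(real k - real j) * l \<le> 0" using assms(1) by (intro mult_nonpos_nonneg) auto
      then have "real k * l - real j * l \<le> 0" by (simp add: algebra_simps)
      then show ?thesis using False by (simp add: max.absorb1 min.coboundedI2)
    qed
  qed
  also have "\<dots> = (\<Sum>j\<in>{..<m} \<inter> {j. j < k}. (if j \<in> A then s else - s) * l)"
    by (subst sum.If_cases) auto
  also have "{..<m} \<inter> {j. j < k} = {..<k}" using assms(2) by auto
  finally show ?thesis by (simp add: sum_distrib_right)
qed

lemma zigzag_linear_piece:
  assumes l: "l > 0" and k: "k < m" and x: "x \<in> {real k * l..real (Suc k) * l}"
  shows "zigzag s l m A x = zigzag s l m A (real k * l) + (if k \<in> A then s else - s) * (x - real k * l)"
proof -
  have "zigzag s l m A x - zigzag s l m A (real k * l) = (\<Sum>j<m. if j = k then (if k \<in> A then s else - s) * (x - real k * l) else 0)"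
    unfolding zigzag_def sum_subtractf[symmetric]
  proof (intro sum.cong refl)
    fix j
    consider "j < k" | "j = k" | "j > k" by linarith
    then show "(if j \<in> A then s else - s) * max 0 (min l (x - real j * l)) - (if j \<in> A then s else - s) * max 0 (min l (real k * l - real j * l))
        = (if j = k then (if k \<in> A then s else - s) * (x - real k * l) else 0)"
    proof cases
      case 1
      then have "1 * l \<le> (real k - real j) * l" using l by (intro mult_right_mono) auto
      then show ?thesis using 1 x l by (simp add: algebra_simps)
    next
      case 2
      then show ?thesis using x l by (auto simp: algebra_simps)
    next
      case 3
      then have "1 * l \<le> (real j - real k) * l" using l by (intro mult_right_mono) auto
      then show ?thesis using 3 x l by (simp add: algebra_simps)
    qed
  qed
  also have "\<dots> = (if k \<in> A then s else - s) * (x - real k * l)" using k by (simp add: sum.delta)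
  finally show ?thesis by simp
qed

lemma zigzag_beyond:
  assumes l: "l > 0" and x: "x \<ge> real m * l"
  shows "zigzag s l m A x = zigzag s l m A (real m * l)"
  unfolding zigzag_def
proof (intro sum.cong refl)
  fix j assume "j \<in> {..<m}"
  then have "1 * l \<le> (real m - real j) * l" using l by (intro mult_right_mono) auto
  then show "(if j \<in> A then s else - s) * max 0 (min l (x - real j * l)) = (if j \<in> A then s else - s) * max 0 (min l (real m * l - real j * l))"
    using x l by (simp add: algebra_simps)
qed

text \<open>As many steps go up as down. The return to 0 is what lets the strips of consecutive
  levels fit together.\<close>

lemma zigzag_balanced:
  assumes l: "l > 0" and A: "A \<subseteq> {..<2*n}" "card A = n" and x: "x \<ge> real (2*n) * l"
  shows "zigzag s l (2*n) A x = 0"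
proof -
  have fin: "finite A" using A(1) finite_subset by blast
  have "(\<Sum>j<2*n. if j \<in> A then s else - s) = (\<Sum>j\<in>{..<2*n} \<inter> {j. j \<in> A}. s) + (\<Sum>j\<in>{..<2*n} \<inter> - {j. j \<in> A}. - s)"
    by (rule sum.If_cases) simp
  also have "{..<2*n} \<inter> {j. j \<in> A} = A" using A by auto
  also have "card ({..<2*n} \<inter> - {j. j \<in> A}) = n"
  proof -
    have "{..<2*n} \<inter> - {j. j \<in> A} = {..<2*n} - A" by auto
    then show ?thesis using A fin by (simp add: card_Diff_subset)
  qed
  then have "(\<Sum>j\<in>A. s) + (\<Sum>j\<in>{..<2*n} \<inter> - {j. j \<in> A}. - s) = 0" using A by simp
  finally show ?thesis
    using zigzag_beyond[OF l x] zigzag_grid[OF l, of "2*n" "2*n"] by simp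
qed

lemma zigzag_lipschitz:
  assumes l: "l > 0"
  shows "\<bar>zigzag s l m A x - zigzag s l m A y\<bar> \<le> \<bar>s\<bar> * \<bar>x - y\<bar>"
proof -
  have W: "\<bar>zigzag s l m A x - zigzag s l m A y\<bar> \<le> \<bar>s\<bar> * (x - y)" if "y \<le> x" for x y
  proof -
    define d where "d = (\<lambda>j. max 0 (min l (x - real j * l)) - max 0 (min l (y - real j * l)))"
    have d0: "d j \<ge> 0" for j using that by (auto simp: d_def)
    \<comment> \<open>The clamped ramps of consecutive intervals add up to the single ramp over
      [0, m l], which is 1-Lipschitz.\<close>
    have tel: "(\<Sum>j<m. max 0 (min l (x - real j * l))) = max 0 (min (real m * l) x)" for x
    proof (induction m)
      case (Suc m)
      define y where "y = real m * l"
      have "0 \<le> y" using l by (simp add: y_def)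
      then have "max 0 (min y x) + max 0 (min l (x - y)) = max 0 (min (y + l) x)" using l by auto
      then show ?case using Suc by (simp add: y_def distrib_right add.commute)
    qed (auto simp: min_def max_def)
    have "\<bar>zigzag s l m A x - zigzag s l m A y\<bar> = \<bar>\<Sum>j<m. (if j \<in> A then s else - s) * d j\<bar>"
      unfolding zigzag_def sum_subtractf[symmetric] d_def by (simp add: right_diff_distrib)
    also have "\<dots> \<le> (\<Sum>j<m. \<bar>(if j \<in> A then s else - s) * d j\<bar>)" by (rule sum_abs)
    also have "\<dots> = (\<Sum>j<m. \<bar>s\<bar> * d j)" using d0 by (intro sum.cong refl) (auto simp: abs_mult)
    also have "\<dots> = \<bar>s\<bar> * (max 0 (min (real m * l) x) - max 0 (min (real m * l) y))"
      by (simp add: d_def sum_distrib_left[symmetric] sum_subtractf tel)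
    also have "\<dots> \<le> \<bar>s\<bar> * (x - y)" using that by (intro mult_left_mono) (auto simp: min_def max_def)
    finally show ?thesis .
  qed
  show ?thesis using W[of x y] W[of y x] by (cases "y \<le> x") (auto simp: abs_minus_commute)
qed

lemma continuous_zigzag: "continuous_on S (zigzag s l m A)"
  unfolding zigzag_def[abs_def] by (intro continuous_intros)

section \<open>Riemann maps and Green functions of spiral strips\<close>

definition spiral_strip :: "(real \<Rightarrow> real) \<Rightarrow> real \<Rightarrow> real \<Rightarrow> real \<Rightarrow> complex set" where
  "spiral_strip \<theta> b x0 x1 = exp ` {\<zeta>. x0 < Re \<zeta> \<and> Re \<zeta> < x1 \<and> \<bar>Im \<zeta> - \<theta> (Re \<zeta>)\<bar> < b}"

text \<open>A sheared exponential maps a rectangle homeomorphically onto D, where b <= pi keeps it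
  injective. The shear is merely continuous, which suffices to make D open and simply connected; the
  map from the Riemann mapping theorem is then normalised to vanish at c. The last two conclusions
  are the Schwarz lemma for the inverse and for the map itself.\<close>

lemma riemann_map_spiral_strip:
  assumes \<theta>: "continuous_on UNIV \<theta>" and b: "0 < b" "b \<le> pi"
    and \<zeta>1: "x0 < Re \<zeta>1" "Re \<zeta>1 < x1" "\<bar>Im \<zeta>1 - \<theta> (Re \<zeta>1)\<bar> < b"
  defines "D \<equiv> spiral_strip \<theta> b x0 x1" and "c \<equiv> exp \<zeta>1"
  obtains \<Phi> where "open D" "\<Phi> holomorphic_on D" "\<Phi> c = 0" "\<And>z. z \<in> D \<Longrightarrow> cmod (\<Phi> z) < 1"
    "\<And>z. z \<in> D \<Longrightarrow> \<Phi> z = 0 \<Longrightarrow> z = c"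
    "\<And>r. r < 1 \<Longrightarrow> compact {z \<in> D. cmod (\<Phi> z) \<le> r}"
    "\<And>\<rho> z. D \<subseteq> ball c \<rho> \<Longrightarrow> z \<in> D \<Longrightarrow> cmod (z - c) \<le> \<rho> * cmod (\<Phi> z)"
    "\<And>\<rho> z. \<rho> > 0 \<Longrightarrow> ball c \<rho> \<subseteq> D \<Longrightarrow> z \<in> ball c \<rho> \<Longrightarrow> cmod (\<Phi> z) \<le> cmod (z - c) / \<rho>"
proof -
  define Q where "Q = {w. x0 < Re w \<and> Re w < x1 \<and> \<bar>Im w\<bar> < b}"
  define H where "H = (\<lambda>w. exp (w + \<i> * of_real (\<theta> (Re w))))"
  have Qeq: "Q = {w. Re w > x0} \<inter> {w. Re w < x1} \<inter> {w. Im w < b} \<inter> {w. Im w > - b}"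
    by (auto simp: Q_def)
  have Q: "open Q" "convex Q" unfolding Qeq
    by (auto intro!: open_Int convex_Int open_halfspace_Re_gt open_halfspace_Re_lt open_halfspace_Im_gt open_halfspace_Im_lt
       convex_halfspace_Re_gt convex_halfspace_Re_lt convex_halfspace_Im_gt convex_halfspace_Im_lt)
  have contH: "continuous_on Q H" unfolding H_def
    by (intro continuous_intros continuous_on_compose2[OF \<theta>]) auto
  have inj: "inj_on H Q"
  proof (rule inj_onI)
    fix w w' assume w: "w \<in> Q" "w' \<in> Q" and eq: "H w = H w'"
    obtain n :: int where n: "w + \<i> * of_real (\<theta> (Re w)) = w' + \<i> * of_real (\<theta> (Re w')) + (of_int (2 * n) * pi) * \<i>"
      using eq unfolding H_def exp_eq by blast
    have re: "Re w = Re w'" using arg_cong[OF n, of Re] by simp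
    have im: "Im w = Im w' + of_int (2 * n) * pi" using arg_cong[OF n, of Im] re by simp
    have "\<bar>of_int (2 * n) * pi\<bar> < 2 * b" using w im by (auto simp: Q_def)
    then have "\<bar>real_of_int n\<bar> * (2 * pi) < 2 * b" by (simp add: abs_mult mult_ac)
    also have "\<dots> \<le> 1 * (2 * pi)" using b by simp
    finally have "\<bar>real_of_int n\<bar> < 1" by (simp add: mult_less_cancel_right)
    then have "n = 0" by linarith
    then show "w = w'" using re im by (simp add: complex_eq_iff)
  qed
  have DH: "D = H ` Q"
  proof (intro equalityI subsetI)
    fix z assume "z \<in> D"
    then obtain \<zeta> where \<zeta>: "x0 < Re \<zeta>" "Re \<zeta> < x1" "\<bar>Im \<zeta> - \<theta> (Re \<zeta>)\<bar> < b" "z = exp \<zeta>"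
      by (auto simp: D_def spiral_strip_def)
    show "z \<in> H ` Q"
      by (rule image_eqI[of _ _ "\<zeta> - \<i> * of_real (\<theta> (Re \<zeta>))"]) (use \<zeta> in \<open>auto simp: H_def Q_def\<close>)
  next
    fix z assume "z \<in> H ` Q"
    then obtain w where w: "w \<in> Q" "z = exp (w + \<i> * of_real (\<theta> (Re w)))" by (auto simp: H_def)
    show "z \<in> D" unfolding D_def spiral_strip_def
      by (rule image_eqI[where f = exp, OF w(2)]) (use w(1) in \<open>auto simp: Q_def\<close>)
  qed
  have openD: "open D" unfolding DH by (rule invariance_of_domain[OF contH Q(1) inj])
  have "Q homeomorphic D" unfolding DH
    by (rule invariance_of_domain_homeomorphic[OF Q(1) contH _ inj]) simp
  then have scD: "simply_connected D"
    using homeomorphic_simply_connected convex_imp_simply_connected[OF Q(2)] by blast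
  have cD: "c \<in> D" unfolding c_def D_def spiral_strip_def using \<zeta>1 by auto
  have "0 \<notin> D" by (auto simp: D_def spiral_strip_def)
  then have "D \<noteq> UNIV" by auto
  with Riemann_mapping_theorem[of D, THEN iffD1, OF conjI[OF openD scD]] cD
  obtain f g where "f holomorphic_on D \<and> g holomorphic_on ball 0 1 \<and>
           (\<forall>z \<in> D. f z \<in> ball 0 1 \<and> g (f z) = z) \<and> (\<forall>z \<in> ball 0 1. g z \<in> D \<and> f (g z) = z)" by blast
  then have fg: "f holomorphic_on D" "g holomorphic_on ball 0 1"
     "\<And>z. z \<in> D \<Longrightarrow> f z \<in> ball 0 1 \<and> g (f z) = z" "\<And>z. z \<in> ball 0 1 \<Longrightarrow> g z \<in> D \<and> f (g z) = z"
    by auto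
  obtain M N where MN: "M (f c) = 0" "M holomorphic_on ball 0 1" "M ` ball 0 1 \<subseteq> ball 0 1"
     "N holomorphic_on ball 0 1" "N ` ball 0 1 \<subseteq> ball 0 1" "\<And>z. z \<in> ball 0 1 \<Longrightarrow> M (N z) = z" "\<And>z. z \<in> ball 0 1 \<Longrightarrow> N (M z) = z"
    using ball_biholomorphism_exists[of "f c"] fg(3)[OF cD] by metis
  define \<Phi> where "\<Phi> = (\<lambda>z. M (f z))"
  define \<Psi> where "\<Psi> = (\<lambda>w. g (N w))"
  have \<Phi>D: "\<Phi> z \<in> ball 0 1" if "z \<in> D" for z unfolding \<Phi>_def by (rule subsetD[OF MN(3) imageI]) (use fg(3)[OF that] in blast)
  have \<Psi>D: "\<Psi> w \<in> D" if "w \<in> ball 0 1" for w unfolding \<Psi>_def using fg(4)[OF subsetD[OF MN(5) imageI[OF that]]] by blast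
  have \<Psi>\<Phi>: "\<Psi> (\<Phi> z) = z" if "z \<in> D" for z using fg(3)[OF that] MN(7) by (auto simp: \<Phi>_def \<Psi>_def)
  have \<Phi>\<Psi>: "\<Phi> (\<Psi> w) = w" if "w \<in> ball 0 1" for w
  proof -
    have "N w \<in> ball 0 1" using MN(5) that by blast
    then show ?thesis using fg(4) MN(6)[OF that] by (auto simp: \<Phi>_def \<Psi>_def)
  qed
  have \<Phi>h: "\<Phi> holomorphic_on D" unfolding \<Phi>_def
    using holomorphic_on_compose_gen[OF fg(1) MN(2)] fg(3) by (auto simp: o_def image_subset_iff)
  have \<Psi>h: "\<Psi> holomorphic_on ball 0 1" unfolding \<Psi>_def
    using holomorphic_on_compose_gen[OF MN(4) fg(2) MN(5)] by (simp add: o_def)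
  have \<Phi>c: "\<Phi> c = 0" using MN(1) by (simp add: \<Phi>_def)
  have \<Psi>0: "\<Psi> 0 = c" using \<Psi>\<Phi>[OF cD] \<Phi>c by simp
  show ?thesis
  proof (rule that[OF openD \<Phi>h \<Phi>c])
    show "cmod (\<Phi> z) < 1" if "z \<in> D" for z using \<Phi>D[OF that] by simp
    show "z = c" if "z \<in> D" "\<Phi> z = 0" for z using \<Psi>\<Phi>[OF that(1)] that(2) \<Psi>0 by simp
    show "compact {z \<in> D. cmod (\<Phi> z) \<le> r}" if "r < 1" for r
    proof -
      have "{z \<in> D. cmod (\<Phi> z) \<le> r} = \<Psi> ` cball 0 r"
      proof (intro equalityI subsetI)
        fix z assume "z \<in> {z \<in> D. cmod (\<Phi> z) \<le> r}"
        then show "z \<in> \<Psi> ` cball 0 r" using \<Psi>\<Phi>[of z] by (intro image_eqI[of _ _ "\<Phi> z"]) auto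
      next
        fix z assume "z \<in> \<Psi> ` cball 0 r"
        then obtain w where w: "cmod w \<le> r" "z = \<Psi> w" by auto
        then have "w \<in> ball 0 1" using that by auto
        then show "z \<in> {z \<in> D. cmod (\<Phi> z) \<le> r}" using \<Psi>D \<Phi>\<Psi> w by auto
      qed
      moreover have "cball 0 r \<subseteq> ball (0::complex) 1" using that by auto
      then have "continuous_on (cball 0 r) \<Psi>" using \<Psi>h holomorphic_on_imp_continuous_on continuous_on_subset by blast
      ultimately show ?thesis using compact_continuous_image[OF _ compact_cball] by simp
    qed
    show "cmod (z - c) \<le> \<rho> * cmod (\<Phi> z)" if D\<rho>: "D \<subseteq> ball c \<rho>" and z: "z \<in> D" for \<rho> z
    proof -
      have \<rho>: "\<rho> > 0" using cD D\<rho> by (force intro: le_less_trans[OF zero_le_dist])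
      have "norm ((\<lambda>w. (\<Psi> w - c) / of_real \<rho>) (\<Phi> z)) \<le> norm (\<Phi> z)"
      proof (rule Schwarz_Lemma(1))
        show "(\<lambda>w. (\<Psi> w - c) / of_real \<rho>) holomorphic_on ball 0 1"
          using \<Psi>h \<rho> by (intro holomorphic_intros) auto
        show "norm ((\<Psi> w - c) / of_real \<rho>) < 1" if "norm w < 1" for w
        proof -
          have "\<Psi> w \<in> ball c \<rho>" using \<Psi>D[of w] D\<rho> that by auto
          then show ?thesis using \<rho> by (simp add: norm_divide dist_norm norm_minus_commute)
        qed
      qed (use \<Psi>0 \<Phi>D[OF z] in auto)
      then show ?thesis using \<rho> by (simp add: \<Psi>\<Phi>[OF z] norm_divide field_simps)
    qed
    show "cmod (\<Phi> z) \<le> cmod (z - c) / \<rho>" if \<rho>: "\<rho> > 0" and sub: "ball c \<rho> \<subseteq> D" and z: "z \<in> ball c \<rho>" for \<rho> z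
    proof -
      have inb: "c + of_real \<rho> * w \<in> ball c \<rho>" if "norm w < 1" for w :: complex
        using that \<rho> by (simp add: dist_norm norm_mult)
      have "norm ((\<lambda>w. \<Phi> (c + of_real \<rho> * w)) ((z - c) / of_real \<rho>)) \<le> norm ((z - c) / of_real \<rho>)"
      proof (rule Schwarz_Lemma(1))
        have "(\<Phi> \<circ> (\<lambda>w. c + of_real \<rho> * w)) holomorphic_on ball 0 1"
          by (rule holomorphic_on_compose_gen[OF _ \<Phi>h]) (use inb sub in \<open>auto intro!: holomorphic_intros\<close>)
        then show "(\<lambda>w. \<Phi> (c + of_real \<rho> * w)) holomorphic_on ball 0 1" by (simp add: o_def)
        show "norm (\<Phi> (c + of_real \<rho> * w)) < 1" if "norm w < 1" for w
          using \<Phi>D[of "c + of_real \<rho> * w"] inb[OF that] sub by auto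
      qed (use \<Phi>c z \<rho> in \<open>auto simp: norm_divide dist_norm norm_minus_commute\<close>)
      then show ?thesis using \<rho> by (simp add: norm_divide)
    qed
  qed
qed


text \<open>The Green function with pole at log radius X + 2 is pulled back to logarithmic
  coordinates, where it is positive harmonic before the pole. The Schwarz lemma gives at least ln 2
  near the pole, the Harnack bound moves along the two straight ends, and
  \<open>positive_harmonic_growth_zigzag\<close> crosses the zigzag part. The strip has half-width b
  > a to make room for the balls which the Harnack bounds need.\<close>

lemma green_function_spiral_strip:
  fixes \<theta> :: "real \<Rightarrow> real"
  assumes l: "l > 0" and a: "0 < a" "a < b" and b: "1 \<le> b" "b \<le> pi"
    and lin: "\<And>j x. j < m \<Longrightarrow> x \<in> {real j * l..real (Suc j) * l} \<Longrightarrow> \<theta> x = \<theta> (real j * l) + \<sigma> j * (x - real j * l)"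
    and slope: "\<And>j. j < m \<Longrightarrow> (\<sigma> j)\<^sup>2 = s\<^sup>2"
    and lip: "\<And>x y. \<bar>\<theta> x - \<theta> y\<bar> \<le> \<bar>s\<bar> * \<bar>x - y\<bar>"
    and ends: "\<And>x. x \<le> 0 \<Longrightarrow> \<theta> x = \<beta>" "\<And>x. x \<ge> real m * l \<Longrightarrow> \<theta> x = \<beta>"
  defines "X \<equiv> real m * l"
  defines "D \<equiv> spiral_strip \<theta> b (-3) (X + 3)" and "c \<equiv> exp (Complex (X + 2) \<beta>)"
    and "\<eta> \<equiv> min (1/4) ((b - a) / (1 + \<bar>s\<bar>))"
  obtains \<Phi> where "open D" "\<Phi> holomorphic_on D" "\<And>z. z \<in> D \<Longrightarrow> \<Phi> z = 0 \<Longrightarrow> z = c"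
    "\<And>r. r < 1 \<Longrightarrow> compact {z \<in> D. cmod (\<Phi> z) \<le> r}"
    "\<And>z. z \<in> D \<Longrightarrow> cmod (z - c) \<le> 2 * exp (X + 3) * cmod (\<Phi> z)"
    "exp (Complex (-2) \<beta>) \<in> D"
    "- ln (cmod (\<Phi> (exp (Complex (-2) \<beta>)))) \<ge> exp (- (pi / (2 * a) * (1 + s\<^sup>2) * X) - (16 * a + 12) / \<eta> - 1)"
proof -
  have X: "X \<ge> 0" using l by (simp add: X_def)
  have cont: "continuous_on UNIV \<theta>"
  proof (rule continuous_on_iff[THEN iffD2], intro ballI allI impI)
    fix x e :: real assume e: "e > 0"
    show "\<exists>d>0. \<forall>x'\<in>UNIV. dist x' x < d \<longrightarrow> dist (\<theta> x') (\<theta> x) < e"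
    proof (intro exI[of _ "e / (1 + \<bar>s\<bar>)"] conjI ballI impI)
      show "e / (1 + \<bar>s\<bar>) > 0" using e by simp
      fix x' assume "dist x' x < e / (1 + \<bar>s\<bar>)"
      then have "\<bar>x' - x\<bar> * (1 + \<bar>s\<bar>) < e" by (simp add: dist_real_def field_simps)
      moreover have "\<bar>s\<bar> * \<bar>x' - x\<bar> \<le> \<bar>x' - x\<bar> * (1 + \<bar>s\<bar>)" by (simp add: algebra_simps)
      ultimately show "dist (\<theta> x') (\<theta> x) < e" using lip[of x' x] by (simp add: dist_real_def)
    qed
  qed
  define \<zeta>1 where "\<zeta>1 = Complex (X + 2) \<beta>"
  define L where "L = {\<zeta>. -3 < Re \<zeta> \<and> Re \<zeta> < X + 3 \<and> \<bar>Im \<zeta> - \<theta> (Re \<zeta>)\<bar> < b}"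
  have \<zeta>1: "-3 < Re \<zeta>1" "Re \<zeta>1 < X + 3" "\<bar>Im \<zeta>1 - \<theta> (Re \<zeta>1)\<bar> < b"
    using X b ends(2)[of "X + 2"] by (auto simp: \<zeta>1_def X_def)
  have c: "c = exp \<zeta>1" by (simp add: c_def \<zeta>1_def)
  have DL: "D = exp ` L" by (simp add: D_def spiral_strip_def L_def)
  obtain \<Phi> where \<Phi>: "open D" "\<Phi> holomorphic_on D" "\<Phi> c = 0" "\<And>z. z \<in> D \<Longrightarrow> cmod (\<Phi> z) < 1"
    "\<And>z. z \<in> D \<Longrightarrow> \<Phi> z = 0 \<Longrightarrow> z = c" "\<And>r. r < 1 \<Longrightarrow> compact {z \<in> D. cmod (\<Phi> z) \<le> r}"
    "\<And>\<rho> z. D \<subseteq> ball c \<rho> \<Longrightarrow> z \<in> D \<Longrightarrow> cmod (z - c) \<le> \<rho> * cmod (\<Phi> z)"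
    "\<And>\<rho> z. \<rho> > 0 \<Longrightarrow> ball c \<rho> \<subseteq> D \<Longrightarrow> z \<in> ball c \<rho> \<Longrightarrow> cmod (\<Phi> z) \<le> cmod (z - c) / \<rho>"
    by (rule riemann_map_spiral_strip[OF cont _ b(2) \<zeta>1, folded D_def, folded c]) (use b in simp, rule that, blast+)
  have openL: "open L"
  proof -
    have "L = {\<zeta>. -3 < Re \<zeta>} \<inter> {\<zeta>. Re \<zeta> < X + 3} \<inter> {\<zeta>. \<bar>Im \<zeta> - \<theta> (Re \<zeta>)\<bar> < b}" by (auto simp: L_def)
    moreover have "open {\<zeta>. \<bar>Im \<zeta> - \<theta> (Re \<zeta>)\<bar> < b}"
      by (intro open_Collect_less continuous_intros continuous_on_compose2[OF cont]) auto
    ultimately show ?thesis by (simp add: open_Int open_halfspace_Re_gt open_halfspace_Re_lt)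
  qed
  define \<phi> where "\<phi> = (\<lambda>\<zeta>. \<Phi> (exp \<zeta>))"
  have \<phi>: "\<phi> holomorphic_on L"
    using holomorphic_on_compose_gen[OF _ \<Phi>(2), of exp L] DL by (auto simp: \<phi>_def o_def intro!: holomorphic_intros)
  \<comment> \<open>Cut off before the pole, so that u is finite and harmonic.\<close>
  define \<Omega> where "\<Omega> = L \<inter> {\<zeta>. Re \<zeta> < X + 2}"
  have \<Omega>: "open \<Omega>" unfolding \<Omega>_def by (intro open_Int openL open_halfspace_Re_lt)
  have \<phi>0: "\<phi> \<zeta> \<noteq> 0" "cmod (\<phi> \<zeta>) < 1" if "\<zeta> \<in> \<Omega>" for \<zeta>
  proof -
    have D: "exp \<zeta> \<in> D" using that by (auto simp: DL \<Omega>_def)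
    show "cmod (\<phi> \<zeta>) < 1" using \<Phi>(4)[OF D] by (simp add: \<phi>_def)
    show "\<phi> \<zeta> \<noteq> 0"
    proof
      assume "\<phi> \<zeta> = 0"
      then have "exp \<zeta> = exp \<zeta>1" using \<Phi>(5)[OF D] c by (simp add: \<phi>_def)
      then have "cmod (exp \<zeta>) = cmod (exp \<zeta>1)" by simp
      then show False using that by (simp add: \<zeta>1_def \<Omega>_def)
    qed
  qed
  define u where "u = (\<lambda>\<zeta>. - ln (cmod (\<phi> \<zeta>)))"
  define q where "q = (\<lambda>\<zeta>. - deriv \<phi> \<zeta> / \<phi> \<zeta>)"
  have q: "q holomorphic_on \<Omega>" unfolding q_def
    by (intro holomorphic_intros holomorphic_on_subset[OF \<phi>] holomorphic_on_subset[OF holomorphic_deriv[OF \<phi> openL]] \<phi>0)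
       (auto simp: \<Omega>_def)
  have der: "(u has_derivative (\<lambda>h. Re (q w * h))) (at w)" if "w \<in> \<Omega>" for w
    unfolding u_def q_def by (rule log_modulus_has_derivative[OF openL \<phi>]) (use that \<phi>0 in \<open>auto simp: \<Omega>_def\<close>)
  have pos: "0 < u w" if "w \<in> \<Omega>" for w using \<phi>0[OF that] by (simp add: u_def ln_less_zero)
  have \<eta>: "\<eta> > 0" "\<eta> \<le> 1/4" "\<eta> * (1 + \<bar>s\<bar>) \<le> b - a"
  proof -
    have "0 < (b - a) / (1 + \<bar>s\<bar>)" using a by simp
    then show "\<eta> > 0" by (simp add: \<eta>_def)
    show "\<eta> \<le> 1/4" unfolding \<eta>_def by (rule min.cobounded1)
    have "\<eta> \<le> (b - a) / (1 + \<bar>s\<bar>)" by (simp add: \<eta>_def)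
    then show "\<eta> * (1 + \<bar>s\<bar>) \<le> b - a" by (simp add: pos_le_divide_eq)
  qed
  \<comment> \<open>Within a ball of radius \<eta> the centre line moves by at most |s| \<eta>, so
    the ball fits into the gap b - a. The distance 1/4 from X + 7/4 to the pole matches \<eta> <=
    1/4.\<close>
  have sub: "ball (Complex x (\<theta> x + v)) \<eta> \<subseteq> \<Omega>" if x: "x \<in> {-2..X + 7/4}" and v: "v \<in> {-a..a}" for x v
  proof
    fix w assume "w \<in> ball (Complex x (\<theta> x + v)) \<eta>"
    then have w: "cmod (w - Complex x (\<theta> x + v)) < \<eta>" by (simp add: dist_norm norm_minus_commute)
    have re: "\<bar>Re w - x\<bar> < \<eta>" using abs_Re_le_cmod[of "w - Complex x (\<theta> x + v)"] w by simp
    have im: "\<bar>Im w - (\<theta> x + v)\<bar> < \<eta>" using abs_Im_le_cmod[of "w - Complex x (\<theta> x + v)"] w by simp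
    have "\<bar>s\<bar> * \<bar>x - Re w\<bar> \<le> \<bar>s\<bar> * \<eta>" using re by (intro mult_left_mono) auto
    then have "\<bar>\<theta> x - \<theta> (Re w)\<bar> \<le> \<bar>s\<bar> * \<eta>" using lip[of x "Re w"] by linarith
    moreover have "\<bar>s\<bar> * \<eta> + \<eta> \<le> b - a" using \<eta>(3) by (simp add: algebra_simps)
    ultimately have "\<bar>Im w - \<theta> (Re w)\<bar> < b" using im v by (auto simp: abs_le_iff abs_less_iff)
    then show "w \<in> \<Omega>" using re x \<eta>(2) X by (auto simp: \<Omega>_def L_def)
  qed
  have growth: "ln (u (Complex (real m * l) (\<theta> (real m * l)))) - pi / (2 * a) * (1 + s\<^sup>2) * (real m * l) - 16 * a / \<eta>
          \<le> ln (u (Complex 0 (\<theta> 0)))"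
  proof (rule positive_harmonic_growth_zigzag[OF \<Omega> q pos der a(1) l \<eta>(1) lin slope])
    fix x v assume "x \<in> {0..real m * l}" "v \<in> {-a..a}"
    then show "Complex x (\<theta> x + v) \<in> \<Omega>" using sub[of x v] \<eta> by (force simp: X_def)
  next
    fix v assume "v \<in> {-a..a}"
    then show "ball (Complex 0 (\<theta> 0 + v)) \<eta> \<subseteq> \<Omega>" "ball (Complex (real m * l) (\<theta> (real m * l) + v)) \<eta> \<subseteq> \<Omega>"
      using sub[of 0 v] sub[of X v] X by (auto simp: X_def)
  qed auto
  have cvx: "convex {\<zeta>. x0 \<le> Re \<zeta> \<and> Re \<zeta> \<le> x1 \<and> Im \<zeta> = \<beta>}" for x0 x1
  proof -
    have "{\<zeta>. x0 \<le> Re \<zeta> \<and> Re \<zeta> \<le> x1 \<and> Im \<zeta> = \<beta>} = {z. Re z \<ge> x0} \<inter> {z. Re z \<le> x1} \<inter> {z. Im z \<ge> \<beta>} \<inter> {z. Im z \<le> \<beta>}" by auto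
    then show ?thesis by (simp add: convex_Int convex_halfspace_Re_ge convex_halfspace_Re_le convex_halfspace_Im_ge convex_halfspace_Im_le)
  qed
  have h1: "\<bar>ln (u (Complex X \<beta>)) - ln (u (Complex (X + 7/4) \<beta>))\<bar> \<le> 2 / \<eta> * cmod (Complex X \<beta> - Complex (X + 7/4) \<beta>)"
  proof (rule log_harnack[OF q pos der \<eta>(1) cvx[of X "X + 7/4"]])
    fix z assume z: "z \<in> {\<zeta>. X \<le> Re \<zeta> \<and> Re \<zeta> \<le> X + 7/4 \<and> Im \<zeta> = \<beta>}"
    then have "z = Complex (Re z) (\<theta> (Re z) + 0)" using ends(2)[of "Re z"] by (auto simp: X_def complex_eq_iff)
    then show "ball z \<eta> \<subseteq> \<Omega>" using sub[of "Re z" 0] z X a by auto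
  qed auto
  have h2: "\<bar>ln (u (Complex (-2) \<beta>)) - ln (u (Complex 0 \<beta>))\<bar> \<le> 2 / \<eta> * cmod (Complex (-2) \<beta> - Complex 0 \<beta>)"
  proof (rule log_harnack[OF q pos der \<eta>(1) cvx[of "-2" 0]])
    fix z assume z: "z \<in> {\<zeta>. -2 \<le> Re \<zeta> \<and> Re \<zeta> \<le> 0 \<and> Im \<zeta> = \<beta>}"
    then have "z = Complex (Re z) (\<theta> (Re z) + 0)" using ends(1)[of "Re z"] by (auto simp: complex_eq_iff)
    then show "ball z \<eta> \<subseteq> \<Omega>" using sub[of "Re z" 0] z X a by auto
  qed auto
  have near: "ln (u (Complex (X + 7/4) \<beta>)) \<ge> -1"
  proof -
    have cpos: "cmod c > 0" by (simp add: c)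
    have ballD: "ball c (cmod c / 2) \<subseteq> D"
    proof
      fix z assume z: "z \<in> ball c (cmod c / 2)"
      define w where "w = z / c - 1"
      have "cmod w = cmod (z - c) / cmod c" using cpos by (simp add: w_def norm_divide[symmetric] diff_divide_distrib)
      also have "\<dots> < (cmod c / 2) / cmod c" using z cpos by (intro divide_strict_right_mono) (auto simp: dist_norm norm_minus_commute)
      also have "\<dots> = 1/2" using cpos by simp
      finally have w: "cmod w < 1/2" .
      then have Lw: "cmod (Ln (1 + w)) < 1" using norm_Ln_le[of w] by simp
      have "1 + w \<noteq> 0"
      proof
        assume "1 + w = 0"
        then have "w = - 1" by (simp add: eq_neg_iff_add_eq_0 add.commute)
        then show False using w by simp
      qed
      then have "z = exp (\<zeta>1 + Ln (1 + w))" using cpos by (simp add: exp_add c w_def)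
      moreover have "\<zeta>1 + Ln (1 + w) \<in> L"
        using Lw abs_Re_le_cmod[of "Ln (1 + w)"] abs_Im_le_cmod[of "Ln (1 + w)"] X b ends(2)[of "X + 2 + Re (Ln (1 + w))"]
        by (auto simp: L_def \<zeta>1_def X_def[symmetric])
      ultimately show "z \<in> D" by (auto simp: DL)
    qed
    define z where "z = exp (Complex (X + 7/4) \<beta>)"
    have "z - c = c * (of_real (exp (-1/4)) - 1)"
    proof -
      have "Complex (X + 7/4) \<beta> = \<zeta>1 + of_real (-1/4)" by (simp add: \<zeta>1_def complex_eq_iff)
      then have "z = exp (\<zeta>1 + of_real (-1/4))" by (simp only: z_def)
      then show ?thesis by (simp only: exp_add c exp_of_real) (simp add: algebra_simps)
    qed
    then have "cmod (z - c) = cmod c * \<bar>exp (-1/4) - 1\<bar>"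
      by (simp only: norm_mult) (metis norm_of_real of_real_1 of_real_diff)
    also have "\<dots> \<le> cmod c * (1/4)"
    proof -
      have "exp (-1/4) \<ge> 1 + (-1/4::real)" by (rule exp_ge_add_one_self)
      moreover have "exp (-1/4) \<le> (1::real)" by simp
      ultimately show ?thesis by (intro mult_left_mono) auto
    qed
    finally have zc: "cmod (z - c) \<le> cmod c / 4" by simp
    then have "cmod (z - c) < cmod c / 2" using cpos by linarith
    then have "z \<in> ball c (cmod c / 2)" by (simp add: dist_norm norm_minus_commute)
    then have "cmod (\<Phi> z) \<le> cmod (z - c) / (cmod c / 2)" using \<Phi>(8)[OF _ ballD] cpos by simp
    also have "\<dots> \<le> (cmod c / 4) / (cmod c / 2)" using zc by (intro divide_right_mono) auto
    also have "\<dots> = 1/2" using cpos by simp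
    finally have 1: "cmod (\<Phi> z) \<le> 1/2" .
    have "Complex (X + 7/4) \<beta> \<in> \<Omega>" using sub[of "X + 7/4" 0] \<eta> a X ends(2)[of "X + 7/4"] by (force simp: X_def)
    then have nz: "\<Phi> z \<noteq> 0" using \<phi>0 by (auto simp: \<phi>_def z_def)
    have "ln (cmod (\<Phi> z)) \<le> ln (1/2)" using 1 nz by (subst ln_le_cancel_iff) auto
    then have u: "u (Complex (X + 7/4) \<beta>) \<ge> ln 2" by (simp add: u_def \<phi>_def z_def ln_div)
    have "exp (-1) \<le> (1/2::real)" using exp_ge_add_one_self[of 1] by (simp add: exp_minus field_simps)
    then have "exp (-1) \<le> ln (2::real)" using ln2_ge_two_thirds by linarith
    then have "exp (-1) \<le> u (Complex (X + 7/4) \<beta>)" using u by linarith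
    then show ?thesis by (metis exp_gt_zero ln_exp ln_le_cancel_iff order_less_le_trans)
  qed
  have uq: "ln (u (Complex (-2) \<beta>)) \<ge> - (pi / (2 * a) * (1 + s\<^sup>2) * X) - (16 * a + 12) / \<eta> - 1"
  proof -
    have 1: "cmod (Complex X \<beta> - Complex (X + 7/4) \<beta>) = 7/4" "cmod (Complex (-2) \<beta> - Complex 0 \<beta>) = 2" by (simp_all add: cmod_def)
    have "ln (u (Complex X \<beta>)) \<ge> -1 - 2 / \<eta> * (7/4)" using h1 near unfolding 1 by linarith
    moreover have "ln (u (Complex 0 \<beta>)) \<ge> ln (u (Complex X \<beta>)) - pi / (2 * a) * (1 + s\<^sup>2) * X - 16 * a / \<eta>"
      using growth ends(1)[of 0] ends(2)[of X] by (simp add: X_def[symmetric])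
    moreover have "ln (u (Complex (-2) \<beta>)) \<ge> ln (u (Complex 0 \<beta>)) - 2 / \<eta> * 2" using h2 unfolding 1 by linarith
    \<comment> \<open>The 12 covers 7/2 + 4 from the two Harnack estimates along the straight
      ends.\<close>
    moreover have "(16 * a + 12) / \<eta> \<ge> 16 * a / \<eta> + 2 / \<eta> * (7/4) + 2 / \<eta> * 2" using \<eta> by (simp add: field_simps)
    ultimately show ?thesis by linarith
  qed
  have q\<Omega>: "Complex (-2) \<beta> \<in> \<Omega>" using sub[of "-2" 0] \<eta> a X ends(1)[of "-2"] by force
  show ?thesis
  proof (rule that[OF \<Phi>(1,2) \<Phi>(5,6)])
    show "cmod (z - c) \<le> 2 * exp (X + 3) * cmod (\<Phi> z)" if "z \<in> D" for z
    proof (rule \<Phi>(7)[OF _ that])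
      show "D \<subseteq> ball c (2 * exp (X + 3))"
      proof
        fix w assume "w \<in> D"
        then have "cmod w < exp (X + 3)" by (auto simp: DL L_def)
        moreover have "cmod c < exp (X + 3)" by (simp add: c \<zeta>1_def)
        ultimately show "w \<in> ball c (2 * exp (X + 3))" using norm_triangle_ineq4[of c w] by (simp add: dist_norm)
      qed
    qed
    show "exp (Complex (-2) \<beta>) \<in> D" using q\<Omega> by (auto simp: DL \<Omega>_def)
    show "- ln (cmod (\<Phi> (exp (Complex (-2) \<beta>)))) \<ge> exp (- (pi / (2 * a) * (1 + s\<^sup>2) * X) - (16 * a + 12) / \<eta> - 1)"
    proof -
      have "exp (- (pi / (2 * a) * (1 + s\<^sup>2) * X) - (16 * a + 12) / \<eta> - 1) \<le> exp (ln (u (Complex (-2) \<beta>)))" using uq by simp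
      also have "\<dots> = u (Complex (-2) \<beta>)" using pos[OF q\<Omega>] by simp
      finally show ?thesis by (simp add: u_def \<phi>_def)
    qed
  qed
qed

section \<open>Survival of walks in spiral strips\<close>

text \<open>Of the value 2 g of the Green function at z, g is spent on the cut that makes the
  support compact, g / 4 on the discretisation error over about t / h steps, and g / 4 on walks that
  survive for time t; g / 2 is left. The order of quantifiers matters: h0 depends on the domain, its
  map and the constants, but not on the step law, the sets or the step numbers.\<close>

lemma log_potential_hit:
  fixes \<Phi> :: "complex \<Rightarrow> complex"
  assumes D: "open D" "D \<subseteq> cball p R" "R > 0" and \<Phi>: "\<Phi> holomorphic_on D" and c: "\<And>z. z \<in> D \<Longrightarrow> \<Phi> z = 0 \<Longrightarrow> z = c"
    and comp: "\<And>r. r < 1 \<Longrightarrow> compact {z \<in> D. cmod (\<Phi> z) \<le> r}" and r: "r > 0"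
    and bound: "\<And>z. z \<in> D \<Longrightarrow> r / 2 \<le> cmod (z - c) \<Longrightarrow> - ln (cmod (\<Phi> z)) \<le> F"
    and g: "0 < g" "g \<le> F" and t: "t \<ge> 0" "3 * F * exp (- t / (24 * R\<^sup>2)) \<le> g / 4"
  shows "\<exists>h0>0. \<forall>\<nu> h S T w k0 k1 k z. step_law \<nu> h \<longrightarrow> 0 < h \<longrightarrow> h \<le> h0 \<longrightarrow> S \<in> sets borel \<longrightarrow> T \<in> sets borel \<longrightarrow>
     D \<subseteq> S \<longrightarrow> 0 \<le> w \<longrightarrow> (\<forall>k z. k0 \<le> k \<longrightarrow> k \<le> k1 \<longrightarrow> z \<in> ball c r \<longrightarrow> w \<le> step_law.stay_and_end \<nu> S T k z) \<longrightarrow>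
     real k0 + t / h + 1 \<le> real k \<longrightarrow> k \<le> k1 \<longrightarrow> z \<in> D \<longrightarrow> cmod (\<Phi> z) \<le> exp (- (2 * g)) \<longrightarrow>
     w * g / (2 * F) \<le> step_law.stay_and_end \<nu> S T k z"
proof -
  have F: "F > 0" using g by linarith
  define f where "f = log_potential \<Phi> D g F"
  define K where "K = {z \<in> D. cmod (\<Phi> z) \<le> exp (- g)} - ball c r"
  have "exp (- g) < 1" using g by simp
  note lp = log_potential_four_point[OF D(1) \<Phi> c comp[OF this] r F bound g(1), folded f_def K_def]
  from lp(3) obtain C where C: "C \<ge> 0"
    and fp: "\<And>z v. z \<in> K \<Longrightarrow> (f (z + v) + f (z + \<i> * v) + f (z - v) + f (z - \<i> * v)) / 4 \<ge> f z - C * (cmod v)^4"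
    by blast
  define h0 where "h0 = min 1 (min (R\<^sup>2 / 4) (g / (32 * (C + 1) * (t + 1))))"
  show ?thesis
  proof (intro exI[of _ h0] conjI allI impI)
    show "h0 > 0" using D(3) g C t by (simp add: h0_def)
    fix \<nu> h S T w k0 k1 k z
    assume sl: "step_law \<nu> h" and h: "0 < h" "h \<le> h0" and ST: "S \<in> sets borel" "T \<in> sets borel" and DS: "D \<subseteq> S" and w: "0 \<le> w"
      and base: "\<forall>k z. k0 \<le> k \<longrightarrow> k \<le> k1 \<longrightarrow> z \<in> ball c r \<longrightarrow> w \<le> step_law.stay_and_end \<nu> S T k z"
      and k: "real k0 + t / h + 1 \<le> real k" "k \<le> k1" and z: "z \<in> D" "cmod (\<Phi> z) \<le> exp (- (2 * g))"
    interpret step_law \<nu> h by fact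
    define j where "j = nat \<lceil>t / h\<rceil>"
    have j: "t / h \<le> real j" "real j \<le> t / h + 1" using t h by (auto simp: j_def)
    have Kb: "K \<in> sets borel" using lp(1) by (simp add: compact_imp_closed)
    have KS: "K \<subseteq> S" using DS by (auto simp: K_def)
    have fb: "f \<in> borel_measurable borel" unfolding f_def
      by (rule log_potential_measurable[OF D(1) holomorphic_on_imp_continuous_on[OF \<Phi>]])
    have f0: "0 \<le> f z" "f z \<le> F" for z using F by (auto simp: f_def log_potential_def)
    have kj: "k0 + j \<le> k" using j k by linarith
    have zK: "z \<in> K \<union> ball c r"
    proof -
      have "cmod (\<Phi> z) \<le> exp (- g)" by (rule order_trans[OF z(2)]) (use g in simp)
      then show ?thesis using z by (auto simp: K_def)
    qed
    have fz: "f z \<ge> g"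
    proof (cases "\<Phi> z = 0")
      case False
      have "ln (cmod (\<Phi> z)) \<le> ln (exp (- (2 * g)))" using z False by (subst ln_le_cancel_iff) auto
      then show ?thesis using z False g by (simp add: f_def log_potential_def)
    qed (use z g in \<open>simp add: f_def log_potential_def\<close>)
    have "stay_and_end S T k z \<ge> w / F * (f z - real j * (8 * C * h\<^sup>2) - F * survival K j z)"
      by (rule hitting_lower_bound[OF ST Kb KS fb f0 F lp(2) C fp w _ kj k(2) zK]) (use base in auto)
    moreover have "w / F * (g / 2) \<le> w / F * (f z - real j * (8 * C * h\<^sup>2) - F * survival K j z)"
    proof (rule mult_left_mono)
      have hC: "h * (32 * (C + 1) * (t + 1)) \<le> g"
      proof -
        have "h \<le> g / (32 * (C + 1) * (t + 1))" using h by (simp add: h0_def)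
        then show ?thesis using C t by (simp add: pos_le_divide_eq)
      qed
      have "real j * h \<le> t + 1" 
      proof -
        have "real j * h \<le> (t / h + 1) * h" using j h by (intro mult_right_mono) auto
        also have "\<dots> = t + h" using h by (simp add: field_simps)
        also have "\<dots> \<le> t + 1" using h by (simp add: h0_def)
        finally show ?thesis .
      qed
      then have "(real j * h) * (8 * C * h) \<le> (t + 1) * (8 * C * h)" using C h by (intro mult_right_mono) auto
      also have "\<dots> \<le> (t + 1) * (8 * (C + 1) * h)" using C h t by (intro mult_left_mono mult_right_mono) auto
      also have "\<dots> \<le> g / 4" using hC by (simp add: algebra_simps)
      finally have 1: "real j * (8 * C * h\<^sup>2) \<le> g / 4" by (simp add: power2_eq_square mult_ac)
      have "survival K j z \<le> 3 * (1 - h / (24 * R\<^sup>2)) ^ j"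
        by (rule survival_bound[OF Kb _ D(3)]) (use D(2) h in \<open>auto simp: K_def h0_def\<close>)
      also have "(1 - h / (24 * R\<^sup>2)) ^ j \<le> exp (- (h / (24 * R\<^sup>2))) ^ j"
      proof (rule power_mono)
        show "1 - h / (24 * R\<^sup>2) \<le> exp (- (h / (24 * R\<^sup>2)))" using exp_ge_add_one_self[of "- (h / (24 * R\<^sup>2))"] by simp
        show "0 \<le> 1 - h / (24 * R\<^sup>2)" using h D(3) by (simp add: h0_def field_simps)
      qed
      also have "exp (- (h / (24 * R\<^sup>2))) ^ j = exp (- (real j * h) / (24 * R\<^sup>2))"
        by (simp add: exp_of_nat_mult[symmetric])
      also have "\<dots> \<le> exp (- t / (24 * R\<^sup>2))"
      proof -
        have "t \<le> real j * h" using j(1) h by (simp add: pos_divide_le_eq)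
        then show ?thesis using D(3) by (simp add: divide_right_mono)
      qed
      finally have "F * survival K j z \<le> F * (3 * exp (- t / (24 * R\<^sup>2)))" using F by (intro mult_left_mono) auto
      then show "g / 2 \<le> f z - real j * (8 * C * h\<^sup>2) - F * survival K j z" using 1 t(2) fz by simp
    qed (use w F in auto)
    ultimately show "w * g / (2 * F) \<le> stay_and_end S T k z" by simp
  qed
qed

text \<open>The bump (1 - |z - p|^2 / L^2)^4, cut at 0, satisfies the hypothesis of
  \<open>holding_lower_bound\<close> with k = 8 / L^2. The fourth power makes it flat enough at the
  boundary of the ball for an error of fourth order in the step.\<close>

lemma hold_in_ball:
  assumes L: "L > 0" and N: "N \<ge> 0"
  shows "\<exists>h0>0. \<forall>\<nu> h S T j z. step_law \<nu> h \<longrightarrow> 0 < h \<longrightarrow> h \<le> h0 \<longrightarrow> S \<in> sets borel \<longrightarrow> T \<in> sets borel \<longrightarrow>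
     ball p L \<subseteq> S \<inter> T \<longrightarrow> real j * h \<le> N \<longrightarrow> z \<in> ball p (L / 2) \<longrightarrow>
     exp (- (32 * N / L\<^sup>2)) / 10 \<le> step_law.stay_and_end \<nu> S T j z"
proof -
  define f where "f = (\<lambda>z. (max 0 (1 - (cmod (z - p) / L)\<^sup>2))^4)"
  define e where "e = exp (- (32 * N / L\<^sup>2))"
  have e: "e > 0" by (simp add: e_def)
  define h0 where "h0 = min (L\<^sup>2 / 32) (e * L^4 / (2240 * (N + 1)))"
  have f01: "0 \<le> f z" "f z \<le> 1" for z unfolding f_def by (auto intro!: power_le_one)
  have fm: "f \<in> borel_measurable borel" unfolding f_def by measurable
  have fpos: "cmod (z - p) < L" if "f z > 0" for z
  proof (rule ccontr)
    assume "\<not> cmod (z - p) < L"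
    then have "1 \<le> cmod (z - p) / L" using L by simp
    then have "1 \<le> (cmod (z - p) / L)\<^sup>2" by simp
    then show False using that by (simp add: f_def)
  qed
  have fp: "(f (z + u) + f (z + \<i> * u) + f (z - u) + f (z - \<i> * u)) / 4 \<ge> f z - (8 / L\<^sup>2) * f z * (cmod u)\<^sup>2 - (28 / L^4) * (cmod u)^4"
    if fz: "f z > 0" for z u
  proof (cases "cmod u \<le> L")
    case False
    have "L^4 \<le> (cmod u)^4" using False L by (intro power_mono) auto
    moreover have "0 \<le> (cmod u)^4" by simp
    ultimately have "L^4 \<le> 28 * (cmod u)^4" by linarith
    then have "1 \<le> (28 / L^4) * (cmod u)^4" using L by (simp add: field_simps)
    moreover have "0 \<le> (8 / L\<^sup>2) * f z * (cmod u)\<^sup>2" using f01 by simp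
    ultimately have "f z - (8 / L\<^sup>2) * f z * (cmod u)\<^sup>2 - (28 / L^4) * (cmod u)^4 \<le> 0" using f01(2)[of z] by linarith
    also have "0 \<le> (f (z + u) + f (z + \<i> * u) + f (z - u) + f (z - \<i> * u)) / 4" using f01(1) by (simp add: add_nonneg_nonneg)
    finally show ?thesis .
  next
    case True
    define x y a b where "x = Re (z - p) / L" and "y = Im (z - p) / L" and "a = Re u / L" and "b = Im u / L"
    define g where "g = 1 - (x\<^sup>2 + y\<^sup>2)"
    have nrm: "(cmod (w - p) / L)\<^sup>2 = (Re (w - p) / L)\<^sup>2 + (Im (w - p) / L)\<^sup>2" for w
      by (simp add: cmod_power2 power_divide add_divide_distrib)
    have fval: "f w = (max 0 (1 - ((Re (w - p) / L)\<^sup>2 + (Im (w - p) / L)\<^sup>2)))^4" for w by (simp add: f_def nrm)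
    have "(cmod (z - p) / L)\<^sup>2 < 1" using fpos[OF fz] L by (simp add: abs_square_less_1)
    then have g: "0 \<le> g" "g \<le> 1" unfolding nrm g_def x_def y_def by auto
    have fg: "f z = g^4" using g by (simp add: fval g_def x_def y_def)
    have u1: "a\<^sup>2 + b\<^sup>2 = (cmod u)\<^sup>2 / L\<^sup>2" by (simp add: a_def b_def cmod_power2 power_divide add_divide_distrib)
    define q where "q = a\<^sup>2 + b\<^sup>2"
    have q: "0 \<le> q" "q \<le> 1"
    proof -
      have "(cmod u)\<^sup>2 \<le> L\<^sup>2" using True L by (intro power_mono) auto
      then show "q \<le> 1" using L by (simp add: q_def u1)
    qed (simp add: q_def)
    \<comment> \<open>Replaces the positive part by a polynomial: if g + t is negative, then |g + t|
      <= |t|, so that t^4 pays for the cut.\<close>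
    have low: "(max 0 (1 - ((x + c)\<^sup>2 + (y + d)\<^sup>2)))^4 \<ge> (g + t)^4 - t^4"
      if "t = - (2 * (x * c + y * d) + (c\<^sup>2 + d\<^sup>2))" for c d t
    proof -
      have gt: "1 - ((x + c)\<^sup>2 + (y + d)\<^sup>2) = g + t" by (simp add: g_def that power2_eq_square algebra_simps)
      show ?thesis
      proof (cases "g + t \<ge> 0")
        case True then show ?thesis unfolding gt by simp
      next
        case False
        then have "\<bar>g + t\<bar> \<le> \<bar>t\<bar>" using g by auto
        then have "(g + t)^4 \<le> t^4" by (simp add: power_mono_even)
        then show ?thesis using False by (simp add: gt)
      qed
    qed
    \<comment> \<open>The increments of g under the steps u, i u, -u and -i u, in units of
      L.\<close>
    define s1 s2 s3 s4 where "s1 = - (2 * (x * a + y * b) + (a\<^sup>2 + b\<^sup>2))" and "s2 = - (2 * (x * (- b) + y * a) + ((- b)\<^sup>2 + a\<^sup>2))"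
      and "s3 = - (2 * (x * (- a) + y * (- b)) + ((- a)\<^sup>2 + (- b)\<^sup>2))" and "s4 = - (2 * (x * b + y * (- a)) + (b\<^sup>2 + (- a)\<^sup>2))"
    have "f (z + u) \<ge> (g + s1)^4 - s1^4" "f (z + \<i> * u) \<ge> (g + s2)^4 - s2^4" "f (z - u) \<ge> (g + s3)^4 - s3^4" "f (z - \<i> * u) \<ge> (g + s4)^4 - s4^4"
      using low[of s1 a b] low[of s2 "- b" a] low[of s3 "- a" "- b"] low[of s4 b "- a"]
      unfolding s1_def s2_def s3_def s4_def fval x_def y_def a_def b_def by (simp_all add: add_divide_distrib diff_divide_distrib algebra_simps)
    moreover have "((g + s1)^4 - s1^4) + ((g + s2)^4 - s2^4) + ((g + s3)^4 - s3^4) + ((g + s4)^4 - s4^4)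
        = 4 * (g^4 - 4 * g^3 * q + 6 * g\<^sup>2 * (2 * (1 - g) * q + q\<^sup>2) - 4 * g * (6 * (1 - g) * q\<^sup>2 + q^3))"
      unfolding s1_def s2_def s3_def s4_def g_def q_def by algebra
    moreover have "g^4 - 4 * g^3 * q + 6 * g\<^sup>2 * (2 * (1 - g) * q + q\<^sup>2) - 4 * g * (6 * (1 - g) * q\<^sup>2 + q^3)
        \<ge> g^4 - 8 * g^4 * q - 28 * q\<^sup>2"
    proof -
      have 1: "g\<^sup>2 * q * (8 * (g - 1)\<^sup>2 + 4) \<ge> 0" using q by simp
      have "g * (6 * (1 - g) * q\<^sup>2 + q^3) \<le> 1 * (6 * 1 * q\<^sup>2 + q\<^sup>2)"
      proof (rule mult_mono)
        have "q^3 \<le> q\<^sup>2" using q by (simp add: power_decreasing)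
        moreover have "6 * (1 - g) * q\<^sup>2 \<le> 6 * 1 * q\<^sup>2" using g by (intro mult_right_mono) auto
        ultimately show "6 * (1 - g) * q\<^sup>2 + q^3 \<le> 6 * 1 * q\<^sup>2 + q\<^sup>2" by linarith
      qed (use g q in auto)
      then have 2: "28 * q\<^sup>2 - 4 * g * (6 * (1 - g) * q\<^sup>2 + q^3) \<ge> 0" by simp
      have 3: "6 * g\<^sup>2 * q\<^sup>2 \<ge> 0" by simp
      have "(g^4 - 4 * g^3 * q + 6 * g\<^sup>2 * (2 * (1 - g) * q + q\<^sup>2) - 4 * g * (6 * (1 - g) * q\<^sup>2 + q^3)) - (g^4 - 8 * g^4 * q - 28 * q\<^sup>2)
         = g\<^sup>2 * q * (8 * (g - 1)\<^sup>2 + 4) + 6 * g\<^sup>2 * q\<^sup>2 + (28 * q\<^sup>2 - 4 * g * (6 * (1 - g) * q\<^sup>2 + q^3))" by algebra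
      then show ?thesis using 1 2 3 by linarith
    qed
    moreover have "g^4 - 8 * g^4 * q - 28 * q\<^sup>2 = f z - (8 / L\<^sup>2) * f z * (cmod u)\<^sup>2 - (28 / L^4) * (cmod u)^4"
      by (simp add: fg q_def u1 power_divide)
    ultimately show ?thesis by argo
  qed
  show ?thesis
  proof (intro exI[of _ h0] conjI allI impI)
    show "h0 > 0" using L N e by (simp add: h0_def)
    fix \<nu> h S T j z
    assume sl: "step_law \<nu> h" and h: "0 < h" "h \<le> h0" and ST: "S \<in> sets borel" "T \<in> sets borel" and sub: "ball p L \<subseteq> S \<inter> T"
      and j: "real j * h \<le> N" and z: "z \<in> ball p (L / 2)"
    interpret step_law \<nu> h by fact
    define x where "x = 2 * (8 / L\<^sup>2) * h"
    have x: "0 \<le> x" "x \<le> 1/2" using h L by (auto simp: x_def h0_def field_simps)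
    have "stay_and_end S T j z \<ge> (1 - x) ^ j * f z - real j * (8 * (28 / L^4) * h\<^sup>2)"
      unfolding x_def
    proof (rule holding_lower_bound[OF ST fm f01])
      show "z \<in> S \<inter> T" if "f z > 0" for z
        using fpos[OF that] sub by (auto simp: dist_norm norm_minus_commute)
      show "2 * (8 / L\<^sup>2) * h \<le> 1" using x by (simp add: x_def)
    qed (use fp L in auto)
    moreover have "(1 - x) ^ j \<ge> e"
    proof -
      have "exp (- (2 * x)) \<le> 1 - x"
      proof -
        have "1 \<le> (1 - x) * (1 + 2 * x)" using mult_nonneg_nonneg[of x "1 - 2 * x"] x by (simp add: algebra_simps)
        also have "\<dots> \<le> (1 - x) * exp (2 * x)" using exp_ge_add_one_self[of "2 * x"] x by (intro mult_left_mono) auto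
        finally show ?thesis by (simp add: exp_minus field_simps)
      qed
      then have "exp (- (2 * x)) ^ j \<le> (1 - x) ^ j" by (intro power_mono) auto
      moreover have "exp (- (2 * x)) ^ j = exp (- (32 * (real j * h) / L\<^sup>2))" by (simp add: exp_of_nat_mult[symmetric] x_def)
      moreover have "\<dots> \<ge> e" unfolding e_def using j L by (simp add: divide_right_mono)
      ultimately show ?thesis by simp
    qed
    moreover have "f z \<ge> 3/10"
    proof -
      have "cmod (z - p) / L \<le> 1/2" using z L by (simp add: dist_norm norm_minus_commute)
      then have "(cmod (z - p) / L)\<^sup>2 \<le> (1/2)\<^sup>2" using L by (intro power_mono) auto
      moreover have "(1/2)\<^sup>2 = (1/4::real)" by (simp add: power2_eq_square)
      ultimately have "3/4 \<le> 1 - (cmod (z - p) / L)\<^sup>2" by linarith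
      then have "3/4 \<le> max 0 (1 - (cmod (z - p) / L)\<^sup>2)" by (rule max.coboundedI2)
      then have "(3/4)^4 \<le> f z" unfolding f_def by (rule power_mono) simp
      then show ?thesis by (simp add: power4_eq_xxxx)
    qed
    then have "(1 - x) ^ j * f z \<ge> e * (3/10)" using \<open>(1 - x) ^ j \<ge> e\<close> e by (intro mult_mono) auto
    moreover have "real j * (8 * (28 / L^4) * h\<^sup>2) \<le> e / 10"
    proof -
      have "h * (2240 * (N + 1)) \<le> e * L^4" using h N by (simp add: h0_def pos_le_divide_eq)
      then have 1: "h * (N + 1) * 224 / L^4 \<le> e / 10" using L by (simp add: field_simps)
      have "real j * (8 * (28 / L^4) * h\<^sup>2) = (real j * h) * (h * 224 / L^4)" by (simp add: power2_eq_square)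
      also have "\<dots> \<le> (N + 1) * (h * 224 / L^4)" using j h L by (intro mult_right_mono) auto
      also have "\<dots> \<le> e / 10" using 1 by (simp add: mult_ac)
      finally show ?thesis .
    qed
    ultimately show "exp (- (32 * N / L\<^sup>2)) / 10 \<le> stay_and_end S T j z" using e unfolding e_def[symmetric] by linarith
  qed
qed

text \<open>The case of a disc, with the explicit map (z - c) / R. The constants: ln 16 <= 4 allows
  the cut F = 4, 3/8 <= exp (-1/2) allows g = 1/4, and after the time 192 R^2 survival is down to 3
  exp (-8) <= 3/256.\<close>

lemma hop_to_ball:
  assumes R: "R > 0"
  shows "\<exists>h0>0. \<forall>\<nu> h S T w k0 k1 k z. step_law \<nu> h \<longrightarrow> 0 < h \<longrightarrow> h \<le> h0 \<longrightarrow> S \<in> sets borel \<longrightarrow> T \<in> sets borel \<longrightarrow>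
     ball c R \<subseteq> S \<longrightarrow> 0 \<le> w \<longrightarrow> (\<forall>k z. k0 \<le> k \<longrightarrow> k \<le> k1 \<longrightarrow> z \<in> ball c (R / 8) \<longrightarrow> w \<le> step_law.stay_and_end \<nu> S T k z) \<longrightarrow>
     real k0 + 192 * R\<^sup>2 / h + 1 \<le> real k \<longrightarrow> k \<le> k1 \<longrightarrow> cmod (z - c) \<le> 3 * R / 8 \<longrightarrow>
     w / 32 \<le> step_law.stay_and_end \<nu> S T k z"
proof -
  define \<Phi> where "\<Phi> = (\<lambda>z. (z - c) / of_real R)"
  have e8: "exp (- 8) \<le> (1/256::real)"
  proof -
    have "(2::real)^8 \<le> exp 1 ^ 8" using exp_ge_add_one_self[of 1] by (intro power_mono) auto
    also have "exp 1 ^ 8 = exp (8::real)" by (simp add: exp_of_nat_mult[symmetric])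
    finally show ?thesis by (simp add: exp_minus field_simps)
  qed
  have e4: "ln (16::real) \<le> 4"
  proof -
    have "(2::real)^4 \<le> exp 1 ^ 4" using exp_ge_add_one_self[of 1] by (intro power_mono) auto
    also have "exp 1 ^ 4 = exp (4::real)" by (simp add: exp_of_nat_mult[symmetric])
    finally have "ln (16::real) \<le> ln (exp 4)" by (subst ln_le_cancel_iff) auto
    then show ?thesis by simp
  qed
  have "\<exists>h0>0. \<forall>\<nu> h S T w k0 k1 k z. step_law \<nu> h \<longrightarrow> 0 < h \<longrightarrow> h \<le> h0 \<longrightarrow> S \<in> sets borel \<longrightarrow> T \<in> sets borel \<longrightarrow>
     ball c R \<subseteq> S \<longrightarrow> 0 \<le> w \<longrightarrow> (\<forall>k z. k0 \<le> k \<longrightarrow> k \<le> k1 \<longrightarrow> z \<in> ball c (R / 8) \<longrightarrow> w \<le> step_law.stay_and_end \<nu> S T k z) \<longrightarrow>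
     real k0 + 192 * R\<^sup>2 / h + 1 \<le> real k \<longrightarrow> k \<le> k1 \<longrightarrow> z \<in> ball c R \<longrightarrow> cmod (\<Phi> z) \<le> exp (- (2 * (1/4))) \<longrightarrow>
     w * (1/4) / (2 * 4) \<le> step_law.stay_and_end \<nu> S T k z"
  proof (rule log_potential_hit)
    show "ball c R \<subseteq> cball c R" by auto
    show "\<Phi> holomorphic_on ball c R" unfolding \<Phi>_def using R by (intro holomorphic_intros) auto
    show "z = c" if "\<Phi> z = 0" for z using that R by (simp add: \<Phi>_def)
    show "compact {z \<in> ball c R. cmod (\<Phi> z) \<le> r}" if "r < 1" for r
    proof -
      have "{z \<in> ball c R. cmod (\<Phi> z) \<le> r} = cball c (r * R)"
      proof (intro equalityI subsetI)
        fix z assume "z \<in> cball c (r * R)"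
        then have "cmod (z - c) \<le> r * R" by (simp add: dist_norm norm_minus_commute)
        moreover have "r * R < 1 * R" using that R by (intro mult_strict_right_mono) auto
        ultimately have "cmod (z - c) \<le> r * R" "cmod (z - c) < R" by linarith+
        then show "z \<in> {z \<in> ball c R. cmod (\<Phi> z) \<le> r}" using R by (auto simp: \<Phi>_def norm_divide dist_norm norm_minus_commute field_simps)
      qed (use R in \<open>auto simp: \<Phi>_def norm_divide dist_norm norm_minus_commute field_simps\<close>)
      then show ?thesis by simp
    qed
    show "- ln (cmod (\<Phi> z)) \<le> 4" if "R / 8 / 2 \<le> cmod (z - c)" for z
    proof -
      have "1/16 \<le> cmod (\<Phi> z)" using that R by (simp add: \<Phi>_def norm_divide field_simps)
      then have "ln (1/16) \<le> ln (cmod (\<Phi> z))" by (subst ln_le_cancel_iff) (auto intro: less_le_trans[of _ "1/16"])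
      then show ?thesis using e4 by (simp add: ln_div)
    qed
    show "3 * 4 * exp (- (192 * R\<^sup>2) / (24 * R\<^sup>2)) \<le> 1 / 4 / (4::real)" using e8 R by simp
  qed (use R in auto)
  moreover have "z \<in> ball c R \<and> cmod (\<Phi> z) \<le> exp (- (2 * (1/4)))" if "cmod (z - c) \<le> 3 * R / 8" for z
  proof -
    have "cmod (\<Phi> z) \<le> 3/8" using that R by (simp add: \<Phi>_def norm_divide field_simps)
    also have "3/8 \<le> exp (- (2 * (1/4::real)))" using exp_ge_add_one_self[of "- (1/2)"] by simp
    finally show ?thesis using that R by (simp add: dist_norm norm_minus_commute)
  qed
  ultimately show ?thesis by (auto simp: mult.commute)
qed

text \<open>A point within R / 8 of one centre is within 3 R / 8 of the next one. So each hop costs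
  the factor 32 and the time 192 R^2, rounded up to whole steps.\<close>

lemma hop_chain:
  fixes c :: "nat \<Rightarrow> complex"
  assumes R: "R > 0" and step: "\<And>i. cmod (c i - c (Suc i)) \<le> R / 4"
  shows "\<exists>h0>0. \<forall>\<nu> h S T w k0 k1 k z. step_law \<nu> h \<longrightarrow> 0 < h \<longrightarrow> h \<le> h0 \<longrightarrow> S \<in> sets borel \<longrightarrow> T \<in> sets borel \<longrightarrow>
     (\<forall>i\<le>M. ball (c i) R \<subseteq> S) \<longrightarrow> 0 \<le> w \<longrightarrow> (\<forall>k z. k0 \<le> k \<longrightarrow> k \<le> k1 \<longrightarrow> z \<in> ball (c M) (R / 8) \<longrightarrow> w \<le> step_law.stay_and_end \<nu> S T k z) \<longrightarrow>
     real k0 + real M * (192 * R\<^sup>2 / h + 2) \<le> real k \<longrightarrow> k \<le> k1 \<longrightarrow> z \<in> ball (c 0) (R / 8) \<longrightarrow>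
     w / 32 ^ M \<le> step_law.stay_and_end \<nu> S T k z"
proof (induction M)
  case 0
  show ?case by (intro exI[of _ 1]) auto
next
  case (Suc M)
  then obtain h1 where h1: "h1 > 0" and IH: "\<forall>\<nu> h S T w k0 k1 k z. step_law \<nu> h \<longrightarrow> 0 < h \<longrightarrow> h \<le> h1 \<longrightarrow> S \<in> sets borel \<longrightarrow> T \<in> sets borel \<longrightarrow>
     (\<forall>i\<le>M. ball (c i) R \<subseteq> S) \<longrightarrow> 0 \<le> w \<longrightarrow> (\<forall>k z. k0 \<le> k \<longrightarrow> k \<le> k1 \<longrightarrow> z \<in> ball (c M) (R / 8) \<longrightarrow> w \<le> step_law.stay_and_end \<nu> S T k z) \<longrightarrow>
     real k0 + real M * (192 * R\<^sup>2 / h + 2) \<le> real k \<longrightarrow> k \<le> k1 \<longrightarrow> z \<in> ball (c 0) (R / 8) \<longrightarrow>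
     w / 32 ^ M \<le> step_law.stay_and_end \<nu> S T k z" by blast
  obtain h2 where h2: "h2 > 0" and hop: "\<forall>\<nu> h S T w k0 k1 k z. step_law \<nu> h \<longrightarrow> 0 < h \<longrightarrow> h \<le> h2 \<longrightarrow> S \<in> sets borel \<longrightarrow> T \<in> sets borel \<longrightarrow>
     ball (c (Suc M)) R \<subseteq> S \<longrightarrow> 0 \<le> w \<longrightarrow> (\<forall>k z. k0 \<le> k \<longrightarrow> k \<le> k1 \<longrightarrow> z \<in> ball (c (Suc M)) (R / 8) \<longrightarrow> w \<le> step_law.stay_and_end \<nu> S T k z) \<longrightarrow>
     real k0 + 192 * R\<^sup>2 / h + 1 \<le> real k \<longrightarrow> k \<le> k1 \<longrightarrow> cmod (z - c (Suc M)) \<le> 3 * R / 8 \<longrightarrow>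
     w / 32 \<le> step_law.stay_and_end \<nu> S T k z" using hop_to_ball[OF R, of "c (Suc M)"] by blast
  show ?case
  proof (intro exI[of _ "min h1 h2"] conjI allI impI)
    show "min h1 h2 > 0" using h1 h2 by simp
    fix \<nu> h S T w k0 k1 k z
    assume sl: "step_law \<nu> h" and h: "0 < h" "h \<le> min h1 h2" and ST: "S \<in> sets borel" "T \<in> sets borel"
      and sub: "\<forall>i\<le>Suc M. ball (c i) R \<subseteq> S" and w: "(0::real) \<le> w"
      and base: "\<forall>k z. k0 \<le> k \<longrightarrow> k \<le> k1 \<longrightarrow> z \<in> ball (c (Suc M)) (R / 8) \<longrightarrow> w \<le> step_law.stay_and_end \<nu> S T k z"
      and k: "real k0 + real (Suc M) * (192 * R\<^sup>2 / h + 2) \<le> real k" "k \<le> k1" and z: "z \<in> ball (c 0) (R / 8)"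
    define k0' where "k0' = nat \<lceil>real k0 + 192 * R\<^sup>2 / h + 1\<rceil>"
    have "0 \<le> real k0 + 192 * R\<^sup>2 / h + 1" using h by simp
    then have k0': "real k0 + 192 * R\<^sup>2 / h + 1 \<le> real k0'" "real k0' \<le> real k0 + 192 * R\<^sup>2 / h + 2"
      unfolding k0'_def by linarith+
    have "w / 32 \<le> step_law.stay_and_end \<nu> S T k z" if k: "k0' \<le> k" "k \<le> k1" and z: "z \<in> ball (c M) (R / 8)" for k z
    proof -
      have "cmod (z - c (Suc M)) \<le> cmod (z - c M) + cmod (c M - c (Suc M))" using norm_triangle_ineq[of "z - c M" "c M - c (Suc M)"] by simp
      also have "\<dots> \<le> R / 8 + R / 4" using z step[of M] by (intro add_mono) (auto simp: dist_norm norm_minus_commute)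
      finally have "cmod (z - c (Suc M)) \<le> 3 * R / 8" by simp
      moreover have "real k0 + 192 * R\<^sup>2 / h + 1 \<le> real k" using k0' k by linarith
      ultimately show ?thesis 
        using hop[rule_format, OF sl h(1) _ ST, where w = w and ?k0.0 = k0 and ?k1.0 = k1] h(2) sub w base k(2) by auto
    qed
    moreover have "real k0' + real M * (192 * R\<^sup>2 / h + 2) \<le> real k" using k0'(2) k(1) by (simp add: distrib_right)
    moreover have "\<forall>i\<le>M. ball (c i) R \<subseteq> S" using sub by auto
    moreover have "0 \<le> w / 32" using w by simp
    ultimately have "w / 32 / 32 ^ M \<le> step_law.stay_and_end \<nu> S T k z"
      using IH[rule_format, OF sl h(1) _ ST, where w = "w / 32" and ?k0.0 = k0' and ?k1.0 = k1] h(2) k(2) z by auto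
    then show "w / 32 ^ Suc M \<le> step_law.stay_and_end \<nu> S T k z" by (simp add: mult.commute)
  qed
qed


text \<open>Three stages, composed from the last to the first: the Green function carries the walk
  through the zigzag part to log radius X + 2, M hops carry it on to radius sqrt N exp (-2), and
  there it waits. The waiting absorbs the remaining time, so one bound serves every total time
  between N / 3 and N; \<open>time\<close> ensures that the first two stages take at most N /
  3.\<close>

lemma shape_lower_bound:
  fixes \<theta> :: "real \<Rightarrow> real"
  assumes l: "l > 0" and a: "0 < a" "a < b" and b: "1 \<le> b" "b \<le> pi"
    and lin: "\<And>j x. j < m \<Longrightarrow> x \<in> {real j * l..real (Suc j) * l} \<Longrightarrow> \<theta> x = \<theta> (real j * l) + \<sigma> j * (x - real j * l)"
    and slope: "\<And>j. j < m \<Longrightarrow> (\<sigma> j)\<^sup>2 = s\<^sup>2"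
    and lip: "\<And>x y. \<bar>\<theta> x - \<theta> y\<bar> \<le> \<bar>s\<bar> * \<bar>x - y\<bar>"
    and ends: "\<And>x. x \<le> 0 \<Longrightarrow> \<theta> x = \<beta>" "\<And>x. x \<ge> real m * l \<Longrightarrow> \<theta> x = \<beta>"
  defines "X \<equiv> real m * l"
  defines "g \<equiv> exp (- (pi / (2 * a) * (1 + s\<^sup>2) * X) - (16 * a + 12) / min (1/4) ((b - a) / (1 + \<bar>s\<bar>)) - 1) / 2"
  assumes N: "exp (X + 5) \<le> sqrt N" and M: "4 * sqrt N * exp (-2) / exp X \<le> real M" "M > 0"
    and time: "24 * (exp (X + 3))\<^sup>2 * ln (96 / g) + 2 + real M * (192 * (exp X)\<^sup>2 + 2) \<le> N / 3"
    and \<rho>: "\<rho> > 0" "exp X / 4 \<le> \<rho> * sqrt N"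
  shows "\<exists>h0>0. \<forall>\<nu> h S T k. step_law \<nu> h \<longrightarrow> 0 < h \<longrightarrow> h \<le> h0 \<longrightarrow> S \<in> sets borel \<longrightarrow> T \<in> sets borel \<longrightarrow>
     spiral_strip \<theta> b (-3) (X + 3) \<subseteq> S \<longrightarrow>
     (\<forall>y. exp (X + 2) \<le> y \<longrightarrow> y \<le> sqrt N * exp (-2) \<longrightarrow> ball (of_real y * cis \<beta>) (exp X) \<subseteq> S) \<longrightarrow>
     ball (of_real (sqrt N * exp (-2)) * cis \<beta>) (\<rho> * sqrt N) \<subseteq> S \<inter> T \<longrightarrow>
     N / 3 \<le> real k * h \<longrightarrow> real k * h \<le> N \<longrightarrow>
     exp (- 32 / \<rho>\<^sup>2) / 10 / 32 ^ M * g / 16 \<le> step_law.stay_and_end \<nu> S T k (exp (Complex (-2) \<beta>))"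
proof -
  define D where "D = spiral_strip \<theta> b (-3) (X + 3)"
  define c0 where "c0 = exp (Complex (X + 2) \<beta>)"
  obtain \<Phi> where \<Phi>: "open D" "\<Phi> holomorphic_on D" "\<And>z. z \<in> D \<Longrightarrow> \<Phi> z = 0 \<Longrightarrow> z = c0"
    "\<And>r. r < 1 \<Longrightarrow> compact {z \<in> D. cmod (\<Phi> z) \<le> r}"
    "\<And>z. z \<in> D \<Longrightarrow> cmod (z - c0) \<le> 2 * exp (X + 3) * cmod (\<Phi> z)"
    "exp (Complex (-2) \<beta>) \<in> D"
    "- ln (cmod (\<Phi> (exp (Complex (-2) \<beta>)))) \<ge> 2 * g"
  proof (rule green_function_spiral_strip[where m = m and \<theta> = \<theta> and \<sigma> = \<sigma> and s = s and \<beta> = \<beta>, OF l a b])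
    fix \<Phi>
    assume *: "open (spiral_strip \<theta> b (- 3) (real m * l + 3))" "\<Phi> holomorphic_on spiral_strip \<theta> b (- 3) (real m * l + 3)"
      "\<And>z. z \<in> spiral_strip \<theta> b (- 3) (real m * l + 3) \<Longrightarrow> \<Phi> z = 0 \<Longrightarrow> z = exp (Complex (real m * l + 2) \<beta>)"
      "\<And>r. r < 1 \<Longrightarrow> compact {z \<in> spiral_strip \<theta> b (- 3) (real m * l + 3). cmod (\<Phi> z) \<le> r}"
      "\<And>z. z \<in> spiral_strip \<theta> b (- 3) (real m * l + 3) \<Longrightarrow> cmod (z - exp (Complex (real m * l + 2) \<beta>)) \<le> 2 * exp (real m * l + 3) * cmod (\<Phi> z)"
      "exp (Complex (-2) \<beta>) \<in> spiral_strip \<theta> b (- 3) (real m * l + 3)"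
      "- ln (cmod (\<Phi> (exp (Complex (-2) \<beta>)))) \<ge> exp (- (pi / (2 * a) * (1 + s\<^sup>2) * (real m * l)) - (16 * a + 12) / min (1/4) ((b - a) / (1 + \<bar>s\<bar>)) - 1)"
    note f = *[folded X_def, folded D_def c0_def]
    have half: "2 * (x / 2) = x" for x :: real by simp
    have "2 * g = exp (- (pi / (2 * a) * (1 + s\<^sup>2) * X) - (16 * a + 12) / min (1/4) ((b - a) / (1 + \<bar>s\<bar>)) - 1)"
      unfolding g_def by (rule half)
    then have f7: "2 * g \<le> - ln (cmod (\<Phi> (exp (Complex (-2) \<beta>))))" using f(7) by (simp only:)
    show thesis by (rule that[of \<Phi>]) (assumption | rule f7 f(1-6))+
  qed ((rule lin slope lip ends; assumption) | rule lip)+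
  have Xpos: "X \<ge> 0" using l by (simp add: X_def)
  have g: "0 < g" "g \<le> 1"
  proof -
    have aux: "0 \<le> P \<Longrightarrow> 0 \<le> Q \<Longrightarrow> - P - Q - 1 \<le> 0" for P Q :: real by linarith
    have "0 \<le> pi / (2 * a) * (1 + s\<^sup>2) * X" using a Xpos by (intro mult_nonneg_nonneg) auto
    moreover have "0 \<le> (16 * a + 12) / min (1/4) ((b - a) / (1 + \<bar>s\<bar>))" using a by (intro divide_nonneg_nonneg) auto
    ultimately have "- (pi / (2 * a) * (1 + s\<^sup>2) * X) - (16 * a + 12) / min (1/4) ((b - a) / (1 + \<bar>s\<bar>)) - 1 \<le> 0" by (rule aux)
    then have "exp (- (pi / (2 * a) * (1 + s\<^sup>2) * X) - (16 * a + 12) / min (1/4) ((b - a) / (1 + \<bar>s\<bar>)) - 1) \<le> 1"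
      by (simp only: exp_le_one_iff)
    moreover have "x / 2 \<le> 1" if "x \<le> 1" for x :: real using that by linarith
    ultimately show "g \<le> 1" unfolding g_def by blast
  qed (simp add: g_def)
  have sN: "sqrt N > 0" using N less_le_trans[OF exp_gt_zero] by blast
  then have Npos: "N > 0" by simp
  define R where "R = exp X"
  have R: "R > 0" by (simp add: R_def)
  \<comment> \<open>Chosen such that survival in a disc of radius exp (X + 3), which contains the
    strip, has decayed to 3 g / 96; with the cut F = 8 this is the required g / 4.\<close>
  define t where "t = 24 * (exp (X + 3))\<^sup>2 * ln (96 / g)"
  have t0: "t \<ge> 0" using g by (simp add: t_def)
  have "\<exists>h1>0. \<forall>\<nu> h S T w k0 k1 k z. step_law \<nu> h \<longrightarrow> 0 < h \<longrightarrow> h \<le> h1 \<longrightarrow> S \<in> sets borel \<longrightarrow> T \<in> sets borel \<longrightarrow>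
     D \<subseteq> S \<longrightarrow> 0 \<le> w \<longrightarrow> (\<forall>k z. k0 \<le> k \<longrightarrow> k \<le> k1 \<longrightarrow> z \<in> ball c0 (R / 8) \<longrightarrow> w \<le> step_law.stay_and_end \<nu> S T k z) \<longrightarrow>
     real k0 + t / h + 1 \<le> real k \<longrightarrow> k \<le> k1 \<longrightarrow> z \<in> D \<longrightarrow> cmod (\<Phi> z) \<le> exp (- (2 * g)) \<longrightarrow>
     w * g / (2 * 8) \<le> step_law.stay_and_end \<nu> S T k z"
  proof (rule log_potential_hit[where p = 0 and R = "exp (X + 3)" and r = "R / 8" and t = t, OF \<Phi>(1) _ _ \<Phi>(2,3,4)])
    show "D \<subseteq> cball 0 (exp (X + 3))" by (auto simp: D_def spiral_strip_def)
    show "- ln (cmod (\<Phi> z)) \<le> 8" if z: "z \<in> D" "R / 8 / 2 \<le> cmod (z - c0)" for z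
    proof -
      have "R / 16 \<le> 2 * exp (X + 3) * cmod (\<Phi> z)" using \<Phi>(5)[OF z(1)] z(2) by simp
      also have "exp (X + 3) = R * exp 3" by (simp add: R_def exp_add)
      finally have "1 \<le> 32 * exp 3 * cmod (\<Phi> z)" using R by (simp add: field_simps)
      moreover have "32 * exp 3 \<le> exp (8::real)"
      proof -
        have "(2::real)^5 \<le> exp 1 ^ 5" using exp_ge_add_one_self[of 1] by (intro power_mono) auto
        also have "exp 1 ^ 5 = exp (5::real)" by (simp add: exp_of_nat_mult[symmetric])
        finally have "32 * exp 3 \<le> exp 5 * exp (3::real)" by (intro mult_right_mono) auto
        then show ?thesis by (simp add: exp_add[symmetric])
      qed
      then have "32 * exp 3 * cmod (\<Phi> z) \<le> exp 8 * cmod (\<Phi> z)" by (intro mult_right_mono) auto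
      ultimately have 1: "1 \<le> exp 8 * cmod (\<Phi> z)" by linarith
      then have "cmod (\<Phi> z) > 0" by (metis less_le_not_le mult_zero_right norm_ge_zero norm_le_zero_iff not_one_le_zero zero_less_norm_iff norm_eq_zero)
      then have "0 \<le> ln (exp 8 * cmod (\<Phi> z))" using 1 by (simp add: ln_ge_zero)
      also have "\<dots> = 8 + ln (cmod (\<Phi> z))" using \<open>cmod (\<Phi> z) > 0\<close> by (subst ln_mult_pos) auto
      finally show ?thesis by simp
    qed
    have "exp (- t / (24 * (exp (X + 3))\<^sup>2)) = g / 96"
      using g by (simp add: t_def exp_minus exp_ln)
    then show "3 * 8 * exp (- t / (24 * (exp (X + 3))\<^sup>2)) \<le> g / 4" by simp
  qed (use g R t0 in auto)
  then obtain h1 where h1: "h1 > 0" and main: "\<forall>\<nu> h S T w k0 k1 k z. step_law \<nu> h \<longrightarrow> 0 < h \<longrightarrow> h \<le> h1 \<longrightarrow> S \<in> sets borel \<longrightarrow> T \<in> sets borel \<longrightarrow>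
     D \<subseteq> S \<longrightarrow> 0 \<le> w \<longrightarrow> (\<forall>k z. k0 \<le> k \<longrightarrow> k \<le> k1 \<longrightarrow> z \<in> ball c0 (R / 8) \<longrightarrow> w \<le> step_law.stay_and_end \<nu> S T k z) \<longrightarrow>
     real k0 + t / h + 1 \<le> real k \<longrightarrow> k \<le> k1 \<longrightarrow> z \<in> D \<longrightarrow> cmod (\<Phi> z) \<le> exp (- (2 * g)) \<longrightarrow>
     w * g / (2 * 8) \<le> step_law.stay_and_end \<nu> S T k z"
    by blast
  define y0 y1 where "y0 = exp (X + 2)" and "y1 = sqrt N * exp (-2)"
  have y01: "y0 \<le> y1"
  proof -
    have "exp (X + 5) * exp (-2) \<le> sqrt N * exp (-2)" using N by (intro mult_right_mono) auto
    moreover have "exp (X + 5) * exp (-2) = exp (X + 3)" by (subst exp_add[symmetric]) simp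
    ultimately have "exp (X + 3) \<le> y1" by (simp add: y1_def)
    moreover have "y0 \<le> exp (X + 3)" by (simp add: y0_def)
    ultimately show ?thesis by linarith
  qed
  define d where "d = (y1 - y0) / real M"
  have d: "d \<ge> 0" "real M * d = y1 - y0" using y01 M by (auto simp: d_def)
  have dR: "d \<le> R / 4"
  proof -
    have "4 * y1 \<le> real M * R" using M R by (simp add: y1_def R_def pos_divide_le_eq mult_ac)
    then have "real M * d \<le> real M * (R / 4)" 
    proof -
      have "y0 > 0" by (simp add: y0_def)
      have "4 * (real M * d) \<le> 4 * y1" unfolding d(2) using \<open>y0 > 0\<close> by simp
      also note \<open>4 * y1 \<le> real M * R\<close>
      finally have "4 * (real M * d) \<le> real M * R" .
      then show ?thesis by simp
    qed
    then show ?thesis using M by simp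
  qed
  \<comment> \<open>Constant from index M on, because \<open>hop_chain\<close> asks for short
    distances at all indices.\<close>
  define c where "c = (\<lambda>i. of_real (y0 + real (min i M) * d) * cis \<beta>)"
  have cstep: "cmod (c i - c (Suc i)) \<le> R / 4" for i
  proof -
    have "c i - c (Suc i) = of_real ((real (min i M) - real (min (Suc i) M)) * d) * cis \<beta>"
      by (simp add: c_def algebra_simps)
    then have "cmod (c i - c (Suc i)) = \<bar>real (min i M) - real (min (Suc i) M)\<bar> * d"
      using d(1) by (simp only: norm_mult norm_of_real norm_cis abs_mult abs_of_nonneg mult_1_right)
    also have "\<dots> \<le> 1 * d" using d by (intro mult_right_mono) (auto simp: min_def)
    finally show ?thesis using dR by simp
  qed
  obtain h2 where h2: "h2 > 0" and chain: "\<forall>\<nu> h S T w k0 k1 k z. step_law \<nu> h \<longrightarrow> 0 < h \<longrightarrow> h \<le> h2 \<longrightarrow> S \<in> sets borel \<longrightarrow> T \<in> sets borel \<longrightarrow>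
     (\<forall>i\<le>M. ball (c i) R \<subseteq> S) \<longrightarrow> 0 \<le> w \<longrightarrow> (\<forall>k z. k0 \<le> k \<longrightarrow> k \<le> k1 \<longrightarrow> z \<in> ball (c M) (R / 8) \<longrightarrow> w \<le> step_law.stay_and_end \<nu> S T k z) \<longrightarrow>
     real k0 + real M * (192 * R\<^sup>2 / h + 2) \<le> real k \<longrightarrow> k \<le> k1 \<longrightarrow> z \<in> ball (c 0) (R / 8) \<longrightarrow>
     w / 32 ^ M \<le> step_law.stay_and_end \<nu> S T k z" using hop_chain[where c = c, OF R cstep, of M] by blast
  define p where "p = of_real y1 * cis \<beta>"
  have Lpos: "\<rho> * sqrt N > 0" using \<rho>(1) sN by simp
  obtain h3 where h3: "h3 > 0" and hold: "\<forall>\<nu> h S T j z. step_law \<nu> h \<longrightarrow> 0 < h \<longrightarrow> h \<le> h3 \<longrightarrow> S \<in> sets borel \<longrightarrow> T \<in> sets borel \<longrightarrow>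
     ball p (\<rho> * sqrt N) \<subseteq> S \<inter> T \<longrightarrow> real j * h \<le> N \<longrightarrow> z \<in> ball p (\<rho> * sqrt N / 2) \<longrightarrow>
     exp (- (32 * N / (\<rho> * sqrt N)\<^sup>2)) / 10 \<le> step_law.stay_and_end \<nu> S T j z"
    using hold_in_ball[OF Lpos less_imp_le[OF Npos], of p] by blast
  have rat: "32 * N / (\<rho> * sqrt N)\<^sup>2 = 32 / \<rho>\<^sup>2" using Npos by (simp add: power_mult_distrib)
  define w where "w = exp (- 32 / \<rho>\<^sup>2) / 10"
  have w: "w \<ge> 0" by (simp add: w_def)
  have cM: "c M = p"
  proof -
    have "y0 + real (min M M) * d = y1" using d(2) by simp
    then show ?thesis by (simp only: c_def p_def)
  qed
  have c0: "c 0 = c0" by (simp add: c_def c0_def y0_def exp_eq_polar)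
  show ?thesis
  proof (intro exI[of _ "Min {1, h1, h2, h3}"] conjI allI impI)
    show "Min {1, h1, h2, h3} > 0" using h1 h2 h3 by simp
    fix \<nu> h S T k
    assume sl: "step_law \<nu> h" and h0: "0 < h" and h': "h \<le> Min {1, h1, h2, h3}" and ST: "S \<in> sets borel" "T \<in> sets borel"
      and DS: "spiral_strip \<theta> b (-3) (X + 3) \<subseteq> S"
      and BS: "\<forall>y. exp (X + 2) \<le> y \<longrightarrow> y \<le> sqrt N * exp (-2) \<longrightarrow> ball (of_real y * cis \<beta>) (exp X) \<subseteq> S"
      and HS: "ball (of_real (sqrt N * exp (-2)) * cis \<beta>) (\<rho> * sqrt N) \<subseteq> S \<inter> T"
      and k: "N / 3 \<le> real k * h" "real k * h \<le> N"
    have h: "h \<le> 1" "h \<le> h1" "h \<le> h2" "h \<le> h3" using h' by auto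
    \<comment> \<open>The largest number of steps that fits into time N; up to it the waiting
      estimate is available.\<close>
    define k1 where "k1 = nat \<lfloor>N / h\<rfloor>"
    have k1: "j \<le> k1 \<longleftrightarrow> real j * h \<le> N" for j
    proof -
      have "j \<le> k1 \<longleftrightarrow> real j \<le> N / h" using h0 Npos by (simp add: k1_def le_nat_iff le_floor_iff)
      then show ?thesis using h0 by (simp add: pos_le_divide_eq)
    qed
    have b1: "w \<le> step_law.stay_and_end \<nu> S T j z" if "j \<le> k1" "z \<in> ball (c M) (R / 8)" for j z
    proof -
      have "R / 8 \<le> \<rho> * sqrt N / 2" using \<rho>(2) by (simp add: R_def)
      then have "z \<in> ball p (\<rho> * sqrt N / 2)" using that(2) by (auto simp: cM)
      then have "exp (- (32 * N / (\<rho> * sqrt N)\<^sup>2)) / 10 \<le> step_law.stay_and_end \<nu> S T j z"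
        by (intro hold[rule_format, OF sl h0 h(4) ST]) (use HS that(1) k1 in \<open>auto simp: p_def y1_def\<close>)
      then show ?thesis unfolding rat w_def by simp
    qed
    define k0 where "k0 = nat \<lceil>real M * (192 * R\<^sup>2 / h + 2)\<rceil>"
    have "0 \<le> real M * (192 * R\<^sup>2 / h + 2)" using h0 by simp
    then have k0: "real M * (192 * R\<^sup>2 / h + 2) \<le> real k0" "real k0 \<le> real M * (192 * R\<^sup>2 / h + 2) + 1"
      unfolding k0_def by linarith+
    have BS': "\<forall>i\<le>M. ball (c i) R \<subseteq> S"
    proof (intro allI impI)
      fix i assume "i \<le> M"
      then have "real i * d \<le> real M * d" using d by (intro mult_right_mono) auto
      then have "y0 \<le> y0 + real (min i M) * d" "y0 + real (min i M) * d \<le> y1" using d \<open>i \<le> M\<close> by (auto simp: min_def)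
      then show "ball (c i) R \<subseteq> S" using BS unfolding c_def R_def y0_def y1_def by blast
    qed
    have b2: "w / 32 ^ M \<le> step_law.stay_and_end \<nu> S T j z" if "k0 \<le> j" "j \<le> k1" "z \<in> ball c0 (R / 8)" for j z
      using chain[rule_format, OF sl h0 h(3) ST _ w, where ?k0.0 = 0 and ?k1.0 = k1 and k = j and z = z] BS' b1 that k0(1) c0 by auto
    have kk: "real k0 + t / h + 1 \<le> real k"
    proof -
      have "(real k0 + t / h + 1) * h \<le> (real M * (192 * R\<^sup>2 / h + 2) + 1 + t / h + 1) * h"
        using k0 h0 by (intro mult_right_mono) auto
      also have "\<dots> = real M * (192 * R\<^sup>2 + 2 * h) + 2 * h + t" using h0 by (simp add: field_simps)
      also have "\<dots> \<le> real M * (192 * R\<^sup>2 + 2) + 2 + t" using h by (intro add_mono mult_left_mono) auto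
      also have "\<dots> \<le> real k * h" using time k(1) by (simp add: t_def R_def)
      finally show ?thesis using h0 by simp
    qed
    have \<Phi>q: "cmod (\<Phi> (exp (Complex (-2) \<beta>))) \<le> exp (- (2 * g))"
    proof (cases "\<Phi> (exp (Complex (-2) \<beta>)) = 0")
      case False
      have "ln (cmod (\<Phi> (exp (Complex (-2) \<beta>)))) \<le> - (2 * g)" using \<Phi>(7) by simp
      then have "exp (ln (cmod (\<Phi> (exp (Complex (-2) \<beta>))))) \<le> exp (- (2 * g))" by (simp only: exp_le_cancel_iff)
      then show ?thesis using False by simp
    qed simp
    have "w / 32 ^ M * g / (2 * 8) \<le> step_law.stay_and_end \<nu> S T k (exp (Complex (-2) \<beta>))"
      using main[rule_format, OF sl h0 h(2) ST DS[folded D_def] _ _ kk _ \<Phi>(6) \<Phi>q, where w = "w / 32 ^ M" and ?k1.0 = k1] b2 k(2) k1 w by auto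
    then show "exp (- 32 / \<rho>\<^sup>2) / 10 / 32 ^ M * g / 16 \<le> step_law.stay_and_end \<nu> S T k (exp (Complex (-2) \<beta>))"
      by (simp add: w_def)
  qed
qed

section \<open>Sequences of independent steps\<close>

text \<open>The pathwise counterpart of \<open>stay_and_end\<close>, for a walk with given
  increments y.\<close>

definition walk_in :: "complex set \<Rightarrow> complex set \<Rightarrow> complex \<Rightarrow> (nat \<Rightarrow> complex) \<Rightarrow> nat \<Rightarrow> bool" where
  "walk_in S T z y k \<longleftrightarrow> (\<forall>j\<le>k. z + (\<Sum>i<j. y i) \<in> S) \<and> z + (\<Sum>i<k. y i) \<in> T"

lemma walk_in_0: "walk_in S T z y 0 \<longleftrightarrow> z \<in> S \<inter> T"
  by (auto simp: walk_in_def)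

lemma walk_in_Suc: "walk_in S T z y (Suc k) \<longleftrightarrow> z \<in> S \<and> walk_in S T (z + y 0) (\<lambda>i. y (Suc i)) k"
proof -
  have *: "z + (\<Sum>i<Suc j. y i) = z + y 0 + (\<Sum>i<j. y (Suc i))" for j
    by (simp only: sum.lessThan_Suc_shift add.assoc)
  have "(\<forall>j\<le>Suc k. z + (\<Sum>i<j. y i) \<in> S) \<longleftrightarrow> z \<in> S \<and> (\<forall>j\<le>k. z + (\<Sum>i<Suc j. y i) \<in> S)"
    by (metis Suc_le_mono add.right_neutral bot_nat_0.extremum lessThan_0 not0_implies_Suc sum.empty)
  then show ?thesis unfolding walk_in_def * by auto
qed

definition depends_on :: "nat set \<Rightarrow> ((nat \<Rightarrow> complex) \<Rightarrow> bool) \<Rightarrow> bool" where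
  "depends_on I P \<longleftrightarrow> (\<forall>x y. (\<forall>i\<in>I. x i = y i) \<longrightarrow> P x = P y)"

lemma depends_onD: "depends_on I P \<Longrightarrow> (\<And>i. i \<in> I \<Longrightarrow> x i = y i) \<Longrightarrow> P x = P y"
  by (auto simp: depends_on_def)

lemma depends_on_conj: "depends_on I P \<Longrightarrow> depends_on I Q \<Longrightarrow> depends_on I (\<lambda>x. P x \<and> Q x)"
  unfolding depends_on_def by metis

lemma depends_on_mono: "depends_on I P \<Longrightarrow> I \<subseteq> J \<Longrightarrow> depends_on J P"
  unfolding depends_on_def by blast

abbreviation seqM :: "(nat \<Rightarrow> complex) measure" where "seqM \<equiv> PiM UNIV (\<lambda>_. borel)"

lemma walk_in_measurable [measurable]:
  assumes [measurable]: "S \<in> sets borel" "T \<in> sets borel"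
    and [measurable]: "\<And>i. (\<lambda>x. y x i) \<in> borel_measurable N"
  shows "Measurable.pred N (\<lambda>x. walk_in S T z (y x) k)"
  unfolding walk_in_def by measurable

context step_law
begin

abbreviation "\<Omega> \<equiv> PiM (UNIV :: nat set) (\<lambda>_. \<nu>)"

sublocale seq: sequence_space \<nu> ..

lemma sets_\<Omega>: "sets \<Omega> = sets seqM"
  by (intro sets_PiM_cong) auto

lemma measurable_\<Omega> [simp]: "measurable \<Omega> N = measurable seqM N" "measurable N \<Omega> = measurable N seqM"
  by (auto intro!: measurable_cong_sets sets_\<Omega>)

lemma space_\<Omega> [simp]: "space \<Omega> = UNIV"
  by (auto simp: space_PiM)

lemma pred_sets_\<Omega>: "Measurable.pred seqM P \<Longrightarrow> {x. P x} \<in> sets \<Omega>"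
  unfolding sets_\<Omega> by (simp add: pred_def space_PiM)

definition prS :: "((nat \<Rightarrow> complex) \<Rightarrow> bool) \<Rightarrow> real" where
  "prS P = measure \<Omega> {x. P x}"

lemma prS_reindex:
  assumes f: "inj f" and P [measurable]: "Measurable.pred seqM P"
  shows "prS (\<lambda>x. P (\<lambda>i. x (f i))) = prS P"
proof -
  have "distr \<Omega> \<Omega> (\<lambda>\<omega>. \<lambda>n\<in>UNIV. \<omega> (f n)) = \<Omega>"
    using distr_PiM_reindex[of UNIV "\<lambda>_. \<nu>" f UNIV] f prob_space_axioms by simp
  then have *: "distr \<Omega> \<Omega> (\<lambda>\<omega> n. \<omega> (f n)) = \<Omega>" by (simp add: restrict_UNIV)
  have "prS P = measure (distr \<Omega> \<Omega> (\<lambda>\<omega> n. \<omega> (f n))) {x. P x}" by (simp add: * prS_def)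
  also have "\<dots> = measure \<Omega> ((\<lambda>\<omega> n. \<omega> (f n)) -` {x. P x} \<inter> space \<Omega>)"
    by (rule measure_distr) (auto simp: pred_sets_\<Omega> intro!: measurable_PiM_single')
  finally show ?thesis by (simp add: prS_def vimage_def)
qed

text \<open>Taking the coordinates in I from one sequence and the others from an independent copy
  again gives an i.i.d. sequence. Predicates that depend on disjoint index sets thus become
  predicates of different factors of a product measure, which is how \<open>prS_indep\<close>
  obtains independence.\<close>

lemma mix_distr: "distr (\<Omega> \<Otimes>\<^sub>M \<Omega>) \<Omega> (\<lambda>(x, y) i. if i \<in> I then x i else y i) = \<Omega>" (is "?D = _")
proof (rule seq.PiM_eq)
  let ?f = "\<lambda>(x, y) i. if i \<in> I then x i else y i :: complex"
  have m: "?f \<in> measurable (\<Omega> \<Otimes>\<^sub>M \<Omega>) \<Omega>"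
    unfolding split_beta' by (simp, intro measurable_PiM_single') (auto simp: measurable_If)
  fix J E assume J: "finite J" "J \<subseteq> (UNIV::nat set)" "\<And>j. j \<in> J \<Longrightarrow> E j \<in> sets \<nu>"
  let ?X = "prod_emb UNIV (\<lambda>_. \<nu>) J (\<Pi>\<^sub>E j\<in>J. E j)"
  have "?f -` ?X \<inter> space (\<Omega> \<Otimes>\<^sub>M \<Omega>) =
     prod_emb UNIV (\<lambda>_. \<nu>) (J \<inter> I) (\<Pi>\<^sub>E j\<in>J \<inter> I. E j) \<times> prod_emb UNIV (\<lambda>_. \<nu>) (J - I) (\<Pi>\<^sub>E j\<in>J - I. E j)" (is "_ = ?E \<times> ?F")
    by (auto simp: space_pair_measure prod_emb_def PiE_iff split: if_splits)
  then have "emeasure ?D ?X = emeasure (\<Omega> \<Otimes>\<^sub>M \<Omega>) (?E \<times> ?F)"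
    using J by (subst emeasure_distr[OF m]) (auto intro!: sets_PiM_I)
  also have "\<dots> = emeasure \<Omega> ?E * emeasure \<Omega> ?F"
    using J by (intro seq.P.emeasure_pair_measure_Times) (auto intro!: sets_PiM_I)
  also have "emeasure \<Omega> ?E = (\<Prod>j\<in>J \<inter> I. emeasure \<nu> (E j))"
    using J by (intro seq.emeasure_PiM_emb) auto
  also have "emeasure \<Omega> ?F = (\<Prod>j\<in>J - I. emeasure \<nu> (E j))"
    using J by (intro seq.emeasure_PiM_emb) auto
  also have "(\<Prod>j\<in>J \<inter> I. emeasure \<nu> (E j)) * (\<Prod>j\<in>J - I. emeasure \<nu> (E j)) = (\<Prod>j\<in>J. emeasure \<nu> (E j))"
    using J by (metis Int_Diff_Un Int_Diff_disjoint finite_Diff finite_Int prod.union_disjoint)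
  finally show "emeasure ?D ?X = (\<Prod>j\<in>J. emeasure \<nu> (E j))" .
qed simp_all

lemma prS_indep:
  assumes P: "depends_on I P" "Measurable.pred seqM P" and Q: "depends_on J Q" "Measurable.pred seqM Q"
    and IJ: "I \<inter> J = {}"
  shows "prS (\<lambda>x. P x \<and> Q x) = prS P * prS Q"
proof -
  let ?f = "\<lambda>(x, y) i. if i \<in> I then x i else y i :: complex"
  have m: "?f \<in> measurable (\<Omega> \<Otimes>\<^sub>M \<Omega>) \<Omega>"
    unfolding split_beta' by (simp, intro measurable_PiM_single') (auto simp: measurable_If)
  have PQ: "Measurable.pred seqM (\<lambda>x. P x \<and> Q x)" using P(2) Q(2) by measurable
  have "prS (\<lambda>x. P x \<and> Q x) = measure (distr (\<Omega> \<Otimes>\<^sub>M \<Omega>) \<Omega> ?f) {x. P x \<and> Q x}"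
    by (simp add: prS_def mix_distr)
  also have "\<dots> = measure (\<Omega> \<Otimes>\<^sub>M \<Omega>) (?f -` {x. P x \<and> Q x} \<inter> space (\<Omega> \<Otimes>\<^sub>M \<Omega>))"
    by (rule measure_distr[OF m pred_sets_\<Omega>[OF PQ]])
  also have "?f -` {x. P x \<and> Q x} \<inter> space (\<Omega> \<Otimes>\<^sub>M \<Omega>) = {x. P x} \<times> {y. Q y}"
  proof -
    have "P (\<lambda>i. if i \<in> I then x i else y i) = P x" for x y by (rule depends_onD[OF P(1)]) auto
    moreover have "Q (\<lambda>i. if i \<in> I then x i else y i) = Q y" for x y by (rule depends_onD[OF Q(1)]) (use IJ in auto)
    ultimately show ?thesis by (auto simp: space_pair_measure)
  qed
  also have "measure (\<Omega> \<Otimes>\<^sub>M \<Omega>) ({x. P x} \<times> {y. Q y}) = prS P * prS Q"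
    unfolding prS_def measure_def
    using seq.P.emeasure_pair_measure_Times[OF pred_sets_\<Omega>[OF P(2)] pred_sets_\<Omega>[OF Q(2)]]
    by (simp add: enn2real_mult)
  finally show ?thesis .
qed

lemma prS_01: "0 \<le> prS P" "prS P \<le> 1"
  unfolding prS_def by auto

lemma prS_mono: "Measurable.pred seqM Q \<Longrightarrow> (\<And>x. P x \<Longrightarrow> Q x) \<Longrightarrow> prS P \<le> prS Q"
  unfolding prS_def by (intro seq.P.finite_measure_mono pred_sets_\<Omega>) auto

lemma step_law_scale: "step_law (distr \<nu> borel (\<lambda>u. of_real r * u)) (r\<^sup>2 * h)"
proof -
  interpret D: prob_space "distr \<nu> borel (\<lambda>u. of_real r * u :: complex)" by (rule prob_space_distr) simp
  show ?thesis
  proof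
    show "distr (distr \<nu> borel (\<lambda>u. of_real r * u)) borel (\<lambda>z. \<i> * z) = distr \<nu> borel (\<lambda>u. of_real r * u)"
    proof -
      have "distr (distr \<nu> borel (\<lambda>u. of_real r * u)) borel (\<lambda>z. \<i> * z) = distr \<nu> borel (\<lambda>u. of_real r * (\<i> * u))"
        by (subst distr_distr) (auto simp: o_def mult_ac)
      also have "\<dots> = distr (distr \<nu> borel (\<lambda>u. \<i> * u)) borel (\<lambda>u. of_real r * u)"
        by (subst distr_distr) (auto simp: o_def)
      finally show ?thesis by (simp add: rotation)
    qed
    have b2: "has_bochner_integral \<nu> (\<lambda>u. (cmod (of_real r * u))\<^sup>2) (2 * (r\<^sup>2 * h))"
      using has_bochner_integral_mult_right[OF second_moment, of "r\<^sup>2"] by (simp add: norm_mult power_mult_distrib mult_ac)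
    show "has_bochner_integral (distr \<nu> borel (\<lambda>u. of_real r * u)) (\<lambda>u. (cmod u)\<^sup>2) (2 * (r\<^sup>2 * h))"
      by (rule has_bochner_integral_distr) (use b2 in auto)
    have b4: "has_bochner_integral \<nu> (\<lambda>u. (cmod (of_real r * u))^4) (8 * (r\<^sup>2 * h)\<^sup>2)"
    proof -
      have "(cmod (of_real r * u))^4 = r^4 * (cmod u)^4" for u by (simp add: norm_mult power_mult_distrib)
      moreover have "8 * (r\<^sup>2 * h)\<^sup>2 = r^4 * (8 * h\<^sup>2)" by algebra
      ultimately show ?thesis using has_bochner_integral_mult_right[OF fourth_moment, of "r^4"] by (simp only: o_def)
    qed
    show "has_bochner_integral (distr \<nu> borel (\<lambda>u. of_real r * u)) (\<lambda>u. (cmod u)^4) (8 * (r\<^sup>2 * h)\<^sup>2)"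
      by (rule has_bochner_integral_distr) (use b4 in auto)
  qed (use h_nonneg in auto)
qed

text \<open>The first step is split off from the sequence by \<open>seq.PiM_iter\<close>, and
  conditioning on it reproduces the recursion of \<open>stay_and_end\<close>.\<close>

lemma walk_probability:
  assumes ST [measurable]: "S \<in> sets borel" "T \<in> sets borel"
  shows "prS (\<lambda>x. walk_in S T z (\<lambda>i. of_real r * x i) k) = step_law.stay_and_end (distr \<nu> borel (\<lambda>u. of_real r * u)) S T k z"
proof -
  interpret D: step_law "distr \<nu> borel (\<lambda>u. of_real r * u)" "r\<^sup>2 * h" by (rule step_law_scale)
  note v = D.stay_and_end_props[OF ST]
  show ?thesis
  proof (induction k arbitrary: z)
    case 0
    have "prS (\<lambda>x. z \<in> S \<inter> T) = indicator (S \<inter> T) z"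
      using seq.P.prob_space by (simp add: prS_def indicator_def)
    then show ?case by (simp add: walk_in_0 D.stay_and_end_0)
  next
    case (Suc k)
    show ?case
    proof (cases "z \<in> S")
      case False
      then show ?thesis by (simp add: walk_in_Suc D.stay_and_end_Suc prS_def)
    next
      case True
      let ?P = "\<lambda>x. walk_in S T z (\<lambda>i. of_real r * x i) (Suc k)"
      let ?c = "\<lambda>(s, \<omega>). case_nat s \<omega>"
      have mP: "Measurable.pred seqM ?P" by measurable
      have m: "?c \<in> measurable (\<nu> \<Otimes>\<^sub>M \<Omega>) \<Omega>" by simp
      have mD [measurable]: "D.stay_and_end S T k \<in> borel_measurable borel" using v by auto
      have iD: "integrable \<nu> (\<lambda>u. D.stay_and_end S T k (z + of_real r * u))"
        by (rule bounded_integrable[of _ 1]) (use v in auto)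
      have A: "?c -` {x. ?P x} \<inter> space (\<nu> \<Otimes>\<^sub>M \<Omega>) \<in> sets (\<nu> \<Otimes>\<^sub>M \<Omega>)"
        using measurable_sets[OF m pred_sets_\<Omega>[OF mP]] .
      have "emeasure \<Omega> {x. ?P x} = emeasure (distr (\<nu> \<Otimes>\<^sub>M \<Omega>) \<Omega> ?c) {x. ?P x}" by (simp add: seq.PiM_iter)
      also have "\<dots> = emeasure (\<nu> \<Otimes>\<^sub>M \<Omega>) (?c -` {x. ?P x} \<inter> space (\<nu> \<Otimes>\<^sub>M \<Omega>))"
        by (rule emeasure_distr[OF m pred_sets_\<Omega>[OF mP]])
      also have "\<dots> = (\<integral>\<^sup>+u. emeasure \<Omega> (Pair u -` (?c -` {x. ?P x} \<inter> space (\<nu> \<Otimes>\<^sub>M \<Omega>))) \<partial>\<nu>)"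
        by (rule seq.P.emeasure_pair_measure_alt[OF A])
      also have "\<dots> = (\<integral>\<^sup>+u. ennreal (D.stay_and_end S T k (z + of_real r * u)) \<partial>\<nu>)"
      proof (rule nn_integral_cong)
        fix u
        have "Pair u -` (?c -` {x. ?P x} \<inter> space (\<nu> \<Otimes>\<^sub>M \<Omega>)) = {x. walk_in S T (z + of_real r * u) (\<lambda>i. of_real r * x i) k}"
          using True by (auto simp: walk_in_Suc space_pair_measure)
        then show "emeasure \<Omega> (Pair u -` (?c -` {x. ?P x} \<inter> space (\<nu> \<Otimes>\<^sub>M \<Omega>))) = ennreal (D.stay_and_end S T k (z + of_real r * u))"
          using Suc.IH[of "z + of_real r * u"] by (simp add: prS_def seq.P.emeasure_eq_measure)
      qed
      also have "\<dots> = ennreal (\<integral>u. D.stay_and_end S T k (z + of_real r * u) \<partial>\<nu>)"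
        by (rule nn_integral_eq_integral[OF iD]) (use v in auto)
      finally have "prS ?P = (\<integral>u. D.stay_and_end S T k (z + of_real r * u) \<partial>\<nu>)"
        using v(2) by (simp add: prS_def measure_def)
      also have "\<dots> = D.stay_and_end S T (Suc k) z"
        using True by (simp add: D.stay_and_end_Suc integral_distr)
      finally show ?thesis .
    qed
  qed
qed

end

section \<open>The event of one level\<close>

text \<open>A closed version of \<open>spiral_strip\<close>, turned by \<beta> and continued up to
  log radius x1. Closedness is what allows membership to pass from grid times to all times.\<close>

definition shape :: "real \<Rightarrow> real \<Rightarrow> nat \<Rightarrow> nat set \<Rightarrow> real \<Rightarrow> real \<Rightarrow> real \<Rightarrow> complex set" where
  "shape s l n A b \<beta> x1 = exp ` {\<zeta>. -3 \<le> Re \<zeta> \<and> Re \<zeta> \<le> x1 \<and> \<bar>Im \<zeta> - \<beta> - zigzag s l (2 * n) A (Re \<zeta>)\<bar> \<le> b}"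

lemma compact_shape: "compact (shape s l n A b \<beta> x1)"
proof -
  define h where "h = (\<lambda>p. Complex (fst p) (\<beta> + zigzag s l (2 * n) A (fst p) + snd p))"
  have "{\<zeta>. -3 \<le> Re \<zeta> \<and> Re \<zeta> \<le> x1 \<and> \<bar>Im \<zeta> - \<beta> - zigzag s l (2 * n) A (Re \<zeta>)\<bar> \<le> b} = h ` ({-3..x1} \<times> {-b..b})"
  proof (intro equalityI subsetI)
    fix \<zeta> assume "\<zeta> \<in> {\<zeta>. -3 \<le> Re \<zeta> \<and> Re \<zeta> \<le> x1 \<and> \<bar>Im \<zeta> - \<beta> - zigzag s l (2 * n) A (Re \<zeta>)\<bar> \<le> b}"
    then show "\<zeta> \<in> h ` ({-3..x1} \<times> {-b..b})"
      by (intro image_eqI[of _ _ "(Re \<zeta>, Im \<zeta> - \<beta> - zigzag s l (2 * n) A (Re \<zeta>))"]) (auto simp: h_def complex_eq_iff)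
  qed (auto simp: h_def)
  moreover have "continuous_on ({-3..x1} \<times> {-b..b}) h" unfolding h_def Complex_eq
    by (intro continuous_intros continuous_on_compose2[OF continuous_zigzag]) auto
  ultimately have "compact {\<zeta>. -3 \<le> Re \<zeta> \<and> Re \<zeta> \<le> x1 \<and> \<bar>Im \<zeta> - \<beta> - zigzag s l (2 * n) A (Re \<zeta>)\<bar> \<le> b}"
    by (simp add: compact_continuous_image compact_Times)
  then show ?thesis unfolding shape_def by (intro compact_continuous_image continuous_intros)
qed

lemma closed_shape [simp]: "closed (shape s l n A b \<beta> x1)"
  by (rule compact_imp_closed[OF compact_shape])

lemma shape_borel [measurable, simp]: "shape s l n A b \<beta> x1 \<in> sets borel"
  by (simp add: borel_closed)

lemma shape_norm: "z \<in> shape s l n A b \<beta> x1 \<Longrightarrow> exp (-3) \<le> cmod z"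
  by (auto simp: shape_def)

lemma spiral_strip_subset_shape:
  "x \<le> x1 \<Longrightarrow> spiral_strip (\<lambda>x. \<beta> + zigzag s l (2 * n) A x) b (-3) x \<subseteq> shape s l n A b \<beta> x1"
  unfolding spiral_strip_def shape_def by (intro image_mono) (auto simp: diff_diff_eq)

text \<open>Beyond log radius 2 n l the balanced zigzag is 0, and on a disc whose radius is half the
  modulus of its centre the logarithm varies by less than 1 <= b.\<close>

lemma ball_subset_shape:
  assumes l: "l > 0" and A: "A \<subseteq> {..<2*n}" "card A = n" and b: "b \<ge> 1"
    and y: "exp (real (2*n) * l + 2) \<le> y" "y \<le> exp (x1 - 1)"
  shows "ball (of_real y * cis \<beta>) (y / 2) \<subseteq> shape s l n A b \<beta> x1"
proof
  fix z assume z: "z \<in> ball (of_real y * cis \<beta>) (y / 2)"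
  define c where "c = of_real y * cis \<beta>"
  have ypos: "y > 0" using y(1) less_le_trans[OF exp_gt_zero] by blast
  have c: "cmod c = y" "c \<noteq> 0" using ypos by (auto simp: c_def norm_mult)
  define w where "w = z / c - 1"
  have "cmod w = cmod (z - c) / y" using c by (simp add: w_def norm_divide[symmetric] diff_divide_distrib flip: c(1))
  also have "\<dots> < (y / 2) / y" using z ypos by (intro divide_strict_right_mono) (auto simp: c_def dist_norm norm_minus_commute)
  also have "\<dots> = 1/2" using ypos by simp
  finally have w: "cmod w < 1/2" .
  then have Lw: "cmod (Ln (1 + w)) < 1" using norm_Ln_le[of w] by simp
  have w1: "1 + w \<noteq> 0"
  proof
    assume "1 + w = 0"
    then have "w = - 1" by (simp add: eq_neg_iff_add_eq_0 add.commute)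
    then show False using w by simp
  qed
  define \<zeta> where "\<zeta> = Complex (ln y) \<beta> + Ln (1 + w)"
  have "exp \<zeta> = c * (1 + w)" using w1 ypos by (simp add: \<zeta>_def exp_add exp_eq_polar[of "Complex _ _"] c_def)
  also have "\<dots> = z" using c by (simp add: w_def)
  finally have ez: "exp \<zeta> = z" .
  have "ln (exp (real (2*n) * l + 2)) \<le> ln y" using y(1) ypos by (subst ln_le_cancel_iff) auto
  moreover have "ln y \<le> ln (exp (x1 - 1))" using y(2) ypos by (subst ln_le_cancel_iff) auto
  ultimately have ly: "real (2*n) * l + 2 \<le> ln y" "ln y \<le> x1 - 1" by (auto simp only: ln_exp)
  have re: "\<bar>Re \<zeta> - ln y\<bar> < 1" and im: "\<bar>Im \<zeta> - \<beta>\<bar> < 1"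
    using Lw abs_Re_le_cmod[of "Ln (1 + w)"] abs_Im_le_cmod[of "Ln (1 + w)"] by (auto simp: \<zeta>_def)
  have "0 \<le> real (2*n) * l" using l by simp
  then have "real (2*n) * l \<le> Re \<zeta>" "-3 \<le> Re \<zeta>" "Re \<zeta> \<le> x1"
    using re ly by linarith+
  moreover have "zigzag s l (2 * n) A (Re \<zeta>) = 0" by (rule zigzag_balanced[OF l A]) fact
  ultimately have "zigzag s l (2 * n) A (Re \<zeta>) = 0" "-3 \<le> Re \<zeta>" "Re \<zeta> \<le> x1" by auto
  then show "z \<in> shape s l n A b \<beta> x1" unfolding shape_def
    using im b ez by (intro image_eqI[where f = exp and x = \<zeta>]) auto
qed

section \<open>Disjointness of the events of different zigzags\<close>

lemma zigzag_first_difference: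
  assumes l: "l > 0" and j: "j < m" "j \<in> A \<longleftrightarrow> j \<notin> A'" "\<And>i. i < j \<Longrightarrow> i \<in> A \<longleftrightarrow> i \<in> A'"
  shows "\<bar>zigzag s l m A (real (Suc j) * l) - zigzag s l m A' (real (Suc j) * l)\<bar> = 2 * \<bar>s\<bar> * l"
proof -
  have "(\<Sum>i<j. if i \<in> A then s else - s) = (\<Sum>i<j. if i \<in> A' then s else - s)"
    using j(3) by (intro sum.cong) auto
  then have "zigzag s l m A (real (Suc j) * l) - zigzag s l m A' (real (Suc j) * l) = ((if j \<in> A then s else - s) - (if j \<in> A' then s else - s)) * l"
    using zigzag_grid[OF l, of "Suc j" m] j(1) by (simp add: algebra_simps)
  also have "\<bar>\<dots>\<bar> = 2 * \<bar>s\<bar> * l" using j(2) l by (cases "j \<in> A") (auto simp: abs_mult)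
  finally show ?thesis .
qed

text \<open>Just after their first different step the two zigzags are 2 s l apart. A walk with small
  steps that gets from radius 1 to radius exp (2 n l) has a position near the corresponding radius,
  where two strips of half-width b < s l around the zigzags cannot both contain it.\<close>

lemma no_common_walk:
  fixes p :: "nat \<Rightarrow> complex"
  assumes l: "l > 0" and s: "s \<ge> 0" and A: "A \<subseteq> {..<2*n}" and A': "A' \<subseteq> {..<2*n}" and ne: "A \<noteq> A'"
    and p: "\<And>i. i \<le> k \<Longrightarrow> p i \<in> shape s l n A b \<beta> x1 \<inter> shape s l n A' b \<beta> x1"
    and step: "\<And>i. i < k \<Longrightarrow> cmod (p (Suc i) - p i) \<le> \<kappa>"
    and start: "cmod (p 0) \<le> 1" and fin: "exp (real (2*n) * l) \<le> cmod (p k)"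
    and \<kappa>: "s * (\<kappa> * exp 3) + b < s * l" and w: "b + s * l + s * (\<kappa> * exp 3) < pi"
  shows False
proof -
  define j where "j = (LEAST j. j \<in> A \<longleftrightarrow> j \<notin> A')"
  from ne obtain j0 where "j0 \<in> A \<longleftrightarrow> j0 \<notin> A'" by blast
  then have j: "j \<in> A \<longleftrightarrow> j \<notin> A'" unfolding j_def by (rule LeastI)
  have jl: "i \<in> A \<longleftrightarrow> i \<in> A'" if "i < j" for i using not_less_Least[OF that[unfolded j_def]] by blast
  have jm: "j < 2*n" using j A A' by auto
  define X where "X = real (Suc j) * l"
  have X: "0 \<le> X" "X \<le> real (2*n) * l" using l jm by (auto simp: X_def intro!: mult_right_mono)
  define x where "x = (\<lambda>i. ln (cmod (p i)))"
  have pp: "cmod (p i) \<ge> exp (-3)" "cmod (p i) > 0" if "i \<le> k" for i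
    using shape_norm p[OF that] less_le_trans[OF exp_gt_zero] by blast+
  have xs: "x (Suc i) \<le> x i + \<kappa> * exp 3" if i: "i < k" for i
  proof -
    have "x (Suc i) - x i = ln (cmod (p (Suc i)) / cmod (p i))" using pp[of i] pp[of "Suc i"] i by (simp add: x_def ln_div)
    also have "\<dots> \<le> cmod (p (Suc i)) / cmod (p i) - 1" using pp[of i] pp[of "Suc i"] i by (intro ln_le_minus_one) auto
    also have "\<dots> = (cmod (p (Suc i)) - cmod (p i)) / cmod (p i)" using pp[of i] i by (simp add: diff_divide_distrib)
    also have "\<dots> \<le> \<kappa> / cmod (p i)" using norm_triangle_ineq2[of "p (Suc i)" "p i"] step[OF i] pp[of i] i by (intro divide_right_mono) auto
    also have "\<dots> \<le> \<kappa> / exp (-3)"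
    proof (rule divide_left_mono)
      show "0 \<le> \<kappa>" using step[OF i] norm_ge_zero order_trans by blast
    qed (use pp[of i] i in auto)
    also have "\<dots> = \<kappa> * exp 3" by (simp add: exp_minus field_simps)
    finally show ?thesis by simp
  qed
  have x0: "x 0 \<le> X" using start pp[of 0] X by (simp add: x_def order_trans[OF _ X(1)])
  have xk: "X \<le> x k"
  proof -
    have "ln (exp (real (2*n) * l)) \<le> x k" unfolding x_def using fin pp[of k] by (subst ln_le_cancel_iff) auto
    then show ?thesis using X by simp
  qed
  \<comment> \<open>The last position before log radius X is first attained or exceeded. A step
    raises the log radius by at most \<kappa> exp 3, because the shape has distance at least exp
    (-3) from the origin.\<close>
  have "\<exists>i\<le>k. X - \<kappa> * exp 3 \<le> x i \<and> x i \<le> X"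
  proof (cases "k = 0")
    case True
    then have "x 0 = X" using x0 xk by simp
    moreover have "0 \<le> \<kappa> \<or> \<kappa> < 0" by auto
    ultimately show ?thesis
    proof -
      show ?thesis
      proof (cases "0 \<le> \<kappa>")
        case True
        then show ?thesis using \<open>x 0 = X\<close> by (intro exI[of _ 0]) auto
      next
        \<comment> \<open>Without any step nothing forces \<kappa> >= 0; a negative \<kappa> is
          handled by x 0 <= 0 < X.\<close>
        case False
        have "x 0 \<le> 0" using start pp[of 0] by (simp add: x_def)
        moreover have "X > 0" using l by (simp add: X_def)
        ultimately show ?thesis using \<open>x 0 = X\<close> by simp
      qed
    qed
  next
    case False
    define i where "i = (LEAST i. X \<le> x i)"
    have i: "X \<le> x i" "i \<le> k" unfolding i_def using xk by (auto intro: LeastI Least_le)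
    have \<kappa>0: "0 \<le> \<kappa> * exp 3" using step[of 0] False norm_ge_zero order_trans by (metis exp_ge_zero mult_nonneg_nonneg neq0_conv)
    show ?thesis
    proof (cases i)
      case 0
      then have "x 0 = X" using x0 i by simp
      then show ?thesis using \<kappa>0 by (intro exI[of _ 0]) auto
    next
      case (Suc i')
      have "\<not> X \<le> x i'" using not_less_Least[of i' "\<lambda>i. X \<le> x i"] Suc by (simp add: i_def)
      then show ?thesis using xs[of i'] i Suc by (intro exI[of _ i']) auto
    qed
  qed
  then obtain i where i: "i \<le> k" "X - \<kappa> * exp 3 \<le> x i" "x i \<le> X" by blast
  obtain \<zeta> where \<zeta>: "p i = exp \<zeta>" "\<bar>Im \<zeta> - \<beta> - zigzag s l (2 * n) A (Re \<zeta>)\<bar> \<le> b" using p[OF i(1)] by (auto simp: shape_def)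
  obtain \<zeta>' where \<zeta>': "p i = exp \<zeta>'" "\<bar>Im \<zeta>' - \<beta> - zigzag s l (2 * n) A' (Re \<zeta>')\<bar> \<le> b" using p[OF i(1)] by (auto simp: shape_def)
  have re: "Re \<zeta> = x i" "Re \<zeta>' = x i" using \<zeta>(1) \<zeta>'(1) by (simp_all add: x_def) (metis ln_exp norm_exp_eq_Re)
  obtain N :: int where "\<zeta> = \<zeta>' + (of_int (2 * N) * pi) * \<i>" using \<zeta>(1) \<zeta>'(1) exp_eq by metis
  then have im: "Im \<zeta> = Im \<zeta>' + of_int (2 * N) * pi" by simp
  define \<Delta> where "\<Delta> = zigzag s l (2 * n) A (x i) - zigzag s l (2 * n) A' (x i)"
  have "\<bar>x i - X\<bar> \<le> \<kappa> * exp 3" using i by auto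
  then have sx: "s * \<bar>x i - X\<bar> \<le> s * (\<kappa> * exp 3)" using s by (rule mult_left_mono)
  have d: "\<bar>zigzag s l (2 * n) A X - zigzag s l (2 * n) A' X\<bar> = 2 * (s * l)"
    using zigzag_first_difference[OF l jm j jl, of s] s by (simp add: X_def)
  have e1: "\<bar>zigzag s l (2 * n) A (x i) - zigzag s l (2 * n) A X\<bar> \<le> s * (\<kappa> * exp 3)"
    using zigzag_lipschitz[OF l, of s "2*n" A "x i" X] s sx by simp
  have e2: "\<bar>zigzag s l (2 * n) A' (x i) - zigzag s l (2 * n) A' X\<bar> \<le> s * (\<kappa> * exp 3)"
    using zigzag_lipschitz[OF l, of s "2*n" A' "x i" X] s sx by simp
  have \<Delta>: "2 * (s * l) - 2 * (s * (\<kappa> * exp 3)) \<le> \<bar>\<Delta>\<bar>" "\<bar>\<Delta>\<bar> \<le> 2 * (s * l) + 2 * (s * (\<kappa> * exp 3))"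
    using d e1 e2 unfolding \<Delta>_def by linarith+
  have close: "\<bar>of_int (2 * N) * pi - \<Delta>\<bar> \<le> 2 * b" using \<zeta>(2) \<zeta>'(2) im unfolding re \<Delta>_def by linarith
  show False
  proof (cases "N = 0")
    case True
    then show False using close \<Delta>(1) \<kappa> by simp
  next
    \<comment> \<open>The two logarithms of the common point may differ by a multiple of 2 pi i, but
      the strips are too narrow to meet after a full turn.\<close>
    case False
    then have "1 \<le> \<bar>real_of_int N\<bar>" by linarith
    then have "1 * (2 * pi) \<le> \<bar>real_of_int N\<bar> * (2 * pi)" by (intro mult_right_mono) auto
    then have "2 * pi \<le> \<bar>of_int (2 * N) * pi\<bar>" by (simp add: abs_mult mult_ac)
    then show False using close \<Delta>(2) w by linarith
  qed
qed

text \<open>\<open>past_event\<close> reads the increments of the \<open>a\<close> cells before a given cell backwards,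
  \<open>future_event\<close> those of the cells after it forwards; a cell consists of \<open>L\<close> steps. The target
  \<open>sqrt N * exp (-2)\<close> is the starting point rescaled by one level. The bound \<open>\<kappa>\<close> on the steps keeps a walk from jumping
  between two zigzags, which makes the past events of different \<open>A\<close> disjoint.\<close>

definition past_event :: "real \<Rightarrow> real \<Rightarrow> nat \<Rightarrow> nat set \<Rightarrow> real \<Rightarrow> real \<Rightarrow> real \<Rightarrow> nat \<Rightarrow> nat \<Rightarrow> nat \<Rightarrow> (nat \<Rightarrow> complex) \<Rightarrow> bool" where
  "past_event s l n A b \<rho> \<kappa> N L a x \<longleftrightarrow>
     walk_in (shape s l n A b 0 (ln (real N) / 2 - 1)) (cball (of_real (sqrt N * exp (-2))) (\<rho> * sqrt N)) (of_real (exp (-2)))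
       (\<lambda>i. of_real (- 1 / sqrt L) * x (a * L - Suc i)) (a * L) \<and> (\<forall>i<a * L. cmod (x i) \<le> \<kappa> * sqrt L)"

definition future_event :: "real \<Rightarrow> real \<Rightarrow> nat \<Rightarrow> nat set \<Rightarrow> real \<Rightarrow> real \<Rightarrow> real \<Rightarrow> nat \<Rightarrow> nat \<Rightarrow> nat \<Rightarrow> (nat \<Rightarrow> complex) \<Rightarrow> bool" where
  "future_event s l n A b \<beta> \<rho> N L a x \<longleftrightarrow>
     walk_in (shape s l n A b \<beta> (ln (real N) / 2 - 1)) (cball (of_real (sqrt N * exp (-2)) * cis \<beta>) (\<rho> * sqrt N)) (of_real (exp (-2)) * cis \<beta>)
       (\<lambda>i. of_real (1 / sqrt L) * x ((a + 1) * L + i)) ((N - 1 - a) * L)"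

definition level_event :: "real \<Rightarrow> real \<Rightarrow> nat \<Rightarrow> real \<Rightarrow> real \<Rightarrow> real \<Rightarrow> real \<Rightarrow> nat \<Rightarrow> nat \<Rightarrow> nat \<Rightarrow> (nat \<Rightarrow> complex) \<Rightarrow> bool" where
  "level_event s l n b \<beta> \<rho> \<kappa> N L a x \<longleftrightarrow>
     (\<exists>A\<in>{A. A \<subseteq> {..<2*n} \<and> card A = n}. past_event s l n A b \<rho> \<kappa> N L a x \<and> future_event s l n A b \<beta> \<rho> N L a x)"

lemma walk_in_cong: "(\<And>i. i < k \<Longrightarrow> y i = y' i) \<Longrightarrow> walk_in S T z y k = walk_in S T z y' k"
proof -
  assume "\<And>i. i < k \<Longrightarrow> y i = y' i"
  then have "(\<Sum>i<j. y i) = (\<Sum>i<j. y' i)" if "j \<le> k" for j using that by (intro sum.cong) auto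
  then show ?thesis unfolding walk_in_def by simp
qed

lemma past_event_measurable [measurable]: "Measurable.pred seqM (past_event s l n A b \<rho> \<kappa> N L a)"
  unfolding past_event_def by measurable

lemma future_event_measurable [measurable]: "Measurable.pred seqM (future_event s l n A b \<beta> \<rho> N L a)"
  unfolding future_event_def by measurable

lemma level_event_measurable [measurable]: "Measurable.pred seqM (level_event s l n b \<beta> \<rho> \<kappa> N L a)"
proof -
  have "finite {A. A \<subseteq> {..<2*n} \<and> card A = n}" by simp
  then show ?thesis unfolding level_event_def[abs_def] by measurable
qed

lemma past_event_depends: "depends_on {..<a * L} (past_event s l n A b \<rho> \<kappa> N L a)"
proof (unfold depends_on_def, intro allI impI)
  fix x y :: "nat \<Rightarrow> complex" assume xy: "\<forall>i\<in>{..<a * L}. x i = y i"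
  have "walk_in S T z (\<lambda>i. of_real (- 1 / sqrt L) * x (a * L - Suc i)) (a * L) = walk_in S T z (\<lambda>i. of_real (- 1 / sqrt L) * y (a * L - Suc i)) (a * L)" for S T z
    by (rule walk_in_cong) (use xy in auto)
  then show "past_event s l n A b \<rho> \<kappa> N L a x = past_event s l n A b \<rho> \<kappa> N L a y" unfolding past_event_def using xy by auto
qed

lemma future_event_depends: "a < N \<Longrightarrow> depends_on {(a + 1) * L..<N * L} (future_event s l n A b \<beta> \<rho> N L a)"
proof (unfold depends_on_def, intro allI impI)
  fix x y :: "nat \<Rightarrow> complex" assume a: "a < N" and xy: "\<forall>i\<in>{(a + 1) * L..<N * L}. x i = y i"
  have "(a + 1) * L + (N - 1 - a) * L = ((a + 1) + (N - 1 - a)) * L" by (simp only: add_mult_distrib)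
  also have "(a + 1) + (N - 1 - a) = N" using a by simp
  finally have "(a + 1) * L + (N - 1 - a) * L = N * L" .
  then have "walk_in S T z (\<lambda>i. of_real (1 / sqrt L) * x ((a + 1) * L + i)) ((N - 1 - a) * L) = walk_in S T z (\<lambda>i. of_real (1 / sqrt L) * y ((a + 1) * L + i)) ((N - 1 - a) * L)" for S T z
    by (intro walk_in_cong) (use xy in auto)
  then show "future_event s l n A b \<beta> \<rho> N L a x = future_event s l n A b \<beta> \<rho> N L a y" unfolding future_event_def by simp
qed

text \<open>The increments of the cell a itself are left out: they stay free for the next level, and
  the independence of the levels of the tree rests on this gap.\<close>

lemma level_event_depends:
  assumes "a < N"
  shows "depends_on ({..<N * L} - {a * L..<(a + 1) * L}) (level_event s l n b \<beta> \<rho> \<kappa> N L a)"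
proof -
  have 1: "{..<a * L} \<subseteq> {..<N * L} - {a * L..<(a + 1) * L}" using assms by (auto intro: less_le_trans mult_le_mono1)
  have 2: "{(a + 1) * L..<N * L} \<subseteq> {..<N * L} - {a * L..<(a + 1) * L}" by auto
  let ?D = "{..<N * L} - {a * L..<(a + 1) * L}"
  show ?thesis
  proof (unfold depends_on_def, intro allI impI)
    fix x y :: "nat \<Rightarrow> complex" assume xy: "\<forall>i\<in>?D. x i = y i"
    have "past_event s l n A b \<rho> \<kappa> N L a x = past_event s l n A b \<rho> \<kappa> N L a y" for A
      by (rule depends_onD[OF depends_on_mono[OF past_event_depends 1]]) (use xy in blast)
    moreover have "future_event s l n A b \<beta> \<rho> N L a x = future_event s l n A b \<beta> \<rho> N L a y" for A
      by (rule depends_onD[OF depends_on_mono[OF future_event_depends[OF assms] 2]]) (use xy in blast)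
    ultimately show "level_event s l n b \<beta> \<rho> \<kappa> N L a x = level_event s l n b \<beta> \<rho> \<kappa> N L a y"
      unfolding level_event_def by simp
  qed
qed

text \<open>Provides the end condition of \<open>no_common_walk\<close>: the target disc around sqrt
  N exp (-2) lies beyond radius exp (2 n l), because \<rho> <= exp (-3) and exp 3 - exp 2 >=
  1.\<close>

lemma past_event_unique:
  assumes l: "l > 0" and s: "s > 0" and A: "A \<subseteq> {..<2*n}" "A' \<subseteq> {..<2*n}" "A \<noteq> A'"
    and \<kappa>: "s * (\<kappa> * exp 3) + b < s * l" and sl: "2 * (s * l) \<le> pi"
    and N: "exp (real (2*n) * l + 5) \<le> sqrt N" and \<rho>: "\<rho> \<le> exp (-3)" and L: "L > 0"
    and P: "past_event s l n A b \<rho> \<kappa> N L a x" "past_event s l n A' b \<rho> \<kappa> N L a x"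
  shows False
proof -
  define y where "y = (\<lambda>i. of_real (- 1 / sqrt L) * x (a * L - Suc i))"
  define p where "p = (\<lambda>j. of_real (exp (-2)) + (\<Sum>i<j. y i))"
  show False
  proof (rule no_common_walk[OF l less_imp_le[OF s] A, where p = p and k = "a * L"])
    show "p i \<in> shape s l n A b 0 (ln (real N) / 2 - 1) \<inter> shape s l n A' b 0 (ln (real N) / 2 - 1)" if "i \<le> a * L" for i
      using P that unfolding past_event_def walk_in_def p_def y_def by blast
    show "cmod (p (Suc i) - p i) \<le> \<kappa>" if "i < a * L" for i
    proof -
      have "cmod (x (a * L - Suc i)) \<le> \<kappa> * sqrt L" using P(1) that unfolding past_event_def by auto
      then have "cmod (y i) \<le> \<kappa>" using L by (simp add: y_def norm_mult norm_divide field_simps)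
      then show ?thesis by (simp add: p_def)
    qed
    show "cmod (p 0) \<le> 1" by (simp add: p_def)
    show "exp (real (2*n) * l) \<le> cmod (p (a * L))"
    proof -
      define c where "c = sqrt (real N) * exp (-2)"
      have "p (a * L) \<in> cball (of_real c) (\<rho> * sqrt N)"
        using P(1) unfolding past_event_def walk_in_def p_def y_def c_def by blast
      then have "cmod (of_real c - p (a * L)) \<le> \<rho> * sqrt N" by (simp add: dist_norm)
      moreover have "0 \<le> c" by (simp add: c_def)
      then have "cmod (of_real c) = c" by (simp only: norm_of_real abs_of_nonneg)
      ultimately have "c - \<rho> * sqrt N \<le> cmod (p (a * L))" using norm_triangle_ineq2[of "of_real c" "p (a * L)"] by linarith
      moreover have "\<rho> * sqrt N \<le> exp (-3) * sqrt N" using \<rho> by (intro mult_right_mono) auto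
      ultimately have 1: "sqrt N * (exp (-2) - exp (-3)) \<le> cmod (p (a * L))" by (simp add: c_def algebra_simps)
      have "exp (real (2*n) * l + 5) * (exp (-2) - exp (-3)) \<le> sqrt N * (exp (-2) - exp (-3))" using N by (intro mult_right_mono) auto
      moreover have "exp (real (2*n) * l + 5) * (exp (-2) - exp (-3)) = exp (real (2*n) * l) * (exp 3 - exp 2)"
      proof -
        have "exp (real (2*n) * l + 5) = exp (real (2*n) * l) * exp 5" by (rule exp_add)
        moreover have "exp 5 * exp (-2) = exp (3::real)" "exp 5 * exp (-3) = exp (2::real)" by (simp_all flip: exp_add)
        ultimately show ?thesis by (simp add: right_diff_distrib mult.assoc)
      qed
      moreover have "exp (real (2*n) * l) * 1 \<le> exp (real (2*n) * l) * (exp 3 - exp 2)"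
      proof (rule mult_left_mono)
        have "exp 3 = exp 1 * exp (2::real)" by (simp flip: exp_add)
        moreover have "2 * exp 2 \<le> exp 1 * exp (2::real)" using exp_ge_add_one_self[of 1] by (intro mult_right_mono) auto
        moreover have "1 \<le> exp (2::real)" by simp
        ultimately show "1 \<le> exp 3 - exp (2::real)" by linarith
      qed simp
      ultimately show ?thesis using 1 by linarith
    qed
    show "b + s * l + s * (\<kappa> * exp 3) < pi" using \<kappa> sl by linarith
  qed (use \<kappa> in auto)
qed

context step_law
begin

section \<open>Probability of the event of one level\<close>

lemma prS_component: "Measurable.pred borel Q \<Longrightarrow> prS (\<lambda>x. Q (x i)) = measure \<nu> {u. Q u}"
proof -
  assume Q: "Measurable.pred borel Q"
  then have Qs: "{u. Q u} \<in> sets \<nu>" by (simp add: pred_def)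
  have "measure \<nu> {u. Q u} = measure (distr \<Omega> \<nu> (\<lambda>x. x i)) {u. Q u}" using seq.PiM_component[of i] by simp
  also have "\<dots> = measure \<Omega> ((\<lambda>x. x i) -` {u. Q u} \<inter> space \<Omega>)" by (rule measure_distr[OF _ Qs]) measurable
  finally show ?thesis by (simp add: prS_def vimage_def)
qed

lemma prS_large_steps:
  assumes "\<kappa> > 0"
  shows "prS (\<lambda>x. \<exists>i<k. \<kappa> < cmod (x i)) \<le> real k * (8 * h\<^sup>2 / \<kappa>^4)"
proof -
  have "prS (\<lambda>x. \<exists>i<k. \<kappa> < cmod (x i)) = measure \<Omega> (\<Union>i\<in>{..<k}. {x. \<kappa> < cmod (x i)})"
    unfolding prS_def by (intro arg_cong[where f = "measure \<Omega>"]) auto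
  also have "\<dots> \<le> (\<Sum>i<k. measure \<Omega> {x. \<kappa> < cmod (x i)})"
    by (rule seq.P.finite_measure_subadditive_finite) (auto intro!: pred_sets_\<Omega>)
  also have "\<dots> \<le> (\<Sum>i<k. 8 * h\<^sup>2 / \<kappa>^4)"
  proof (rule sum_mono)
    fix i
    show "measure \<Omega> {x. \<kappa> < cmod (x i)} \<le> 8 * h\<^sup>2 / \<kappa>^4"
      using tail_bound[OF assms] prS_component[of "\<lambda>u. \<kappa> < cmod u" i] by (simp add: prS_def)
  qed
  finally show ?thesis by simp
qed

end

text \<open>The events of different A are disjoint, so their probabilities add up to the binomial
  coefficient times the bound for one of them. Past and future of a cell use different increments
  and multiply; the bound on the steps costs the past at most half of \<psi>, by a fourth moment
  union bound. The reversed past has steps scaled by -1 / sqrt L, which is harmless since only the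
  square of the factor enters the step law.\<close>

lemma level_event_prob:
  fixes \<nu> :: "complex measure"
  assumes "step_law \<nu> 1"
    and l: "l > 0" and s: "s > 0"
    and \<kappa>: "s * (\<kappa> * exp 3) + b < s * l" "\<kappa> > 0" and sl: "2 * (s * l) \<le> pi"
    and N: "exp (real (2*n) * l + 5) \<le> sqrt N" and \<rho>: "\<rho> \<le> exp (-3)" and L: "L > 0" and a: "a < N"
    and \<psi>: "0 \<le> \<psi>" "8 * real a / (real L * \<kappa>^4) \<le> \<psi> / 2"
    and low: "\<And>A \<beta>' k \<nu>. A \<subseteq> {..<2*n} \<Longrightarrow> card A = n \<Longrightarrow> \<beta>' \<in> {0, \<beta>} \<Longrightarrow> k \<in> {a, N - 1 - a} \<Longrightarrow> step_law \<nu> (1 / real L) \<Longrightarrow>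
       \<psi> \<le> step_law.stay_and_end \<nu> (shape s l n A b \<beta>' (ln (real N) / 2 - 1)) (cball (of_real (sqrt N * exp (-2)) * cis \<beta>') (\<rho> * sqrt N))
              (k * L) (of_real (exp (-2)) * cis \<beta>')"
  shows "real ((2 * n) choose n) * \<psi>\<^sup>2 / 2 \<le> step_law.prS \<nu> (level_event s l n b \<beta> \<rho> \<kappa> N L a)"
proof -
  interpret step_law \<nu> 1 by fact
  let ?S = "{A. A \<subseteq> {..<2*n} \<and> card A = n}"
  have r2: "(- 1 / sqrt L)\<^sup>2 * 1 = 1 / real L" "(1 / sqrt L)\<^sup>2 * 1 = 1 / real L" using L by (simp_all add: power_divide)
  have past: "\<psi> / 2 \<le> prS (past_event s l n A b \<rho> \<kappa> N L a)" if A: "A \<in> ?S" for A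
  proof -
    define S T z where "S = shape s l n A b 0 (ln (real N) / 2 - 1)" and "T = cball (of_real (sqrt N * exp (-2)) :: complex) (\<rho> * sqrt N)"
      and "z = (of_real (exp (-2)) :: complex)"
    have ST [measurable]: "S \<in> sets borel" "T \<in> sets borel" by (simp_all add: S_def T_def)
    let ?W = "\<lambda>x. walk_in S T z (\<lambda>i. of_real (- 1 / sqrt L) * x i) (a * L)"
    let ?V = "\<lambda>x. walk_in S T z (\<lambda>i. of_real (- 1 / sqrt L) * x (a * L - Suc i)) (a * L)"
    \<comment> \<open>Reverses the first a L indices and fixes all others: an injection of the
      indices, so the reversed increments have the same law.\<close>
    define f where "f = (\<lambda>i. if i < a * L then a * L - Suc i else i)"
    have "inj f" by (rule injI) (auto simp: f_def split: if_splits)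
    have "?V x = ?W (\<lambda>i. x (f i))" for x by (rule walk_in_cong) (simp add: f_def)
    then have "prS ?V = prS ?W" using prS_reindex[OF \<open>inj f\<close>, of ?W] by simp
    also have "\<dots> = step_law.stay_and_end (distr \<nu> borel (\<lambda>u. of_real (- 1 / sqrt L) * u)) S T (a * L) z"
      by (rule walk_probability[OF ST])
    also have "\<dots> \<ge> \<psi>"
      using low[of A 0 a "distr \<nu> borel (\<lambda>u. of_real (- 1 / sqrt L) * u)"] A step_law_scale[of "- 1 / sqrt L"] unfolding r2
      by (simp add: S_def T_def z_def)
    finally have V: "\<psi> \<le> prS ?V" .
    have B: "prS (\<lambda>x. \<exists>i<a * L. \<kappa> * sqrt L < cmod (x i)) \<le> \<psi> / 2"
    proof -
      have "prS (\<lambda>x. \<exists>i<a * L. \<kappa> * sqrt L < cmod (x i)) \<le> real (a * L) * (8 * 1\<^sup>2 / (\<kappa> * sqrt L)^4)"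
        by (rule prS_large_steps) (use \<kappa> L in auto)
      also have "(\<kappa> * sqrt L)^4 = \<kappa>^4 * (real L)\<^sup>2" 
      proof -
        have "(sqrt L)^4 = ((sqrt L)\<^sup>2)\<^sup>2" by (simp only: power_mult[symmetric]) simp
        then show ?thesis by (simp add: power_mult_distrib)
      qed
      also have "real (a * L) * (8 * 1\<^sup>2 / (\<kappa>^4 * (real L)\<^sup>2)) = 8 * real a / (real L * \<kappa>^4)" using L by (simp add: power2_eq_square mult.commute)
      finally show ?thesis using \<psi>(2) by linarith
    qed
    have "prS ?V \<le> prS (\<lambda>x. past_event s l n A b \<rho> \<kappa> N L a x \<or> (\<exists>i<a * L. \<kappa> * sqrt L < cmod (x i)))"
      by (rule prS_mono) (measurable, auto simp: past_event_def S_def T_def z_def not_le)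
    also have "\<dots> \<le> prS (past_event s l n A b \<rho> \<kappa> N L a) + prS (\<lambda>x. \<exists>i<a * L. \<kappa> * sqrt L < cmod (x i))"
      proof -
      have "Measurable.pred seqM (\<lambda>x. \<exists>i<a * L. \<kappa> * sqrt L < cmod (x i))" by measurable
      then show ?thesis unfolding prS_def Collect_disj_eq
        by (intro measure_Un_le pred_sets_\<Omega> past_event_measurable)
    qed
    finally show ?thesis using V B by linarith
  qed
  have fut: "\<psi> \<le> prS (future_event s l n A b \<beta> \<rho> N L a)" if A: "A \<in> ?S" for A
  proof -
    define S T z where "S = shape s l n A b \<beta> (ln (real N) / 2 - 1)" and "T = cball (of_real (sqrt N * exp (-2)) * cis \<beta>) (\<rho> * sqrt N)"
      and "z = of_real (exp (-2)) * cis \<beta>"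
    have ST [measurable]: "S \<in> sets borel" "T \<in> sets borel" by (simp_all add: S_def T_def)
    let ?W = "\<lambda>x. walk_in S T z (\<lambda>i. of_real (1 / sqrt L) * x i) ((N - 1 - a) * L)"
    have "inj (\<lambda>i. (a + 1) * L + i)" by (simp add: inj_def)
    from prS_reindex[OF this, of ?W]
    have "prS (future_event s l n A b \<beta> \<rho> N L a) = prS ?W"
      unfolding future_event_def[abs_def] by (simp add: S_def T_def z_def)
    also have "\<dots> = step_law.stay_and_end (distr \<nu> borel (\<lambda>u. of_real (1 / sqrt L) * u)) S T ((N - 1 - a) * L) z"
      by (rule walk_probability[OF ST])
    also have "\<dots> \<ge> \<psi>"
      using low[of A \<beta> "N - 1 - a" "distr \<nu> borel (\<lambda>u. of_real (1 / sqrt L) * u)"] A step_law_scale[of "1 / sqrt L"] unfolding r2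
      by (simp add: S_def T_def z_def)
    finally show ?thesis .
  qed
  let ?E = "\<lambda>A. {x. past_event s l n A b \<rho> \<kappa> N L a x \<and> future_event s l n A b \<beta> \<rho> N L a x}"
  have disj: "disjoint_family_on ?E ?S"
    unfolding disjoint_family_on_def using past_event_unique[OF l s _ _ _ \<kappa>(1) sl N \<rho> L] by blast
  have "prS (level_event s l n b \<beta> \<rho> \<kappa> N L a) = measure \<Omega> (\<Union>A\<in>?S. ?E A)"
    unfolding prS_def level_event_def[abs_def] by (intro arg_cong[where f = "measure \<Omega>"]) auto
  also have "\<dots> = (\<Sum>A\<in>?S. measure \<Omega> (?E A))"
    by (rule seq.P.finite_measure_finite_Union) (use disj in \<open>auto intro!: pred_sets_\<Omega>\<close>)
  also have "\<dots> \<ge> (\<Sum>A\<in>?S. \<psi> / 2 * \<psi>)"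
  proof (rule sum_mono)
    fix A assume A: "A \<in> ?S"
    have "measure \<Omega> (?E A) = prS (past_event s l n A b \<rho> \<kappa> N L a) * prS (future_event s l n A b \<beta> \<rho> N L a)"
      unfolding prS_def[symmetric]
      by (rule prS_indep[OF past_event_depends _ future_event_depends[OF a]]) auto
    also have "\<dots> \<ge> \<psi> / 2 * \<psi>" using past[OF A] fut[OF A] \<psi>(1) by (intro mult_mono) (auto simp: prS_01)
    finally show "\<psi> / 2 * \<psi> \<le> measure \<Omega> (?E A)" .
  qed
  finally have "real (card ?S) * (\<psi> / 2 * \<psi>) \<le> prS (level_event s l n b \<beta> \<rho> \<kappa> N L a)" by simp
  moreover have "card ?S = (2 * n) choose n" using n_subsets[of "{..<2*n}" n] by simp
  ultimately show ?thesis by (simp add: power2_eq_square)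
qed

section \<open>Choice of the parameters\<close>

text \<open>\<open>N\<close> is the number of cells per level, \<open>H\<close> the number of steps
  in a cell of the finest level, and \<open>\<A>\<close> the set of cells that may be selected, away
  from both ends. The third condition on \<rho> leaves room in the strips for recentring them at the
  limit point. The mean is required for all L >= H with the same constants because L changes from
  level to level.\<close>

locale pivot_parameters =
  fixes \<alpha> s l b \<rho> \<kappa> :: real and n N H :: nat and \<A> :: "nat set"
  assumes \<alpha>: "0 \<le> \<alpha>" and s: "s > 0" and l: "l > 0" and sl: "s * l = (pi - \<alpha> / 2) / 2"
    and \<rho>: "\<rho> > 0" "\<rho> \<le> exp (-3) / 8" "b + (1 + s) * (4 * exp 3 * \<rho>) < s * l"
    and N: "exp (real (2*n) * l + 5) \<le> sqrt N"
    and H: "H > 0"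
    and \<A>: "\<A> \<subseteq> {1..<N - 1}" "finite \<A>"
    and mean: "\<And>\<nu> L. step_law \<nu> 1 \<Longrightarrow> H \<le> L \<Longrightarrow>
      2 \<le> (\<Sum>a\<in>\<A>. step_law.prS \<nu> (level_event s l n b (pi + \<alpha> / 2) \<rho> \<kappa> N L a))"

text \<open>The walk needs a time of order exp (2 X) ln (1 / g), where ln (1 / g) is linear in n; so
  N / exp (2 X) is taken of order n, and the number of hops is of order sqrt n. Hence the hops fit
  into the time, and their cost, a power of 32, cannot spoil the exponential gain with rate
  \<epsilon>.\<close>

lemma eventually_parameters:
  fixes c \<epsilon> C D q :: real
  assumes "c > 0" "\<epsilon> > 0" "C > 0"
  shows "eventually (\<lambda>n::nat. q \<le> c * n \<and> D + 194 * sqrt (3 * c * n + 3) \<le> n \<and> 1 \<le> C * exp (\<epsilon> * n - 2 * ln 32 * (sqrt (3 * c * n + 3) + 2))) at_top"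
proof (intro eventually_conj)
  show "eventually (\<lambda>n::nat. q \<le> c * n) at_top" using assms by real_asymp
  show "eventually (\<lambda>n::nat. D + 194 * sqrt (3 * c * n + 3) \<le> n) at_top" using assms by real_asymp
  have "ln (32::real) > 0" by simp
  then show "eventually (\<lambda>n::nat. 1 \<le> C * exp (\<epsilon> * n - 2 * ln 32 * (sqrt (3 * c * n + 3) + 2))) at_top"
    using assms by real_asymp
qed


lemma finite_common_bound:
  fixes P :: "'a \<Rightarrow> real \<Rightarrow> bool"
  assumes "finite F" and "\<And>i. i \<in> F \<Longrightarrow> \<exists>h0>0. \<forall>h. 0 < h \<longrightarrow> h \<le> h0 \<longrightarrow> P i h"
  shows "\<exists>h0>0. \<forall>i\<in>F. \<forall>h. 0 < h \<longrightarrow> h \<le> h0 \<longrightarrow> P i h"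
  using assms
proof (induction F rule: finite_induct)
  case empty
  show ?case by (intro exI[of _ 1]) auto
next
  case (insert i F)
  obtain h1 where h1: "h1 > 0" "\<forall>j\<in>F. \<forall>h. 0 < h \<longrightarrow> h \<le> h1 \<longrightarrow> P j h" using insert by auto
  obtain h2 where h2: "h2 > 0" "\<forall>h. 0 < h \<longrightarrow> h \<le> h2 \<longrightarrow> P i h" using insert.prems by auto
  show ?case by (intro exI[of _ "min h1 h2"]) (use h1 h2 in auto)
qed

theorem pivot_parameters_exist:
  assumes \<alpha>: "0 \<le> \<alpha>" "\<alpha> < (ln 2)\<^sup>2 / (2 * pi)"
  shows "\<exists>s l b \<rho> \<kappa> n N H \<A>. pivot_parameters \<alpha> s l b \<rho> \<kappa> n N H \<A>"
proof -
  define T where "T = (ln 2)\<^sup>2 / (2 * pi :: real)"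
  define d where "d = (pi - \<alpha> / 2) / 2"
  have ln2: "0 < ln (2::real)" "ln (2::real) \<le> 25/36" using ln2_le_25_over_36 by auto
  have T: "T \<le> 1/12"
  proof -
    have "(ln 2)\<^sup>2 \<le> (25/36::real)\<^sup>2" using ln2 by (intro power_mono) auto
    also have "\<dots> \<le> 1/2" by (simp add: power2_eq_square)
    finally have "T \<le> (1/2) / (2 * pi)" unfolding T_def by (intro divide_right_mono) auto
    also have "\<dots> \<le> (1/2) / (2 * 3)" using pi_gt3 by (intro divide_left_mono) auto
    finally show ?thesis by simp
  qed
  have d: "d > 1" "2 * d \<le> pi" "4 * d = 2 * pi - \<alpha>"
  proof -
    have "\<alpha> < 1/12" using \<alpha>(2) T unfolding T_def by linarith
    then show "d > 1" using pi_gt3 \<alpha>(1) by (simp add: d_def field_simps)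
    show "2 * d \<le> pi" using \<alpha>(1) by (simp add: d_def field_simps)
    show "4 * d = 2 * pi - \<alpha>" by (simp add: d_def field_simps)
  qed
  define s where "s = ln 2 / (2 * pi :: real)"
  define l where "l = d / s"
  have s: "s > 0" using ln2 by (simp add: s_def)
  have l: "l > 0" using s d by (simp add: l_def)
  have sl: "s * l = d" using s by (simp add: l_def)
  define Q where "Q = 2 * ln 2 + 4 * l"
  have Q: "Q > 0" unfolding Q_def by (intro add_pos_pos mult_pos_pos ln2 l) simp_all
  \<comment> \<open>The critical half-width: a > a0 is the balance in favour of existence.\<close>
  define a0 where "a0 = 2 * pi * l * (1 + s\<^sup>2) / Q"
  have a0: "a0 < d"
  proof -
    \<comment> \<open>The choice of s enters here: both expressions equal T, so that the inequality
      below reduces to \<alpha> < T.\<close>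
    have "2 * pi * s\<^sup>2 = T" "s * ln 2 = T" by (simp_all add: s_def T_def power2_eq_square)
    then have "2 * pi * (1 + s\<^sup>2) < 2 * s * ln 2 + 4 * d" using \<alpha>(2) d(3) by (simp add: T_def[symmetric] distrib_left)
    then have "l * (2 * pi * (1 + s\<^sup>2)) < l * (2 * s * ln 2 + 4 * d)" using l by (rule mult_strict_left_mono)
    also have "\<dots> = d * Q" using sl by (simp add: Q_def algebra_simps)
    finally show ?thesis using Q by (simp add: a0_def pos_divide_less_eq mult_ac)
  qed
  define a where "a = (max a0 1 + d) / 2"
  have a: "a0 < a" "1 < a" "a < d" using a0 d by (auto simp: a_def)
  define b where "b = (a + d) / 2"
  have b: "a < b" "b < d" "1 \<le> b" "b \<le> pi" using a d by (auto simp: b_def)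
  define P where "P = pi / (2 * a) * (1 + s\<^sup>2)"
  have P: "P > 0" using a by (simp add: P_def add_pos_nonneg)
  \<comment> \<open>The exponential rate in n of the mean offspring: 2 ln 2 counts the zigzags, 4 l
    the cells, and 4 P l is the cost of the two halves.\<close>
  define \<epsilon> where "\<epsilon> = 2 * ln 2 + 4 * l - 4 * P * l"
  have \<epsilon>: "\<epsilon> > 0"
  proof -
    have "a0 * Q < a * Q" using a Q by (intro mult_strict_right_mono) auto
    then have "2 * pi * l * (1 + s\<^sup>2) < a * Q" using Q by (simp add: a0_def)
    then have "2 * pi * l * (1 + s\<^sup>2) / a < Q" using a by (simp add: pos_divide_less_eq mult.commute)
    moreover have "2 * pi * l * (1 + s\<^sup>2) / a = 4 * P * l" using a by (simp add: P_def)
    ultimately show ?thesis by (simp add: \<epsilon>_def Q_def)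
  qed
  define K where "K = (16 * a + 12) / min (1/4) ((b - a) / (1 + \<bar>s\<bar>)) + 1"
  have K: "K > 0"
  proof -
    have "0 \<le> (16 * a + 12) / min (1/4) ((b - a) / (1 + \<bar>s\<bar>))" using a b by (intro divide_nonneg_nonneg) auto
    then show ?thesis unfolding K_def by simp
  qed
  define \<rho> where "\<rho> = min (exp (-3) / 8) ((d - b) / (8 * (1 + s) * exp 3))"
  have \<rho>: "\<rho> > 0" "\<rho> \<le> exp (-3) / 8" "b + (1 + s) * (4 * exp 3 * \<rho>) < d"
  proof -
    show "\<rho> > 0" using b s by (simp add: \<rho>_def)
    show "\<rho> \<le> exp (-3) / 8" unfolding \<rho>_def by (rule min.cobounded1)
    have "\<rho> \<le> (d - b) / (8 * (1 + s) * exp 3)" unfolding \<rho>_def by (rule min.cobounded2)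
    then have "\<rho> * (8 * (1 + s) * exp 3) \<le> d - b" using s by (simp add: pos_le_divide_eq)
    moreover have "\<rho> * (8 * (1 + s) * exp 3) = 2 * ((1 + s) * (4 * exp 3 * \<rho>))" by (simp add: algebra_simps)
    ultimately have "2 * ((1 + s) * (4 * exp 3 * \<rho>)) \<le> d - b" by (simp only:)
    then show "b + (1 + s) * (4 * exp 3 * \<rho>) < d" using b by linarith
  qed
  define \<kappa> where "\<kappa> = (d - b) / (2 * s * exp 3)"
  have \<kappa>: "\<kappa> > 0" "s * (\<kappa> * exp 3) + b < s * l"
  proof -
    show "\<kappa> > 0" using b s by (simp add: \<kappa>_def)
    have "2 * (s * (\<kappa> * exp 3)) = d - b" using s by (simp add: \<kappa>_def)
    then show "s * (\<kappa> * exp 3) + b < s * l" unfolding sl using b by linarith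
  qed
  define w0 where "w0 = exp (- 32 / \<rho>\<^sup>2) / 10"
  have w0: "w0 > 0" by (simp add: w0_def)
  \<comment> \<open>The time for the zigzag part grows, in units of exp (2 X), with rate c - 1 in n;
    the additional 1 makes room for the hops and the lower order terms.\<close>
  define c where "c = 24 * exp 6 * (2 * P * l) + 1"
  have c: "c > 0" using P l by (simp add: c_def add_pos_pos)
  \<comment> \<open>8192 = 2 * 4 * 1024: the 2 is the required mean, the 4 comes from 4^n / (2 n)
    and the half in \<open>level_event_prob\<close>, and 1024 = 16^2 * 4 comes from the square of
    \<psi>.\<close>
  define C where "C = c * w0\<^sup>2 * exp (- 2 * K) / 8192"
  have C: "C > 0" using c w0 by (simp add: C_def)
  define D where "D = 24 * exp 6 * (ln 192 + K) + 390"
  obtain n0 where n0: "\<And>n. n \<ge> n0 \<Longrightarrow> exp 10 + 1 / (16 * \<rho>\<^sup>2) \<le> c * real n \<and> D + 194 * sqrt (3 * c * real n + 3) \<le> real n \<and> 1 \<le> C * exp (\<epsilon> * real n - 2 * ln 32 * (sqrt (3 * c * real n + 3) + 2))"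
    using eventually_parameters[OF c \<epsilon> C, of "exp 10 + 1 / (16 * \<rho>\<^sup>2)" D] unfolding eventually_at_top_linorder by blast
  define n where "n = Suc n0"
  have n: "n > 0" and n1: "exp 10 + 1 / (16 * \<rho>\<^sup>2) \<le> c * n" and n2: "D + 194 * sqrt (3 * c * n + 3) \<le> n"
    and n3: "1 \<le> C * exp (\<epsilon> * n - 2 * ln 32 * (sqrt (3 * c * n + 3) + 2))"
    using n0[of n] by (auto simp: n_def)
  define X where "X = real (2*n) * l"
  have X: "X \<ge> 0" using l by (simp add: X_def)
  define E where "E = exp X"
  have E: "E \<ge> 1" using X by (simp add: E_def)
  define N' where "N' = nat \<lceil>E\<^sup>2 * (c * n)\<rceil>"
  define N where "N = 3 * N'"
  have N': "E\<^sup>2 * (c * n) \<le> real N'" "real N' \<le> E\<^sup>2 * (c * n) + 1"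
    using c by (auto simp: N'_def of_nat_ceiling)
  have E2: "E\<^sup>2 \<ge> 1" using E by simp
  have NN: "E\<^sup>2 * (c * n) \<le> real N" "real N \<le> E\<^sup>2 * (3 * c * n + 3)"
    using N' E2 by (auto simp: N_def algebra_simps)
  have sN1: "E * sqrt (c * n) \<le> sqrt N"
  proof -
    have "sqrt (E\<^sup>2 * (c * n)) \<le> sqrt N" using NN by simp
    then show ?thesis using E by (simp add: real_sqrt_mult)
  qed
  have sN2: "sqrt N \<le> E * sqrt (3 * c * n + 3)"
  proof -
    have "sqrt N \<le> sqrt (E\<^sup>2 * (3 * c * n + 3))" using NN by simp
    then show ?thesis using E by (simp add: real_sqrt_mult)
  qed
  have cond1: "exp (X + 5) \<le> sqrt N"
  proof -
    have "(exp 5)\<^sup>2 = exp (10::real)" by (simp flip: exp_double)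
    then have "(exp 5)\<^sup>2 \<le> c * n" using n1 by (simp add: add_increasing2 order_trans[OF _ n1])
    then have "exp 5 \<le> sqrt (c * n)" by (rule real_le_rsqrt)
    then have "E * exp 5 \<le> E * sqrt (c * n)" using E by (intro mult_left_mono) auto
    moreover have "exp (X + 5) = E * exp 5" by (simp add: E_def exp_add)
    ultimately show ?thesis using sN1 by linarith
  qed
  have cond2: "exp X / 4 \<le> \<rho> * sqrt N"
  proof -
    have "(1 / (4 * \<rho>))\<^sup>2 = 1 / (16 * \<rho>\<^sup>2)" by (simp add: power_divide power_mult_distrib)
    then have "(1 / (4 * \<rho>))\<^sup>2 \<le> c * n" using n1 exp_gt_zero[of "10::real"] by linarith
    then have "1 / (4 * \<rho>) \<le> sqrt (c * n)" by (rule real_le_rsqrt)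
    then have "E * (1 / (4 * \<rho>)) \<le> E * sqrt (c * n)" using E by (intro mult_left_mono) auto
    then have "\<rho> * (E * (1 / (4 * \<rho>))) \<le> \<rho> * sqrt N" using sN1 \<rho>(1) by (intro mult_left_mono) auto
    then show ?thesis using \<rho>(1) by (simp add: E_def)
  qed
  define M where "M = nat \<lceil>4 * sqrt N * exp (-2) / exp X\<rceil> + 1"
  have M: "4 * sqrt N * exp (-2) / exp X \<le> real M" "M > 0" unfolding M_def by (auto intro: order_trans[OF real_nat_ceiling_ge])
  have M2: "real M \<le> sqrt (3 * c * n + 3) + 2"
  proof -
    have e2: "4 * exp (-2) \<le> (1::real)"
    proof -
      have "(2::real)\<^sup>2 \<le> exp 1 ^ 2" using exp_ge_add_one_self[of 1] by (intro power_mono) auto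
      also have "exp 1 ^ 2 = exp (2::real)" by (simp flip: exp_double)
      finally show ?thesis by (simp add: exp_minus field_simps)
    qed
    have "4 * sqrt N * exp (-2) / exp X = (4 * exp (-2)) * (sqrt N / E)" by (simp add: E_def)
    also have "\<dots> \<le> 1 * (sqrt N / E)" using e2 E by (intro mult_right_mono) auto
    also have "\<dots> \<le> sqrt (3 * c * n + 3)" using sN2 E by (simp add: pos_divide_le_eq mult.commute)
    finally have 1: "4 * sqrt N * exp (-2) / exp X \<le> sqrt (3 * c * n + 3)" .
    have "0 \<le> 4 * sqrt N * exp (-2) / exp X" by simp
    then have "real M \<le> 4 * sqrt N * exp (-2) / exp X + 2" unfolding M_def by linarith
    then show ?thesis using 1 by linarith
  qed
  define g where "g = exp (- (P * X) - K) / 2"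
  have g: "g > 0" by (simp add: g_def)
  have lg: "ln (96 / g) = ln 192 + (P * X + K)"
  proof -
    have "96 / g = 192 * exp (P * X + K)" by (simp add: g_def exp_minus exp_diff exp_add field_simps)
    then show ?thesis by (simp add: ln_mult_pos)
  qed
  have time: "24 * (exp (X + 3))\<^sup>2 * ln (96 / g) + 2 + real M * (192 * (exp X)\<^sup>2 + 2) \<le> real N / 3"
  proof -
    have "(exp (X + 3))\<^sup>2 = E\<^sup>2 * exp 6"
    proof -
      have "(exp (3::real))\<^sup>2 = exp 6" by (simp flip: exp_double)
      then show ?thesis by (simp add: E_def exp_add power_mult_distrib)
    qed
    then have 1: "24 * (exp (X + 3))\<^sup>2 * ln (96 / g) = E\<^sup>2 * (24 * exp 6 * (ln 192 + K) + 24 * exp 6 * (2 * P * l) * n)"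
      unfolding lg by (simp add: X_def algebra_simps)
    have "real M * (192 * (exp X)\<^sup>2 + 2) \<le> (sqrt (3 * c * n + 3) + 2) * (194 * E\<^sup>2)"
      using M2 E2 by (intro mult_mono) (auto simp: E_def)
    then have "24 * (exp (X + 3))\<^sup>2 * ln (96 / g) + 2 + real M * (192 * (exp X)\<^sup>2 + 2)
       \<le> E\<^sup>2 * (24 * exp 6 * (ln 192 + K) + 24 * exp 6 * (2 * P * l) * n) + 2 * E\<^sup>2 + (sqrt (3 * c * n + 3) + 2) * (194 * E\<^sup>2)"
      unfolding 1 using E2 by linarith
    also have "\<dots> = E\<^sup>2 * (D + 194 * sqrt (3 * c * n + 3) + (c - 1) * n)" by (simp add: D_def c_def algebra_simps)
    also have "\<dots> \<le> E\<^sup>2 * (n + (c - 1) * n)" using n2 E2 by (intro mult_left_mono) auto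
    also have "\<dots> = E\<^sup>2 * (c * n)" by (simp add: algebra_simps)
    also have "\<dots> \<le> real N / 3" using N' by (simp add: N_def)
    finally show ?thesis .
  qed
  define \<psi> where "\<psi> = w0 / 32 ^ M * g / 16"
  have \<psi>: "\<psi> > 0" using w0 g by (simp add: \<psi>_def)
  have final: "2 \<le> real N' * (real ((2 * n) choose n) * \<psi>\<^sup>2 / 2)"
  proof -
    have "(32::real) ^ (2 * M) = exp (2 * ln 32 * M)" by (simp add: powr_realpow[symmetric] powr_def mult_ac)
    then have 32: "((32::real) ^ M)\<^sup>2 = exp (2 * ln 32 * M)" by (simp add: power_mult[symmetric] mult.commute)
    have g2: "g\<^sup>2 = exp (- (2 * P * X)) * exp (- 2 * K) / 4" unfolding g_def power_divide by (simp flip: exp_double exp_add)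
    have E2e: "E\<^sup>2 = exp (2 * X)" by (simp add: E_def flip: exp_double)
    have \<psi>2: "\<psi>\<^sup>2 = w0\<^sup>2 * exp (- 2 * K) / 1024 * exp (- (2 * P * X)) * exp (- (2 * ln 32 * M))"
      unfolding \<psi>_def power_divide power_mult_distrib 32 g2 by (simp add: exp_minus field_simps)
    have n4: "(4::real) ^ n = exp (2 * ln 2 * n)"
    proof -
      have "(4::real) ^ n = 2 ^ (2 * n)" by (simp add: power_mult)
      also have "\<dots> = exp (ln 2 * (2 * n))" by (simp add: powr_realpow[symmetric] powr_def mult_ac)
      finally show ?thesis by (simp add: mult_ac)
    qed
    have "2 * 1 \<le> 2 * (C * exp (\<epsilon> * n - 2 * ln 32 * (sqrt (3 * c * n + 3) + 2)))" using n3 by (intro mult_left_mono) auto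
    also have "\<dots> \<le> 2 * (C * exp (\<epsilon> * n - 2 * ln 32 * M))" using M2 C by (intro mult_left_mono) auto
    also have "\<epsilon> * n - 2 * ln 32 * M = 2 * X + 2 * ln 2 * n + - (2 * P * X) + - (2 * ln 32 * M)" by (simp add: \<epsilon>_def X_def algebra_simps)
    also have "2 * (C * exp (2 * X + 2 * ln 2 * n + - (2 * P * X) + - (2 * ln 32 * M))) = E\<^sup>2 * (c * n) * (4 ^ n / (2 * n) * \<psi>\<^sup>2 / 2)"
    proof -
      have alg: "2 * (c * v * k / 8192 * (e * f * p * m)) = e * (c * r) * (f / (2 * r) * (v * k / 1024 * p * m) / 2)" if "r \<noteq> 0" for v k e f p m r :: real
        using that by simp
      show ?thesis unfolding exp_add E2e[symmetric] n4[symmetric] \<psi>2 C_def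
        unfolding of_nat_mult of_nat_numeral by (rule alg) (use n in simp)
    qed
    also have "\<dots> \<le> real N' * (real ((2 * n) choose n) * \<psi>\<^sup>2 / 2)"
      using N' central_binomial_lower_bound[OF n] by (intro mult_mono divide_right_mono mult_right_mono) auto
    finally show ?thesis by simp
  qed
  let ?x1 = "ln (real N) / 2 - 1"
  have Npos: "real N > 0" using less_le_trans[OF exp_gt_zero cond1] by simp
  have sNexp: "sqrt N = exp (ln N / 2)"
  proof -
    have "(exp (ln N / 2))\<^sup>2 = real N" using Npos by (simp flip: exp_double)
    then show ?thesis by (metis exp_ge_zero real_sqrt_unique)
  qed
  have x1: "X + 4 \<le> ?x1" using cond1 unfolding sNexp by simp
  \<comment> \<open>Each zigzag and each of the two directions has its own threshold for the step
    size; there are finitely many, so a common one exists.\<close>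
  define F where "F = {A. A \<subseteq> {..<2*n} \<and> card A = n} \<times> {0, pi + \<alpha> / 2}"
  have finF: "finite F" by (simp add: F_def)
  define Pr where "Pr p h \<longleftrightarrow> (\<forall>\<nu> k. step_law \<nu> h \<longrightarrow> real N / 3 \<le> real k * h \<longrightarrow> real k * h \<le> real N \<longrightarrow>
      \<psi> \<le> step_law.stay_and_end \<nu> (shape s l n (fst p) b (snd p) ?x1) (cball (of_real (sqrt N * exp (-2)) * cis (snd p)) (\<rho> * sqrt N))
              k (of_real (exp (-2)) * cis (snd p)))" for p h
  have lo: "\<exists>h0>0. \<forall>h. 0 < h \<longrightarrow> h \<le> h0 \<longrightarrow> Pr p h" if p: "p \<in> F" for p
  proof -
    define A \<beta> where "A = fst p" and "\<beta> = snd p"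
    have A: "A \<subseteq> {..<2*n}" "card A = n" using p by (auto simp: F_def A_def)
    let ?\<theta> = "\<lambda>x. \<beta> + zigzag s l (2 * n) A x"
    let ?S = "shape s l n A b \<beta> ?x1" and ?T = "cball (of_real (sqrt N * exp (-2)) * cis \<beta>) (\<rho> * sqrt N)"
    have "\<exists>h0>0. \<forall>\<nu> h S T k. step_law \<nu> h \<longrightarrow> 0 < h \<longrightarrow> h \<le> h0 \<longrightarrow> S \<in> sets borel \<longrightarrow> T \<in> sets borel \<longrightarrow>
     spiral_strip ?\<theta> b (-3) (real (2*n) * l + 3) \<subseteq> S \<longrightarrow>
     (\<forall>y. exp (real (2*n) * l + 2) \<le> y \<longrightarrow> y \<le> sqrt N * exp (-2) \<longrightarrow> ball (of_real y * cis \<beta>) (exp (real (2*n) * l)) \<subseteq> S) \<longrightarrow>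
     ball (of_real (sqrt N * exp (-2)) * cis \<beta>) (\<rho> * sqrt N) \<subseteq> S \<inter> T \<longrightarrow>
     real N / 3 \<le> real k * h \<longrightarrow> real k * h \<le> real N \<longrightarrow>
     exp (- 32 / \<rho>\<^sup>2) / 10 / 32 ^ M * (exp (- (pi / (2 * a) * (1 + s\<^sup>2) * (real (2*n) * l)) - (16 * a + 12) / min (1/4) ((b - a) / (1 + \<bar>s\<bar>)) - 1) / 2) / 16
         \<le> step_law.stay_and_end \<nu> S T k (exp (Complex (-2) \<beta>))"
    proof (rule shape_lower_bound[where \<sigma> = "\<lambda>j. if j \<in> A then s else - s"])
      fix j x assume "j < 2 * n" "x \<in> {real j * l..real (Suc j) * l}"
      from zigzag_linear_piece[OF l this, of s A]
      show "\<beta> + zigzag s l (2 * n) A x = \<beta> + zigzag s l (2 * n) A (real j * l) + (if j \<in> A then s else - s) * (x - real j * l)" by simp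
    next
      fix x y
      show "\<bar>(\<beta> + zigzag s l (2 * n) A x) - (\<beta> + zigzag s l (2 * n) A y)\<bar> \<le> \<bar>s\<bar> * \<bar>x - y\<bar>"
        using zigzag_lipschitz[OF l, of s "2*n" A x y] by simp
    next
      fix x :: real assume "x \<le> 0"
      then show "\<beta> + zigzag s l (2 * n) A x = \<beta>" using zigzag_nonpos[OF l] by simp
    next
      fix x assume "real (2 * n) * l \<le> x"
      then show "\<beta> + zigzag s l (2 * n) A x = \<beta>" using zigzag_balanced[OF l A] by simp
    next
      show "exp (real (2 * n) * l + 5) \<le> sqrt (real N)" using cond1 by (simp only: X_def)
      show "4 * sqrt (real N) * exp (- 2) / exp (real (2 * n) * l) \<le> real M" using M by (simp only: X_def)
      show "exp (real (2 * n) * l) / 4 \<le> \<rho> * sqrt (real N)" using cond2 by (simp only: X_def)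
      have "exp (- (pi / (2 * a) * (1 + s\<^sup>2) * (real (2*n) * l)) - (16 * a + 12) / min (1/4) ((b - a) / (1 + \<bar>s\<bar>)) - 1) / 2 = g"
        unfolding g_def P_def K_def X_def by (simp only: diff_diff_eq)
      then show "24 * (exp (real (2 * n) * l + 3))\<^sup>2 * ln (96 / (exp (- (pi / (2 * a) * (1 + s\<^sup>2) * (real (2*n) * l)) - (16 * a + 12) / min (1/4) ((b - a) / (1 + \<bar>s\<bar>)) - 1) / 2)) + 2
          + real M * (192 * (exp (real (2 * n) * l))\<^sup>2 + 2) \<le> real N / 3"
        using time by (simp only: X_def)
    qed (use l a b \<rho> M in auto)
    then obtain h0 where h0: "h0 > 0" and LB: "\<forall>\<nu> h S T k. step_law \<nu> h \<longrightarrow> 0 < h \<longrightarrow> h \<le> h0 \<longrightarrow> S \<in> sets borel \<longrightarrow> T \<in> sets borel \<longrightarrow>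
     spiral_strip ?\<theta> b (-3) (real (2*n) * l + 3) \<subseteq> S \<longrightarrow>
     (\<forall>y. exp (real (2*n) * l + 2) \<le> y \<longrightarrow> y \<le> sqrt N * exp (-2) \<longrightarrow> ball (of_real y * cis \<beta>) (exp (real (2*n) * l)) \<subseteq> S) \<longrightarrow>
     ball (of_real (sqrt N * exp (-2)) * cis \<beta>) (\<rho> * sqrt N) \<subseteq> S \<inter> T \<longrightarrow>
     real N / 3 \<le> real k * h \<longrightarrow> real k * h \<le> real N \<longrightarrow>
     exp (- 32 / \<rho>\<^sup>2) / 10 / 32 ^ M * (exp (- (pi / (2 * a) * (1 + s\<^sup>2) * (real (2*n) * l)) - (16 * a + 12) / min (1/4) ((b - a) / (1 + \<bar>s\<bar>)) - 1) / 2) / 16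
         \<le> step_law.stay_and_end \<nu> S T k (exp (Complex (-2) \<beta>))" by blast
    have geq: "exp (- (pi / (2 * a) * (1 + s\<^sup>2) * (real (2*n) * l)) - (16 * a + 12) / min (1/4) ((b - a) / (1 + \<bar>s\<bar>)) - 1) / 2 = g"
      unfolding g_def P_def K_def X_def by (simp only: diff_diff_eq)
    have S1: "spiral_strip ?\<theta> b (-3) (real (2*n) * l + 3) \<subseteq> ?S"
      by (rule spiral_strip_subset_shape) (use x1 in \<open>simp add: X_def\<close>)
    have bs: "ball (of_real y * cis \<beta>) (y / 2) \<subseteq> ?S" if "exp (X + 2) \<le> y" "y \<le> sqrt N * exp (-2)" for y
    proof (rule ball_subset_shape[OF l A b(3)])
      have "sqrt N * exp (-2) = exp (?x1 - 1)" unfolding sNexp by (simp flip: exp_add)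
      then show "y \<le> exp (?x1 - 1)" using that by simp
    qed (use that in \<open>simp add: X_def\<close>)
    have S2: "\<forall>y. exp (real (2*n) * l + 2) \<le> y \<longrightarrow> y \<le> sqrt N * exp (-2) \<longrightarrow> ball (of_real y * cis \<beta>) (exp (real (2*n) * l)) \<subseteq> ?S"
    proof (intro allI impI)
      fix y assume y: "exp (real (2*n) * l + 2) \<le> y" "y \<le> sqrt N * exp (-2)"
      have "2 * exp X \<le> exp 2 * exp X" using exp_ge_add_one_self[of 2] by (intro mult_right_mono) auto
      moreover have "exp X * exp 2 \<le> y" using y(1) unfolding X_def exp_add .
      ultimately have "2 * exp X \<le> y" by (simp only: mult.commute[of "exp X" "exp 2"])
      then have "exp X \<le> y / 2" by simp
      then have "ball (of_real y * cis \<beta>) (exp X) \<subseteq> ball (of_real y * cis \<beta>) (y / 2)" by (rule subset_ball)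
      also have "\<dots> \<subseteq> ?S" by (rule bs) (use y in \<open>simp_all only: X_def\<close>)
      finally show "ball (of_real y * cis \<beta>) (exp (real (2*n) * l)) \<subseteq> ?S" by (simp only: X_def)
    qed
    have S3: "ball (of_real (sqrt N * exp (-2)) * cis \<beta>) (\<rho> * sqrt N) \<subseteq> ?S \<inter> ?T"
    proof -
      have "exp (X + 2) \<le> sqrt N * exp (-2)" unfolding sNexp using x1 by (simp flip: exp_add)
      then have "ball (of_real (sqrt N * exp (-2)) * cis \<beta>) (sqrt N * exp (-2) / 2) \<subseteq> ?S" using bs by blast
      moreover have "\<rho> * sqrt N \<le> sqrt N * exp (-2) / 2"
      proof -
        have "exp (-3) \<le> exp (-2::real)" by simp
        then have "\<rho> \<le> exp (-2) / 2" using \<rho>(2) exp_gt_zero[of "-2::real"] by linarith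
        then have "\<rho> * sqrt N \<le> exp (-2) / 2 * sqrt N" by (rule mult_right_mono) simp
        also have "\<dots> = sqrt N * exp (-2) / 2" by simp
        finally show ?thesis .
      qed
      ultimately have "ball (of_real (sqrt N * exp (-2)) * cis \<beta>) (\<rho> * sqrt N) \<subseteq> ?S" using subset_ball order_trans by fast
      then show ?thesis using ball_subset_cball by fast
    qed
    have z: "exp (Complex (-2) \<beta>) = of_real (exp (-2)) * cis \<beta>" by (simp add: exp_eq_polar)
    show ?thesis unfolding Pr_def
    proof (intro exI[of _ h0] conjI allI impI h0)
      fix h \<nu> k assume h: "0 < h" "h \<le> h0" "step_law \<nu> h" "real N / 3 \<le> real k * h" "real k * h \<le> real N"
      have "exp (- 32 / \<rho>\<^sup>2) / 10 / 32 ^ M * g / 16 \<le> step_law.stay_and_end \<nu> ?S ?T k (exp (Complex (-2) \<beta>))"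
        using LB[rule_format, OF h(3,1,2) _ _ S1 S2[rule_format] S3 h(4,5)] unfolding geq by simp
      then show "\<psi> \<le> step_law.stay_and_end \<nu> (shape s l n (fst p) b (snd p) ?x1) (cball (of_real (sqrt N * exp (-2)) * cis (snd p)) (\<rho> * sqrt N))
              k (of_real (exp (-2)) * cis (snd p))"
        unfolding z A_def[symmetric] \<beta>_def[symmetric] \<psi>_def w0_def .
    qed
  qed
  obtain h0 where h0: "h0 > 0" and low': "\<forall>p\<in>F. \<forall>h. 0 < h \<longrightarrow> h \<le> h0 \<longrightarrow> Pr p h"
    using finite_common_bound[of F Pr, OF finF lo] by blast
  have low: "\<psi> \<le> step_law.stay_and_end \<nu> (shape s l n (fst p) b (snd p) ?x1) (cball (of_real (sqrt N * exp (-2)) * cis (snd p)) (\<rho> * sqrt N))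
              k (of_real (exp (-2)) * cis (snd p))"
    if "p \<in> F" "0 < h" "h \<le> h0" "step_law \<nu> h" "real N / 3 \<le> real k * h" "real k * h \<le> real N" for p h \<nu> k
    using low'[rule_format, OF that(1-3)] that(4-6) unfolding Pr_def by blast
  \<comment> \<open>The first summand brings 1 / L below the threshold h0, the second bounds the
    probability of a large step by \<psi> / 2.\<close>
  define H where "H = nat \<lceil>1 / h0 + 16 * real N / (\<kappa>^4 * \<psi>)\<rceil> + 1"
  have N'1: "N' > 1"
  proof -
    have "1 * (exp 10 + 0) \<le> E\<^sup>2 * (c * n)" using E2 n1 \<rho> by (intro mult_mono) (auto intro: order_trans[OF _ n1])
    moreover have "exp 10 \<ge> (11::real)" using exp_ge_add_one_self[of 10] by simp
    ultimately have "11 \<le> E\<^sup>2 * (c * n)" by simp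
    then have "real N' \<ge> 11" using N'(1) by (rule order_trans)
    then show ?thesis by simp
  qed
  define \<A> where "\<A> = {N'..<2*N'}"
  have "pivot_parameters \<alpha> s l b \<rho> \<kappa> n N H \<A>"
  proof
    show "0 \<le> \<alpha>" "s > 0" "l > 0" "\<rho> > 0" "\<rho> \<le> exp (-3) / 8" "finite \<A>" "H > 0" using \<alpha> s l \<rho> by (auto simp: \<A>_def H_def)
    show "s * l = (pi - \<alpha> / 2) / 2" using sl by (simp add: d_def)
    show "b + (1 + s) * (4 * exp 3 * \<rho>) < s * l" using \<rho> sl by simp
    show "exp (real (2 * n) * l + 5) \<le> sqrt (real N)" using cond1 by (simp add: X_def)
    show "\<A> \<subseteq> {1..<N - 1}" using N'1 by (auto simp: \<A>_def N_def)
    fix \<nu> :: "complex measure" and L assume sl\<nu>: "step_law \<nu> 1" and L: "H \<le> L"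
    have "1 / h0 + 16 * real N / (\<kappa>^4 * \<psi>) \<le> real H" unfolding H_def by linarith
    moreover have "0 \<le> 1 / h0" "0 \<le> 16 * real N / (\<kappa>^4 * \<psi>)" using h0 \<psi> by auto
    ultimately have L1: "1 / h0 \<le> real L" and L2: "16 * real N / (\<kappa>^4 * \<psi>) \<le> real L" using L by linarith+
    have L0: "L > 0" using L by (auto simp: H_def)
    have hL: "1 / real L \<le> h0" using L1 L0 h0 by (simp add: field_simps)
    have "real ((2 * n) choose n) * \<psi>\<^sup>2 / 2 \<le> step_law.prS \<nu> (level_event s l n b (pi + \<alpha> / 2) \<rho> \<kappa> N L a)" if a: "a \<in> \<A>" for a
    proof (rule level_event_prob[OF sl\<nu> l s \<kappa>(2,1)])
      show "2 * (s * l) \<le> pi" using sl d by simp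
      show "exp (real (2 * n) * l + 5) \<le> sqrt (real N)" using cond1 by (simp add: X_def)
      show "\<rho> \<le> exp (- 3)" using \<rho>(2) exp_gt_zero[of "-3::real"] by linarith
      show "a < N" using a by (auto simp: \<A>_def N_def)
      have "8 * real a / (real L * \<kappa>^4) \<le> 8 * real N / (real L * \<kappa>^4)" using \<open>a < N\<close> \<kappa> by (intro divide_right_mono) auto
      also have "\<dots> \<le> \<psi> / 2"
      proof -
        have "16 * real N \<le> real L * (\<kappa>^4 * \<psi>)" using L2 \<kappa> \<psi> by (simp add: pos_divide_le_eq)
        then show ?thesis using L0 \<kappa> by (simp add: pos_divide_le_eq mult_ac)
      qed
      finally show "8 * real a / (real L * \<kappa>^4) \<le> \<psi> / 2" .
      fix A \<beta>' k \<nu>' assume *: "A \<subseteq> {..<2*n}" "card A = n" "\<beta>' \<in> {0, pi + \<alpha> / 2}" "k \<in> {a, N - 1 - a}" "step_law \<nu>' (1 / real L)"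
      have "real N / 3 \<le> real (k * L) * (1 / real L)" "real (k * L) * (1 / real L) \<le> real N"
        using *(4) a L0 by (auto simp: \<A>_def N_def)
      then show "\<psi> \<le> step_law.stay_and_end \<nu>' (shape s l n A b \<beta>' ?x1) (cball (of_real (sqrt N * exp (-2)) * cis \<beta>') (\<rho> * sqrt N))
              (k * L) (of_real (exp (-2)) * cis \<beta>')"
        using low[of "(A, \<beta>')" "1 / real L" \<nu>' "k * L"] * hL L0 by (simp add: F_def)
    qed (use L0 \<psi> in auto)
    note ge = this
    have "(\<Sum>a\<in>\<A>. real ((2 * n) choose n) * \<psi>\<^sup>2 / 2) \<le> (\<Sum>a\<in>\<A>. step_law.prS \<nu> (level_event s l n b (pi + \<alpha> / 2) \<rho> \<kappa> N L a))"
    proof (rule sum_mono)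
      fix a assume "a \<in> \<A>"
      then show "real ((2 * n) choose n) * \<psi>\<^sup>2 / 2 \<le> step_law.prS \<nu> (level_event s l n b (pi + \<alpha> / 2) \<rho> \<kappa> N L a)" by (rule ge)
    qed
    then show "2 \<le> (\<Sum>a\<in>\<A>. step_law.prS \<nu> (level_event s l n b (pi + \<alpha> / 2) \<rho> \<kappa> N L a))"
      using final by (simp add: \<A>_def)
  qed
  then show ?thesis by blast
qed

section \<open>Second moment on the tree of words\<close>

definition words :: "'a set \<Rightarrow> nat \<Rightarrow> 'a list set" where
  "words \<A> n = {w. set w \<subseteq> \<A> \<and> length w = n}"

lemma finite_words [simp]: "finite \<A> \<Longrightarrow> finite (words \<A> n)"
  unfolding words_def by (rule finite_lists_length_eq)

lemma words_0 [simp]: "words \<A> 0 = {[]}"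
  by (auto simp: words_def)

lemma sum_words_Suc:
  fixes g :: "'a list \<Rightarrow> real"
  shows "(\<Sum>w\<in>words \<A> (Suc n). g w) = (\<Sum>a\<in>\<A>. \<Sum>w\<in>words \<A> n. g (a # w))"
proof -
  have "words \<A> (Suc n) = (\<lambda>(a, w). a # w) ` (\<A> \<times> words \<A> n)"
  proof (intro equalityI subsetI)
    fix w assume "w \<in> words \<A> (Suc n)"
    then show "w \<in> (\<lambda>(a, w). a # w) ` (\<A> \<times> words \<A> n)" by (cases w) (auto simp: words_def)
  qed (auto simp: words_def)
  moreover have "inj_on (\<lambda>(a, w). a # w) (\<A> \<times> words \<A> n)" by (auto simp: inj_on_def)
  ultimately show ?thesis by (simp add: sum.reindex sum.cartesian_product split_beta' o_def)
qed

fun agreement :: "'a list \<Rightarrow> 'a list \<Rightarrow> nat" where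
  "agreement (a # w) (b # v) = (if a = b then Suc (agreement w v) else 0)"
| "agreement _ _ = 0"

lemma le_agreement: "k \<le> length w \<Longrightarrow> k \<le> length v \<Longrightarrow> take k w = take k v \<Longrightarrow> k \<le> agreement w v"
proof (induction w v arbitrary: k rule: agreement.induct)
  case (1 a w b v)
  then show ?case by (cases k) auto
qed auto

text \<open>A discrete Riesz energy of the counting measure on G. The base 3/2 lies below the mean
  offspring 2, so that the expected energy is controlled by the squared first moment, and above 1,
  so that bounded energy forces a positive dimension.\<close>

definition energy :: "'a list set \<Rightarrow> real" where
  "energy G = (\<Sum>w\<in>G. \<Sum>v\<in>G. (3/2) ^ agreement w v)"

text \<open>\<open>E L a\<close> is meant as the event of a level with L steps per cell. The last
  level has H steps per cell and every earlier one N times as many as its successor; after the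
  letter a the rest of the word is tested on the increments of the cell a only.\<close>

primrec good_word :: "(nat \<Rightarrow> nat \<Rightarrow> (nat \<Rightarrow> complex) \<Rightarrow> bool) \<Rightarrow> nat \<Rightarrow> nat \<Rightarrow> nat list \<Rightarrow> (nat \<Rightarrow> complex) \<Rightarrow> bool" where
  "good_word E H N [] x = True"
| "good_word E H N (a # w) x = (E (H * N ^ length w) a x \<and> good_word E H N w (\<lambda>i. x (a * (H * N ^ length w) + i)))"

lemma measurable_shift [measurable]: "(\<lambda>x i. x (c + i)) \<in> measurable seqM seqM"
  by (rule measurable_PiM_single') (auto simp: space_PiM)

lemma good_word_measurable:
  assumes [measurable]: "\<And>L a. Measurable.pred seqM (E L a)"
  shows "Measurable.pred seqM (good_word E H N w)"
  by (induction w) (simp_all del: good_word.simps add: good_word.simps[abs_def])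

lemma depends_on_shift:
  assumes "depends_on {..<L} P"
  shows "depends_on {c..<c + L} (\<lambda>x. P (\<lambda>i. x (c + i)))"
  unfolding depends_on_def by (intro allI impI depends_onD[OF assms]) auto

lemma good_word_depends:
  assumes E: "\<And>L a. a \<in> \<A> \<Longrightarrow> depends_on ({..<N * L} - {a * L..<(a + 1) * L}) (E L a)"
    and \<A>: "\<A> \<subseteq> {..<N}" and w: "set w \<subseteq> \<A>"
  shows "depends_on {..<H * N ^ length w} (good_word E H N w)"
  using w
proof (induction w)
  case Nil
  show ?case by (simp add: depends_on_def)
next
  case (Cons a w)
  let ?L = "H * N ^ length w"
  have a: "a \<in> \<A>" "a < N" using Cons.prems \<A> by auto
  have "a * ?L + ?L \<le> N * ?L" using mult_le_mono1[of "Suc a" N ?L] a by simp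
  then have "{a * ?L..<a * ?L + ?L} \<subseteq> {..<H * N ^ length (a # w)}" by (auto simp: mult_ac)
  with Cons have 1: "depends_on {..<H * N ^ length (a # w)} (\<lambda>x. good_word E H N w (\<lambda>i. x (a * ?L + i)))"
    by (intro depends_on_mono[OF depends_on_shift]) auto
  have 2: "depends_on {..<H * N ^ length (a # w)} (E ?L a)"
    by (rule depends_on_mono[OF E[OF a(1)]]) (auto simp: mult_ac)
  show ?case using depends_on_conj[OF 2 1] by simp
qed

text \<open>The uniform distribution on the good words has energy at most C. Nonemptiness is
  demanded separately because the inequality is trivial for the empty set.\<close>

definition many_words :: "(nat \<Rightarrow> nat \<Rightarrow> (nat \<Rightarrow> complex) \<Rightarrow> bool) \<Rightarrow> nat \<Rightarrow> nat \<Rightarrow> nat set \<Rightarrow> real \<Rightarrow> nat \<Rightarrow> (nat \<Rightarrow> complex) \<Rightarrow> bool" where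
  "many_words E H N \<A> C n x \<longleftrightarrow> {w \<in> words \<A> n. good_word E H N w x} \<noteq> {} \<and>
     energy {w \<in> words \<A> n. good_word E H N w x} \<le> C * (real (card {w \<in> words \<A> n. good_word E H N w x}))\<^sup>2"

lemma card_good_words: "finite W \<Longrightarrow> real (card {w \<in> W. P w}) = (\<Sum>w\<in>W. of_bool (P w))"
  by (simp add: of_bool_def sum.If_cases Int_def)

lemma energy_good_words:
  assumes "finite W"
  shows "energy {w \<in> W. P w} = (\<Sum>w\<in>W. \<Sum>v\<in>W. (3/2) ^ agreement w v * of_bool (P w \<and> P v))"
proof -
  have "(\<Sum>v\<in>W. (3/2) ^ agreement w v * of_bool (P w \<and> P v)) = (if P w then \<Sum>v\<in>W. if P v then (3/2) ^ agreement w v else 0 else (0::real))" for w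
    by (auto simp: of_bool_def intro!: sum.cong)
  then show ?thesis unfolding energy_def sum.inter_filter[OF assms] by simp
qed

lemma many_words_depends:
  assumes E: "\<And>L a. a \<in> \<A> \<Longrightarrow> depends_on ({..<N * L} - {a * L..<(a + 1) * L}) (E L a)"
    and \<A>: "\<A> \<subseteq> {..<N}"
  shows "depends_on {..<H * N ^ n} (many_words E H N \<A> C n)"
proof (unfold depends_on_def, intro allI impI)
  fix x y :: "nat \<Rightarrow> complex" assume xy: "\<forall>i\<in>{..<H * N ^ n}. x i = y i"
  have "good_word E H N w x = good_word E H N w y" if "w \<in> words \<A> n" for w
  proof (rule depends_onD[OF good_word_depends[where E = E, OF E \<A>]])
    show "set w \<subseteq> \<A>" using that by (simp add: words_def)
    show "x i = y i" if "i \<in> {..<H * N ^ length w}" for i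
      using xy that \<open>w \<in> words \<A> n\<close> by (simp add: words_def)
  qed
  then have "{w \<in> words \<A> n. good_word E H N w x} = {w \<in> words \<A> n. good_word E H N w y}" by auto
  then show "many_words E H N \<A> C n x = many_words E H N \<A> C n y" unfolding many_words_def by simp
qed

lemma many_words_measurable:
  assumes "\<And>L a. Measurable.pred seqM (E L a)" and fin: "finite \<A>"
  shows "Measurable.pred seqM (many_words E H N \<A> C n)"
proof -
  note [measurable] = good_word_measurable[of E, OF assms(1)]
  have *: "many_words E H N \<A> C n x \<longleftrightarrow> 0 < (\<Sum>w\<in>words \<A> n. of_bool (good_word E H N w x) :: real) \<and>
     (\<Sum>w\<in>words \<A> n. \<Sum>v\<in>words \<A> n. (3/2) ^ agreement w v * of_bool (good_word E H N w x \<and> good_word E H N v x))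
       \<le> C * ((\<Sum>w\<in>words \<A> n. of_bool (good_word E H N w x)))\<^sup>2" for x
  proof -
    have "finite {w \<in> words \<A> n. good_word E H N w x}" using fin by simp
    then have "{w \<in> words \<A> n. good_word E H N w x} \<noteq> {} \<longleftrightarrow> 0 < real (card {w \<in> words \<A> n. good_word E H N w x})"
      by (simp add: card_gt_0_iff)
    then show ?thesis unfolding many_words_def using fin by (simp only: card_good_words[OF finite_words] energy_good_words[OF finite_words])
  qed
  have [measurable]: "(\<lambda>x. of_bool (good_word E H N w x) :: real) \<in> borel_measurable seqM" for w
    unfolding of_bool_def by measurable
  have [measurable]: "(\<lambda>x. of_bool (good_word E H N w x \<and> good_word E H N v x) :: real) \<in> borel_measurable seqM" for w v
    unfolding of_bool_def by measurable
  have 1: "(\<lambda>x. \<Sum>w\<in>words \<A> n. of_bool (good_word E H N w x) :: real) \<in> borel_measurable seqM"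
    by (rule borel_measurable_sum) measurable
  have 2: "(\<lambda>x. \<Sum>w\<in>words \<A> n. \<Sum>v\<in>words \<A> n. (3/2) ^ agreement w v * of_bool (good_word E H N w x \<and> good_word E H N v x) :: real)
      \<in> borel_measurable seqM"
    by (rule borel_measurable_sum)+ measurable
  have "Measurable.pred seqM (\<lambda>x. 0 < f x \<and> g x \<le> C * (f x)\<^sup>2)"
    if f: "f \<in> borel_measurable seqM" and g: "g \<in> borel_measurable seqM" for f g :: "(nat \<Rightarrow> complex) \<Rightarrow> real"
  proof (rule pred_intros_logic)
    show "Measurable.pred seqM (\<lambda>x. 0 < f x)" using f by (rule borel_measurable_const[THEN borel_measurable_pred_less])
    have "(\<lambda>x. C * (f x)\<^sup>2) \<in> borel_measurable seqM" by (intro borel_measurable_times borel_measurable_power borel_measurable_const f)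
    with g show "Measurable.pred seqM (\<lambda>x. g x \<le> C * (f x)\<^sup>2)" unfolding pred_def by (rule borel_measurable_le)
  qed
  from this[OF 1 2] show ?thesis unfolding *[abs_def] .
qed

context step_law
begin

lemma integral_of_bool:
  assumes "Measurable.pred seqM P"
  shows "integrable \<Omega> (\<lambda>x. of_bool (P x) :: real)" "(\<integral>x. of_bool (P x) \<partial>\<Omega>) = prS P"
proof -
  have *: "(\<lambda>x. of_bool (P x) :: real) = indicator {x. P x}" by (auto simp: indicator_def)
  show "integrable \<Omega> (\<lambda>x. of_bool (P x) :: real)" unfolding * using pred_sets_\<Omega>[OF assms]
    by (simp add: seq.P.emeasure_eq_measure)
  show "(\<integral>x. of_bool (P x) \<partial>\<Omega>) = prS P" unfolding * prS_def using pred_sets_\<Omega>[OF assms] by simp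
qed

text \<open>Let Z be the expected number of good words and Q their expected energy. In the
  recursion, pairs with the same first letter contribute 3/2 m Q; pairs with different first letters
  become independent once their first events are dropped, and contribute at most N^2 Z^2. As m >= 2,
  the bound Q <= R Z^2 reproduces itself. It is converted into a probability by a second moment
  argument that keeps the energy bounded at the same time.\<close>

theorem many_words_probability:
  assumes E: "\<And>L a. Measurable.pred seqM (E L a)"
    and dep: "\<And>L a. a \<in> \<A> \<Longrightarrow> depends_on ({..<N * L} - {a * L..<(a + 1) * L}) (E L a)"
    and \<A>: "\<A> \<subseteq> {..<N}"
    and mean: "\<And>k. 2 \<le> (\<Sum>a\<in>\<A>. prS (E (H * N ^ k) a))"
  shows "1 / (8 * ((real N)\<^sup>2 + 1)) \<le> prS (many_words E H N \<A> (64 * ((real N)\<^sup>2 + 1)\<^sup>2) n)"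
proof -
  define R where "R = (real N)\<^sup>2 + 1"
  have R: "R \<ge> 1" by (simp add: R_def)
  have fin: "finite \<A>" using \<A> finite_subset by blast
  have cA: "real (card \<A>) \<le> real N" using card_mono[OF _ \<A>] by simp
  let ?g = "good_word E H N"
  note mg [measurable] = good_word_measurable[of E H N, OF E]
  note mE [measurable] = E
  define Z where "Z k = (\<Sum>w\<in>words \<A> k. prS (?g w))" for k
  define Q where "Q k = (\<Sum>w\<in>words \<A> k. \<Sum>v\<in>words \<A> k. (3/2) ^ agreement w v * prS (\<lambda>x. ?g w x \<and> ?g v x))" for k
  define m where "m k = (\<Sum>a\<in>\<A>. prS (E (H * N ^ k) a))" for k
  have gd: "depends_on {..<H * N ^ k} (?g w)" if "w \<in> words \<A> k" for w k
    using good_word_depends[where E = E, OF dep \<A>, of w H] that by (auto simp: words_def)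
  have shift: "prS (\<lambda>x. P (\<lambda>i. x (c + i))) = prS P" if "Measurable.pred seqM P" for P c
    by (rule prS_reindex[of "\<lambda>i. c + i"]) (use that in auto)
  have split: "prS (\<lambda>x. E (H * N ^ k) a x \<and> P (\<lambda>i. x (a * (H * N ^ k) + i))) = prS (E (H * N ^ k) a) * prS P"
    if a: "a \<in> \<A>" and P: "depends_on {..<H * N ^ k} P" "Measurable.pred seqM P" for a k P
  proof -
    note [measurable] = P(2)
    have "prS (\<lambda>x. E (H * N ^ k) a x \<and> P (\<lambda>i. x (a * (H * N ^ k) + i))) = prS (E (H * N ^ k) a) * prS (\<lambda>x. P (\<lambda>i. x (a * (H * N ^ k) + i)))"
    proof (rule prS_indep[OF dep[OF a] mE depends_on_shift[OF P(1), of "a * (H * N ^ k)"]])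
      show "Measurable.pred seqM (\<lambda>x. P (\<lambda>i. x (a * (H * N ^ k) + i)))" by measurable
    qed auto
    then show ?thesis using shift[OF P(2)] by simp
  qed
  have Zs: "Z (Suc k) = m k * Z k" for k
  proof -
    have "Z (Suc k) = (\<Sum>a\<in>\<A>. \<Sum>w\<in>words \<A> k. prS (E (H * N ^ k) a) * prS (?g w))"
      unfolding Z_def sum_words_Suc
    proof (intro sum.cong refl)
      fix a w assume "a \<in> \<A>" "w \<in> words \<A> k"
      moreover from this have "length w = k" by (simp add: words_def)
      then have "?g (a # w) = (\<lambda>x. E (H * N ^ k) a x \<and> ?g w (\<lambda>i. x (a * (H * N ^ k) + i)))" by (simp add: fun_eq_iff)
      ultimately show "prS (?g (a # w)) = prS (E (H * N ^ k) a) * prS (?g w)"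
        using split[OF _ gd mg] by simp
    qed
    then show ?thesis by (simp add: Z_def m_def sum_product)
  qed
  have m2: "2 \<le> m k" for k using mean by (simp add: m_def)
  have Zpos: "Z k > 0" for k
  proof (induction k)
    case 0
    show ?case using seq.P.prob_space by (simp add: Z_def prS_def)
  next
    case (Suc k)
    then show ?case using m2[of k] by (simp add: Zs)
  qed
  have Qs: "Q (Suc k) \<le> 3/2 * m k * Q k + (real N)\<^sup>2 * (Z k)\<^sup>2" for k
  proof -
    let ?W = "words \<A> k"
    let ?c = "\<lambda>a a' w v. (3/2) ^ agreement (a # w) (a' # v) * prS (\<lambda>x. ?g (a # w) x \<and> ?g (a' # v) x)"
    let ?S = "\<lambda>a a'. \<Sum>w\<in>?W. \<Sum>v\<in>?W. ?c a a' w v"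
    have diag: "?S a a = 3/2 * prS (E (H * N ^ k) a) * Q k" if a: "a \<in> \<A>" for a
    proof -
      have "?c a a w v = 3/2 * prS (E (H * N ^ k) a) * ((3/2) ^ agreement w v * prS (\<lambda>x. ?g w x \<and> ?g v x))"
        if wv: "w \<in> ?W" "v \<in> ?W" for w v
      proof -
        have "prS (\<lambda>x. ?g (a # w) x \<and> ?g (a # v) x)
           = prS (\<lambda>x. E (H * N ^ k) a x \<and> (?g w (\<lambda>i. x (a * (H * N ^ k) + i)) \<and> ?g v (\<lambda>i. x (a * (H * N ^ k) + i))))"
          using wv by (intro arg_cong[where f = prS]) (auto simp: words_def)
        also have "\<dots> = prS (E (H * N ^ k) a) * prS (\<lambda>x. ?g w x \<and> ?g v x)"
          using split[OF a depends_on_conj[OF gd[OF wv(1)] gd[OF wv(2)]]] by simp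
        finally show ?thesis by simp
      qed
      then have "?S a a = (\<Sum>w\<in>?W. \<Sum>v\<in>?W. 3/2 * prS (E (H * N ^ k) a) * ((3/2) ^ agreement w v * prS (\<lambda>x. ?g w x \<and> ?g v x)))"
        by (intro sum.cong refl)
      then show ?thesis by (simp only: Q_def sum_distrib_left)
    qed
    have off: "?S a a' \<le> (Z k)\<^sup>2" if a: "a \<in> \<A>" "a' \<in> \<A>" "a \<noteq> a'" for a a'
    proof -
      have "?c a a' w v \<le> prS (?g w) * prS (?g v)" if wv: "w \<in> ?W" "v \<in> ?W" for w v
      proof -
        let ?L = "H * N ^ k"
        have disj: "{a * ?L..<a * ?L + ?L} \<inter> {a' * ?L..<a' * ?L + ?L} = {}"
        proof (cases "a < a'")
          case True
          then show ?thesis using mult_le_mono1[of "Suc a" a' ?L] by auto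
        next
          case False
          then show ?thesis using mult_le_mono1[of "Suc a'" a ?L] a(3) by auto
        qed
        have "prS (\<lambda>x. ?g (a # w) x \<and> ?g (a' # v) x)
            \<le> prS (\<lambda>x. ?g w (\<lambda>i. x (a * ?L + i)) \<and> ?g v (\<lambda>i. x (a' * ?L + i)))"
          using wv by (intro prS_mono) (auto simp: words_def)
        also have "\<dots> = prS (\<lambda>x. ?g w (\<lambda>i. x (a * ?L + i))) * prS (\<lambda>x. ?g v (\<lambda>i. x (a' * ?L + i)))"
          by (rule prS_indep[OF depends_on_shift[OF gd[OF wv(1)]] _ depends_on_shift[OF gd[OF wv(2)]] _ disj]) measurable
        also have "\<dots> = prS (?g w) * prS (?g v)" using shift[OF mg] by simp
        finally show ?thesis using a by simp
      qed
      then have "?S a a' \<le> (\<Sum>w\<in>?W. \<Sum>v\<in>?W. prS (?g w) * prS (?g v))" by (intro sum_mono) auto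
      then show ?thesis by (simp add: Z_def sum_product power2_eq_square)
    qed
    have "Q (Suc k) = (\<Sum>a\<in>\<A>. \<Sum>w\<in>?W. \<Sum>a'\<in>\<A>. \<Sum>v\<in>?W. ?c a a' w v)" unfolding Q_def sum_words_Suc ..
    also have "\<dots> = (\<Sum>a\<in>\<A>. \<Sum>a'\<in>\<A>. ?S a a')" by (intro sum.cong refl sum.swap)
    also have "\<dots> \<le> (\<Sum>a\<in>\<A>. \<Sum>a'\<in>\<A>. (if a' = a then 3/2 * prS (E (H * N ^ k) a) * Q k else 0) + (Z k)\<^sup>2)"
    proof (intro sum_mono)
      fix a a' assume a: "a \<in> \<A>" "a' \<in> \<A>"
      show "?S a a' \<le> (if a' = a then 3/2 * prS (E (H * N ^ k) a) * Q k else 0) + (Z k)\<^sup>2"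
      proof (cases "a' = a")
        case True
        show ?thesis unfolding True diag[OF a(1)] by simp
      next
        case False
        then show ?thesis using off[OF a] by simp
      qed
    qed
    also have "\<dots> = 3/2 * m k * Q k + (real (card \<A>))\<^sup>2 * (Z k)\<^sup>2"
      using fin by (simp add: sum.distrib m_def sum_distrib_left sum_distrib_right power2_eq_square)
    also have "\<dots> \<le> 3/2 * m k * Q k + (real N)\<^sup>2 * (Z k)\<^sup>2"
      using cA by (intro add_left_mono mult_right_mono power_mono) auto
    finally show ?thesis .
  qed
  have QZ: "Q k \<le> R * (Z k)\<^sup>2" for k
  proof (induction k)
    case 0
    show ?case using seq.P.prob_space R by (simp add: Z_def Q_def prS_def)
  next
    case (Suc k)
    have "3/2 * m k * Q k \<le> 3/2 * m k * (R * (Z k)\<^sup>2)" using Suc m2[of k] by (intro mult_left_mono) auto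
    moreover have "(3/2 * m k * R + (R - 1)) * (Z k)\<^sup>2 = 3/2 * m k * (R * (Z k)\<^sup>2) + (real N)\<^sup>2 * (Z k)\<^sup>2"
      by (simp add: R_def algebra_simps)
    ultimately have "Q (Suc k) \<le> (3/2 * m k * R + (R - 1)) * (Z k)\<^sup>2" using Qs[of k] by linarith
    also have "\<dots> \<le> (R * (m k)\<^sup>2) * (Z k)\<^sup>2"
    proof (rule mult_right_mono)
      \<comment> \<open>The weight 3/2 fits the mean 2: m^2 - 3/2 m - 1 = (m - 2) (m + 1/2).\<close>
      have "0 \<le> R * ((m k - 2) * (m k + 1/2))" using R m2[of k] by (intro mult_nonneg_nonneg) auto
      then show "3/2 * m k * R + (R - 1) \<le> R * (m k)\<^sup>2" by (simp add: algebra_simps power2_eq_square)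
    qed simp
    finally show ?case by (simp add: Zs power_mult_distrib mult_ac)
  qed
  define X where "X x = (\<Sum>w\<in>words \<A> n. of_bool (?g w x) :: real)" for x
  define I where "I x = (\<Sum>w\<in>words \<A> n. \<Sum>v\<in>words \<A> n. (3/2) ^ agreement w v * of_bool (?g w x \<and> ?g v x) :: real)" for x
  let ?D = "many_words E H N \<A> (64 * R\<^sup>2) n"
  have iX: "integrable \<Omega> X" "(\<integral>x. X x \<partial>\<Omega>) = Z n"
  proof -
    show "integrable \<Omega> X" unfolding X_def by (intro Bochner_Integration.integrable_sum integral_of_bool mg)
    show "(\<integral>x. X x \<partial>\<Omega>) = Z n" unfolding X_def Z_def
      by (subst Bochner_Integration.integral_sum) (auto intro: integral_of_bool(1)[OF mg] simp: integral_of_bool(2)[OF mg])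
  qed
  have mgg: "Measurable.pred seqM (\<lambda>x. ?g w x \<and> ?g v x)" for w v by measurable
  have iI: "integrable \<Omega> I" "(\<integral>x. I x \<partial>\<Omega>) = Q n"
  proof -
    have 1: "integrable \<Omega> (\<lambda>x. (3/2) ^ agreement w v * of_bool (?g w x \<and> ?g v x) :: real)" for w v
      by (intro integrable_mult_right integral_of_bool mgg)
    have 2: "(\<integral>x. (3/2) ^ agreement w v * of_bool (?g w x \<and> ?g v x) \<partial>\<Omega>) = (3/2) ^ agreement w v * prS (\<lambda>x. ?g w x \<and> ?g v x)" for w v
      using integral_of_bool(2)[OF mgg] by (subst integral_mult_right_zero) simp
    show "integrable \<Omega> I" unfolding I_def by (intro Bochner_Integration.integrable_sum 1)
    have 3: "(\<integral>x. (\<Sum>v\<in>words \<A> n. (3/2) ^ agreement w v * of_bool (?g w x \<and> ?g v x)) \<partial>\<Omega>)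
        = (\<Sum>v\<in>words \<A> n. (3/2) ^ agreement w v * prS (\<lambda>x. ?g w x \<and> ?g v x))" for w
      by (subst Bochner_Integration.integral_sum[OF 1]) (simp only: 2)
    show "(\<integral>x. I x \<partial>\<Omega>) = Q n" unfolding I_def Q_def
      by (subst Bochner_Integration.integral_sum[OF Bochner_Integration.integrable_sum[OF 1]]) (simp only: 3)
  qed
  have mD: "Measurable.pred seqM ?D" by (rule many_words_measurable[OF E fin])
  have XI: "(X x)\<^sup>2 \<le> I x" for x
  proof -
    have "(X x)\<^sup>2 = (\<Sum>w\<in>words \<A> n. \<Sum>v\<in>words \<A> n. of_bool (?g w x \<and> ?g v x))"
      by (simp add: X_def power2_eq_square sum_product of_bool_conj)
    also have "\<dots> \<le> I x" unfolding I_def by (intro sum_mono) (auto simp: of_bool_def)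
    finally show ?thesis .
  qed
  have X0: "X x \<ge> 0" for x by (auto simp: X_def intro: sum_nonneg)
  define z where "z = Z n"
  have z: "z > 0" using Zpos by (simp add: z_def)
  \<comment> \<open>One pointwise inequality replaces the Paley-Zygmund and Markov inequalities; its
    expectation is already the claim. The cases are a small number of words, the event itself, where
    the square of X - 4 R z is used, and an energy above 64 R^2 X^2.\<close>
  have key: "4 * R * z * X x \<le> 2 * R * z\<^sup>2 + I x / 2 + 8 * R\<^sup>2 * z\<^sup>2 * of_bool (?D x)" for x
  proof (cases "X x < z / 2")
    case True
    then have "4 * R * z * X x \<le> 4 * R * z * (z / 2)" using R z by (intro mult_left_mono) auto
    moreover have "0 \<le> I x / 2 + 8 * R\<^sup>2 * z\<^sup>2 * of_bool (?D x)" using XI[of x] by (intro add_nonneg_nonneg) (auto intro: order_trans[OF zero_le_power2])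
    ultimately show ?thesis by (simp add: power2_eq_square)
  next
    case F: False
    show ?thesis
    proof (cases "?D x")
      case True
      have "0 \<le> (X x - 4 * R * z)\<^sup>2" by simp
      then have "4 * R * z * X x \<le> (X x)\<^sup>2 / 2 + 8 * R\<^sup>2 * z\<^sup>2" by (simp add: power2_eq_square algebra_simps)
      moreover have "0 \<le> 2 * R * z\<^sup>2" using R by simp
      ultimately show ?thesis using True XI[of x] by simp
    next
      case False
      have cardX: "real (card {w \<in> words \<A> n. ?g w x}) = X x" using fin by (simp add: X_def card_good_words)
      have enI: "energy {w \<in> words \<A> n. ?g w x} = I x" using fin by (simp add: I_def energy_good_words)
      have "X x > 0" using F z by linarith
      then have "{w \<in> words \<A> n. ?g w x} \<noteq> {}" unfolding cardX[symmetric] by (metis card.empty of_nat_0 less_irrefl)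
      then have "64 * R\<^sup>2 * (X x)\<^sup>2 < I x" using False unfolding many_words_def cardX enI by simp
      moreover have "(8 * R * X x)\<^sup>2 = 64 * R\<^sup>2 * (X x)\<^sup>2" by (simp add: power_mult_distrib)
      moreover have "4 * R * z * X x \<le> (8 * R * X x) * X x"
        using F R X0[of x] by (intro mult_right_mono) auto
      moreover have "8 * R * X x * X x \<le> 32 * R\<^sup>2 * (X x)\<^sup>2"
      proof -
        have "8 * R * (X x)\<^sup>2 \<le> 32 * R\<^sup>2 * (X x)\<^sup>2" using R by (intro mult_right_mono) (auto simp: power2_eq_square)
        then show ?thesis by (simp add: power2_eq_square mult.assoc)
      qed
      moreover have "0 \<le> 2 * R * z\<^sup>2" using R by simp
      ultimately show ?thesis using False by simp
    qed
  qed
  have "(\<integral>x. 4 * R * z * X x \<partial>\<Omega>) \<le> (\<integral>x. 2 * R * z\<^sup>2 + I x / 2 + 8 * R\<^sup>2 * z\<^sup>2 * of_bool (?D x) \<partial>\<Omega>)"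
    by (rule integral_mono) (use key in \<open>auto intro!: iX iI integral_of_bool mD integrable_mult_right Bochner_Integration.integrable_add\<close>)
  also have "\<dots> = 2 * R * z\<^sup>2 + Q n / 2 + 8 * R\<^sup>2 * z\<^sup>2 * prS ?D"
    using iI integral_of_bool[OF mD] seq.P.prob_space by simp
  finally have "4 * R * z\<^sup>2 \<le> 2 * R * z\<^sup>2 + Q n / 2 + 8 * R\<^sup>2 * z\<^sup>2 * prS ?D"
    using iX by (simp add: z_def power2_eq_square)
  then have "3/2 * R * z\<^sup>2 \<le> 8 * R\<^sup>2 * z\<^sup>2 * prS ?D" using QZ[of n] by (simp add: z_def)
  then have "(R * z\<^sup>2) * (3/2) \<le> (R * z\<^sup>2) * (8 * R * prS ?D)" by (simp add: power2_eq_square mult_ac)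
  then have "3/2 \<le> 8 * R * prS ?D" using R z by simp
  then have "1 \<le> prS ?D * (8 * R)" by (simp add: mult_ac)
  then have "1 / (8 * R) \<le> prS ?D" using R by (simp add: pos_divide_le_eq)
  then show ?thesis by (simp add: R_def)
qed

end

section \<open>Limit words and the mass distribution principle\<close>

text \<open>Infinite words each of whose prefixes starts a word of F n for infinitely many n. The
  sets F n of different n need not be related, and many of them may be empty.\<close>

definition limit_words :: "(nat \<Rightarrow> 'a list set) \<Rightarrow> (nat \<Rightarrow> 'a) set" where
  "limit_words F = {a. \<forall>k. infinite {n. k \<le> n \<and> (\<exists>w\<in>F n. take k w = map a [0..<k])}}"

text \<open>Koenig's lemma for the prefixes that occur for infinitely many n: the alphabet is
  finite, so some extension by one letter again occurs for infinitely many n.\<close>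

lemma limit_words_nonempty:
  assumes fin: "finite \<A>" and F: "\<And>n. F n \<subseteq> words \<A> n" and inf: "infinite {n. F n \<noteq> {}}"
  shows "limit_words F \<noteq> {}"
proof -
  define P where "P p \<longleftrightarrow> infinite {n. length p \<le> n \<and> (\<exists>w\<in>F n. take (length p) w = p)}" for p
  have P0: "P []"
  proof -
    have "{n. length [] \<le> n \<and> (\<exists>w\<in>F n. take (length []) w = [])} = {n. F n \<noteq> {}}" by auto
    then show ?thesis using inf unfolding P_def by simp
  qed
  have step: "\<exists>x. P (p @ [x])" if "P p" for p
  proof (rule ccontr)
    assume "\<nexists>x. P (p @ [x])"
    then have "finite {n. length (p @ [x]) \<le> n \<and> (\<exists>w\<in>F n. take (length (p @ [x])) w = p @ [x])}" for x
      unfolding P_def by blast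
    then have "finite (insert (length p) (\<Union>x\<in>\<A>. {n. length (p @ [x]) \<le> n \<and> (\<exists>w\<in>F n. take (length (p @ [x])) w = p @ [x])}))"
      using fin by blast
    moreover have "{n. length p \<le> n \<and> (\<exists>w\<in>F n. take (length p) w = p)}
       \<subseteq> insert (length p) (\<Union>x\<in>\<A>. {n. length (p @ [x]) \<le> n \<and> (\<exists>w\<in>F n. take (length (p @ [x])) w = p @ [x])})"
    proof
      fix n assume "n \<in> {n. length p \<le> n \<and> (\<exists>w\<in>F n. take (length p) w = p)}"
      then obtain w where n: "length p \<le> n" and w: "w \<in> F n" "take (length p) w = p" by blast
      have lw: "length w = n" "set w \<subseteq> \<A>" using F w(1) by (auto simp: words_def)
      show "n \<in> insert (length p) (\<Union>x\<in>\<A>. {n. length (p @ [x]) \<le> n \<and> (\<exists>w\<in>F n. take (length (p @ [x])) w = p @ [x])})"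
      proof (cases "n = length p")
        case False
        then have lt: "length p < length w" using n lw by simp
        then have "take (length (p @ [w ! length p])) w = p @ [w ! length p]"
          using w(2) by (simp add: take_Suc_conv_app_nth)
        moreover have "w ! length p \<in> \<A>" using lt lw(2) by (meson nth_mem subsetD)
        ultimately show ?thesis using w(1) lt lw(1) by (intro insertI2 UN_I[of "w ! length p"]) auto
      qed simp
    qed
    ultimately show False using that finite_subset unfolding P_def by blast
  qed
  define f where "f = rec_nat [] (\<lambda>_ p. p @ [SOME x. P (p @ [x])])"
  define a where "a k = (SOME x. P (f k @ [x]))" for k
  have fS: "f 0 = []" "f (Suc k) = f k @ [a k]" for k by (simp_all add: f_def a_def)
  have Pf: "P (f k)" for k
  proof (induction k)
    case (Suc k)
    then show ?case unfolding fS a_def by (rule someI_ex[OF step])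
  qed (simp add: fS P0)
  have fm: "f k = map a [0..<k]" for k by (induction k) (simp_all add: fS)
  have "a \<in> limit_words F" using Pf unfolding limit_words_def P_def fm by simp
  then show ?thesis by blast
qed

lemma limit_words_letters:
  assumes "\<And>n. F n \<subseteq> words \<A> n" "a \<in> limit_words F"
  shows "a k \<in> \<A>"
proof -
  have "{n. Suc k \<le> n \<and> (\<exists>w\<in>F n. take (Suc k) w = map a [0..<Suc k])} \<noteq> {}"
    using assms(2) unfolding limit_words_def by (intro infinite_imp_nonempty) blast
  then obtain n w where w: "Suc k \<le> n" "w \<in> F n" "take (Suc k) w = map a [0..<Suc k]" by blast
  then have "w ! k = map a [0..<Suc k] ! k" by (metis lessI nth_take)
  then have "w ! k = a k" by (simp add: nth_append)
  moreover have "length w = n" "set w \<subseteq> \<A>" using w(2) assms(1) by (auto simp: words_def)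
  ultimately show ?thesis using w(1) by (metis Suc_le_lessD nth_mem subsetD)
qed

text \<open>Compactness and Cauchy-Schwarz. If words of F n without a prefix among the v i existed
  for infinitely many n, \<open>limit_words_nonempty\<close> would yield an uncovered limit word. So
  for some n all words of a nonempty F n are covered, by finitely many v i, and bounded energy
  prevents the prefixes from having small total weight.\<close>

lemma limit_words_cover:
  assumes fin: "finite \<A>" and F: "\<And>n. F n \<subseteq> words \<A> n" and inf: "infinite {n. F n \<noteq> {}}"
    and en: "\<And>n. F n \<noteq> {} \<Longrightarrow> energy (F n) \<le> C * (real (card (F n)))\<^sup>2"
    and cov: "\<And>a. a \<in> limit_words F \<Longrightarrow> \<exists>i::nat. map a [0..<length (v i)] = v i"
  shows "\<exists>J. finite J \<and> 1 \<le> C * (\<Sum>i\<in>J. (2/3) ^ length (v i))"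
proof -
  define B where "B n = {w \<in> F n. \<forall>i. \<not> (length (v i) \<le> n \<and> take (length (v i)) w = v i)}" for n
  have "finite {n. B n \<noteq> {}}"
  proof (rule ccontr)
    assume "infinite {n. B n \<noteq> {}}"
    then obtain a where a: "a \<in> limit_words B" using limit_words_nonempty[OF fin, of B] F by (force simp: B_def)
    have aF: "a \<in> limit_words F"
      unfolding limit_words_def
    proof (intro CollectI allI)
      fix k
      have "infinite {n. k \<le> n \<and> (\<exists>w\<in>B n. take k w = map a [0..<k])}" using a by (simp add: limit_words_def)
      then show "infinite {n. k \<le> n \<and> (\<exists>w\<in>F n. take k w = map a [0..<k])}"
        by (rule infinite_super[rotated]) (auto simp: B_def)
    qed
    then obtain i where i: "map a [0..<length (v i)] = v i" using cov by blast
    have "infinite {n. length (v i) \<le> n \<and> (\<exists>w\<in>B n. take (length (v i)) w = map a [0..<length (v i)])}"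
      using a unfolding limit_words_def by blast
    from infinite_imp_nonempty[OF this]
    obtain n w where "length (v i) \<le> n" "w \<in> B n" "take (length (v i)) w = map a [0..<length (v i)]" by blast
    then have "length (v i) \<le> n" "w \<in> B n" "take (length (v i)) w = v i" by (simp_all only: i)
    then show False unfolding B_def by blast
  qed
  then have "infinite ({n. F n \<noteq> {}} - {n. B n \<noteq> {}})" using inf by (rule Diff_infinite_finite)
  from infinite_imp_nonempty[OF this] obtain n where n: "F n \<noteq> {}" "B n = {}" by blast
  have finF: "finite (F n)" using finite_subset[OF F] fin by simp
  have "\<forall>w\<in>F n. \<exists>i. length (v i) \<le> n \<and> take (length (v i)) w = v i" using n(2) unfolding B_def by blast
  \<comment> \<open>Each word is assigned to a single prefix, so that the classes are disjoint; two
    words of the class of i agree on at least \<open>length (v i)\<close> letters.\<close>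
  then obtain f where f: "\<And>w. w \<in> F n \<Longrightarrow> length (v (f w)) \<le> n \<and> take (length (v (f w))) w = v (f w)" by metis
  define J where "J = f ` F n"
  define g where "g i = real (card {w \<in> F n. f w = i})" for i
  have finJ: "finite J" using finF by (simp add: J_def)
  have gsum: "(\<Sum>w\<in>F n. h (f w)) = (\<Sum>i\<in>J. g i * h i)" for h :: "nat \<Rightarrow> real"
    using sum.image_gen[OF finF, of "\<lambda>w. h (f w)" f] by (simp add: J_def g_def)
  have low: "(\<Sum>i\<in>J. g i * ((3/2) ^ length (v i) * g i)) \<le> energy (F n)"
  proof -
    have "(3/2) ^ length (v (f w)) * g (f w) \<le> (\<Sum>u\<in>F n. (3/2) ^ agreement w u)" if w: "w \<in> F n" for w
    proof -
      have "(3/2) ^ length (v (f w)) * g (f w) = (\<Sum>u\<in>{u \<in> F n. f u = f w}. (3/2) ^ length (v (f w)) :: real)"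
        by (simp add: g_def mult.commute)
      also have "\<dots> \<le> (\<Sum>u\<in>{u \<in> F n. f u = f w}. (3/2) ^ agreement w u)"
      proof (rule sum_mono)
        fix u assume "u \<in> {u \<in> F n. f u = f w}"
        then have u: "u \<in> F n" "f u = f w" by auto
        have "length w = n" "length u = n" using F w u by (auto simp: words_def)
        then have "length (v (f w)) \<le> agreement w u" using f[OF w] f[OF u(1)] u(2) by (intro le_agreement) auto
        then show "(3/2) ^ length (v (f w)) \<le> (3/2 :: real) ^ agreement w u" by (intro power_increasing) auto
      qed
      also have "\<dots> \<le> (\<Sum>u\<in>F n. (3/2) ^ agreement w u)" using finF by (intro sum_mono2) auto
      finally show ?thesis .
    qed
    note w_le = this
    have "(\<Sum>w\<in>F n. (3/2) ^ length (v (f w)) * g (f w)) \<le> energy (F n)" unfolding energy_def by (rule sum_mono, rule w_le)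
    then show ?thesis unfolding gsum[of "\<lambda>i. (3/2) ^ length (v i) * g i"] .
  qed
  have "real (card (F n)) = (\<Sum>i\<in>J. g i)" using gsum[of "\<lambda>_. 1"] by simp
  \<comment> \<open>Inserts two inverse weights for Cauchy-Schwarz: one factor becomes the total
    weight of the prefixes, the other is bounded by the energy.\<close>
  also have "\<dots> = (\<Sum>i\<in>J. sqrt ((2/3) ^ length (v i)) * (sqrt ((3/2) ^ length (v i)) * g i))"
  proof (intro sum.cong refl)
    fix i
    have "(2/3::real) ^ length (v i) * (3/2) ^ length (v i) = 1" by (simp flip: power_mult_distrib)
    then have "sqrt ((2/3) ^ length (v i)) * sqrt ((3/2) ^ length (v i)) = 1" by (metis real_sqrt_mult real_sqrt_one)
    then show "g i = sqrt ((2/3) ^ length (v i)) * (sqrt ((3/2) ^ length (v i)) * g i)" by (simp add: mult.assoc[symmetric])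
  qed
  finally have "(real (card (F n)))\<^sup>2 \<le> (\<Sum>i\<in>J. (sqrt ((2/3) ^ length (v i)))\<^sup>2) * (\<Sum>i\<in>J. (sqrt ((3/2) ^ length (v i)) * g i)\<^sup>2)"
    using Cauchy_Schwarz_ineq_sum by metis
  also have "\<dots> = (\<Sum>i\<in>J. (2/3) ^ length (v i)) * (\<Sum>i\<in>J. g i * ((3/2) ^ length (v i) * g i))"
    by (simp add: power_mult_distrib power2_eq_square[of "g _"] mult_ac)
  also have "\<dots> \<le> (\<Sum>i\<in>J. (2/3) ^ length (v i)) * (C * (real (card (F n)))\<^sup>2)"
    using low en[OF n(1)] by (intro mult_left_mono sum_nonneg) auto
  finally have "(real (card (F n)))\<^sup>2 * 1 \<le> (real (card (F n)))\<^sup>2 * (C * (\<Sum>i\<in>J. (2/3) ^ length (v i)))" by (simp add: mult_ac)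
  moreover have "(real (card (F n)))\<^sup>2 > 0" using n finF by (simp add: card_gt_0_iff)
  ultimately have "1 \<le> C * (\<Sum>i\<in>J. (2/3) ^ length (v i))" by (simp only: mult_le_cancel_left_pos)
  then show ?thesis using finJ by blast
qed

text \<open>The Hausdorff gauge of a cover element is compared with the weight of the longest prefix
  common to all words whose points it contains.\<close>

lemma hausdorff_premeasure_lower_bound:
  fixes p :: "(nat \<Rightarrow> 'b) \<Rightarrow> 'a::metric_space" and c \<theta> s s0 C :: real
  assumes c: "c > 0" and \<theta>: "\<theta> > 0" "\<theta> powr s0 = 2/3" and C: "C > 0"
    and sep: "\<And>a a' k. a \<in> W \<Longrightarrow> a' \<in> W \<Longrightarrow> a k \<noteq> a' k \<Longrightarrow> (\<And>j. j < k \<Longrightarrow> a j = a' j) \<Longrightarrow> c * \<theta> ^ k \<le> dist (p a) (p a')"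
    and cov: "\<And>v :: nat \<Rightarrow> 'b list. (\<And>a. a \<in> W \<Longrightarrow> \<exists>i. map a [0..<length (v i)] = v i) \<Longrightarrow> \<exists>J. finite J \<and> 1 \<le> C * (\<Sum>i\<in>J. (2/3) ^ length (v i))"
    and sub: "p ` W \<subseteq> A" and s: "0 \<le> s" "s \<le> s0" and s0: "s0 > 0"
  shows "ennreal (c powr s0 / (2 * C)) \<le> hausdorff_premeasure s 1 A"
  unfolding hausdorff_premeasure_def
proof (rule Inf_greatest)
  fix S assume "S \<in> {\<Sum>i. hausdorff_gauge s (U i) | U :: nat \<Rightarrow> 'a set. A \<subseteq> (\<Union>i. U i) \<and> (\<forall>i. bounded (U i) \<and> diameter (U i) \<le> 1)}"
  then obtain U :: "nat \<Rightarrow> 'a set" where S: "S = (\<Sum>i. hausdorff_gauge s (U i))" and AU: "A \<subseteq> (\<Union>i. U i)"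
    and U: "\<And>i. bounded (U i)" "\<And>i. diameter (U i) \<le> 1" by blast
  define G where "G i = (if U i = {} then 0 else if s = 0 then 1 else diameter (U i) powr s)" for i
  have G0: "G i \<ge> 0" for i by (simp add: G_def)
  have gG: "hausdorff_gauge s (U i) = ennreal (G i)" for i by (simp add: hausdorff_gauge_def G_def)
  \<comment> \<open>Summable slack for cover elements that catch at most one word. Their gauge may
    be 0, so they are given a prefix long enough for its weight to stay below the slack.\<close>
  define \<eta> where "\<eta> = 1 / (4 * C)"
  have \<eta>: "\<eta> > 0" using C by (simp add: \<eta>_def)
  define c1 where "c1 = c powr s0"
  have c1: "c1 > 0" using c by (simp add: c1_def)
  have "\<exists>v. (\<forall>a\<in>W. p a \<in> U i \<longrightarrow> map a [0..<length v] = v) \<and> (2/3) ^ length v \<le> G i / c1 + \<eta> * (1/2) ^ i" for i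
  proof -
    define Wi where "Wi = {a \<in> W. p a \<in> U i}"
    show ?thesis
    proof (cases "\<exists>a\<in>Wi. \<exists>a'\<in>Wi. a \<noteq> a'")
      case False
      obtain K where K: "(2/3) ^ K < \<eta> * (1/2) ^ i" using real_arch_pow_inv[of "\<eta> * (1/2) ^ i" "2/3::real"] \<eta> by auto
      define a0 where "a0 = (SOME a. a \<in> Wi)"
      have "map a [0..<length (map a0 [0..<K])] = map a0 [0..<K]" if "a \<in> W" "p a \<in> U i" for a
      proof -
        have "a \<in> Wi" using that by (simp add: Wi_def)
        then have "a0 \<in> Wi" unfolding a0_def by (rule someI[where P = "\<lambda>a. a \<in> Wi"])
        then have "a = a0" using False \<open>a \<in> Wi\<close> by blast
        then show ?thesis by simp
      qed
      moreover have "(2/3) ^ length (map a0 [0..<K]) \<le> G i / c1 + \<eta> * (1/2) ^ i"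
        using K G0[of i] c1 by (simp add: add_increasing)
      ultimately show ?thesis by blast
    next
      case True
      define k where "k = (LEAST k. \<exists>a\<in>Wi. \<exists>a'\<in>Wi. a k \<noteq> a' k)"
      have "\<exists>k. \<exists>a\<in>Wi. \<exists>a'\<in>Wi. a k \<noteq> a' k" using True by (metis ext)
      then have "\<exists>a\<in>Wi. \<exists>a'\<in>Wi. a k \<noteq> a' k" unfolding k_def by (rule LeastI_ex)
      then obtain a a' where a: "a \<in> Wi" "a' \<in> Wi" "a k \<noteq> a' k" by blast
      have agree: "b j = b' j" if "b \<in> Wi" "b' \<in> Wi" "j < k" for b b' j
        using not_less_Least[of j "\<lambda>k. \<exists>a\<in>Wi. \<exists>a'\<in>Wi. a k \<noteq> a' k"] that unfolding k_def by blast
      have "c * \<theta> ^ k \<le> dist (p a) (p a')" using a agree by (intro sep) (auto simp: Wi_def)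
      also have "\<dots> \<le> diameter (U i)" using a by (intro diameter_bounded_bound U) (auto simp: Wi_def)
      finally have d: "c * \<theta> ^ k \<le> diameter (U i)" .
      have dpos: "diameter (U i) > 0" using d c \<theta> by (meson less_le_trans mult_pos_pos zero_less_power)
      have "(c * \<theta> ^ k) powr s0 \<le> diameter (U i) powr s0" using d s0 c \<theta> by (intro powr_mono2) auto
      also have "(c * \<theta> ^ k) powr s0 = c1 * (2/3) ^ k"
      proof -
        have "(\<theta> ^ k) powr s0 = (\<theta> powr s0) ^ k" using \<theta> by (simp add: powr_power powr_realpow[symmetric] powr_powr mult.commute)
        then show ?thesis using c \<theta> by (simp add: powr_mult c1_def)
      qed
      also have "diameter (U i) powr s0 \<le> G i"
      proof (cases "s = 0")
        case True
        then show ?thesis using a dpos U(2)[of i] s0 by (auto simp: G_def Wi_def intro: powr_le1)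
      next
        case False
        have "diameter (U i) powr s0 \<le> diameter (U i) powr s" using s U(2)[of i] dpos by (intro powr_mono') auto
        then show ?thesis using a False by (auto simp: G_def Wi_def)
      qed
      finally have "(2/3) ^ k \<le> G i / c1" using c1 by (simp add: pos_le_divide_eq mult.commute)
      moreover have "map b [0..<length (map a [0..<k])] = map a [0..<k]" if "b \<in> W" "p b \<in> U i" for b
        using agree[of b a] that a by (auto simp: Wi_def)
      moreover have "0 \<le> \<eta> * (1/2) ^ i" using \<eta> by simp
      ultimately show ?thesis by (intro exI[of _ "map a [0..<k]"]) auto
    qed
  qed
  then obtain v where v: "\<And>i a. a \<in> W \<Longrightarrow> p a \<in> U i \<Longrightarrow> map a [0..<length (v i)] = v i"
    "\<And>i. (2/3) ^ length (v i) \<le> G i / c1 + \<eta> * (1/2) ^ i" by metis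
  have "\<exists>i. map a [0..<length (v i)] = v i" if "a \<in> W" for a
    using v(1)[OF that] that sub AU by blast
  from cov[OF this] obtain J where J: "finite J" "1 \<le> C * (\<Sum>i\<in>J. (2/3) ^ length (v i))" by blast
  have "(\<Sum>i\<in>J. (2/3) ^ length (v i)) \<le> (\<Sum>i\<in>J. G i / c1 + \<eta> * (1/2) ^ i)" using v(2) by (rule sum_mono)
  also have "\<dots> = (\<Sum>i\<in>J. G i) / c1 + \<eta> * (\<Sum>i\<in>J. (1/2) ^ i)" by (simp add: sum.distrib sum_divide_distrib sum_distrib_left)
  also have "\<dots> \<le> (\<Sum>i\<in>J. G i) / c1 + \<eta> * 2"
  proof -
    have "(\<Sum>i\<in>J. (1/2) ^ i) \<le> (\<Sum>i. (1/2 :: real) ^ i)" by (rule sum_le_suminf) (use J in auto)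
    also have "\<dots> = 2" by (subst suminf_geometric) auto
    finally show ?thesis using \<eta> by simp
  qed
  finally have "C * (\<Sum>i\<in>J. (2/3) ^ length (v i)) \<le> C * ((\<Sum>i\<in>J. G i) / c1 + \<eta> * 2)" using C by (intro mult_left_mono) auto
  then have "1 \<le> C * ((\<Sum>i\<in>J. G i) / c1) + 1/2" using J(2) C by (simp add: \<eta>_def algebra_simps)
  then have "c1 / (2 * C) \<le> (\<Sum>i\<in>J. G i)" using c1 C by (simp add: field_simps)
  then have "ennreal (c1 / (2 * C)) \<le> ennreal (\<Sum>i\<in>J. G i)" by (rule ennreal_leI)
  also have "\<dots> = (\<Sum>i\<in>J. hausdorff_gauge s (U i))" using G0 by (simp add: gG sum_ennreal)
  also have "\<dots> \<le> S" unfolding S by (rule sum_le_suminf) (use J in auto)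
  finally show "ennreal (c powr s0 / (2 * C)) \<le> S" by (simp add: c1_def)
qed

text \<open>Points whose words part at level k are at least c \<theta>^k apart, and a prefix of
  length k has weight (2/3)^k; so the exponent s0 with \<theta>^s0 = 2/3 is a lower bound for the
  dimension.\<close>

lemma hausdorff_dim_pos:
  fixes p :: "(nat \<Rightarrow> 'b) \<Rightarrow> 'a::metric_space" and c \<theta> C :: real
  assumes c: "c > 0" and \<theta>: "0 < \<theta>" "\<theta> < 1" and C: "C > 0"
    and sep: "\<And>a a' k. a \<in> W \<Longrightarrow> a' \<in> W \<Longrightarrow> a k \<noteq> a' k \<Longrightarrow> (\<And>j. j < k \<Longrightarrow> a j = a' j) \<Longrightarrow> c * \<theta> ^ k \<le> dist (p a) (p a')"
    and cov: "\<And>v :: nat \<Rightarrow> 'b list. (\<And>a. a \<in> W \<Longrightarrow> \<exists>i. map a [0..<length (v i)] = v i) \<Longrightarrow> \<exists>J. finite J \<and> 1 \<le> C * (\<Sum>i\<in>J. (2/3) ^ length (v i))"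
    and sub: "p ` W \<subseteq> A"
  shows "0 < hausdorff_dim A"
proof -
  define s0 where "s0 = log \<theta> (2/3)"
  have s0: "s0 > 0" "\<theta> powr s0 = 2/3" using \<theta> by (auto simp: s0_def) (simp add: log_def divide_neg_neg)
  have pos: "hausdorff_measure s A \<noteq> 0" if s: "0 \<le> s" "s \<le> s0" for s
  proof -
    have "ennreal (c powr s0 / (2 * C)) \<le> hausdorff_premeasure s 1 A"
      by (rule hausdorff_premeasure_lower_bound[OF c \<theta>(1) s0(2) C sep cov sub s s0(1)])
    also have "\<dots> \<le> hausdorff_measure s A" unfolding hausdorff_measure_def by (rule SUP_upper) simp
    finally have "ennreal (c powr s0 / (2 * C)) \<le> hausdorff_measure s A" .
    moreover have "0 < c powr s0 / (2 * C)" using c C by simp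
    ultimately show ?thesis by auto
  qed
  have "ennreal s0 \<le> hausdorff_dim A"
    unfolding hausdorff_dim_def
  proof (rule Inf_greatest)
    fix t assume "t \<in> {ennreal s | s. 0 \<le> s \<and> hausdorff_measure s A = 0}"
    then obtain s where "t = ennreal s" "0 \<le> s" "hausdorff_measure s A = 0" by blast
    then show "ennreal s0 \<le> t" using pos[of s] by (cases "s \<le> s0") (auto intro: ennreal_leI)
  qed
  then show ?thesis using s0(1) by (metis ennreal_less_zero_iff less_le_trans)
qed

text \<open>With this, a positive dimension also yields that the set is nonempty.\<close>

lemma hausdorff_dim_empty: "hausdorff_dim ({} :: 'a::metric_space set) = 0"
proof -
  have "hausdorff_premeasure 0 \<delta> ({} :: 'a set) = 0" if "\<delta> > 0" for \<delta>
  proof -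
    have "hausdorff_premeasure 0 \<delta> ({} :: 'a set) \<le> (\<Sum>i::nat. hausdorff_gauge 0 ({} :: 'a set))"
      unfolding hausdorff_premeasure_def
      by (rule Inf_lower) (use that in \<open>auto simp: diameter_def intro!: exI[of _ "\<lambda>_::nat. {}"]\<close>)
    then show ?thesis by (simp add: hausdorff_gauge_def)
  qed
  then have "hausdorff_measure 0 ({} :: 'a set) = 0"
    unfolding hausdorff_measure_def by (subst SUP_eq_const[of _ _ 0]) auto
  then have "hausdorff_dim ({} :: 'a set) \<le> ennreal 0" unfolding hausdorff_dim_def by (intro Inf_lower CollectI exI[of _ 0]) simp
  then show ?thesis by simp
qed

section \<open>From good words to pivoting points\<close>

text \<open>Since S at least halves, \<rho> S k is at most 2 \<rho> (S k - S (Suc k)); so the steps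
  telescope and add up to at most 2 \<rho> S k.\<close>

lemma geometric_drift:
  fixes y :: "nat \<Rightarrow> complex" and S :: "nat \<Rightarrow> real"
  assumes step: "\<And>k. cmod (y (Suc k) - y k) \<le> \<rho> * S k" and S: "\<And>k. S (Suc k) \<le> S k / 2" "\<And>k. 0 \<le> S k"
    and \<rho>: "0 \<le> \<rho>" and lim: "y \<longlonglongrightarrow> Y"
  shows "cmod (y k - Y) \<le> 2 * \<rho> * S k"
proof -
  have "cmod (y (k + m) - y k) \<le> 2 * \<rho> * (S k - S (k + m))" for m
  proof (induction m)
    case (Suc m)
    have "y (k + Suc m) - y k = (y (Suc (k + m)) - y (k + m)) + (y (k + m) - y k)" by simp
    then have "cmod (y (k + Suc m) - y k) \<le> cmod (y (Suc (k + m)) - y (k + m)) + cmod (y (k + m) - y k)"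
      by (metis norm_triangle_ineq)
    also have "\<dots> \<le> \<rho> * S (k + m) + 2 * \<rho> * (S k - S (k + m))" by (rule add_mono[OF step Suc.IH])
    also have "\<dots> \<le> 2 * \<rho> * (S k - S (k + Suc m))"
    proof -
      have "\<rho> * (2 * S (Suc (k + m))) \<le> \<rho> * S (k + m)" using S(1)[of "k + m"] \<rho> by (intro mult_left_mono) auto
      then show ?thesis by (simp add: algebra_simps)
    qed
    finally show ?case .
  qed simp
  then have "cmod (y (k + m) - y k) \<le> 2 * \<rho> * S k" for m
    using S(2)[of "k + m"] \<rho> by (meson mult_left_mono order_trans diff_le_eq le_add_same_cancel1 mult_nonneg_nonneg zero_le_numeral)
  then have "cmod (y k - y (m + k)) \<le> 2 * \<rho> * S k" for m by (metis add.commute norm_minus_commute)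
  moreover have "(\<lambda>m. cmod (y k - y (m + k))) \<longlonglongrightarrow> cmod (y k - Y)"
    by (intro tendsto_intros LIMSEQ_ignore_initial_segment lim)
  ultimately show ?thesis by (intro Lim_bounded[where M = 0]) auto
qed

lemma exp_perturbation:
  assumes \<delta>: "cmod \<delta> \<le> r * cmod (exp \<zeta>)" and r: "r < 1/2"
  shows "\<exists>\<xi>. exp \<zeta> + \<delta> = exp \<xi> \<and> \<bar>Re \<xi> - Re \<zeta>\<bar> \<le> 2 * r \<and> \<bar>Im \<xi> - Im \<zeta>\<bar> \<le> 2 * r"
proof -
  define v where "v = \<delta> / exp \<zeta>"
  have "cmod v \<le> r" using \<delta> by (simp add: v_def norm_divide divide_le_eq)
  then have v: "cmod v < 1/2" "cmod (Ln (1 + v)) \<le> 2 * r"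
    using r norm_Ln_le[of v] by auto
  have "1 + v \<noteq> 0"
  proof
    assume "1 + v = 0"
    then have "v = - 1" by (simp add: eq_neg_iff_add_eq_0 add.commute)
    then show False using v by simp
  qed
  then have "exp (\<zeta> + Ln (1 + v)) = exp \<zeta> + \<delta>" by (simp add: exp_add v_def distrib_left)
  then show ?thesis using v(2) abs_Re_le_cmod[of "Ln (1 + v)"] abs_Im_le_cmod[of "Ln (1 + v)"]
    by (intro exI[of _ "\<zeta> + Ln (1 + v)"]) auto
qed

text \<open>The bounds 1 <= a k < N - 1 keep each cell away from both ends of the preceding one. So
  the limit lies strictly inside all cells and has a past and a future at every scale.\<close>

lemma nested_points:
  fixes a :: "nat \<Rightarrow> nat" and u h :: real
  assumes h: "h > 0" and N: "N > (1::nat)" and a: "\<And>k. 1 \<le> a k \<and> a k < N - 1"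
  defines "t \<equiv> \<lambda>k. u + h * (\<Sum>j<k. real (a j) / real N ^ Suc j)"
  defines "t' \<equiv> \<lambda>k. t k + h / real N ^ k"
  shows "\<exists>T. t \<longlonglongrightarrow> T \<and> t' \<longlonglongrightarrow> T \<and> (\<forall>k. t k < T \<and> T < t' k)"
proof -
  have tS: "t (Suc k) = t k + real (a k) * (h / real N ^ Suc k)" for k by (simp add: t_def algebra_simps)
  have cell: "h / real N ^ k = real N * (h / real N ^ Suc k)" for k using N by simp
  have pos: "h / real N ^ k > 0" for k using h N by simp
  have inc: "t k < t (Suc k)" for k
  proof -
    have "0 < real (a k) * (h / real N ^ Suc k)" using a[of k] pos[of "Suc k"] by (intro mult_pos_pos) auto
    then show ?thesis unfolding tS by linarith
  qed
  have dec: "t' (Suc k) < t' k" for k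
  proof -
    have "real (a k) + 1 < real N" using a[of k] by linarith
    then have "(real (a k) + 1) * (h / real N ^ Suc k) < real N * (h / real N ^ Suc k)" using pos[of "Suc k"] by (rule mult_strict_right_mono)
    then show ?thesis unfolding t'_def tS cell[of k] by (simp only: distrib_right mult_1 add.assoc add_strict_left_mono)
  qed
  have i: "incseq t" using inc by (intro incseq_SucI less_imp_le)
  have d: "decseq t'" using dec by (intro decseq_SucI less_imp_le)
  have tt: "t k < t' k" for k using pos[of k] by (simp add: t'_def)
  have "t k \<le> t' 0" for k using tt[of k] decseqD[OF d, of 0 k] by simp
  then obtain T where T: "t \<longlonglongrightarrow> T" using incseq_convergent[OF i] by blast
  have "(\<lambda>k. h * (1 / real N) ^ k) \<longlonglongrightarrow> h * 0" using N by (intro tendsto_intros LIMSEQ_power_zero) auto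
  moreover have "t' = (\<lambda>k. t k + h * (1 / real N) ^ k)" by (simp add: t'_def power_one_over fun_eq_iff)
  ultimately have T': "t' \<longlonglongrightarrow> T" using tendsto_add[OF T] by fastforce
  have "t k < T" for k using inc[of k] incseq_le[OF i T, of "Suc k"] by simp
  moreover have "T < t' k" for k using dec[of k] decseq_ge[OF d T', of "Suc k"] by simp
  ultimately show ?thesis using T T' by blast
qed

text \<open>The last two conditions allow to recentre the shapes of all levels at the limit point: the
  path at the end of a level, shifted by a multiple of the square root of its length, hardly moves.\<close>

definition level_ok :: "real \<Rightarrow> real \<Rightarrow> nat \<Rightarrow> real \<Rightarrow> real \<Rightarrow> real \<Rightarrow> nat \<Rightarrow> (real \<Rightarrow> complex) \<Rightarrow> real \<Rightarrow> real \<Rightarrow> nat \<Rightarrow> nat set \<Rightarrow> (real \<Rightarrow> bool) \<Rightarrow> bool" where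
  "level_ok s l n b \<beta> \<rho> N \<gamma> t \<tau> a A D \<longleftrightarrow> A \<subseteq> {..<2*n} \<and> card A = n \<and>
    (\<forall>r\<in>{t..t + real a * \<tau>}. D r \<longrightarrow> of_real (exp (-2)) + (\<gamma> r - \<gamma> (t + real a * \<tau>)) / of_real (sqrt \<tau>) \<in> shape s l n A b 0 (ln (real N) / 2 - 1)) \<and>
    (\<forall>r\<in>{t + real (a + 1) * \<tau>..t + real N * \<tau>}. D r \<longrightarrow> of_real (exp (-2)) * cis \<beta> + (\<gamma> r - \<gamma> (t + real (a + 1) * \<tau>)) / of_real (sqrt \<tau>) \<in> shape s l n A b \<beta> (ln (real N) / 2 - 1)) \<and>
    cmod (\<gamma> t - of_real (sqrt (real N * \<tau>) * exp (-2)) - (\<gamma> (t + real a * \<tau>) - of_real (sqrt \<tau> * exp (-2)))) \<le> \<rho> * sqrt (real N * \<tau>) \<and>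
    cmod (\<gamma> (t + real N * \<tau>) - of_real (sqrt (real N * \<tau>) * exp (-2)) * cis \<beta> - (\<gamma> (t + real (a + 1) * \<tau>) - of_real (sqrt \<tau> * exp (-2)) * cis \<beta>)) \<le> \<rho> * sqrt (real N * \<tau>)"

text \<open>The sums of normalised increments telescope to increments of \<gamma> divided by sqrt
  \<tau>. Multiplied by sqrt \<tau>, the target becomes sqrt (N \<tau>) exp (-2), which is the
  starting offset one level up.\<close>

lemma level_event_imp_level_ok:
  assumes ev: "level_event s l n b \<beta> \<rho> \<kappa> N L a x" and L: "L > 0" and \<tau>: "\<tau> > 0" and a: "a < N"
    and x: "\<And>i. i < N * L \<Longrightarrow> x i = of_real (sqrt (real L / \<tau>)) * (\<gamma> (t + real (Suc i) * (\<tau> / real L)) - \<gamma> (t + real i * (\<tau> / real L)))"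
  shows "\<exists>A. level_ok s l n b \<beta> \<rho> N \<gamma> t \<tau> a A (\<lambda>r. \<exists>i. r = t + real i * (\<tau> / real L))"
proof -
  obtain A where A: "A \<subseteq> {..<2*n}" "card A = n" and P: "past_event s l n A b \<rho> \<kappa> N L a x" and Fu: "future_event s l n A b \<beta> \<rho> N L a x"
    using ev unfolding level_event_def by blast
  define g where "g i = \<gamma> (t + real i * (\<tau> / real L))" for i
  let ?e = "of_real (exp (-2)) :: complex"
  have x': "x i = of_real (sqrt (real L / \<tau>)) * (g (Suc i) - g i)" if "i < N * L" for i using x[OF that] by (simp add: g_def)
  have sq: "sqrt (real L / \<tau>) / sqrt (real L) = 1 / sqrt \<tau>" using L \<tau> by (simp add: real_sqrt_divide)
  have sN: "sqrt (real N * \<tau>) = sqrt N * sqrt \<tau>" by (rule real_sqrt_mult)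
  have s\<tau>: "sqrt \<tau> > 0" using \<tau> by simp
  have aLN: "a * L \<le> N * L" by (rule mult_le_mono1) (use a in simp)
  have NL: "(a + 1) * L + (N - 1 - a) * L = N * L"
  proof -
    have "(a + 1) * L + (N - 1 - a) * L = ((a + 1) + (N - 1 - a)) * L" by (simp only: add_mult_distrib)
    also have "(a + 1) + (N - 1 - a) = N" using a by simp
    finally show ?thesis .
  qed
  have grid: "g (m * L) = \<gamma> (t + real m * \<tau>)" for m using L by (simp add: g_def)
  have g0: "g 0 = \<gamma> t" by (simp add: g_def)
  have past: "?e + (\<Sum>i<j. of_real (- 1 / sqrt L) * x (a * L - Suc i)) = ?e + (g (a * L - j) - g (a * L)) / of_real (sqrt \<tau>)" if "j \<le> a * L" for j
  proof -
    have "(\<Sum>i<j. of_real (- 1 / sqrt L) * x (a * L - Suc i)) = (\<Sum>i<j. (g (a * L - Suc i) - g (a * L - i)) / of_real (sqrt \<tau>))"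
    proof (intro sum.cong refl)
      fix i assume "i \<in> {..<j}"
      then have i: "i < a * L" using that by simp
      then have S: "Suc (a * L - Suc i) = a * L - i" by simp
      have "of_real (- 1 / sqrt L) * x (a * L - Suc i) = - of_real (sqrt (real L / \<tau>) / sqrt (real L)) * (g (a * L - i) - g (a * L - Suc i))"
      proof -
        have "a * L - Suc i < N * L" using i aLN by linarith
        from x'[OF this] show ?thesis unfolding S by (simp add: of_real_divide)
      qed
      also have "\<dots> = (g (a * L - Suc i) - g (a * L - i)) / of_real (sqrt \<tau>)" unfolding sq by (simp add: diff_divide_distrib)
      finally show "of_real (- 1 / sqrt L) * x (a * L - Suc i) = (g (a * L - Suc i) - g (a * L - i)) / of_real (sqrt \<tau>)" .
    qed
    also have "\<dots> = (g (a * L - j) - g (a * L)) / of_real (sqrt \<tau>)"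
      using sum_lessThan_telescope[of "\<lambda>i. g (a * L - i)" j] by (simp flip: sum_divide_distrib)
    finally show ?thesis by simp
  qed
  have fut: "?e * cis \<beta> + (\<Sum>i<j. of_real (1 / sqrt L) * x ((a + 1) * L + i)) = ?e * cis \<beta> + (g ((a + 1) * L + j) - g ((a + 1) * L)) / of_real (sqrt \<tau>)"
    if "j \<le> (N - 1 - a) * L" for j
  proof -
    have "(\<Sum>i<j. of_real (1 / sqrt L) * x ((a + 1) * L + i)) = (\<Sum>i<j. (g (Suc ((a + 1) * L + i)) - g ((a + 1) * L + i)) / of_real (sqrt \<tau>))"
    proof (intro sum.cong refl)
      fix i assume "i \<in> {..<j}"
      then have i: "(a + 1) * L + i < N * L" using that NL by simp
      have "of_real (1 / sqrt L) * x ((a + 1) * L + i) = of_real (sqrt (real L / \<tau>) / sqrt (real L)) * (g (Suc ((a + 1) * L + i)) - g ((a + 1) * L + i))"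
        using x'[OF i] by (simp add: of_real_divide)
      also have "\<dots> = (g (Suc ((a + 1) * L + i)) - g ((a + 1) * L + i)) / of_real (sqrt \<tau>)" unfolding sq by (simp add: field_simps)
      finally show "of_real (1 / sqrt L) * x ((a + 1) * L + i) = (g (Suc ((a + 1) * L + i)) - g ((a + 1) * L + i)) / of_real (sqrt \<tau>)" .
    qed
    also have "\<dots> = (g ((a + 1) * L + j) - g ((a + 1) * L)) / of_real (sqrt \<tau>)"
      using sum_lessThan_telescope[of "\<lambda>i. g ((a + 1) * L + i)" j] by (simp flip: sum_divide_distrib)
    finally show ?thesis by simp
  qed
  have scaled: "cmod (X - of_real (sqrt (real N * \<tau>)) * c - (Y - of_real (sqrt \<tau>) * c)) \<le> \<rho> * sqrt (real N * \<tau>)"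
    if "c + (X - Y) / of_real (sqrt \<tau>) \<in> cball (of_real (sqrt N) * c) (\<rho> * sqrt N)" for X Y c
  proof -
    have "X - of_real (sqrt (real N * \<tau>)) * c - (Y - of_real (sqrt \<tau>) * c) = of_real (sqrt \<tau>) * (c + (X - Y) / of_real (sqrt \<tau>) - of_real (sqrt N) * c)"
    proof -
      have "(of_real (sqrt \<tau>) :: complex) \<noteq> 0" using s\<tau> by simp
      then show ?thesis unfolding sN by (simp add: right_diff_distrib distrib_left mult_ac del: of_real_eq_0_iff)
    qed
    then have "cmod (X - of_real (sqrt (real N * \<tau>)) * c - (Y - of_real (sqrt \<tau>) * c)) = sqrt \<tau> * cmod (c + (X - Y) / of_real (sqrt \<tau>) - of_real (sqrt N) * c)"
      using \<tau> by (simp add: norm_mult)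
    also have "\<dots> \<le> sqrt \<tau> * (\<rho> * sqrt N)" using that s\<tau> by (intro mult_left_mono) (auto simp: dist_norm norm_minus_commute)
    finally show ?thesis unfolding sN by (simp add: mult_ac)
  qed
  have "level_ok s l n b \<beta> \<rho> N \<gamma> t \<tau> a A (\<lambda>r. \<exists>i. r = t + real i * (\<tau> / real L))"
    unfolding level_ok_def
  proof (intro conjI ballI impI A)
    fix r assume r: "r \<in> {t..t + real a * \<tau>}" "\<exists>i. r = t + real i * (\<tau> / real L)"
    then obtain i where i: "r = t + real i * (\<tau> / real L)" by blast
    then have "real i * \<tau> \<le> real (a * L) * \<tau>" using r(1) L by (simp add: pos_divide_le_eq mult_ac)
    from mult_right_le_imp_le[OF this \<tau>] have iL: "i \<le> a * L" by (simp only: of_nat_le_iff)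
    then have "?e + (g (a * L - (a * L - i)) - g (a * L)) / of_real (sqrt \<tau>) \<in> shape s l n A b 0 (ln (real N) / 2 - 1)"
      using P past[of "a * L - i"] unfolding past_event_def walk_in_def by (metis diff_le_self)
    moreover have "a * L - (a * L - i) = i" using iL by simp
    ultimately show "?e + (\<gamma> r - \<gamma> (t + real a * \<tau>)) / of_real (sqrt \<tau>) \<in> shape s l n A b 0 (ln (real N) / 2 - 1)"
      by (simp only: grid i g_def[of i, symmetric])
  next
    fix r assume r: "r \<in> {t + real (a + 1) * \<tau>..t + real N * \<tau>}" "\<exists>i. r = t + real i * (\<tau> / real L)"
    then obtain i where i: "r = t + real i * (\<tau> / real L)" by blast
    have "real (a + 1) * \<tau> \<le> real i * \<tau> / real L" "real i * \<tau> / real L \<le> real N * \<tau>" using r(1) unfolding i by simp_all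
    then have "real (a + 1) * \<tau> * real L \<le> real i * \<tau>" "real i * \<tau> \<le> real N * \<tau> * real L"
      using L by (simp_all only: pos_divide_le_eq pos_le_divide_eq of_nat_0_less_iff)
    moreover have "real (a + 1) * \<tau> * real L = real ((a + 1) * L) * \<tau>" "real N * \<tau> * real L = real (N * L) * \<tau>" by (simp_all add: algebra_simps)
    ultimately have i\<tau>: "real ((a + 1) * L) * \<tau> \<le> real i * \<tau>" "real i * \<tau> \<le> real (N * L) * \<tau>" by (simp_all only:)
    have iL: "(a + 1) * L \<le> i" "i \<le> N * L"
      using mult_right_le_imp_le[OF i\<tau>(1) \<tau>] mult_right_le_imp_le[OF i\<tau>(2) \<tau>] by (simp_all only: of_nat_le_iff)
    then have "i - (a + 1) * L \<le> (N - 1 - a) * L" using NL by linarith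
    then have "?e * cis \<beta> + (g ((a + 1) * L + (i - (a + 1) * L)) - g ((a + 1) * L)) / of_real (sqrt \<tau>) \<in> shape s l n A b \<beta> (ln (real N) / 2 - 1)"
      using Fu fut[of "i - (a + 1) * L"] unfolding future_event_def walk_in_def by metis
    moreover have "(a + 1) * L + (i - (a + 1) * L) = i" using iL by simp
    ultimately show "?e * cis \<beta> + (\<gamma> r - \<gamma> (t + real (a + 1) * \<tau>)) / of_real (sqrt \<tau>) \<in> shape s l n A b \<beta> (ln (real N) / 2 - 1)"
      by (simp only: grid i g_def[of i, symmetric])
  next
    have "?e + (g 0 - g (a * L)) / of_real (sqrt \<tau>) \<in> cball (of_real (sqrt N) * ?e) (\<rho> * sqrt N)"
      using P past[of "a * L"] unfolding past_event_def walk_in_def by simp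
    from scaled[OF this] show "cmod (\<gamma> t - of_real (sqrt (real N * \<tau>) * exp (-2)) - (\<gamma> (t + real a * \<tau>) - of_real (sqrt \<tau> * exp (-2)))) \<le> \<rho> * sqrt (real N * \<tau>)"
      by (simp only: g0 grid of_real_mult)
  next
    have "?e * cis \<beta> + (g (N * L) - g ((a + 1) * L)) / of_real (sqrt \<tau>) \<in> cball (of_real (sqrt N) * (?e * cis \<beta>)) (\<rho> * sqrt N)"
      using Fu fut[of "(N - 1 - a) * L"] unfolding future_event_def walk_in_def NL by (simp add: mult.assoc)
    from scaled[OF this] show "cmod (\<gamma> (t + real N * \<tau>) - of_real (sqrt (real N * \<tau>) * exp (-2)) * cis \<beta> - (\<gamma> (t + real (a + 1) * \<tau>) - of_real (sqrt \<tau> * exp (-2)) * cis \<beta>)) \<le> \<rho> * sqrt (real N * \<tau>)"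
      by (simp only: grid of_real_mult mult.assoc)
  qed
  then show ?thesis by blast
qed

lemma closed_grid_limit:
  fixes \<gamma> :: "real \<Rightarrow> complex"
  assumes c: "continuous_on {p..q} \<gamma>" and r: "r \<in> {p..q}" and S: "closed S" and f: "continuous_on UNIV f"
    and app: "\<And>e. e > 0 \<Longrightarrow> \<exists>r'\<in>{p..q}. \<bar>r' - r\<bar> < e \<and> f (\<gamma> r') \<in> S"
  shows "f (\<gamma> r) \<in> (S :: complex set)"
proof -
  have cf: "continuous_on {p..q} (\<lambda>x. f (\<gamma> x))" using c continuous_on_compose2[OF f] by blast
  have "\<exists>y\<in>S. dist y (f (\<gamma> r)) < e" if "e > 0" for e
  proof -
    obtain d where d: "d > 0" "\<And>r'. r' \<in> {p..q} \<Longrightarrow> dist r' r < d \<Longrightarrow> dist (f (\<gamma> r')) (f (\<gamma> r)) < e"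
      using cf r \<open>e > 0\<close> unfolding continuous_on_iff by blast
    then show ?thesis using app[OF d(1)] by (force simp: dist_real_def)
  qed
  then show ?thesis using closed_approachable[OF S] by blast
qed

text \<open>There are finitely many zigzags, so a single A occurs for infinitely many L. The grids
  of these L come arbitrarily close to every time, and membership in the closed shapes passes to the
  limit.\<close>

lemma level_ok_limit:
  assumes c: "continuous_on {0..1} \<gamma>" and t: "0 \<le> t" "t + real N * \<tau> \<le> 1" and \<tau>: "\<tau> > 0" and a: "a < N"
    and inf: "infinite {L. L > 0 \<and> (\<exists>A. level_ok s l n b \<beta> \<rho> N \<gamma> t \<tau> a A (\<lambda>r. \<exists>i::nat. r = t + real i * (\<tau> / real L)))}"
  shows "\<exists>A. level_ok s l n b \<beta> \<rho> N \<gamma> t \<tau> a A (\<lambda>_. True)"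
proof -
  let ?R = "\<lambda>L A. level_ok s l n b \<beta> \<rho> N \<gamma> t \<tau> a A (\<lambda>r. \<exists>i::nat. r = t + real i * (\<tau> / real L))"
  have "\<exists>A\<in>{A. A \<subseteq> {..<2*n}}. infinite {L \<in> {L. L > 0 \<and> (\<exists>A. ?R L A)}. ?R L A}"
  proof (rule pigeonhole_infinite_rel[OF inf])
    show "\<forall>L\<in>{L. L > 0 \<and> (\<exists>A. ?R L A)}. \<exists>A\<in>{A. A \<subseteq> {..<2*n}}. ?R L A" by (auto simp: level_ok_def)
  qed simp
  then obtain A where "infinite {L \<in> {L. L > 0 \<and> (\<exists>A. ?R L A)}. ?R L A}" by blast
  then have many: "\<exists>L>m. L > 0 \<and> ?R L A" for m unfolding infinite_nat_iff_unbounded by blast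
  from many[of 0] obtain L0 where L0: "?R L0 A" by blast
  have approx: "\<exists>i. t + real m * \<tau> \<le> t + real i * (\<tau> / real L) \<and> t + real i * (\<tau> / real L) \<le> r \<and> r < t + real i * (\<tau> / real L) + \<tau> / real L"
    if r: "t + real m * \<tau> \<le> r" and L: "L > 0" for r and L m :: nat
  proof -
    define w where "w = \<tau> / real L"
    have w: "w > 0" "\<tau> = real L * w" using \<tau> L by (auto simp: w_def)
    define i where "i = nat \<lfloor>(r - t) / w\<rfloor>"
    have m: "real (m * L) * w \<le> r - t" using r by (simp add: w(2) mult.assoc)
    then have mq: "real (m * L) \<le> (r - t) / w" using w by (simp only: pos_le_divide_eq)
    then have "0 \<le> (r - t) / w" using of_nat_0_le_iff order_trans by blast
    then have fl: "real i \<le> (r - t) / w" "(r - t) / w < real i + 1" unfolding i_def by linarith+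
    then have "real (m * L) < real (i + 1)" using mq by simp
    then have "real (m * L) \<le> real i" by (simp only: of_nat_less_iff of_nat_le_iff)
    then have "real (m * L) * w \<le> real i * w" using w by (intro mult_right_mono) auto
    moreover have "real (m * L) * w = real m * \<tau>" by (simp add: w(2))
    moreover have "real i * w \<le> r - t" "r - t < (real i + 1) * w"
      using fl w by (simp_all only: pos_le_divide_eq pos_divide_less_eq)
    moreover have "(real i + 1) * w = real i * w + w" by (simp only: distrib_right mult_1)
    ultimately have "t + real m * \<tau> \<le> t + real i * w \<and> t + real i * w \<le> r \<and> r < t + real i * w + w" by linarith
    then show ?thesis unfolding w_def by blast
  qed
  define R where "R L = ?R L A" for L
  define K where "K r' \<longleftrightarrow> (\<exists>L>0. R L \<and> (\<exists>i::nat. r' = t + real i * (\<tau> / real L)))" for r'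
  have K_past: "of_real (exp (-2)) + (\<gamma> r' - \<gamma> (t + real a * \<tau>)) / of_real (sqrt \<tau>) \<in> shape s l n A b 0 (ln (real N) / 2 - 1)"
    if Kr: "K r'" and r': "r' \<in> {t..t + real a * \<tau>}" for r'
  proof -
    obtain L i where RL: "R L" and i: "r' = t + real i * (\<tau> / real L)" using Kr unfolding K_def by blast
    show ?thesis by (rule RL[unfolded R_def level_ok_def, THEN conjunct2, THEN conjunct2, THEN conjunct1, rule_format, OF r']) (rule exI[of _ i], rule i)
  qed
  have K_future: "of_real (exp (-2)) * cis \<beta> + (\<gamma> r' - \<gamma> (t + real (a + 1) * \<tau>)) / of_real (sqrt \<tau>) \<in> shape s l n A b \<beta> (ln (real N) / 2 - 1)"
    if Kr: "K r'" and r': "r' \<in> {t + real (a + 1) * \<tau>..t + real N * \<tau>}" for r'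
  proof -
    obtain L i where RL: "R L" and i: "r' = t + real i * (\<tau> / real L)" using Kr unfolding K_def by blast
    show ?thesis by (rule RL[unfolded R_def level_ok_def, THEN conjunct2, THEN conjunct2, THEN conjunct2, THEN conjunct1, rule_format, OF r']) (rule exI[of _ i], rule i)
  qed
  \<comment> \<open>The approximating grid times lie to the left of r but not before the start of
    the interval under consideration, so the shape condition of that interval applies to
    them.\<close>
  have app: "\<exists>r'\<in>{t + real m * \<tau>..r}. \<bar>r' - r\<bar> < e \<and> K r'"
    if r: "t + real m * \<tau> \<le> r" and e: "e > 0" for r e m
  proof -
    obtain M :: nat where M: "\<tau> / e < real M" using reals_Archimedean2 by blast
    obtain L where L: "L > M" "L > 0" "?R L A" using many[of M] by blast
    have "\<tau> / e < real L" using M L(1) by linarith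
    then have small: "\<tau> / real L < e" using e L(2) by (simp add: pos_divide_less_eq mult.commute)
    obtain i where i: "t + real m * \<tau> \<le> t + real i * (\<tau> / real L)" "t + real i * (\<tau> / real L) \<le> r" "r < t + real i * (\<tau> / real L) + \<tau> / real L"
      using approx[OF r L(2)] by blast
    have gen: "\<exists>r'\<in>{c..r}. \<bar>r' - r\<bar> < e \<and> Q r'" if "u < e" "c \<le> z" "z \<le> r" "r < z + u" "Q z" for u c z Q
      using that by (intro bexI[of _ z]) auto
    show ?thesis
      unfolding K_def R_def by (rule gen[OF small i]) (intro exI[of _ L] exI[of _ i] conjI L(2,3) refl)
  qed
  have "real a * \<tau> \<le> real N * \<tau>" "0 \<le> real a * \<tau>" "0 \<le> real (a + 1) * \<tau>"
    using a \<tau> by (auto intro!: mult_right_mono)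
  then have Na: "t + real a * \<tau> \<le> 1" "t + real a * \<tau> \<le> t + real N * \<tau>" "0 \<le> real a * \<tau>" "0 \<le> real (a + 1) * \<tau>"
    using t(2) by linarith+
  have "level_ok s l n b \<beta> \<rho> N \<gamma> t \<tau> a A (\<lambda>_. True)"
    unfolding level_ok_def
  proof (intro conjI ballI impI)
    fix r assume r: "r \<in> {t..t + real a * \<tau>}"
    show "of_real (exp (-2)) + (\<gamma> r - \<gamma> (t + real a * \<tau>)) / of_real (sqrt \<tau>) \<in> shape s l n A b 0 (ln (real N) / 2 - 1)"
    proof (rule closed_grid_limit[where f = "\<lambda>z. of_real (exp (-2)) + (z - \<gamma> (t + real a * \<tau>)) / of_real (sqrt \<tau>)", OF c _ closed_shape])
      show "r \<in> {0..1}" using r t(1) Na by auto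
      show "continuous_on UNIV (\<lambda>z. of_real (exp (-2)) + (z - \<gamma> (t + real a * \<tau>)) / of_real (sqrt \<tau>))"
        using \<tau> by (intro continuous_intros) auto
      fix e :: real assume e: "e > 0"
      have "t + real 0 * \<tau> \<le> r" using r by simp
      from app[OF this e] obtain r' where r': "r' \<in> {t + real 0 * \<tau>..r}" "\<bar>r' - r\<bar> < e" and K: "K r'" by blast
      have "r' \<in> {t..t + real a * \<tau>}" using r r' by auto
      note K_past[OF K this]
      moreover have "r' \<in> {0..1}" using r r' t(1) Na by auto
      ultimately show "\<exists>r'\<in>{0..1}. \<bar>r' - r\<bar> < e \<and> of_real (exp (-2)) + (\<gamma> r' - \<gamma> (t + real a * \<tau>)) / of_real (sqrt \<tau>) \<in> shape s l n A b 0 (ln (real N) / 2 - 1)"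
        using r'(2) by (auto intro!: bexI[of _ r'])
    qed
  next
    fix r assume r: "r \<in> {t + real (a + 1) * \<tau>..t + real N * \<tau>}"
    show "of_real (exp (-2)) * cis \<beta> + (\<gamma> r - \<gamma> (t + real (a + 1) * \<tau>)) / of_real (sqrt \<tau>) \<in> shape s l n A b \<beta> (ln (real N) / 2 - 1)"
    proof (rule closed_grid_limit[where f = "\<lambda>z. of_real (exp (-2)) * cis \<beta> + (z - \<gamma> (t + real (a + 1) * \<tau>)) / of_real (sqrt \<tau>)", OF c _ closed_shape])
      show "r \<in> {0..1}" using r t Na by auto
      show "continuous_on UNIV (\<lambda>z. of_real (exp (-2)) * cis \<beta> + (z - \<gamma> (t + real (a + 1) * \<tau>)) / of_real (sqrt \<tau>))"
        using \<tau> by (intro continuous_intros) auto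
      fix e :: real assume e: "e > 0"
      have "t + real (a + 1) * \<tau> \<le> r" using r by simp
      from app[OF this e] obtain r' where r': "r' \<in> {t + real (a + 1) * \<tau>..r}" "\<bar>r' - r\<bar> < e" and K: "K r'" by blast
      have "r' \<in> {t + real (a + 1) * \<tau>..t + real N * \<tau>}" using r r' by auto
      note K_future[OF K this]
      moreover have "r' \<in> {0..1}" using r r' t Na by auto
      ultimately show "\<exists>r'\<in>{0..1}. \<bar>r' - r\<bar> < e \<and> of_real (exp (-2)) * cis \<beta> + (\<gamma> r' - \<gamma> (t + real (a + 1) * \<tau>)) / of_real (sqrt \<tau>) \<in> shape s l n A b \<beta> (ln (real N) / 2 - 1)"
        using r'(2) by (auto intro!: bexI[of _ r'])
    qed
  qed (rule L0[unfolded level_ok_def, THEN conjunct1] L0[unfolded level_ok_def, THEN conjunct2, THEN conjunct1]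
      L0[unfolded level_ok_def, THEN conjunct2, THEN conjunct2, THEN conjunct2, THEN conjunct2, THEN conjunct1]
      L0[unfolded level_ok_def, THEN conjunct2, THEN conjunct2, THEN conjunct2, THEN conjunct2, THEN conjunct2])+
  then show ?thesis by blast
qed

section \<open>Nested cells, encoded by base N digits, and their limit times\<close>

definition partial_time :: "nat \<Rightarrow> real \<Rightarrow> real \<Rightarrow> (nat \<Rightarrow> nat) \<Rightarrow> nat \<Rightarrow> real" where
  "partial_time N u h a k = u + h * (\<Sum>j<k. real (a j) / real N ^ Suc j)"

definition word_time :: "nat \<Rightarrow> real \<Rightarrow> real \<Rightarrow> (nat \<Rightarrow> nat) \<Rightarrow> real" where
  "word_time N u h a = lim (partial_time N u h a)"

context pivot_parameters
begin

text \<open>The shape in logarithmic coordinates after recentring. A shift by at most 2 \<rho> of a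
  point of modulus at least exp (-3) changes both coordinates by at most 4 exp 3 \<rho> <= 1/2, and
  hence the zigzag by at most s times as much.\<close>

definition near_shape :: "nat set \<Rightarrow> real \<Rightarrow> complex \<Rightarrow> bool" where
  "near_shape A \<beta> \<xi> \<longleftrightarrow> A \<subseteq> {..<2*n} \<and> card A = n \<and> - (7/2) \<le> Re \<xi> \<and> Re \<xi> \<le> ln (real N) / 2 - 1/2 \<and>
     \<bar>Im \<xi> - \<beta> - zigzag s l (2 * n) A (Re \<xi>)\<bar> \<le> b + (1 + s) * (4 * exp 3 * \<rho>)"

lemma sqrt_N: "2 \<le> sqrt N"
proof -
  have "0 \<le> real (2 * n) * l" using l by simp
  then have "exp 1 \<le> exp (real (2*n) * l + 5)" by simp
  moreover have "(2::real) \<le> exp 1" using exp_ge_add_one_self[of "1::real"] by simp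
  ultimately show ?thesis using N by linarith
qed

lemma N_gt_1: "1 < N"
proof (rule ccontr)
  assume "\<not> 1 < N"
  then have "real N \<le> 1" by simp
  then have "sqrt N \<le> 1" by simp
  then show False using sqrt_N by linarith
qed

lemma ln_N: "real (2*n) * l + 5 \<le> ln (real N) / 2"
proof -
  have "ln (exp (real (2*n) * l + 5)) \<le> ln (sqrt N)" using N N_gt_1 by (subst ln_le_cancel_iff) auto
  then show ?thesis using N_gt_1 by (simp add: ln_sqrt)
qed

lemma perturbed_shape:
  assumes A: "A \<subseteq> {..<2*n}" "card A = n" and w: "w \<in> shape s l n A b \<beta> (ln (real N) / 2 - 1)" and \<delta>: "cmod \<delta> \<le> 2 * \<rho>"
  shows "\<exists>\<xi>. w + \<delta> = exp \<xi> \<and> near_shape A \<beta> \<xi>"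
proof -
  obtain \<zeta> where \<zeta>: "w = exp \<zeta>" "-3 \<le> Re \<zeta>" "Re \<zeta> \<le> ln (real N) / 2 - 1" "\<bar>Im \<zeta> - \<beta> - zigzag s l (2 * n) A (Re \<zeta>)\<bar> \<le> b"
    using w unfolding shape_def by blast
  define r where "r = 2 * \<rho> * exp 3"
  have "\<rho> * exp 3 \<le> exp (-3) / 8 * exp 3" using \<rho>(2) by (intro mult_right_mono) auto
  also have "\<dots> = 1/8" by (simp add: exp_minus)
  finally have r: "r \<le> 1/4" "r \<ge> 0" using \<rho>(1) by (auto simp: r_def)
  have "2 * \<rho> = r * exp (-3)" by (simp add: r_def exp_minus)
  also have "\<dots> \<le> r * cmod (exp \<zeta>)" using r \<zeta>(2) by (intro mult_left_mono) auto
  finally have "cmod \<delta> \<le> r * cmod (exp \<zeta>)" using \<delta> by simp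
  from exp_perturbation[OF this] r
  obtain \<xi> where \<xi>: "exp \<zeta> + \<delta> = exp \<xi>" "\<bar>Re \<xi> - Re \<zeta>\<bar> \<le> 2 * r" "\<bar>Im \<xi> - Im \<zeta>\<bar> \<le> 2 * r" by auto
  have "\<bar>zigzag s l (2*n) A (Re \<zeta>) - zigzag s l (2*n) A (Re \<xi>)\<bar> \<le> s * \<bar>Re \<zeta> - Re \<xi>\<bar>"
    using zigzag_lipschitz[OF l, of s "2*n" A "Re \<zeta>" "Re \<xi>"] s by simp
  also have "\<dots> \<le> s * (2 * r)" using \<xi>(2) s by (intro mult_left_mono) auto
  finally have "\<bar>Im \<xi> - \<beta> - zigzag s l (2 * n) A (Re \<xi>)\<bar> \<le> b + 2 * r + s * (2 * r)" using \<zeta>(4) \<xi>(3) by linarith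
  also have "b + 2 * r + s * (2 * r) = b + (1 + s) * (4 * exp 3 * \<rho>)" by (simp add: r_def algebra_simps)
  finally have "near_shape A \<beta> \<xi>" unfolding near_shape_def using A \<xi>(2) \<zeta>(2,3) r by auto
  then show ?thesis using \<xi>(1) \<zeta>(1) by auto
qed

text \<open>On the same level the zigzags agree. On different levels equal moduli occur only after
  the zigzag part of one shape and before that of the other, as ln N / 2 exceeds 2 n l by 5, and
  both zigzags are 0 there. So only the turn of the strips remains, and their half-widths add up to
  less than pi - \<alpha> / 2.\<close>

lemma rotated_shapes_disjoint:
  assumes \<phi>: "0 \<le> \<phi>" "\<phi> \<le> \<alpha>" and h: "h > 0"
    and eq: "of_real (sqrt (h / real N ^ k)) * exp \<xi> = cis \<phi> * (of_real (sqrt (h / real N ^ j)) * exp \<zeta>)"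
    and \<xi>: "near_shape A (pi + \<alpha> / 2) \<xi>" and \<zeta>: "near_shape A' 0 \<zeta>" and kj: "k = j \<Longrightarrow> A = A'"
  shows False
proof -
  define \<Lambda> where "\<Lambda> = ln (real N) / 2"
  have Npos: "real N > 0" using N_gt_1 by simp
  have scale: "sqrt (h / real N ^ i) = exp (ln h / 2 - real i * \<Lambda>)" for i
  proof -
    have "sqrt (h / real N ^ i) = exp (ln (sqrt (h / real N ^ i)))" using h Npos by simp
    also have "ln (sqrt (h / real N ^ i)) = ln h / 2 - real i * \<Lambda>"
      using h Npos by (simp add: ln_sqrt ln_div ln_realpow \<Lambda>_def diff_divide_distrib)
    finally show ?thesis .
  qed
  have "exp (of_real (ln h / 2 - real k * \<Lambda>) + \<xi>) = exp (\<i> * of_real \<phi> + of_real (ln h / 2 - real j * \<Lambda>) + \<zeta>)"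
    using eq unfolding scale cis_conv_exp exp_of_real[symmetric] by (simp add: exp_add mult.assoc)
  then obtain m :: int where m: "of_real (ln h / 2 - real k * \<Lambda>) + \<xi> = \<i> * of_real \<phi> + of_real (ln h / 2 - real j * \<Lambda>) + \<zeta> + of_real (of_int (2 * m) * pi) * \<i>"
    unfolding exp_eq by blast
  have re: "Re \<xi> - real k * \<Lambda> = Re \<zeta> - real j * \<Lambda>" using arg_cong[OF m, of Re] by simp
  have im: "Im \<xi> = \<phi> + Im \<zeta> + 2 * of_int m * pi" using arg_cong[OF m, of Im] by simp
  have L: "real (2*n) * l + 5 \<le> \<Lambda>" "0 \<le> real (2*n) * l" using ln_N l by (auto simp: \<Lambda>_def)
  have b1: "- (7/2) \<le> Re \<xi>" "Re \<xi> \<le> \<Lambda> - 1/2" "A \<subseteq> {..<2*n}" "card A = n" using \<xi> by (auto simp: near_shape_def \<Lambda>_def)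
  have b2: "- (7/2) \<le> Re \<zeta>" "Re \<zeta> \<le> \<Lambda> - 1/2" "A' \<subseteq> {..<2*n}" "card A' = n" using \<zeta> by (auto simp: near_shape_def \<Lambda>_def)
  have gap: "real i * \<Lambda> + \<Lambda> \<le> real i' * \<Lambda>" if "i < i'" for i i' :: nat
  proof -
    have "0 \<le> \<Lambda>" using L by linarith
    then have "real (Suc i) * \<Lambda> \<le> real i' * \<Lambda>" using that by (intro mult_right_mono) auto
    then show ?thesis by (simp add: algebra_simps)
  qed
  have zz: "zigzag s l (2*n) A (Re \<xi>) = zigzag s l (2*n) A' (Re \<zeta>)"
  proof -
    consider "k = j" | "k < j" | "j < k" by linarith
    then show ?thesis
    proof cases
      case 1
      then show ?thesis using kj re by simp
    next
      case 2
      have "Re \<xi> \<le> 0" "real (2*n) * l \<le> Re \<zeta>" using gap[OF 2] re b1 b2 L by linarith+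
      then show ?thesis using zigzag_nonpos[OF l] zigzag_balanced[OF l b2(3,4)] by simp
    next
      case 3
      have "Re \<zeta> \<le> 0" "real (2*n) * l \<le> Re \<xi>" using gap[OF 3] re b1 b2 L by linarith+
      then show ?thesis using zigzag_nonpos[OF l] zigzag_balanced[OF l b1(3,4)] by simp
    qed
  qed
  define B where "B = b + (1 + s) * (4 * exp 3 * \<rho>)"
  have B: "2 * B < pi - \<alpha> / 2" using \<rho>(3) sl by (simp add: B_def)
  have "\<bar>Im \<xi> - (pi + \<alpha> / 2) - zigzag s l (2*n) A (Re \<xi>)\<bar> \<le> B" "\<bar>Im \<zeta> - 0 - zigzag s l (2*n) A' (Re \<zeta>)\<bar> \<le> B"
    using \<xi> \<zeta> by (auto simp: near_shape_def B_def)
  then have c: "\<bar>\<phi> + 2 * of_int m * pi - (pi + \<alpha> / 2)\<bar> \<le> 2 * B" using im zz by linarith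
  show False
  proof (cases "m \<le> 0")
    case True
    then have "2 * of_int m * pi \<le> 0" by (simp add: mult_nonpos_nonneg)
    then show False using c B \<phi> by linarith
  next
    case False
    then have "2 * 1 * pi \<le> 2 * of_int m * pi" by (intro mult_right_mono) auto
    then show False using c B \<phi> \<alpha> by linarith
  qed
qed

definition good_limit :: "(real \<Rightarrow> complex) \<Rightarrow> real \<Rightarrow> real \<Rightarrow> (nat \<Rightarrow> nat) \<Rightarrow> bool" where
  "good_limit \<gamma> u h a \<longleftrightarrow> (\<forall>k. a k \<in> \<A> \<and>
     (\<exists>A. level_ok s l n b (pi + \<alpha> / 2) \<rho> N \<gamma> (partial_time N u h a k) (h / real N ^ Suc k) (a k) A (\<lambda>_. True)))"

section \<open>The path around the limit time of a good word\<close>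

context
  fixes \<gamma> :: "real \<Rightarrow> complex" and u h :: real
  assumes \<gamma>: "continuous_on {0..1} \<gamma>" and u: "0 \<le> u" "u + h \<le> 1" and h: "h > 0"
begin

abbreviation "S k \<equiv> sqrt (h / real N ^ k)"
abbreviation "t a k \<equiv> partial_time N u h a k"
abbreviation "t' a k \<equiv> t a k + h / real N ^ k"

lemma word_time_limit:
  assumes "good_limit \<gamma> u h a"
  shows "t a \<longlonglongrightarrow> word_time N u h a" "t' a \<longlonglongrightarrow> word_time N u h a"
    "t a k < word_time N u h a" "word_time N u h a < t' a k"
proof -
  have "1 \<le> a k \<and> a k < N - 1" for k using assms \<A>(1) by (force simp: good_limit_def)
  from nested_points[of h N a u, OF h N_gt_1 this]
  obtain T where T: "t a \<longlonglongrightarrow> T" "t' a \<longlonglongrightarrow> T" "\<And>k. t a k < T \<and> T < t' a k"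
    unfolding partial_time_def[abs_def] by blast
  have "word_time N u h a = T" unfolding word_time_def using T(1) by (rule limI)
  then show "t a \<longlonglongrightarrow> word_time N u h a" "t' a \<longlonglongrightarrow> word_time N u h a"
    "t a k < word_time N u h a" "word_time N u h a < t' a k" using T by auto
qed

lemma partial_time_steps:
  "t a 0 = u" "t' a 0 = u + h" "t a (Suc k) = t a k + real (a k) * (h / real N ^ Suc k)"
  "t' a (Suc k) = t a k + real (a k + 1) * (h / real N ^ Suc k)" "t' a k = t a k + real N * (h / real N ^ Suc k)"
proof -
  show 1: "t a (Suc k) = t a k + real (a k) * (h / real N ^ Suc k)" by (simp add: partial_time_def distrib_left)
  show "t' a (Suc k) = t a k + real (a k + 1) * (h / real N ^ Suc k)"
    unfolding 1 by (simp only: of_nat_add of_nat_1 distrib_right mult_1 add.assoc)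
qed (use N_gt_1 in \<open>simp_all add: partial_time_def\<close>)

lemma partial_time_bounds:
  assumes "good_limit \<gamma> u h a"
  shows "u \<le> t a k" "t' a k \<le> u + h" "t a k \<le> t a (Suc k)" "t' a (Suc k) \<le> t' a k"
proof -
  have ak: "a k < N" for k
  proof -
    have "a k \<in> {1..<N - 1}" using assms \<A>(1) unfolding good_limit_def by blast
    then have "a k < N - 1" by simp
    then show ?thesis by linarith
  qed
  have pos: "0 \<le> h / real N ^ k" for k using h by simp
  show 1: "t a k \<le> t a (Suc k)" for k unfolding partial_time_steps(3) using mult_nonneg_nonneg[OF of_nat_0_le_iff pos[of "Suc k"], of "a k"] by linarith
  show 2: "t' a (Suc k) \<le> t' a k" for k
    unfolding partial_time_steps(4) partial_time_steps(5)[of _ k] using ak[of k] pos[of "Suc k"] by (intro add_left_mono mult_right_mono) auto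
  show "u \<le> t a k"
    by (induction k) (use 1 order_trans partial_time_steps(1)[of a] in auto)
  show "t' a k \<le> u + h"
  proof (induction k)
    case (Suc k)
    then show ?case using 2[of k] by linarith
  qed (simp only: partial_time_steps(2))
qed

text \<open>Each level speaks about the path relative to its own centre, namely the path at an end
  of the cell minus the starting offset. From one level to the next the centres move by at most
  \<rho> S k, and they converge to the path at the limit time. So all shapes can be recentred there,
  at the price of a shift by 2 \<rho> in the units of the level.\<close>

lemma path_near_shape:
  assumes g: "good_limit \<gamma> u h a"
  shows "\<exists>A. (\<forall>r\<in>{t a k..t a (Suc k)}. \<exists>\<zeta>. \<gamma> r - \<gamma> (word_time N u h a) = of_real (S (Suc k)) * exp \<zeta> \<and> near_shape A 0 \<zeta>) \<and>
     (\<forall>r\<in>{t' a (Suc k)..t' a k}. \<exists>\<xi>. \<gamma> r - \<gamma> (word_time N u h a) = of_real (S (Suc k)) * exp \<xi> \<and> near_shape A (pi + \<alpha> / 2) \<xi>)"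
proof -
  let ?T = "word_time N u h a" and ?\<beta> = "pi + \<alpha> / 2"
  note wt = word_time_limit[OF g] and bd = partial_time_bounds[OF g]
  have Npos: "real N > 0" using N_gt_1 by simp
  have Spos: "S k > 0" for k using h Npos by simp
  have "\<exists>A. level_ok s l n b ?\<beta> \<rho> N \<gamma> (t a k) (h / real N ^ Suc k) (a k) A (\<lambda>_. True)" for k
    using g unfolding good_limit_def by blast
  then obtain A where lev: "\<And>k. level_ok s l n b ?\<beta> \<rho> N \<gamma> (t a k) (h / real N ^ Suc k) (a k) (A k) (\<lambda>_. True)" by metis
  have NS: "real N * (h / real N ^ Suc k) = h / real N ^ k" for k using Npos by simp
  note lev' = lev[unfolded level_ok_def partial_time_steps(3)[symmetric] partial_time_steps(4)[symmetric] partial_time_steps(5)[symmetric] NS]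
  have inI: "r \<in> {0..1}" if "t a k \<le> r" "r \<le> t' a k" for r k using that bd u by (meson atLeastAtMost_iff order_trans)
  have hk: "0 \<le> h / real N ^ k" for k using h by simp
  have tS: "t a k \<in> {0..1}" "t' a k \<in> {0..1}" for k using hk[of k] by (intro inI[of k]; linarith)+
  have TI: "?T \<in> {0..1}" using wt(3,4)[of 0] inI[of 0 ?T] by simp
  have lim: "(\<lambda>k. \<gamma> (t a k)) \<longlonglongrightarrow> \<gamma> ?T" "(\<lambda>k. \<gamma> (t' a k)) \<longlonglongrightarrow> \<gamma> ?T"
    using continuous_on_tendsto_compose[OF \<gamma> wt(1) TI] continuous_on_tendsto_compose[OF \<gamma> wt(2) TI] tS by auto
  have S0: "S \<longlonglongrightarrow> 0"
  proof -
    have "(\<lambda>k. sqrt (h * (1 / real N) ^ k)) \<longlonglongrightarrow> sqrt (h * 0)" using N_gt_1 by (intro tendsto_intros LIMSEQ_power_zero) auto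
    then show ?thesis by (simp add: power_one_over)
  qed
  have half: "S (Suc k) \<le> S k / 2" for k
  proof -
    have "S k = sqrt N * S (Suc k)" unfolding NS[of k, symmetric] by (rule real_sqrt_mult)
    then show ?thesis using mult_right_mono[OF sqrt_N, of "S (Suc k)"] Spos[of "Suc k"] by simp
  qed
  \<comment> \<open>The centres of the levels as seen from the past, and below from the future. The
    offsets tend to 0, so both sequences tend to the path at the limit time.\<close>
  define y where "y k = \<gamma> (t a k) - of_real (S k * exp (-2))" for k
  define y' where "y' k = \<gamma> (t' a k) - of_real (S k * exp (-2)) * cis ?\<beta>" for k
  have y: "cmod (y k - \<gamma> ?T) \<le> 2 * \<rho> * S k" for k
  proof (rule geometric_drift[where S = S and y = y, OF _ half])
    show "cmod (y (Suc k) - y k) \<le> \<rho> * S k" for k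
      unfolding y_def by (subst norm_minus_commute) (rule lev'[of k, THEN conjunct2, THEN conjunct2, THEN conjunct2, THEN conjunct2, THEN conjunct1])
    have "y \<longlonglongrightarrow> \<gamma> ?T - of_real (0 * exp (-2))" unfolding y_def by (intro tendsto_intros lim S0)
    then show "y \<longlonglongrightarrow> \<gamma> ?T" by simp
  qed (use \<rho>(1) Spos in \<open>auto intro: less_imp_le\<close>)
  have y': "cmod (y' k - \<gamma> ?T) \<le> 2 * \<rho> * S k" for k
  proof (rule geometric_drift[where S = S and y = y', OF _ half])
    show "cmod (y' (Suc k) - y' k) \<le> \<rho> * S k" for k
      unfolding y'_def by (subst norm_minus_commute) (rule lev'[of k, THEN conjunct2, THEN conjunct2, THEN conjunct2, THEN conjunct2, THEN conjunct2])
    have "y' \<longlonglongrightarrow> \<gamma> ?T - of_real (0 * exp (-2)) * cis ?\<beta>" unfolding y'_def by (intro tendsto_intros lim S0)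
    then show "y' \<longlonglongrightarrow> \<gamma> ?T" by simp
  qed (use \<rho>(1) Spos in \<open>auto intro: less_imp_le\<close>)
  have A: "A k \<subseteq> {..<2*n}" "card (A k) = n" using lev'[of k] by blast+
  have conv: "\<exists>\<xi>. X - \<gamma> ?T = of_real (S (Suc k)) * exp \<xi> \<and> near_shape (A k) \<beta>' \<xi>"
    if w: "c + (X - Y) / of_real (S (Suc k)) \<in> shape s l n (A k) b \<beta>' (ln (real N) / 2 - 1)"
      and d: "cmod (Y - of_real (S (Suc k)) * c - \<gamma> ?T) \<le> 2 * \<rho> * S (Suc k)" for X Y c \<beta>'
  proof -
    let ?s = "of_real (S (Suc k)) :: complex"
    have s: "?s \<noteq> 0" using Spos[of "Suc k"] by (simp only: of_real_eq_0_iff less_irrefl)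
    define \<delta> where "\<delta> = (Y - ?s * c - \<gamma> ?T) / ?s"
    have "cmod \<delta> \<le> 2 * \<rho>" using d Spos[of "Suc k"] unfolding \<delta>_def norm_divide by (simp only: norm_of_real abs_of_pos pos_divide_le_eq)
    from perturbed_shape[OF A w this] obtain \<xi> where \<xi>: "c + (X - Y) / ?s + \<delta> = exp \<xi>" "near_shape (A k) \<beta>' \<xi>" by blast
    have "?s * (c + (X - Y) / ?s + \<delta>) = X - \<gamma> ?T" using s by (simp only: \<delta>_def distrib_left nonzero_mult_div_cancel_left times_divide_eq_right) simp
    then show ?thesis using \<xi> by metis
  qed
  show ?thesis
  proof (intro exI[of _ "A k"] conjI ballI)
    fix r assume r: "r \<in> {t a k..t a (Suc k)}"
    have "of_real (exp (-2)) + (\<gamma> r - \<gamma> (t a (Suc k))) / of_real (S (Suc k)) \<in> shape s l n (A k) b 0 (ln (real N) / 2 - 1)"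
      using lev'[of k] r by blast
    moreover have "cmod (\<gamma> (t a (Suc k)) - of_real (S (Suc k)) * of_real (exp (-2)) - \<gamma> ?T) \<le> 2 * \<rho> * S (Suc k)"
      using y[of "Suc k"] by (simp only: y_def of_real_mult)
    ultimately show "\<exists>\<zeta>. \<gamma> r - \<gamma> ?T = of_real (S (Suc k)) * exp \<zeta> \<and> near_shape (A k) 0 \<zeta>" by (rule conv)
  next
    fix r assume r: "r \<in> {t' a (Suc k)..t' a k}"
    have "of_real (exp (-2)) * cis ?\<beta> + (\<gamma> r - \<gamma> (t' a (Suc k))) / of_real (S (Suc k)) \<in> shape s l n (A k) b ?\<beta> (ln (real N) / 2 - 1)"
      using lev'[of k] r by blast
    moreover have "cmod (\<gamma> (t' a (Suc k)) - of_real (S (Suc k)) * (of_real (exp (-2)) * cis ?\<beta>) - \<gamma> ?T) \<le> 2 * \<rho> * S (Suc k)"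
      using y'[of "Suc k"] by (simp only: y'_def of_real_mult mult.assoc)
    ultimately show "\<exists>\<xi>. \<gamma> r - \<gamma> ?T = of_real (S (Suc k)) * exp \<xi> \<and> near_shape (A k) ?\<beta> \<xi>" by (rule conv)
  qed
qed

text \<open>The differences of consecutive cells exhaust the times on both sides of the limit time.
  So a time before and a time after it are both described by \<open>path_near_shape\<close>,
  possibly at different levels, and \<open>rotated_shapes_disjoint\<close> covers all
  combinations.\<close>

lemma good_limit_pivoting:
  assumes g: "good_limit \<gamma> u h a"
  shows "\<gamma> (word_time N u h a) \<in> local_pivoting_points \<alpha> \<gamma>"
proof -
  let ?T = "word_time N u h a"
  note wt = word_time_limit[OF g] and bd = partial_time_bounds[OF g]
  from path_near_shape[OF g] obtain A where
    A: "\<And>k r. r \<in> {t a k..t a (Suc k)} \<Longrightarrow> \<exists>\<zeta>. \<gamma> r - \<gamma> ?T = of_real (S (Suc k)) * exp \<zeta> \<and> near_shape (A k) 0 \<zeta>"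
      "\<And>k r. r \<in> {t' a (Suc k)..t' a k} \<Longrightarrow> \<exists>\<xi>. \<gamma> r - \<gamma> ?T = of_real (S (Suc k)) * exp \<xi> \<and> near_shape (A k) (pi + \<alpha> / 2) \<xi>"
    by metis
  have past: "\<exists>k. r \<in> {t a k..t a (Suc k)}" if ur: "u \<le> r" and rT: "r < ?T" for r
  proof -
    define m where "m = (LEAST m. r < t a m)"
    obtain m0 where "r < t a m0" using order_tendstoD(1)[OF wt(1) rT] by (auto simp: eventually_sequentially)
    then have m: "r < t a m" unfolding m_def by (rule LeastI)
    then have "m \<noteq> 0" using ur by (metis not_less partial_time_steps(1))
    then obtain k where k: "m = Suc k" by (cases m) auto
    then have "\<not> r < t a k" using not_less_Least[of k "\<lambda>m. r < t a m"] by (simp add: m_def)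
    then show ?thesis using m k by (intro exI[of _ k]) auto
  qed
  have future: "\<exists>k. r \<in> {t' a (Suc k)..t' a k}" if ur: "r \<le> u + h" and rT: "?T < r" for r
  proof -
    define m where "m = (LEAST m. t' a m < r)"
    obtain m0 where "t' a m0 < r" using order_tendstoD(2)[OF wt(2) rT] by (auto simp: eventually_sequentially)
    then have m: "t' a m < r" unfolding m_def by (rule LeastI)
    then have "m \<noteq> 0" using ur by (metis not_less partial_time_steps(2))
    then obtain k where k: "m = Suc k" by (cases m) auto
    then have "\<not> t' a k < r" using not_less_Least[of k "\<lambda>m. t' a m < r"] by (simp add: m_def)
    then show ?thesis using m k by (intro exI[of _ k]) auto
  qed
  \<comment> \<open>Keeps both halves inside [u, u + h], the cell of level 0.\<close>
  define \<epsilon> where "\<epsilon> = min (?T - u) (u + h - ?T)"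
  have T: "u < ?T" "?T < u + h" using wt(3,4)[of 0] partial_time_steps(1,2) by auto
  have \<epsilon>: "\<epsilon> > 0" "u \<le> ?T - \<epsilon>" "?T + \<epsilon> \<le> u + h" using T by (auto simp: \<epsilon>_def)
  have "(\<lambda>r. \<gamma> r - \<gamma> ?T) ` {?T<..?T + \<epsilon>} \<inter> (unit_arc \<alpha> * ((\<lambda>r. \<gamma> r - \<gamma> ?T) ` {?T - \<epsilon>..<?T})) = {}"
  proof (rule ccontr)
    assume "\<not> ?thesis"
    then obtain r' r \<phi> where r': "r' \<in> {?T<..?T + \<epsilon>}" and r: "r \<in> {?T - \<epsilon>..<?T}" and \<phi>: "\<phi> \<in> {0..\<alpha>}"
      and eq: "\<gamma> r' - \<gamma> ?T = cis \<phi> * (\<gamma> r - \<gamma> ?T)"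
      unfolding unit_arc_def set_times_def by blast
    obtain k where k: "r' \<in> {t' a (Suc k)..t' a k}" using future[of r'] r' \<epsilon> by auto
    obtain j where j: "r \<in> {t a j..t a (Suc j)}" using past[of r] r \<epsilon> by auto
    obtain \<xi> where \<xi>: "\<gamma> r' - \<gamma> ?T = of_real (S (Suc k)) * exp \<xi>" "near_shape (A k) (pi + \<alpha> / 2) \<xi>" using A(2)[OF k] by blast
    obtain \<zeta> where \<zeta>: "\<gamma> r - \<gamma> ?T = of_real (S (Suc j)) * exp \<zeta>" "near_shape (A j) 0 \<zeta>" using A(1)[OF j] by blast
    show False
      by (rule rotated_shapes_disjoint[OF _ _ h _ \<xi>(2) \<zeta>(2), of \<phi> "Suc k" "Suc j"]) (use \<phi> eq \<xi>(1) \<zeta>(1) in auto)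
  qed
  moreover have "?T \<in> {0<..<1}" "0 \<le> ?T - \<epsilon>" "?T + \<epsilon> \<le> 1" using T \<epsilon> u by auto
  ultimately show ?thesis unfolding local_pivoting_points_def using \<epsilon>(1) by blast
qed

text \<open>At the first difference, the later of the two limit times falls into the part of level k
  after the cell selected by the earlier one. There \<open>near_shape\<close> bounds the log modulus
  of the difference from below by -7/2, in units of S (Suc k).\<close>

lemma good_limit_separated:
  assumes g: "good_limit \<gamma> u h a" "good_limit \<gamma> u h a'" and ne: "a k \<noteq> a' k" and eq: "\<And>j. j < k \<Longrightarrow> a j = a' j"
  shows "exp (- (7/2)) * sqrt (h / real N) * (1 / sqrt N) ^ k \<le> dist (\<gamma> (word_time N u h a)) (\<gamma> (word_time N u h a'))"
proof -
  have scale: "sqrt (h / real N) * (1 / sqrt N) ^ k = S (Suc k)"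
  proof -
    have "h / real N ^ Suc k = h / real N * (1 / real N) ^ k" by (simp add: power_one_over)
    then have "S (Suc k) = sqrt (h / real N * (1 / real N) ^ k)" by (simp only:)
    also have "\<dots> = sqrt (h / real N) * (sqrt (1 / real N)) ^ k" by (simp only: real_sqrt_mult real_sqrt_power)
    also have "sqrt (1 / real N) = 1 / sqrt N" by (simp only: real_sqrt_divide real_sqrt_one)
    finally show ?thesis ..
  qed
  have *: "exp (- (7/2)) * S (Suc k) \<le> dist (\<gamma> (word_time N u h a)) (\<gamma> (word_time N u h a'))"
    if g: "good_limit \<gamma> u h a" "good_limit \<gamma> u h a'" and lt: "a k < a' k" and eq: "\<And>j. j < k \<Longrightarrow> a j = a' j" for a a'
  proof -
    have tk: "t a k = t a' k" using eq by (simp add: partial_time_def)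
    have pos: "0 < h / real N ^ Suc k" using h N_gt_1 by simp
    have "real (a k + 1) * (h / real N ^ Suc k) \<le> real (a' k) * (h / real N ^ Suc k)" using lt pos by (intro mult_right_mono) auto
    then have "t' a (Suc k) \<le> t a' (Suc k)"
      unfolding partial_time_steps(4)[of a k] partial_time_steps(3)[of a' k] tk by (rule add_left_mono)
    then have "t' a (Suc k) \<le> word_time N u h a'" using word_time_limit(3)[OF g(2), of "Suc k"] by linarith
    moreover have "word_time N u h a' \<le> t' a k" using word_time_limit(4)[OF g(2), of k] unfolding tk by linarith
    ultimately obtain \<xi> A where \<xi>: "\<gamma> (word_time N u h a') - \<gamma> (word_time N u h a) = of_real (S (Suc k)) * exp \<xi>" "near_shape A (pi + \<alpha> / 2) \<xi>"
      using path_near_shape[OF g(1), of k] by (metis atLeastAtMost_iff)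
    have "dist (\<gamma> (word_time N u h a)) (\<gamma> (word_time N u h a')) = S (Suc k) * exp (Re \<xi>)"
    proof -
      have "dist (\<gamma> (word_time N u h a)) (\<gamma> (word_time N u h a')) = cmod (of_real (S (Suc k)) * exp \<xi>)"
        unfolding \<xi>(1)[symmetric] by (simp only: dist_norm norm_minus_commute)
      then show ?thesis using h by (simp add: norm_mult)
    qed
    moreover have "S (Suc k) * exp (- (7/2)) \<le> S (Suc k) * exp (Re \<xi>)" using \<xi>(2) h by (intro mult_left_mono) (auto simp: near_shape_def)
    ultimately show ?thesis by (simp only: mult.commute)
  qed
  show ?thesis
  proof (cases "a k < a' k")
    case True
    show ?thesis unfolding mult.assoc scale using *[OF g True eq] .
  next
    case False
    then have "a' k < a k" using ne by simp
    from *[OF g(2,1) this] show ?thesis unfolding mult.assoc scale by (subst dist_commute) (use eq in auto)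
  qed
qed

end
end

section \<open>Gaussian increments\<close>

lemma lborel_complex_eqI:
  assumes "sets M = sets borel"
    and "\<And>a b :: complex. Re a \<le> Re b \<Longrightarrow> Im a \<le> Im b \<Longrightarrow> emeasure M (box a b) = ennreal ((Re b - Re a) * (Im b - Im a))"
  shows "lborel = M"
proof (rule lborel_eqI)
  fix l u :: complex assume *: "\<And>b. b \<in> Basis \<Longrightarrow> l \<bullet> b \<le> u \<bullet> b"
  then have "Re l \<le> Re u" "Im l \<le> Im u" using *[of 1] *[of \<i>] by (auto simp: Basis_complex_def)
  from assms(2)[OF this] show "emeasure M (box l u) = ennreal (\<Prod>b\<in>Basis. (u - l) \<bullet> b)"
    by (simp add: Basis_complex_def)
qed (use assms in simp)

lemma emeasure_lborel_complex_box:
  assumes "Re a \<le> Re b" "Im a \<le> Im b"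
  shows "emeasure lborel (box a b :: complex set) = ennreal ((Re b - Re a) * (Im b - Im a))"
  using assms by (subst emeasure_lborel_box) (auto simp: Basis_complex_def)

lemma Complex_measurable:
  "sets M = sets borel \<Longrightarrow> sets N = sets borel \<Longrightarrow> (\<lambda>z. Complex (fst z) (snd z)) \<in> borel_measurable (M \<Otimes>\<^sub>M N)"
proof -
  assume [measurable_cong]: "sets M = sets borel" "sets N = sets borel"
  show ?thesis unfolding Complex_eq by measurable
qed

lemma lborel_complex_product: "lborel = distr (lborel \<Otimes>\<^sub>M lborel) borel (\<lambda>z. Complex (fst z) (snd z))"
proof (rule lborel_complex_eqI)
  have [simp, measurable]: "(\<lambda>z. Complex (fst z) (snd z)) \<in> borel_measurable (lborel \<Otimes>\<^sub>M lborel)"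
    by (rule Complex_measurable) simp_all
  fix a b :: complex assume ab: "Re a \<le> Re b" "Im a \<le> Im b"
  have "(\<lambda>z. Complex (fst z) (snd z)) -` box a b \<inter> space (lborel \<Otimes>\<^sub>M lborel) = {Re a<..<Re b} \<times> {Im a<..<Im b}"
    by (auto simp: box_def Basis_complex_def space_pair_measure)
  moreover have "emeasure (distr (lborel \<Otimes>\<^sub>M lborel) borel (\<lambda>z. Complex (fst z) (snd z))) (box a b)
      = emeasure (lborel \<Otimes>\<^sub>M lborel) ((\<lambda>z. Complex (fst z) (snd z)) -` box a b \<inter> space (lborel \<Otimes>\<^sub>M lborel))"
    by (rule emeasure_distr) simp_all
  ultimately have "emeasure (distr (lborel \<Otimes>\<^sub>M lborel) borel (\<lambda>z. Complex (fst z) (snd z))) (box a b)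
      = emeasure (lborel \<Otimes>\<^sub>M lborel) ({Re a<..<Re b} \<times> {Im a<..<Im b})" by simp
  also have "\<dots> = ennreal (Re b - Re a) * ennreal (Im b - Im a)"
    using ab by (subst lborel.emeasure_pair_measure_Times) auto
  finally show "emeasure (distr (lborel \<Otimes>\<^sub>M lborel) borel (\<lambda>z. Complex (fst z) (snd z))) (box a b) = ennreal ((Re b - Re a) * (Im b - Im a))"
    using ab by (simp add: ennreal_mult)
qed simp

lemma lborel_complex_rotate: "distr lborel borel (\<lambda>z. \<i> * z) = (lborel :: complex measure)"
proof (rule lborel_complex_eqI[symmetric])
  fix a b :: complex assume ab: "Re a \<le> Re b" "Im a \<le> Im b"
  have "(\<lambda>z. \<i> * z) -` box a b = box (Complex (Im a) (- Re b)) (Complex (Im b) (- Re a))"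
    by (auto simp: box_def Basis_complex_def)
  then have "emeasure (distr lborel borel (\<lambda>z. \<i> * z)) (box a b) = emeasure lborel (box (Complex (Im a) (- Re b)) (Complex (Im b) (- Re a)))"
    by (subst emeasure_distr) auto
  also have "\<dots> = ennreal ((Im b - Im a) * (Re b - Re a))"
    using ab by (subst emeasure_lborel_complex_box) auto
  finally show "emeasure (distr lborel borel (\<lambda>z. \<i> * z)) (box a b) = ennreal ((Re b - Re a) * (Im b - Im a))"
    by (simp add: mult.commute)
qed simp

definition complex_normal_density :: "real \<Rightarrow> complex \<Rightarrow> real" where
  "complex_normal_density \<sigma> z = normal_density 0 \<sigma> (Re z) * normal_density 0 \<sigma> (Im z)"

lemma complex_normal_density_measurable [measurable]: "complex_normal_density \<sigma> \<in> borel_measurable borel"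
  unfolding complex_normal_density_def[abs_def] by measurable

definition complex_normal :: "complex measure" where
  "complex_normal = density lborel (\<lambda>z. ennreal (complex_normal_density 1 z))"

text \<open>Through the product form the moments of the complex normal law reduce to those of the
  real one.\<close>

lemma complex_normal_product:
  "complex_normal = distr (std_normal_distribution \<Otimes>\<^sub>M std_normal_distribution) borel (\<lambda>z. Complex (fst z) (snd z))"
proof -
  let ?C = "\<lambda>z. Complex (fst z) (snd z)"
  have [measurable]: "?C \<in> borel_measurable (lborel \<Otimes>\<^sub>M lborel)" by (rule Complex_measurable) simp_all
  interpret N: prob_space std_normal_distribution by (rule prob_space_normal_density) simp
  have "std_normal_distribution \<Otimes>\<^sub>M std_normal_distribution = density (lborel \<Otimes>\<^sub>M lborel) (\<lambda>(x, y). ennreal (std_normal_density x) * ennreal (std_normal_density y))"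
    by (rule pair_measure_density) (auto intro: lborel.sigma_finite_measure_axioms N.sigma_finite_measure_axioms)
  also have "(\<lambda>(x, y). ennreal (std_normal_density x) * ennreal (std_normal_density y)) = (\<lambda>z. ennreal (complex_normal_density 1 (?C z)))"
    by (intro ext) (simp add: split_beta complex_normal_density_def ennreal_mult)
  finally have "distr (std_normal_distribution \<Otimes>\<^sub>M std_normal_distribution) borel ?C = distr (density (lborel \<Otimes>\<^sub>M lborel) (\<lambda>z. ennreal (complex_normal_density 1 (?C z)))) borel ?C"
    by simp
  also have "\<dots> = density (distr (lborel \<Otimes>\<^sub>M lborel) borel ?C) (\<lambda>z. ennreal (complex_normal_density 1 z))"
    by (rule density_distr[of "\<lambda>z. ennreal (complex_normal_density 1 z)" borel, symmetric]) (simp_all add: Complex_measurable)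
  also have "\<dots> = complex_normal" unfolding complex_normal_def lborel_complex_product[symmetric] ..
  finally show ?thesis ..
qed

lemma std_normal_product_moment:
  fixes j k :: nat
  shows "has_bochner_integral (std_normal_distribution \<Otimes>\<^sub>M std_normal_distribution) (\<lambda>z. fst z ^ (2 * j) * snd z ^ (2 * k))
     (fact (2 * j) / (2^j * fact j) * (fact (2 * k) / (2^k * fact k)))"
proof -
  let ?N = std_normal_distribution
  interpret N: prob_space ?N by (rule prob_space_normal_density) simp
  interpret P: pair_sigma_finite ?N ?N ..
  note m = std_normal_distribution_even_moments
  have i: "integrable (?N \<Otimes>\<^sub>M ?N) (\<lambda>z. fst z ^ (2 * j) * snd z ^ (2 * k))"
  proof (rule P.Fubini_integrable)
    have [measurable_cong]: "sets ?N = sets borel" by simp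
    show "(\<lambda>z. fst z ^ (2 * j) * snd z ^ (2 * k)) \<in> borel_measurable (?N \<Otimes>\<^sub>M ?N)" by measurable
    have "(\<lambda>x. \<integral>y. norm (fst (x, y) ^ (2 * j) * snd (x, y) ^ (2 * k)) \<partial>?N) = (\<lambda>x. x ^ (2 * j) * (\<integral>y. y ^ (2 * k) \<partial>?N))"
      by (simp add: abs_mult power_mult)
    then show "integrable ?N (\<lambda>x. \<integral>y. norm (fst (x, y) ^ (2 * j) * snd (x, y) ^ (2 * k)) \<partial>?N)"
      by (simp only:) (intro integrable_mult_left m(2))
    show "AE x in ?N. integrable ?N (\<lambda>y. fst (x, y) ^ (2 * j) * snd (x, y) ^ (2 * k))"
      by (intro AE_I2) (simp only: fst_conv snd_conv, intro integrable_mult_right m(2))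
  qed
  have "(\<integral>z. fst z ^ (2 * j) * snd z ^ (2 * k) \<partial>(?N \<Otimes>\<^sub>M ?N)) = (\<integral>x. (\<integral>y. x ^ (2 * j) * y ^ (2 * k) \<partial>?N) \<partial>?N)"
    using P.integral_fst'[OF i] by simp
  also have "\<dots> = fact (2 * j) / (2^j * fact j) * (fact (2 * k) / (2^k * fact k))"
    by (simp only: integral_mult_right_zero integral_mult_left_zero m(1))
  finally show ?thesis using i by (simp add: has_bochner_integral_iff)
qed

text \<open>The fourth moment is 3 + 2 + 3 = 8, from |z|^4 = x^4 + 2 x^2 y^2 + y^4; this and the
  second moment 2 are the values demanded for h = 1.\<close>

lemma step_law_complex_normal: "step_law complex_normal 1"
proof -
  let ?N = std_normal_distribution and ?C = "\<lambda>z. Complex (fst z) (snd z)"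
  interpret N: prob_space ?N by (rule prob_space_normal_density) simp
  interpret P: pair_prob_space ?N ?N ..
  have [simp, measurable]: "?C \<in> borel_measurable (?N \<Otimes>\<^sub>M ?N)" by (rule Complex_measurable) simp_all
  interpret G: prob_space complex_normal unfolding complex_normal_product by (rule P.prob_space_distr) simp
  show ?thesis
  proof
    show "sets complex_normal = sets borel" by (simp add: complex_normal_def)
    have "complex_normal = density (distr lborel borel (\<lambda>z. \<i> * z)) (\<lambda>z. ennreal (complex_normal_density 1 z))"
      unfolding complex_normal_def lborel_complex_rotate ..
    also have "\<dots> = distr (density lborel (\<lambda>z. ennreal (complex_normal_density 1 (\<i> * z)))) borel (\<lambda>z. \<i> * z)"
      by (rule density_distr[of "\<lambda>z. ennreal (complex_normal_density 1 z)" borel]) simp_all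
    also have "(\<lambda>z. ennreal (complex_normal_density 1 (\<i> * z))) = (\<lambda>z. ennreal (complex_normal_density 1 z))"
      by (simp add: complex_normal_density_def normal_density_def mult.commute)
    finally show "distr complex_normal borel (\<lambda>z. \<i> * z) = complex_normal" unfolding complex_normal_def ..
    have c2: "(\<lambda>z. (cmod (?C z))\<^sup>2) = (\<lambda>z. fst z ^ (2 * 1) * snd z ^ (2 * 0) + fst z ^ (2 * 0) * snd z ^ (2 * 1))"
      by (auto simp: cmod_power2)
    have "has_bochner_integral (?N \<Otimes>\<^sub>M ?N) (\<lambda>z. (cmod (?C z))\<^sup>2) (2 * 1)" unfolding c2
      by (rule has_bochner_integral_cong[THEN iffD1, OF refl _ _ has_bochner_integral_add[OF std_normal_product_moment[of 1 0] std_normal_product_moment[of 0 1]]]) (simp_all add: fact_numeral)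
    then show "has_bochner_integral complex_normal (\<lambda>u. (cmod u)\<^sup>2) (2 * 1)"
      unfolding complex_normal_product by (intro has_bochner_integral_distr) simp_all
    have c4: "(\<lambda>z. (cmod (?C z))^4) = (\<lambda>z. (fst z ^ (2 * 2) * snd z ^ (2 * 0) + 2 * (fst z ^ (2 * 1) * snd z ^ (2 * 1))) + fst z ^ (2 * 0) * snd z ^ (2 * 2))"
    proof
      fix z
      have "(cmod (?C z))^4 = ((cmod (?C z))\<^sup>2)\<^sup>2" by simp
      also have "(cmod (?C z))\<^sup>2 = (fst z)\<^sup>2 + (snd z)\<^sup>2" by (simp add: cmod_power2 split_beta)
      also have "((fst z)\<^sup>2 + (snd z)\<^sup>2)\<^sup>2 = (fst z ^ (2 * 2) * snd z ^ (2 * 0) + 2 * (fst z ^ (2 * 1) * snd z ^ (2 * 1))) + fst z ^ (2 * 0) * snd z ^ (2 * 2)"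
        by (simp add: power2_eq_square power4_eq_xxxx algebra_simps)
      finally show "(cmod (?C z))^4 = (fst z ^ (2 * 2) * snd z ^ (2 * 0) + 2 * (fst z ^ (2 * 1) * snd z ^ (2 * 1))) + fst z ^ (2 * 0) * snd z ^ (2 * 2)" .
    qed
    have "has_bochner_integral (?N \<Otimes>\<^sub>M ?N) (\<lambda>z. (cmod (?C z))^4) (8 * 1\<^sup>2)" unfolding c4
      by (rule has_bochner_integral_cong[THEN iffD1, OF refl _ _ has_bochner_integral_add[OF has_bochner_integral_add[OF std_normal_product_moment[of 2 0]
          has_bochner_integral_mult_right[OF std_normal_product_moment[of 1 1], of 2]] std_normal_product_moment[of 0 2]]]) (simp_all add: fact_numeral)
    then show "has_bochner_integral complex_normal (\<lambda>u. (cmod u)^4) (8 * 1\<^sup>2)"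
      unfolding complex_normal_product by (intro has_bochner_integral_distr) simp_all
  qed simp
qed

text \<open>The density is divided by \<sigma>^2 and Lebesgue measure is multiplied by it under the
  scaling, so the factors cancel.\<close>

lemma distr_scaled_normal:
  assumes X: "distributed M lborel X (\<lambda>z. ennreal (normal_density 0 \<sigma> (Re z) * normal_density 0 \<sigma> (Im z)))" and \<sigma>: "\<sigma> > 0"
  shows "distr M borel (\<lambda>\<omega>. of_real (1 / \<sigma>) * X \<omega>) = complex_normal"
proof -
  let ?s = "\<lambda>z. of_real (1 / \<sigma>) * z :: complex"
  have mX [measurable]: "X \<in> borel_measurable M" 
  proof -
    have "X \<in> measurable M lborel" by (rule X[unfolded distributed_def, THEN conjunct2, THEN conjunct2])
    then show ?thesis by (simp only: measurable_lborel1)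
  qed
  have D: "distr M lborel X = density lborel (\<lambda>z. ennreal (complex_normal_density \<sigma> z))"
    unfolding complex_normal_density_def by (rule X[unfolded distributed_def, THEN conjunct1])
  have "distr M borel (\<lambda>\<omega>. ?s (X \<omega>)) = distr (distr M lborel X) borel ?s" 
    by (subst distr_distr) (simp_all add: o_def mX)
  also have "\<dots> = distr (density lborel (\<lambda>z. ennreal (complex_normal_density \<sigma> z))) borel ?s" unfolding D ..
  also have "(\<lambda>z. ennreal (complex_normal_density \<sigma> z)) = (\<lambda>z. ennreal (complex_normal_density 1 (?s z) / \<sigma>\<^sup>2))"
  proof
    fix z :: complex
    have "normal_density 0 \<sigma> x = normal_density 0 1 (x / \<sigma>) / \<sigma>" for x
      using \<sigma> by (simp add: normal_density_def real_sqrt_mult power_divide field_simps)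
    then show "ennreal (complex_normal_density \<sigma> z) = ennreal (complex_normal_density 1 (?s z) / \<sigma>\<^sup>2)"
      by (simp add: complex_normal_density_def power2_eq_square)
  qed
  also have "distr (density lborel (\<lambda>z. ennreal (complex_normal_density 1 (?s z) / \<sigma>\<^sup>2))) borel ?s
     = density (distr lborel borel ?s) (\<lambda>z. ennreal (complex_normal_density 1 z / \<sigma>\<^sup>2))"
    by (rule density_distr[of "\<lambda>z. ennreal (complex_normal_density 1 z / \<sigma>\<^sup>2)" borel, symmetric]) simp_all
  also have "distr lborel borel ?s = density lborel (\<lambda>_. ennreal (\<sigma>\<^sup>2))"
  proof -
    have "density (distr lborel borel ?s) (\<lambda>_. ennreal (1 / \<sigma>\<^sup>2)) = lborel"
      using lborel_affine[of "1 / \<sigma>" "0 :: complex"] \<sigma> by (simp add: scaleR_conv_of_real power_divide)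
    then have "density (density (distr lborel borel ?s) (\<lambda>_. ennreal (1 / \<sigma>\<^sup>2))) (\<lambda>_. ennreal (\<sigma>\<^sup>2)) = density lborel (\<lambda>_. ennreal (\<sigma>\<^sup>2))"
      by simp
    moreover have "density (density (distr lborel borel ?s) (\<lambda>_. ennreal (1 / \<sigma>\<^sup>2))) (\<lambda>_. ennreal (\<sigma>\<^sup>2)) = density (distr lborel borel ?s) (\<lambda>_. 1)"
      using \<sigma> by (subst density_density_eq) (auto simp: ennreal_mult[symmetric])
    ultimately show ?thesis by (simp add: density_1)
  qed
  also have "density (density lborel (\<lambda>_. ennreal (\<sigma>\<^sup>2))) (\<lambda>z. ennreal (complex_normal_density 1 z / \<sigma>\<^sup>2)) = complex_normal"
    unfolding complex_normal_def using \<sigma> by (subst density_density_eq) (auto simp: ennreal_mult'[symmetric])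
  finally show ?thesis .
qed

text \<open>At a given mesh the path supplies finitely many increments, while the events live on
  infinite sequences. Padding by 0 is invisible to a predicate that depends on the first T
  coordinates.\<close>

lemma (in step_law) prS_finite_marginal:
  assumes P: "Measurable.pred seqM P" and dep: "depends_on {..<T} P"
    and \<mu>: "distr M (PiM {..<T} (\<lambda>_. borel)) X = PiM {..<T} (\<lambda>_. \<nu>)" and X: "X \<in> measurable M (PiM {..<T} (\<lambda>_. borel))"
  shows "{\<omega> \<in> space M. P (\<lambda>i. if i < T then X \<omega> i else 0)} \<in> sets M"
    "measure M {\<omega> \<in> space M. P (\<lambda>i. if i < T then X \<omega> i else 0)} = prS P"
proof -
  let ?e = "\<lambda>y i. if i < T then y i else (0 :: complex)"
  have "(\<lambda>y. ?e y i) \<in> borel_measurable (PiM {..<T} (\<lambda>_. borel))" for i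
  proof (cases "i < T")
    case True
    then have "(\<lambda>y :: nat \<Rightarrow> complex. y i) \<in> borel_measurable (PiM {..<T} (\<lambda>_. borel))" by (intro measurable_component_singleton) simp
    then show ?thesis using True by simp
  qed simp
  note comp = this
  have e: "?e \<in> measurable (PiM {..<T} (\<lambda>_. borel)) seqM"
    by (rule measurable_PiM_single', rule comp) (simp add: space_PiM)
  have Pe: "Measurable.pred (PiM {..<T} (\<lambda>_. borel)) (\<lambda>y. P (?e y))" by (rule measurable_compose[OF e P])
  let ?A = "{y \<in> space (PiM {..<T} (\<lambda>_. borel)). P (?e y)}"
  have A: "?A \<in> sets (PiM {..<T} (\<lambda>_. borel))" using Pe by (simp add: pred_def)
  have s: "sets (PiM {..<T} (\<lambda>_. \<nu>)) = sets (PiM {..<T} (\<lambda>_. borel))" by (intro sets_PiM_cong) auto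
  have "{\<omega> \<in> space M. P (?e (X \<omega>))} = X -` ?A \<inter> space M" using measurable_space[OF X] by auto
  then show "{\<omega> \<in> space M. P (\<lambda>i. if i < T then X \<omega> i else 0)} \<in> sets M" using measurable_sets[OF X A] by simp
  have "measure M {\<omega> \<in> space M. P (?e (X \<omega>))} = measure (distr M (PiM {..<T} (\<lambda>_. borel)) X) ?A"
    unfolding measure_distr[OF X A] by (intro arg_cong[where f = "measure M"]) fact
  also have "\<dots> = measure (PiM {..<T} (\<lambda>_. \<nu>)) ?A" unfolding \<mu> ..
  also have "\<dots> = measure (distr \<Omega> (PiM {..<T} (\<lambda>_. \<nu>)) (\<lambda>x. restrict x {..<T})) ?A"
    by (subst seq.distr_PiM_restrict_finite) auto
  also have "\<dots> = measure \<Omega> ((\<lambda>x. restrict x {..<T}) -` ?A \<inter> space \<Omega>)"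
    by (rule measure_distr) (use A s in \<open>auto intro!: measurable_restrict_subset\<close>)
  also have "(\<lambda>x. restrict x {..<T}) -` ?A \<inter> space \<Omega> = {x. P x}"
  proof -
    have "P (?e (restrict x {..<T})) = P x" for x by (rule depends_onD[OF dep]) auto
    then show ?thesis by (auto simp: space_PiM)
  qed
  finally show "measure M {\<omega> \<in> space M. P (\<lambda>i. if i < T then X \<omega> i else 0)} = prS P" by (simp add: prS_def)
qed

text \<open>The blocks are independent, so all K of them fail with probability at most (1 -
  \<delta>)^K. This takes the place of a zero-one law.\<close>

lemma (in step_law) prS_some_block:
  assumes D: "Measurable.pred seqM D" "depends_on {..<L} D" and \<delta>: "\<delta> \<le> prS D"
  shows "1 - (1 - \<delta>) ^ K \<le> prS (\<lambda>x. \<exists>m<K. D (\<lambda>i. x (m * L + i)))"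
proof -
  note [measurable] = D(1)
  have compl: "prS (\<lambda>x. \<not> Q x) = 1 - prS Q" if "Measurable.pred seqM Q" for Q
  proof -
    have "{x. \<not> Q x} = space \<Omega> - {x. Q x}" by auto
    then show ?thesis unfolding prS_def using seq.P.prob_compl[OF pred_sets_\<Omega>[OF that]] by simp
  qed
  have "prS (\<lambda>x. \<forall>m<K. \<not> D (\<lambda>i. x (m * L + i))) \<le> (1 - \<delta>) ^ K"
  proof (induction K)
    case 0
    show ?case using prS_01 by simp
  next
    case (Suc K)
    have dep1: "depends_on {..<K * L} (\<lambda>x. \<forall>m<K. \<not> D (\<lambda>i. x (m * L + i)))"
    proof (unfold depends_on_def, intro allI impI)
      fix x y :: "nat \<Rightarrow> complex" assume xy: "\<forall>i\<in>{..<K * L}. x i = y i"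
      have "D (\<lambda>i. x (m * L + i)) = D (\<lambda>i. y (m * L + i))" if "m < K" for m
      proof (rule depends_onD[OF D(2)])
        fix i assume "i \<in> {..<L}"
        then have "m * L + i < K * L" using mult_le_mono1[of "Suc m" K L] that by simp
        then show "x (m * L + i) = y (m * L + i)" using xy by simp
      qed
      then show "(\<forall>m<K. \<not> D (\<lambda>i. x (m * L + i))) = (\<forall>m<K. \<not> D (\<lambda>i. y (m * L + i)))" by simp
    qed
    have dep2: "depends_on {K * L..<K * L + L} (\<lambda>x. \<not> D (\<lambda>i. x (K * L + i)))"
      using depends_on_shift[OF D(2), of "K * L"] by (simp add: depends_on_def)
    have "prS (\<lambda>x. \<forall>m<Suc K. \<not> D (\<lambda>i. x (m * L + i))) = prS (\<lambda>x. (\<forall>m<K. \<not> D (\<lambda>i. x (m * L + i))) \<and> \<not> D (\<lambda>i. x (K * L + i)))"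
      by (intro arg_cong[where f = prS]) (auto simp: less_Suc_eq)
    also have "\<dots> = prS (\<lambda>x. \<forall>m<K. \<not> D (\<lambda>i. x (m * L + i))) * prS (\<lambda>x. \<not> D (\<lambda>i. x (K * L + i)))"
      by (rule prS_indep[OF dep1 _ dep2]) (measurable, auto)
    also have "prS (\<lambda>x. \<not> D (\<lambda>i. x (K * L + i))) = 1 - prS D"
    proof -
      have "prS (\<lambda>x. D (\<lambda>i. x (K * L + i))) = prS D" by (rule prS_reindex[of "\<lambda>i. K * L + i"]) (use D in auto)
      moreover have "Measurable.pred seqM (\<lambda>x. D (\<lambda>i. x (K * L + i)))" by measurable
      ultimately show ?thesis by (simp add: compl)
    qed
    also have "prS (\<lambda>x. \<forall>m<K. \<not> D (\<lambda>i. x (m * L + i))) * (1 - prS D) \<le> (1 - \<delta>) ^ K * (1 - \<delta>)"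
      using Suc.IH \<delta> prS_01 order_trans[OF \<delta> prS_01(2)] by (intro mult_mono) auto
    finally show ?case by (simp add: mult.commute)
  qed
  moreover have "prS (\<lambda>x. \<not> (\<exists>m<K. D (\<lambda>i. x (m * L + i)))) = 1 - prS (\<lambda>x. \<exists>m<K. D (\<lambda>i. x (m * L + i)))"
    by (rule compl) measurable
  ultimately show ?thesis by simp
qed

section \<open>Existence of pivoting points\<close>

text \<open>Unfolds the recursion: the letter at position k is tested on the increments after the
  left end of the cell which the first k letters select.\<close>

lemma good_word_level:
  "good_word E H N w x \<Longrightarrow> k < length w \<Longrightarrow>
    E (H * N ^ (length w - Suc k)) (w ! k) (\<lambda>i. x ((\<Sum>j<k. w ! j * (H * N ^ (length w - Suc j))) + i))"
proof (induction w arbitrary: x k)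
  case (Cons a w)
  show ?case
  proof (cases k)
    case 0
    then show ?thesis using Cons.prems(1) by simp
  next
    case (Suc k')
    have "E (H * N ^ (length w - Suc k')) (w ! k') (\<lambda>i. x (a * (H * N ^ length w) + ((\<Sum>j<k'. w ! j * (H * N ^ (length w - Suc j))) + i)))"
      using Cons.prems Suc by (intro Cons.IH) auto
    then show ?thesis by (simp only: Suc sum.lessThan_Suc_shift nth_Cons_0 nth_Cons_Suc length_Cons diff_Suc_Suc diff_zero add.assoc)
  qed
qed simp

lemma digit_sum_bound:
  assumes "\<And>j. a j < (N::nat)"
  shows "(\<Sum>j<k. real (a j) / real N ^ Suc j) + 1 / real N ^ k \<le> 1"
proof (induction k)
  case (Suc k)
  have N: "real N > 0" using assms[of 0] by simp
  have "(real (a k) + 1) / real N ^ Suc k \<le> real N / real N ^ Suc k"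
    using assms[of k] N by (intro divide_right_mono) auto
  also have "\<dots> = 1 / real N ^ k" using N by simp
  finally have "real (a k) / real N ^ Suc k + 1 / real N ^ Suc k \<le> 1 / real N ^ k" by (simp only: add_divide_distrib)
  then show ?case using Suc.IH by (simp only: sum.lessThan_Suc)
qed simp

text \<open>The factor sqrt T normalises Brownian increments over the time 1 / T to the standard
  complex normal law.\<close>

definition grid_increments :: "(real \<Rightarrow> complex) \<Rightarrow> nat \<Rightarrow> nat \<Rightarrow> complex" where
  "grid_increments \<gamma> T i = (if i < T then of_real (sqrt (real T)) * (\<gamma> (real (Suc i) / real T) - \<gamma> (real i / real T)) else 0)"

context pivot_parameters
begin

abbreviation level :: "nat \<Rightarrow> nat \<Rightarrow> (nat \<Rightarrow> complex) \<Rightarrow> bool" where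
  "level L a \<equiv> level_event s l n b (pi + \<alpha> / 2) \<rho> \<kappa> N L a"

text \<open>Every prefix of a limit word starts good words of infinitely many lengths q. For such a
  word, level k has H N^(q - Suc k) steps per cell; these grids become finer as q grows, so
  \<open>level_ok_limit\<close> passes to all times.\<close>

lemma limit_word_good:
  assumes \<gamma>: "continuous_on {0..1} \<gamma>" and m: "m < (K::nat)"
    and F: "\<And>q. F q \<subseteq> {w \<in> words \<A> q. good_word level H N w (\<lambda>i. grid_increments \<gamma> (K * (H * N ^ q)) (m * (H * N ^ q) + i))}"
    and a: "a \<in> limit_words F"
  shows "good_limit \<gamma> (real m / real K) (1 / real K) a"
proof -
  define u h where "u = real m / real K" and "h = 1 / real K"
  have K: "real K > 0" using m by simp
  have h: "h > 0" using K by (simp add: h_def)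
  have u: "0 \<le> u" "u + h \<le> 1"
  proof -
    have "real m + 1 \<le> real K" using m by simp
    then show "u + h \<le> 1" using K by (simp add: u_def h_def add_divide_distrib[symmetric])
  qed (simp add: u_def)
  have Npos: "real N > 0" using N_gt_1 by simp
  have Fw: "F q \<subseteq> words \<A> q" for q using F by blast
  have aA: "a k \<in> \<A>" for k by (rule limit_words_letters[OF Fw a])
  have aN: "a k < N" for k
  proof -
    have "a k \<in> {1..<N - 1}" using aA \<A>(1) by blast
    then have "a k < N - 1" by simp
    then show ?thesis by linarith
  qed
  have "\<exists>A. level_ok s l n b (pi + \<alpha> / 2) \<rho> N \<gamma> (partial_time N u h a k) (h / real N ^ Suc k) (a k) A (\<lambda>_. True)" for k
  proof -
    define t \<tau> where "t = partial_time N u h a k" and "\<tau> = h / real N ^ Suc k"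
    have \<tau>: "\<tau> > 0" using h Npos by (simp add: \<tau>_def)
    have N\<tau>: "real N * \<tau> = h / real N ^ k" using Npos by (simp add: \<tau>_def)
    have t1: "t + real N * \<tau> \<le> u + h"
    proof -
      have "h * ((\<Sum>j<k. real (a j) / real N ^ Suc j) + 1 / real N ^ k) \<le> h * 1"
        using digit_sum_bound[of a N k, OF aN] h by (intro mult_left_mono) auto
      then show ?thesis unfolding N\<tau> t_def partial_time_def by (simp add: distrib_left)
    qed
    have t0: "0 \<le> t" using u h by (auto simp: t_def partial_time_def intro!: add_nonneg_nonneg mult_nonneg_nonneg sum_nonneg)
    define Q where "Q = {q. Suc k \<le> q \<and> (\<exists>w\<in>F q. take (Suc k) w = map a [0..<Suc k])}"
    have infQ: "infinite Q" using a unfolding limit_words_def Q_def by blast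
    have lev: "\<exists>A. level_ok s l n b (pi + \<alpha> / 2) \<rho> N \<gamma> t \<tau> (a k) A (\<lambda>r. \<exists>i::nat. r = t + real i * (\<tau> / real (H * N ^ (q - Suc k))))"
      if q: "q \<in> Q" for q
    proof -
      define L T where "L = H * N ^ (q - Suc k)" and "T = K * (H * N ^ q)"
      obtain w where w: "w \<in> F q" "take (Suc k) w = map a [0..<Suc k]" and kq: "Suc k \<le> q" using q by (auto simp: Q_def)
      have lw: "length w = q" using Fw w(1) by (auto simp: words_def)
      have wj: "w ! j = a j" if "j \<le> k" for j
      proof -
        have "take (Suc k) w ! j = map a [0..<Suc k] ! j" using w(2) by simp
        then show ?thesis using that kq lw by (simp add: nth_append del: upt_Suc)
      qed
      define c where "c = (\<Sum>j<k. a j * (H * N ^ (q - Suc j)))"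
      have "good_word level H N w (\<lambda>i. grid_increments \<gamma> T (m * (H * N ^ q) + i))" using F w(1) unfolding T_def by blast
      from good_word_level[OF this, of k]
      have ev: "level L (a k) (\<lambda>i. grid_increments \<gamma> T (m * (H * N ^ q) + (c + i)))"
        using kq lw wj by (simp add: L_def c_def)
      have L: "L > 0" using H Npos by (simp add: L_def)
      have Tpos: "real T > 0" using K H Npos by (simp add: T_def)
      have pow: "real N ^ Suc j * real N ^ (q - Suc j) = real N ^ q" if "j \<le> k" for j
        using that kq by (simp only: power_add[symmetric]) simp
      have LT: "real T = real K * (real N ^ Suc k) * real L"
        using pow[of k] by (simp add: T_def L_def mult_ac)
      have \<tau>L: "\<tau> / real L = 1 / real T" "real L / \<tau> = real T"
        using L K Npos by (simp_all add: LT \<tau>_def h_def)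
      have ct: "real (m * (H * N ^ q) + c) / real T = t"
      proof -
        have "real (m * (H * N ^ q)) / real T = u" using H K Npos by (simp add: T_def u_def)
        moreover have "real c / real T = h * (\<Sum>j<k. real (a j) / real N ^ Suc j)"
        proof -
          have "real (a j * (H * N ^ (q - Suc j))) / real T = h * (real (a j) / real N ^ Suc j)" if "j < k" for j
          proof -
            have "real T = real K * (real H * (real N ^ Suc j * real N ^ (q - Suc j)))"
              unfolding pow[OF less_imp_le[OF that]] by (simp add: T_def)
            then show ?thesis using H K Npos by (simp add: h_def)
          qed
          then show ?thesis by (simp add: c_def sum_divide_distrib sum_distrib_left)
        qed
        ultimately show ?thesis by (simp only: of_nat_add add_divide_distrib t_def partial_time_def)
      qed
      have idx: "real (m * (H * N ^ q) + (c + i)) / real T = t + real i * (\<tau> / real L)" for i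
      proof -
        have "real (m * (H * N ^ q) + (c + i)) / real T = real (m * (H * N ^ q) + c) / real T + real i / real T"
          by (simp only: add.assoc[symmetric] of_nat_add add_divide_distrib)
        then show ?thesis unfolding ct \<tau>L by simp
      qed
      show ?thesis unfolding L_def[symmetric]
      proof (rule level_event_imp_level_ok[OF ev L \<tau> aN])
        fix i assume i: "i < N * L"
        have "real i * (\<tau> / real L) < real (N * L) * (\<tau> / real L)" using i \<tau> L by (intro mult_strict_right_mono) (simp_all only: of_nat_less_iff, simp)
        also have "\<dots> = real N * \<tau>" using L by simp
        finally have "real (m * (H * N ^ q) + (c + i)) / real T < 1" unfolding idx using t1 u by linarith
        then have "real (m * (H * N ^ q) + (c + i)) < real T" using Tpos by (simp only: pos_divide_less_eq mult_1)
        then have "m * (H * N ^ q) + (c + i) < T" by (simp only: of_nat_less_iff)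
        moreover have "real (Suc (m * (H * N ^ q) + (c + i))) / real T = t + real (Suc i) * (\<tau> / real L)"
          using idx[of "Suc i"] by (simp only: add_Suc_right)
        ultimately show "grid_increments \<gamma> T (m * (H * N ^ q) + (c + i))
            = of_real (sqrt (real L / \<tau>)) * (\<gamma> (t + real (Suc i) * (\<tau> / real L)) - \<gamma> (t + real i * (\<tau> / real L)))"
          unfolding grid_increments_def \<tau>L(2) by (simp only: idx if_True)
      qed
    qed
    \<comment> \<open>Different q give different numbers of steps, so infinitely many meshes occur
      at level k.\<close>
    have inj: "inj_on (\<lambda>q. H * N ^ (q - Suc k)) Q"
    proof (rule inj_onI)
      fix q q' assume "q \<in> Q" "q' \<in> Q" and "H * N ^ (q - Suc k) = H * N ^ (q' - Suc k)"
      then show "q = q'" using H N_gt_1 by (auto simp: Q_def)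
    qed
    have "infinite ((\<lambda>q. H * N ^ (q - Suc k)) ` Q)" using infQ inj finite_imageD by blast
    moreover have "(\<lambda>q. H * N ^ (q - Suc k)) ` Q \<subseteq> {L. L > 0 \<and> (\<exists>A. level_ok s l n b (pi + \<alpha> / 2) \<rho> N \<gamma> t \<tau> (a k) A (\<lambda>r. \<exists>i::nat. r = t + real i * (\<tau> / real L)))}"
      using lev H N_gt_1 by (intro image_subsetI CollectI conjI) auto
    ultimately have inf: "infinite {L. L > 0 \<and> (\<exists>A. level_ok s l n b (pi + \<alpha> / 2) \<rho> N \<gamma> t \<tau> (a k) A (\<lambda>r. \<exists>i::nat. r = t + real i * (\<tau> / real L)))}"
      by (rule infinite_super[rotated])
    show ?thesis unfolding t_def[symmetric] \<tau>_def[symmetric]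
      by (rule level_ok_limit[OF \<gamma> t0 _ \<tau> aN inf]) (use t1 u in linarith)
  qed
  then have "good_limit \<gamma> u h a" unfolding good_limit_def using aA by blast
  then show ?thesis by (simp only: u_def h_def)
qed

text \<open>By the pigeonhole principle one of the K intervals is good for infinitely many q. Its
  limit words yield pivoting points that are separated according to their common prefixes, and the
  energy bound enters through \<open>limit_words_cover\<close>.\<close>

theorem pivoting_points_of_frequent_words:
  assumes \<gamma>: "continuous_on {0..1} \<gamma>" and C: "C > 0"
    and inf: "infinite {q. \<exists>m<K. many_words level H N \<A> C q (\<lambda>i. grid_increments \<gamma> (K * (H * N ^ q)) (m * (H * N ^ q) + i))}"
  shows "local_pivoting_points \<alpha> \<gamma> \<noteq> {} \<and> 0 < hausdorff_dim (local_pivoting_points \<alpha> \<gamma>)"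
proof -
  let ?x = "\<lambda>q m i. grid_increments \<gamma> (K * (H * N ^ q)) (m * (H * N ^ q) + i)"
  have "\<exists>m\<in>{..<K}. infinite {q \<in> {q. \<exists>m<K. many_words level H N \<A> C q (?x q m)}. many_words level H N \<A> C q (?x q m)}"
    by (rule pigeonhole_infinite_rel[OF inf]) auto
  note ex = this
  obtain m where m: "m \<in> {..<K}" and inf': "infinite {q \<in> {q. \<exists>m<K. many_words level H N \<A> C q (?x q m)}. many_words level H N \<A> C q (?x q m)}"
    by (rule bexE[OF ex], rule that)
  have infm: "infinite {q. many_words level H N \<A> C q (?x q m)}" by (rule infinite_super[OF _ inf']) blast
  have m: "m < K" using m by simp
  define F where "F q = (if many_words level H N \<A> C q (?x q m) then {w \<in> words \<A> q. good_word level H N w (?x q m)} else {})" for q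
  have Fsub: "F q \<subseteq> {w \<in> words \<A> q. good_word level H N w (?x q m)}" for q by (simp add: F_def)
  have Fw: "F q \<subseteq> words \<A> q" for q using Fsub by blast
  have Fne: "F q \<noteq> {} \<longleftrightarrow> many_words level H N \<A> C q (?x q m)" for q
    unfolding F_def many_words_def by auto
  have infF: "infinite {q. F q \<noteq> {}}" unfolding Fne by (rule infm)
  have en: "energy (F q) \<le> C * (real (card (F q)))\<^sup>2" if "F q \<noteq> {}" for q
    using that unfolding Fne by (simp add: F_def many_words_def)
  have K: "real K > 0" using m by simp
  define u h where "u = real m / real K" and "h = 1 / real K"
  have h: "h > 0" using K by (simp add: h_def)
  have u: "0 \<le> u" "u + h \<le> 1"
  proof -
    have "real m + 1 \<le> real K" using m by simp
    then show "u + h \<le> 1" using K by (simp add: u_def h_def add_divide_distrib[symmetric])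
  qed (simp add: u_def)
  have good: "good_limit \<gamma> u h a" if "a \<in> limit_words F" for a
    unfolding u_def h_def by (rule limit_word_good[OF \<gamma> m Fsub that])
  have dim: "0 < hausdorff_dim (local_pivoting_points \<alpha> \<gamma>)"
  proof (rule hausdorff_dim_pos[where W = "limit_words F" and p = "\<lambda>a. \<gamma> (word_time N u h a)" and \<theta> = "1 / sqrt N" and c = "exp (- (7/2)) * sqrt (h / real N)" and C = C])
    show "0 < exp (- (7/2)) * sqrt (h / real N)" using h N_gt_1 by simp
    have "1 < sqrt N" using sqrt_N by linarith
    then show "0 < 1 / sqrt N" "1 / sqrt N < 1" by simp_all
    show "exp (- (7/2)) * sqrt (h / real N) * (1 / sqrt N) ^ k \<le> dist (\<gamma> (word_time N u h a)) (\<gamma> (word_time N u h a'))"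
      if "a \<in> limit_words F" "a' \<in> limit_words F" "a k \<noteq> a' k" "\<And>j. j < k \<Longrightarrow> a j = a' j" for a a' k
      by (rule good_limit_separated[OF \<gamma> u h good[OF that(1)] good[OF that(2)] that(3,4)])
    show "\<exists>J. finite J \<and> 1 \<le> C * (\<Sum>i\<in>J. (2/3) ^ length (v i))" if "\<And>a. a \<in> limit_words F \<Longrightarrow> \<exists>i::nat. map a [0..<length (v i)] = v i" for v
      by (rule limit_words_cover[OF \<A>(2) Fw infF en that])
    show "(\<lambda>a. \<gamma> (word_time N u h a)) ` limit_words F \<subseteq> local_pivoting_points \<alpha> \<gamma>"
      using good_limit_pivoting[OF \<gamma> u h good] by blast
  qed fact
  then show ?thesis using hausdorff_dim_empty[where 'a = complex] by (metis less_irrefl)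
qed

end

lemma (in planar_brownian) grid_increments_law:
  assumes T: "T > (0::nat)"
  defines "X \<equiv> \<lambda>\<omega>. \<lambda>i\<in>{..<T}. grid_increments (\<lambda>t. B t \<omega>) T i"
  shows "X \<in> measurable M (PiM {..<T} (\<lambda>_. borel))" "distr M (PiM {..<T} (\<lambda>_. borel)) X = PiM {..<T} (\<lambda>_. complex_normal)"
proof -
  let ?Y = "\<lambda>i \<omega>. of_real (sqrt (real T)) * (B (real (Suc i) / real T) \<omega> - B (real i / real T) \<omega>)"
  have "indep_vars (\<lambda>_. borel) (\<lambda>i \<omega>. B (real (Suc i) / real T) \<omega> - B (real i / real T) \<omega>) {..<T}"
    using T by (intro indep_increments) (auto simp: divide_right_mono)
  then have indep: "indep_vars (\<lambda>_. borel) ?Y {..<T}" by (rule indep_vars_compose2) simp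
  have rv: "random_variable borel (?Y i)" if "i \<in> {..<T}" for i using indep that unfolding indep_vars_def by blast
  have X: "X = (\<lambda>\<omega>. \<lambda>i\<in>{..<T}. ?Y i \<omega>)" by (auto simp: X_def grid_increments_def fun_eq_iff)
  show "X \<in> measurable M (PiM {..<T} (\<lambda>_. borel))" unfolding X by (intro measurable_restrict rv)
  have law: "distr M borel (?Y i) = complex_normal" if i: "i \<in> {..<T}" for i
  proof -
    have "real (Suc i) / real T - real i / real T = 1 / real T" by (simp add: diff_divide_distrib[symmetric])
    then have D: "distributed M lborel (\<lambda>\<omega>. B (real (Suc i) / real T) \<omega> - B (real i / real T) \<omega>)
       (\<lambda>z. ennreal (normal_density 0 (sqrt (1 / real T)) (Re z) * normal_density 0 (sqrt (1 / real T)) (Im z)))"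
      using gaussian_increments[of "real i / real T" "real (Suc i) / real T"] i T by (simp add: divide_strict_right_mono)
    have "distr M borel (\<lambda>\<omega>. of_real (1 / sqrt (1 / real T)) * (B (real (Suc i) / real T) \<omega> - B (real i / real T) \<omega>)) = complex_normal"
      by (rule distr_scaled_normal[OF D]) (use T in simp)
    then show ?thesis by (simp add: real_sqrt_divide)
  qed
  have "distr M (PiM {..<T} (\<lambda>_. borel)) X = PiM {..<T} (\<lambda>i. distr M borel (?Y i))"
    unfolding X
  proof (rule iffD1[OF indep_vars_iff_distr_eq_PiM' indep])
    show "{..<T} \<noteq> {}" using T by (simp add: lessThan_empty_iff)
  qed (rule rv)
  also have "\<dots> = PiM {..<T} (\<lambda>_. complex_normal)" by (rule PiM_cong[OF refl law])
  finally show "distr M (PiM {..<T} (\<lambda>_. borel)) X = PiM {..<T} (\<lambda>_. complex_normal)" .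
qed

text \<open>Reverse Fatou for events: the unions over q >= m decrease to the limit superior, and
  each of them has probability at least c.\<close>

lemma (in prob_space) prob_infinitely_often:
  assumes A: "\<And>q::nat. A q \<in> events" and c: "\<And>q. c \<le> prob (A q)"
  shows "{\<omega> \<in> space M. infinite {q. \<omega> \<in> A q}} \<in> events" "c \<le> prob {\<omega> \<in> space M. infinite {q. \<omega> \<in> A q}}"
proof -
  have eq: "{\<omega> \<in> space M. infinite {q. \<omega> \<in> A q}} = (\<Inter>m. \<Union>q\<in>{m..}. A q)"
    using sets.sets_into_space[OF A] unfolding infinite_nat_iff_unbounded_le by fastforce
  show "{\<omega> \<in> space M. infinite {q. \<omega> \<in> A q}} \<in> events" unfolding eq using A by (intro sets.countable_INT sets.countable_UN) auto
  have "(\<lambda>m. prob (\<Union>q\<in>{m..}. A q)) \<longlonglongrightarrow> prob (\<Inter>m. \<Union>q\<in>{m..}. A q)"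
  proof (rule finite_Lim_measure_decseq)
    show "range (\<lambda>m. \<Union>q\<in>{m..}. A q) \<subseteq> events" using A by auto
    show "decseq (\<lambda>m. \<Union>q\<in>{m..}. A q)" unfolding decseq_def by (intro allI impI UN_mono) auto
  qed
  moreover have "c \<le> prob (\<Union>q\<in>{m..}. A q)" for m
    using c[of m] by (rule order_trans) (use A in \<open>auto intro!: finite_measure_mono\<close>)
  ultimately show "c \<le> prob {\<omega> \<in> space M. infinite {q. \<omega> \<in> A q}}" unfolding eq
    by (intro LIMSEQ_le_const) auto
qed

theorem theorem4:
  fixes M :: "'w measure" and x :: complex and B :: "real \<Rightarrow> 'w \<Rightarrow> complex" and \<alpha> :: real
  assumes "planar_brownian M x B"
    and "0 \<le> \<alpha>" and "\<alpha> < (ln 2)\<^sup>2 / (2 * pi)"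
  shows "AE \<omega> in M. local_pivoting_points \<alpha> (\<lambda>t. B t \<omega>) \<noteq> {} \<and>
                    0 < hausdorff_dim (local_pivoting_points \<alpha> (\<lambda>t. B t \<omega>))"
proof -
  interpret planar_brownian M x B by fact
  obtain s l b \<rho> \<kappa> n N H \<A> where "pivot_parameters \<alpha> s l b \<rho> \<kappa> n N H \<A>"
    using pivot_parameters_exist[OF assms(2,3)] by blast
  then interpret P: pivot_parameters \<alpha> s l b \<rho> \<kappa> n N H \<A> .
  interpret G: step_law complex_normal 1 by (rule step_law_complex_normal)
  define R where "R = (real N)\<^sup>2 + 1"
  define C where "C = 64 * R\<^sup>2"
  define \<delta> where "\<delta> = 1 / (8 * R)"
  have R: "R \<ge> 1" by (simp add: R_def)
  have C: "C > 0" and \<delta>: "0 < \<delta>" "\<delta> < 1" using R by (auto simp: C_def \<delta>_def)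
  have \<A>N: "\<A> \<subseteq> {..<N}"
  proof
    fix a assume "a \<in> \<A>"
    then have "a < N - 1" using P.\<A>(1) by auto
    then show "a \<in> {..<N}" by simp
  qed
  have Npos: "N > 0" using P.N_gt_1 by simp
  have dep: "depends_on ({..<N * L} - {a * L..<(a + 1) * L}) (P.level L a)" if "a \<in> \<A>" for L a
    by (rule level_event_depends) (use that \<A>N in auto)
  define D where "D q = many_words P.level H N \<A> C q" for q
  have Dm: "Measurable.pred seqM (D q)" for q
    unfolding D_def by (rule many_words_measurable[OF level_event_measurable P.\<A>(2)])
  have Dd: "depends_on {..<H * N ^ q} (D q)" for q
    unfolding D_def by (rule many_words_depends[OF dep \<A>N])
  have Dp: "\<delta> \<le> G.prS (D q)" for q
    unfolding D_def \<delta>_def C_def R_def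
  proof (rule G.many_words_probability[OF level_event_measurable dep \<A>N])
    fix k
    have "H * 1 \<le> H * N ^ k" using Npos by (intro mult_le_mono2) simp
    then show "2 \<le> (\<Sum>a\<in>\<A>. G.prS (P.level (H * N ^ k) a))"
      by (intro P.mean[OF step_law_complex_normal]) simp
  qed
  define A where "A K q = {\<omega> \<in> space M. \<exists>m<K. D q (\<lambda>i. grid_increments (\<lambda>t. B t \<omega>) (K * (H * N ^ q)) (m * (H * N ^ q) + i))}" for K q
  have AK: "A K q \<in> events" "1 - (1 - \<delta>) ^ K \<le> prob (A K q)" if K: "K > 0" for K q
  proof -
    define T where "T = K * (H * N ^ q)"
    have T: "T > 0" using K P.H Npos by (simp add: T_def)
    note [measurable] = Dm
    let ?P = "\<lambda>x. \<exists>m<K. D q (\<lambda>i. x (m * (H * N ^ q) + i))"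
    have Pm: "Measurable.pred seqM ?P" by measurable
    have Pd: "depends_on {..<T} ?P"
    proof (unfold depends_on_def, intro allI impI)
      fix x y :: "nat \<Rightarrow> complex" assume xy: "\<forall>i\<in>{..<T}. x i = y i"
      have "D q (\<lambda>i. x (m * (H * N ^ q) + i)) = D q (\<lambda>i. y (m * (H * N ^ q) + i))" if "m < K" for m
      proof (rule depends_onD[OF Dd])
        fix i assume "i \<in> {..<H * N ^ q}"
        then have "m * (H * N ^ q) + i < T" using mult_le_mono1[of "Suc m" K "H * N ^ q"] that by (simp add: T_def)
        then show "x (m * (H * N ^ q) + i) = y (m * (H * N ^ q) + i)" using xy by simp
      qed
      then show "?P x = ?P y" by blast
    qed
    let ?X = "\<lambda>\<omega>. \<lambda>i\<in>{..<T}. grid_increments (\<lambda>t. B t \<omega>) T i"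
    note law = grid_increments_law[OF T]
    have "(\<lambda>i. if i < T then ?X \<omega> i else 0) = grid_increments (\<lambda>t. B t \<omega>) T" for \<omega>
      by (auto simp: grid_increments_def fun_eq_iff)
    note restr = this
    have eq: "A K q = {\<omega> \<in> space M. ?P (\<lambda>i. if i < T then ?X \<omega> i else 0)}"
    proof -
      have "A K q = {\<omega> \<in> space M. ?P (grid_increments (\<lambda>t. B t \<omega>) T)}" by (simp only: A_def T_def)
      also have "\<dots> = {\<omega> \<in> space M. ?P (\<lambda>i. if i < T then ?X \<omega> i else 0)}"
        by (intro Collect_cong conj_cong refl) (rule arg_cong[OF restr[symmetric], of ?P])
      finally show ?thesis .
    qed
    show "A K q \<in> events" unfolding eq by (rule G.prS_finite_marginal(1)[OF Pm Pd law(2,1)])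
    have "prob (A K q) = G.prS ?P" unfolding eq by (rule G.prS_finite_marginal(2)[OF Pm Pd law(2,1)])
    then show "1 - (1 - \<delta>) ^ K \<le> prob (A K q)" using G.prS_some_block[OF Dm Dd Dp] by simp
  qed
  \<comment> \<open>The index is shifted to have at least one interval. Since \<delta> depends
    neither on q nor on K, the bound survives for infinitely many q, as the passage to limit words
    requires, and tends to 1 as K grows.\<close>
  define E where "E K = {\<omega> \<in> space M. infinite {q. \<omega> \<in> A (Suc K) q}}" for K
  have E: "E K \<in> events" "1 - (1 - \<delta>) ^ Suc K \<le> prob (E K)" for K
    unfolding E_def using prob_infinitely_often[of "A (Suc K)" "1 - (1 - \<delta>) ^ Suc K"] AK[of "Suc K"] by auto
  have U: "(\<Union>K. E K) \<in> events" using E(1) by auto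
  have "1 - (1 - \<delta>) ^ Suc K \<le> prob (\<Union>K. E K)" for K
    using E(2)[of K] by (rule order_trans) (use E(1) U in \<open>auto intro!: finite_measure_mono\<close>)
  moreover have "(\<lambda>K. 1 - (1 - \<delta>) ^ Suc K) \<longlonglongrightarrow> 1 - 0"
    using \<delta> by (intro tendsto_intros LIMSEQ_Suc LIMSEQ_power_zero) auto
  ultimately have "1 \<le> prob (\<Union>K. E K)" by (intro LIMSEQ_le_const2[of _ "1 - 0 :: real", simplified]) auto
  then have "prob (\<Union>K. E K) = 1" using prob_le_1 by (metis antisym)
  then have "AE \<omega> in M. \<omega> \<in> (\<Union>K. E K)" by (rule AE_prob_1)
  with continuous_paths show ?thesis
  proof eventually_elim
    case (elim \<omega>)
    then obtain K where "infinite {q. \<omega> \<in> A (Suc K) q}" by (auto simp: E_def)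
    then have "infinite {q. \<exists>m<Suc K. many_words P.level H N \<A> C q (\<lambda>i. grid_increments (\<lambda>t. B t \<omega>) (Suc K * (H * N ^ q)) (m * (H * N ^ q) + i))}"
      by (rule infinite_super[rotated]) (auto simp: A_def D_def)
    from P.pivoting_points_of_frequent_words[OF elim(1) C this] show ?case .
  qed
qed

end
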